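(* Let $v$ be a solution of the state equation satisfying $$\mathbb E\Big[\exp\Big\{\hat c\int_0^t\|v(s)\|_{\dot{\mathbb H}^3}^2ds\Big\}\Big]<+\infty\quad\text{for all }\hat c>0,\ t\in[0,T],$$ and let $g,\psi\in L^p(\Omega;L^2(0,T;\dot{\mathbb L}^2(\mathbb T^2)))$ for some $p>2$. Let $\mathfrak p$ be the solution of the adjoint equation (with coefficient $v$ and right-hand side $g$) and $\mathfrak m$ the solution of the linearized equation (with coefficient $v$ and right-hand side $\psi$). Then $$\mathbb E\Big[\int_0^T(\psi(t),\mathfrak p(t))\,dt\Big]=\mathbb E\Big[\int_0^T(g(t),\mathfrak m(t))\,dt\Big].$$
   Context: **Spaces.** Fix $\ell>0$, $T>0$, $\mathbb T^2=(\mathbb R/\ell\mathbb Z)^2$. $\dot{\mathbb L}^2(\mathbb T^2)$: mean-zero $\mathbb R^2$-valued $L^2$ fields, with norm $\|\cdot\|_2$ and inner product $(\cdot,\cdot)$ (also used for matrix fields, with $A:B=\operatorname{Tr}(AB^T)$, $|A|^2=A:A$). $\dot{\mathbb H}^s(\mathbb T^2)$: mean-zero $\mathbb R^2$-valued $H^s$ fields with norm $\|u\|_{\dot{\mathbb H}^s}^2=\sum_{k\in\mathbb Z^2}|k|^{2s}|u_k|^2$, where $u_k$ are the Fourier coefficients. $\mathbb H$ (resp. $\mathbb V$) is the closure of the smooth mean-zero divergence-free fields in $\dot{\mathbb L}^2$ (resp. $\dot{\mathbb H}^1$); $\mathbb V'$ is the dual of $\mathbb V$ with pairing $\langle\cdot,\cdot\rangle$.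 $\mathcal P:\dot{\mathbb L}^2\to\mathbb H$ is the Leray projection, $\mathcal A=-\mathcal P\Delta$ the Stokes operator, $D(\mathcal A^{s/2})=\{u\in\dot{\mathbb H}^s:\operatorname{div}u=0\}$. **Parameters and notation.** $\nu>0$, $\alpha_1>0$, $\alpha_2\in\mathbb R$, $\beta>0$, $|\alpha_1+\alpha_2|\le\sqrt{24\nu\beta}$. $\Upsilon(u)=u-\alpha_1\Delta u$; $\mathrm A(u)=\nabla u+(\nabla u)^T$; $(\operatorname{div}M)_i=\sum_j\partial_jM_{ij}$; $b(u,v,w)=\sum_{i,j}\int_{\mathbb T^2}u^i\,\partial_iv^j\,w^j\,dx$. **Noise.** $(\Omega,\mathscr F,\{\mathscr F_t\}_{t\ge0},\mathbb P)$ is a filtered probability space (usual conditions), $\mathbb U$ a Hilbert space, $G:\mathbb U\to\mathbb H$ Hilbert–Schmidt, $\mathrm W$ an $\mathbb H$-valued $GG^*$-Wiener process. **State equation** (with force $f\in L^2(\Omega;L^2(0,T;\dot{\mathbb H}^1))$ and initial datum $v_0\in D(\mathcal A^{3/2})$): $$d\Upsilon(v)+\Big\{-\nu\Delta v+(v\cdot\nabla)\Upsilon(v)+\sum_{j=1}^2[\Upsilon(v)]^j\nabla v^j-(\alpha_1+\alpha_2)\operatorname{div}[\mathrm A(v)^2]-\beta\operatorname{div}[|\mathrm A(v)|^2\mathrm A(v)]\Big\}dt=(-\nabla p+f)\,dt+d\mathrm W,\quad\operatorname{div}v=0,\quad v(0)=v_0.$$ A *solution* is a $D(\mathcal A)$-valued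 $\{\mathscr F_t\}$-adapted process $v$ with paths in $C([0,T];D(\mathcal A))\cap L^\infty(0,T;D(\mathcal A^{3/2}))$ $\mathbb P$-a.s. such that, for every $t\in[0,T]$ and every $\phi\in\mathbb H$, $\mathbb P$-a.s., $$(\Upsilon(v(t)),\phi)=(\Upsilon(v_0),\phi)-\int_0^t\big[\nu(\mathcal Av,\phi)+b(v,\Upsilon(v),\phi)+b(\phi,v,\Upsilon(v))-(\alpha_1+\alpha_2)(\operatorname{div}[\mathrm A(v)^2],\phi)-\beta(\operatorname{div}[|\mathrm A(v)|^2\mathrm A(v)],\phi)\big]ds+\int_0^t(f,\phi)\,ds+(\mathrm W(t),\phi).$$ **Linearized equation.** A solution is a stochastic process $\mathfrak m$ with trajectories in $C([0,T];\mathbb V)\cap L^\infty(0,T;D(\mathcal A))$, $\partial_t\mathfrak m\in L^2(0,T;\mathbb V)$, $\mathfrak m(0)=0$, such that $\mathbb P$-a.s., for a.e. $t\in[0,T]$ and all $\phi\in\mathbb V$, $$\langle\partial_t\Upsilon(\mathfrak m),\phi\rangle=(\psi,\phi)-\nu(\nabla\mathfrak m,\nabla\phi)+b(v,\phi,\Upsilon(\mathfrak m))+b(\mathfrak m,\phi,\Upsilon(v))-b(\phi,v,\Upsilon(\mathfrak m))-b(\phi,\mathfrak m,\Upsilon(v))$$ $$-(\alpha_1+\alpha_2)(\mathrm A(v)\mathrm A(\mathfrak m)+\mathrm A(\mathfrak m)\mathrm A(v),\nabla\phi)-\beta(|\mathrm A(v)|^2\mathrm A(\mathfrak m),\nabla\phi)-2\beta((\mathrm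 A(\mathfrak m):\mathrm A(v))\mathrm A(v),\nabla\phi).$$ **Adjoint equation.** A solution is a stochastic process $\mathfrak p$ with trajectories in $C([0,T];\mathbb V)\cap L^\infty(0,T;D(\mathcal A))$, $\partial_t\mathfrak p\in L^2(0,T;\mathbb V)$, $\mathfrak p(T)=0$, such that $\mathbb P$-a.s., for a.e. $t\in[0,T]$ and all $\phi\in\mathbb V$, $$-\langle\partial_t\Upsilon(\mathfrak p),\phi\rangle=\Big\langle g-\nu\mathcal A\mathfrak p+(\mathrm I-\alpha_1\Delta)[(v\cdot\nabla)\mathfrak p]-\sum_{j=1}^2\mathfrak p^j\nabla[\Upsilon(v)]^j-(\mathrm I-\alpha_1\Delta)[(\mathfrak p\cdot\nabla)v]+(\mathfrak p\cdot\nabla)\Upsilon(v)$$ $$+(\alpha_1+\alpha_2)\operatorname{div}(\mathrm A(v)\mathrm A(\mathfrak p)+\mathrm A(\mathfrak p)\mathrm A(v))+\beta\operatorname{div}(|\mathrm A(v)|^2\mathrm A(\mathfrak p))+2\beta\operatorname{div}[(\mathrm A(\mathfrak p):\mathrm A(v))\mathrm A(v)],\ \phi\Big\rangle.$$ *)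

theory Defs
  imports "HOL-Probability.Probability"
begin

text \<open>
  Functions on the torus \<open>(\<real>/l\<int>)\<^sup>2\<close> are \<open>l\<close>-periodic functions on \<open>\<real>\<^sup>2\<close>, integrated over one period cell.
  Elements of Lebesgue and Sobolev spaces are represented by functions rather than by classes modulo
  almost-everywhere equality, so the norms below are seminorms on functions.
\<close>

type_synonym sfield = "real^2 \<Rightarrow> real"
type_synonym vfield = "real^2 \<Rightarrow> real^2"
type_synonym mfield = "real^2 \<Rightarrow> real^2^2"


section \<open>Function spaces on the torus\<close>

definition periodic :: "real \<Rightarrow> (real^2 \<Rightarrow> 'b) \<Rightarrow> bool" where
  "periodic l h \<longleftrightarrow> (\<forall>x i. h (x + axis i l) = h x)"

definition torus :: "real \<Rightarrow> (real^2) measure" where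
  "torus l = restrict_space lborel {x. \<forall>i. 0 \<le> x $ i \<and> x $ i < l}"

definition same_field :: "real \<Rightarrow> vfield \<Rightarrow> vfield \<Rightarrow> bool" where
  "same_field l u w \<longleftrightarrow> (AE x in torus l. u x = w x)"

definition partial :: "2 \<Rightarrow> sfield \<Rightarrow> sfield" where
  "partial i h = (\<lambda>x. frechet_derivative h (at x) (axis i 1))"

definition smooth :: "sfield \<Rightarrow> bool" where
  "smooth h \<longleftrightarrow> (\<forall>is. foldr partial is h differentiable_on UNIV)"

text \<open>Weak partial derivatives; the chosen function is unique up to null sets.\<close>

definition is_weak_partial :: "real \<Rightarrow> 2 \<Rightarrow> sfield \<Rightarrow> sfield \<Rightarrow> bool" where
  "is_weak_partial l i h w \<longleftrightarrow>
     w \<in> borel_measurable borel \<and> periodic l w \<and> integrable (torus l) w \<and>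
     (\<forall>\<theta>. smooth \<theta> \<and> periodic l \<theta> \<longrightarrow>
        (\<integral>x. h x * partial i \<theta> x \<partial>torus l) = - (\<integral>x. w x * \<theta> x \<partial>torus l))"

definition wpartial :: "real \<Rightarrow> 2 \<Rightarrow> sfield \<Rightarrow> sfield" where
  "wpartial l i h = (SOME w. is_weak_partial l i h w)"

definition L2dot :: "real \<Rightarrow> vfield set" where
  "L2dot l = {u. u \<in> borel_measurable borel \<and> periodic l u \<and>
     integrable (torus l) (\<lambda>x. (norm (u x))\<^sup>2) \<and> (\<integral>x. u x \<partial>torus l) = 0}"

definition ip :: "real \<Rightarrow> vfield \<Rightarrow> vfield \<Rightarrow> real" where
  "ip l u w = (\<integral>x. u x \<bullet> w x \<partial>torus l)"

definition norm2 :: "real \<Rightarrow> vfield \<Rightarrow> real" where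
  "norm2 l u = sqrt (ip l u u)"

definition fourier :: "real \<Rightarrow> vfield \<Rightarrow> int \<times> int \<Rightarrow> 2 \<Rightarrow> complex" where
  "fourier l u k j =
     (\<integral>x. complex_of_real (u x $ j) *
        cis (- 2 * pi * (real_of_int (fst k) * x $ 1 + real_of_int (snd k) * x $ 2) / l) \<partial>torus l) / l\<^sup>2"

definition sobolev_term :: "real \<Rightarrow> nat \<Rightarrow> vfield \<Rightarrow> int \<times> int \<Rightarrow> real" where
  "sobolev_term l s u k =
     real_of_int ((fst k)\<^sup>2 + (snd k)\<^sup>2) ^ s * (\<Sum>j\<in>UNIV. (cmod (fourier l u k j))\<^sup>2)"

definition Hdot :: "real \<Rightarrow> nat \<Rightarrow> vfield set" where
  "Hdot l s = {u \<in> L2dot l. sobolev_term l s u summable_on UNIV}"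

definition Hnorm :: "real \<Rightarrow> nat \<Rightarrow> vfield \<Rightarrow> real" where
  "Hnorm l s u = sqrt (\<Sum>\<^sub>\<infinity>k. sobolev_term l s u k)"

definition smooth_divfree :: "real \<Rightarrow> vfield set" where
  "smooth_divfree l = {u. periodic l u \<and> (\<forall>j. smooth (\<lambda>x. u x $ j)) \<and> (\<integral>x. u x \<partial>torus l) = 0 \<and>
     (\<forall>x. (\<Sum>i\<in>UNIV. partial i (\<lambda>y. u y $ i) x) = 0)}"

definition spaceH :: "real \<Rightarrow> vfield set" where
  "spaceH l = {u \<in> L2dot l. \<forall>e>0. \<exists>w\<in>smooth_divfree l. norm2 l (u - w) < e}"

definition spaceV :: "real \<Rightarrow> vfield set" where
  "spaceV l = {u \<in> Hdot l 1. \<forall>e>0. \<exists>w\<in>smooth_divfree l. Hnorm l 1 (u - w) < e}"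

text \<open>\<open>DAhalf l s\<close> is \<open>D(\<A>\<^bsup>s/2\<^esup>)\<close> for \<open>s \<ge> 1\<close>, normed by \<open>Hnorm l s\<close>.\<close>

definition DAhalf :: "real \<Rightarrow> nat \<Rightarrow> vfield set" where
  "DAhalf l s = {u \<in> Hdot l s. AE x in torus l. (\<Sum>i\<in>UNIV. wpartial l i (\<lambda>y. u y $ i) x) = 0}"

definition leray :: "real \<Rightarrow> vfield \<Rightarrow> vfield" where
  "leray l h = (SOME w. w \<in> spaceH l \<and> (\<forall>\<phi>\<in>spaceH l. ip l (h - w) \<phi> = 0))"


section \<open>Differential operators\<close>

definition grad :: "real \<Rightarrow> vfield \<Rightarrow> mfield" where
  "grad l u = (\<lambda>x. \<chi> i j. wpartial l j (\<lambda>y. u y $ i) x)"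

definition laplace :: "real \<Rightarrow> vfield \<Rightarrow> vfield" where
  "laplace l u = (\<lambda>x. \<chi> j. \<Sum>i\<in>UNIV. wpartial l i (wpartial l i (\<lambda>y. u y $ j)) x)"

definition divm :: "real \<Rightarrow> mfield \<Rightarrow> vfield" where
  "divm l M = (\<lambda>x. \<chi> i. \<Sum>j\<in>UNIV. wpartial l j (\<lambda>y. M y $ i $ j) x)"

definition stokes :: "real \<Rightarrow> vfield \<Rightarrow> vfield" where
  "stokes l u = (\<lambda>x. - leray l (laplace l u) x)"

definition Upsilon :: "real \<Rightarrow> real \<Rightarrow> vfield \<Rightarrow> vfield" where
  "Upsilon l \<alpha>\<^sub>1 u = (\<lambda>x. u x - \<alpha>\<^sub>1 *\<^sub>R laplace l u x)"

definition symgrad :: "real \<Rightarrow> vfield \<Rightarrow> mfield" where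
  "symgrad l u = (\<lambda>x. grad l u x + transpose (grad l u x))"

definition frob :: "real^2^2 \<Rightarrow> real^2^2 \<Rightarrow> real" where
  "frob A B = trace (A ** transpose B)"

definition ipm :: "real \<Rightarrow> mfield \<Rightarrow> mfield \<Rightarrow> real" where
  "ipm l M K = (\<integral>x. frob (M x) (K x) \<partial>torus l)"

definition trib :: "real \<Rightarrow> vfield \<Rightarrow> vfield \<Rightarrow> vfield \<Rightarrow> real" where
  "trib l u v w =
     (\<Sum>i\<in>UNIV. \<Sum>j\<in>UNIV. \<integral>x. u x $ i * wpartial l i (\<lambda>y. v y $ j) x * w x $ j \<partial>torus l)"

text \<open>\<open>convect l u w\<close> is \<open>(u\<cdot>\<nabla>)w\<close> and \<open>cograd l u w\<close> is \<open>\<Sum>\<^sub>j u\<^sup>j \<nabla>w\<^sup>j\<close>.\<close>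

definition convect :: "real \<Rightarrow> vfield \<Rightarrow> vfield \<Rightarrow> vfield" where
  "convect l u w = (\<lambda>x. \<chi> j. \<Sum>i\<in>UNIV. u x $ i * wpartial l i (\<lambda>y. w y $ j) x)"

definition cograd :: "real \<Rightarrow> vfield \<Rightarrow> vfield \<Rightarrow> vfield" where
  "cograd l u w = (\<lambda>x. \<chi> i. \<Sum>j\<in>UNIV. u x $ j * wpartial l i (\<lambda>y. w y $ j) x)"

text \<open>
  For \<open>h\<close> merely of class \<open>H\<^sup>1\<close>, \<open>(I - \<alpha>\<^sub>1\<Delta>)h\<close> is an element of the dual of \<open>\<V>\<close>, since \<open>-\<Delta>h\<close> acts as
  \<open>\<phi> \<mapsto> (\<nabla>h, \<nabla>\<phi>)\<close>; \<open>Upsilon_pair l \<alpha>\<^sub>1 h \<phi>\<close> is its pairing with \<open>\<phi> \<in> \<V>\<close>.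
\<close>

definition Upsilon_pair :: "real \<Rightarrow> real \<Rightarrow> vfield \<Rightarrow> vfield \<Rightarrow> real" where
  "Upsilon_pair l \<alpha>\<^sub>1 h \<phi> = ip l h \<phi> + \<alpha>\<^sub>1 * ipm l (grad l h) (grad l \<phi>)"


section \<open>Spaces of vector-valued functions\<close>

text \<open>The Borel sigma-algebra of a subset \<open>S\<close> for the topology induced by a seminorm \<open>N\<close>.\<close>

definition borel_sn :: "'b::minus set \<Rightarrow> ('b \<Rightarrow> real) \<Rightarrow> 'b measure" where
  "borel_sn S N = sigma S {U. U \<subseteq> S \<and> (\<forall>u\<in>U. \<exists>r>0. \<forall>w\<in>S. N (w - u) < r \<longrightarrow> w \<in> U)}"

text \<open>
  The Bochner space \<open>L\<^sup>p(M; S)\<close>. All spaces \<open>S\<close> to which it is applied are separable, so that Borel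
  and strong measurability coincide.
\<close>

definition Lp_space :: "'a measure \<Rightarrow> real \<Rightarrow> 'b::minus set \<Rightarrow> ('b \<Rightarrow> real) \<Rightarrow> ('a \<Rightarrow> 'b) set" where
  "Lp_space M p S N = {u \<in> M \<rightarrow>\<^sub>M borel_sn S N. integrable M (\<lambda>x. N (u x) powr p)}"

definition Lp_norm :: "'a measure \<Rightarrow> real \<Rightarrow> ('b \<Rightarrow> real) \<Rightarrow> ('a \<Rightarrow> 'b) \<Rightarrow> real" where
  "Lp_norm M p N u = (\<integral>x. N (u x) powr p \<partial>M) powr (1 / p)"

definition time_interval :: "real \<Rightarrow> real measure" where
  "time_interval T = restrict_space lborel {0..T}"

definition Lp_L2 ::
  "'w measure \<Rightarrow> real \<Rightarrow> real \<Rightarrow> vfield set \<Rightarrow> (vfield \<Rightarrow> real) \<Rightarrow> ('w \<Rightarrow> real \<Rightarrow> vfield) set" where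
  "Lp_L2 M p T S N =
     Lp_space M p (Lp_space (time_interval T) 2 S N) (Lp_norm (time_interval T) 2 N)"

definition in_C :: "real \<Rightarrow> vfield set \<Rightarrow> (vfield \<Rightarrow> real) \<Rightarrow> (real \<Rightarrow> vfield) \<Rightarrow> bool" where
  "in_C T S N u \<longleftrightarrow>
     (\<forall>t\<in>{0..T}. u t \<in> S \<and> ((\<lambda>s. N (u s - u t)) \<longlongrightarrow> 0) (at t within {0..T}))"

definition in_Linf ::
  "real \<Rightarrow> real \<Rightarrow> vfield set \<Rightarrow> (vfield \<Rightarrow> real) \<Rightarrow> (real \<Rightarrow> vfield) \<Rightarrow> bool" where
  "in_Linf l T S N u \<longleftrightarrow>
     (\<exists>w \<in> time_interval T \<rightarrow>\<^sub>M borel_sn S N.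
        (\<exists>C. AE t in time_interval T. N (w t) \<le> C) \<and>
        (AE t in time_interval T. same_field l (w t) (u t)))"

text \<open>
  Distributional time derivative on \<open>(0,T)\<close>: the identity \<open>\<integral>\<eta>' u dt = - \<integral>\<eta> u' dt\<close> between Bochner
  integrals, expressed through the functionals \<open>(\<cdot>, \<zeta>)\<close>, which separate points.
\<close>

definition has_time_deriv ::
  "real \<Rightarrow> real \<Rightarrow> (real \<Rightarrow> vfield) \<Rightarrow> (real \<Rightarrow> vfield) \<Rightarrow> bool" where
  "has_time_deriv l T u u' \<longleftrightarrow>
     (\<forall>\<eta>::real \<Rightarrow> real. \<forall>\<zeta>\<in>L2dot l.
        (\<forall>n. (deriv ^^ n) \<eta> differentiable_on UNIV) \<and>
        (\<exists>a b. 0 < a \<and> b < T \<and> (\<forall>t. t \<notin> {a..b} \<longrightarrow> \<eta> t = 0)) \<longrightarrow>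
        (\<integral>t. deriv \<eta> t * ip l (u t) \<zeta> \<partial>time_interval T) =
        - (\<integral>t. \<eta> t * ip l (u' t) \<zeta> \<partial>time_interval T))"


section \<open>Noise\<close>

definition filtered_space :: "'w measure \<Rightarrow> (real \<Rightarrow> 'w measure) \<Rightarrow> bool" where
  "filtered_space M F \<longleftrightarrow>
     prob_space M \<and> complete_measure M \<and>
     (\<forall>t\<ge>0. subalgebra M (F t)) \<and>
     (\<forall>s t. 0 \<le> s \<and> s \<le> t \<longrightarrow> sets (F s) \<subseteq> sets (F t)) \<and>
     (\<forall>t\<ge>0. (\<Inter>s\<in>{t<..}. sets (F s)) = sets (F t)) \<and>
     null_sets M \<subseteq> sets (F 0)"

definition orthonormal_basis :: "'u::real_inner set \<Rightarrow> bool" where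
  "orthonormal_basis B \<longleftrightarrow>
     pairwise orthogonal B \<and> (\<forall>e\<in>B. norm e = 1) \<and> closure (span B) = UNIV"

definition hilbert_schmidt ::
  "real \<Rightarrow> ('u::{real_inner, complete_space} \<Rightarrow> vfield) \<Rightarrow> bool" where
  "hilbert_schmidt l G \<longleftrightarrow>
     (\<forall>a. G a \<in> spaceH l) \<and>
     (\<forall>c a b. same_field l (G (c *\<^sub>R a + b)) (\<lambda>x. c *\<^sub>R G a x + G b x)) \<and>
     (\<exists>K. \<forall>a. norm2 l (G a) \<le> K * norm a) \<and>
     (\<exists>B. orthonormal_basis B \<and> (\<lambda>e. (norm2 l (G e))\<^sup>2) summable_on B)"

definition adj :: "real \<Rightarrow> ('u::{real_inner, complete_space} \<Rightarrow> vfield) \<Rightarrow> vfield \<Rightarrow> 'u" where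
  "adj l G \<phi> = (THE z. \<forall>a. z \<bullet> a = ip l \<phi> (G a))"

definition centered_gaussian :: "real \<Rightarrow> real measure" where
  "centered_gaussian V =
     (if V = 0 then return borel 0 else density lborel (\<lambda>x. ennreal (normal_density 0 (sqrt V) x)))"

text \<open>An \<open>\<H>\<close>-valued Wiener process with covariance operator \<open>GG\<^sup>*\<close>, relative to the filtration \<open>F\<close>.\<close>

definition wiener ::
  "real \<Rightarrow> 'w measure \<Rightarrow> (real \<Rightarrow> 'w measure) \<Rightarrow>
    ('u::{real_inner, complete_space} \<Rightarrow> vfield) \<Rightarrow> ('w \<Rightarrow> real \<Rightarrow> vfield) \<Rightarrow> bool" where
  "wiener l M F G W \<longleftrightarrow>
     (\<forall>t\<ge>0. (\<lambda>\<omega>. W \<omega> t) \<in> F t \<rightarrow>\<^sub>M borel_sn (spaceH l) (norm2 l)) \<and>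
     (AE \<omega> in M. same_field l (W \<omega> 0) (\<lambda>x. 0)) \<and>
     (AE \<omega> in M. \<forall>T>0. in_C T (spaceH l) (norm2 l) (W \<omega>)) \<and>
     (\<forall>s t. 0 \<le> s \<and> s < t \<longrightarrow>
        prob_space.indep_set M (sets (F s))
          {(\<lambda>\<omega>. W \<omega> t - W \<omega> s) -` A \<inter> space M | A. A \<in> sets (borel_sn (spaceH l) (norm2 l))} \<and>
        (\<forall>\<phi>\<in>spaceH l. distr M borel (\<lambda>\<omega>. ip l (W \<omega> t - W \<omega> s) \<phi>) =
           centered_gaussian ((t - s) * ip l (G (adj l G \<phi>)) \<phi>)))"


section \<open>State, linearized and adjoint equations\<close>

definition state_solution ::
  "real \<Rightarrow> real \<Rightarrow> real \<Rightarrow> real \<Rightarrow> real \<Rightarrow> real \<Rightarrow> 'w measure \<Rightarrow> (real \<Rightarrow> 'w measure) \<Rightarrow>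
    ('w \<Rightarrow> real \<Rightarrow> vfield) \<Rightarrow> ('w \<Rightarrow> real \<Rightarrow> vfield) \<Rightarrow> vfield \<Rightarrow> ('w \<Rightarrow> real \<Rightarrow> vfield) \<Rightarrow> bool" where
  "state_solution l T \<nu> \<alpha>\<^sub>1 \<alpha>\<^sub>2 \<beta> M F W f v\<^sub>0 v \<longleftrightarrow>
     (\<forall>t\<in>{0..T}. (\<lambda>\<omega>. v \<omega> t) \<in> F t \<rightarrow>\<^sub>M borel_sn (DAhalf l 2) (Hnorm l 2)) \<and>
     (AE \<omega> in M. in_C T (DAhalf l 2) (Hnorm l 2) (v \<omega>) \<and>
        in_Linf l T (DAhalf l 3) (Hnorm l 3) (v \<omega>)) \<and>
     (\<forall>t\<in>{0..T}. \<forall>\<phi>\<in>spaceH l. AE \<omega> in M.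
        ip l (Upsilon l \<alpha>\<^sub>1 (v \<omega> t)) \<phi> =
        ip l (Upsilon l \<alpha>\<^sub>1 v\<^sub>0) \<phi>
        - (\<integral>s. (let u = v \<omega> s in
              \<nu> * ip l (stokes l u) \<phi>
              + trib l u (Upsilon l \<alpha>\<^sub>1 u) \<phi>
              + trib l \<phi> u (Upsilon l \<alpha>\<^sub>1 u)
              - (\<alpha>\<^sub>1 + \<alpha>\<^sub>2) * ip l (divm l (\<lambda>x. symgrad l u x ** symgrad l u x)) \<phi>
              - \<beta> * ip l (divm l (\<lambda>x. frob (symgrad l u x) (symgrad l u x) *\<^sub>R symgrad l u x)) \<phi>)
            \<partial>time_interval t)
        + (\<integral>s. ip l (f \<omega> s) \<phi> \<partial>time_interval t)
        + ip l (W \<omega> t) \<phi>)"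

text \<open>
  In the next two definitions \<open>m'\<close> and \<open>p'\<close> are the time derivatives, and \<open>\<partial>\<^sub>t\<Upsilon>(m)\<close> is
  \<open>\<Upsilon>(\<partial>\<^sub>t m)\<close>, an element of the dual of \<open>\<V>\<close>.
\<close>

definition linearized_solution ::
  "real \<Rightarrow> real \<Rightarrow> real \<Rightarrow> real \<Rightarrow> real \<Rightarrow> real \<Rightarrow> 'w measure \<Rightarrow>
    ('w \<Rightarrow> real \<Rightarrow> vfield) \<Rightarrow> ('w \<Rightarrow> real \<Rightarrow> vfield) \<Rightarrow> ('w \<Rightarrow> real \<Rightarrow> vfield) \<Rightarrow> bool" where
  "linearized_solution l T \<nu> \<alpha>\<^sub>1 \<alpha>\<^sub>2 \<beta> M v \<psi> \<mm> \<longleftrightarrow>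
     (\<forall>t\<in>{0..T}. (\<lambda>\<omega>. \<mm> \<omega> t) \<in> M \<rightarrow>\<^sub>M borel_sn (spaceV l) (Hnorm l 1)) \<and>
     (AE \<omega> in M.
        in_C T (spaceV l) (Hnorm l 1) (\<mm> \<omega>) \<and>
        in_Linf l T (DAhalf l 2) (Hnorm l 2) (\<mm> \<omega>) \<and>
        same_field l (\<mm> \<omega> 0) (\<lambda>x. 0) \<and>
        (\<exists>m' \<in> Lp_space (time_interval T) 2 (spaceV l) (Hnorm l 1).
           has_time_deriv l T (\<mm> \<omega>) m' \<and>
           (AE t in time_interval T. \<forall>\<phi>\<in>spaceV l.
              (let u = v \<omega> t; m = \<mm> \<omega> t; Au = symgrad l u; Am = symgrad l m in
               Upsilon_pair l \<alpha>\<^sub>1 (m' t) \<phi> =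
               ip l (\<psi> \<omega> t) \<phi>
               - \<nu> * ipm l (grad l m) (grad l \<phi>)
               + trib l u \<phi> (Upsilon l \<alpha>\<^sub>1 m)
               + trib l m \<phi> (Upsilon l \<alpha>\<^sub>1 u)
               - trib l \<phi> u (Upsilon l \<alpha>\<^sub>1 m)
               - trib l \<phi> m (Upsilon l \<alpha>\<^sub>1 u)
               - (\<alpha>\<^sub>1 + \<alpha>\<^sub>2) * ipm l (\<lambda>x. Au x ** Am x + Am x ** Au x) (grad l \<phi>)
               - \<beta> * ipm l (\<lambda>x. frob (Au x) (Au x) *\<^sub>R Am x) (grad l \<phi>)
               - 2 * \<beta> * ipm l (\<lambda>x. frob (Am x) (Au x) *\<^sub>R Au x) (grad l \<phi>)))))"

definition adjoint_solution ::
  "real \<Rightarrow> real \<Rightarrow> real \<Rightarrow> real \<Rightarrow> real \<Rightarrow> real \<Rightarrow> 'w measure \<Rightarrow>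
    ('w \<Rightarrow> real \<Rightarrow> vfield) \<Rightarrow> ('w \<Rightarrow> real \<Rightarrow> vfield) \<Rightarrow> ('w \<Rightarrow> real \<Rightarrow> vfield) \<Rightarrow> bool" where
  "adjoint_solution l T \<nu> \<alpha>\<^sub>1 \<alpha>\<^sub>2 \<beta> M v g \<pp> \<longleftrightarrow>
     (\<forall>t\<in>{0..T}. (\<lambda>\<omega>. \<pp> \<omega> t) \<in> M \<rightarrow>\<^sub>M borel_sn (spaceV l) (Hnorm l 1)) \<and>
     (AE \<omega> in M.
        in_C T (spaceV l) (Hnorm l 1) (\<pp> \<omega>) \<and>
        in_Linf l T (DAhalf l 2) (Hnorm l 2) (\<pp> \<omega>) \<and>
        same_field l (\<pp> \<omega> T) (\<lambda>x. 0) \<and>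
        (\<exists>p' \<in> Lp_space (time_interval T) 2 (spaceV l) (Hnorm l 1).
           has_time_deriv l T (\<pp> \<omega>) p' \<and>
           (AE t in time_interval T. \<forall>\<phi>\<in>spaceV l.
              (let u = v \<omega> t; q = \<pp> \<omega> t; Au = symgrad l u; Aq = symgrad l q in
               - Upsilon_pair l \<alpha>\<^sub>1 (p' t) \<phi> =
               ip l (g \<omega> t) \<phi>
               - \<nu> * ip l (stokes l q) \<phi>
               + Upsilon_pair l \<alpha>\<^sub>1 (convect l u q) \<phi>
               - ip l (cograd l q (Upsilon l \<alpha>\<^sub>1 u)) \<phi>
               - Upsilon_pair l \<alpha>\<^sub>1 (convect l q u) \<phi>
               + ip l (convect l q (Upsilon l \<alpha>\<^sub>1 u)) \<phi>
               + (\<alpha>\<^sub>1 + \<alpha>\<^sub>2) * ip l (divm l (\<lambda>x. Au x ** Aq x + Aq x ** Au x)) \<phi>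
               + \<beta> * ip l (divm l (\<lambda>x. frob (Au x) (Au x) *\<^sub>R Aq x)) \<phi>
               + 2 * \<beta> * ip l (divm l (\<lambda>x. frob (Aq x) (Au x) *\<^sub>R Au x)) \<phi>))))"

end

theory Submission
  imports Defs
begin

text \<open>
  Testing the linearized equation with \<open>\<pp>\<close> and the adjoint equation with \<open>\<mm>\<close>, integration by parts in
  space shows that both right-hand sides contain the same bilinear expression (\<open>Lform\<close>), so that
  \<open>d/dt (\<langle>\<Upsilon>(\<mm>), \<pp>\<rangle>) = (\<psi>, \<pp>) - (g, \<mm>)\<close>; integrating from \<open>\<mm>(0) = 0\<close> to \<open>\<pp>(T) = 0\<close> gives the identity path by
  path. The expectations are finite because testing the linearized equation with \<open>\<mm>\<close> and Gronwall's inequality yield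
  \<open>\<parallel>\<mm>(t)\<parallel> \<le> K \<parallel>\<psi>\<parallel> exp (c \<integral>\<parallel>v\<parallel>\<^sub>H\<^sub>3\<^sup>2)\<close>, so that \<open>\<bar>\<integral>(g, \<mm>) dt\<bar>\<close> is dominated by a product of two \<open>L\<^sup>p\<close> variables and
  one with all moments. Everything in space is computed with Fourier coefficients, to which the weak derivatives, the
  embedding \<open>H\<^sup>2 \<subseteq> L\<^sup>\<infinity>\<close> and the measurability questions reduce.
\<close>

section \<open>Calculus on the torus\<close>

text \<open>The delicate point is the energy estimate. \<open>Lform\<close> tested with
  \<open>\<mm>\<close> itself contains second derivatives of \<open>\<mm>\<close> through
  \<open>Upsilon\<close>, while the energy \<open>Upsilon_pair\<close> controls only an H^1 norm,
  and Gronwall may cost at most the squared H^3 norm of the state, the quantity whose exponential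
  moments are available. Three facts close the gap: the two terms with \<open>Upsilon\<close> of the
  state cancel when the test field is \<open>\<mm>\<close>; one derivative of the Laplacian is
  integrated away, and the top-order transport term vanishes because the state is divergence free;
  the rest is bounded by an H^1 x H^1 x L^2 estimate, since H^1 does not embed into L^infinity in
  two dimensions. In the adjoint equation the stress products have derivatives that are only
  integrable, so they can be paired only with bounded fields; this dictates the forms of integration
  by parts. Joint measurability in time and chance is not at hand: solutions are measurable at each
  fixed time and the data as L^2(0,T)-valued variables, so the pairings are rebuilt from finitely
  many time samples.\<close>

lemma smooth_coinduct:
  assumes "\<And>f. f \<in> C \<Longrightarrow> f differentiable_on UNIV" "\<And>f i. f \<in> C \<Longrightarrow> partial i f \<in> C" "f \<in> C"
  shows "smooth f"
proof -
  have "foldr partial is f \<in> C" for "is"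
    by (induction "is") (use assms in auto)
  then show ?thesis unfolding smooth_def using assms(1) by blast
qed

lemma smooth_partial: "smooth f \<Longrightarrow> smooth (partial i f)"
  unfolding smooth_def
proof
  fix "is" assume *: "\<forall>is. foldr partial is f differentiable_on UNIV"
  show "foldr partial is (partial i f) differentiable_on UNIV"
    using *[rule_format, of "is @ [i]"] by simp
qed

lemma smooth_differentiable: "smooth f \<Longrightarrow> f differentiable (at x)"
  unfolding smooth_def differentiable_on_def by (metis UNIV_I foldr.simps(1) id_apply)

lemma smooth_continuous: "smooth f \<Longrightarrow> continuous_on UNIV f"
  by (simp add: continuous_at_imp_continuous_on differentiable_imp_continuous_within smooth_differentiable)

lemma smooth_borel: "smooth f \<Longrightarrow> f \<in> borel_measurable borel"
  by (intro borel_measurable_continuous_onI smooth_continuous)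

lemma partial_eqI:
  assumes "(f has_derivative D) (at x)" shows "partial i f x = D (axis i 1)"
  unfolding partial_def using frechet_derivative_at[OF assms] by simp

lemma partial_add:
  assumes "f differentiable (at x)" "g differentiable (at x)"
  shows "partial i (\<lambda>x. f x + g x) x = partial i f x + partial i g x"
proof -
  obtain f' g' where d: "(f has_derivative f') (at x)" "(g has_derivative g') (at x)"
    using assms unfolding differentiable_def by blast
  show ?thesis
    using partial_eqI[OF has_derivative_add[OF d]] partial_eqI[OF d(1)] partial_eqI[OF d(2)] by simp
qed

lemma partial_mult:
  assumes "f differentiable (at x)" "g differentiable (at x)"
  shows "partial i (\<lambda>x. f x * g x) x = partial i f x * g x + f x * partial i g x"
proof -
  obtain f' g' where d: "(f has_derivative f') (at x)" "(g has_derivative g') (at x)"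
    using assms unfolding differentiable_def by blast
  show ?thesis
    using partial_eqI[OF has_derivative_mult[OF d]] partial_eqI[OF d(1)] partial_eqI[OF d(2)] by simp
qed

text \<open>Closing the smooth functions under sums and products in advance gives a class stable
  under \<open>partial\<close>: the product rule stays inside it. Then
  \<open>smooth_coinduct\<close> applies, and no Leibniz formula for iterated derivatives is
  needed.\<close>

inductive_set smooth_alg :: "sfield set" where
  base: "smooth f \<Longrightarrow> f \<in> smooth_alg"
| add: "f \<in> smooth_alg \<Longrightarrow> g \<in> smooth_alg \<Longrightarrow> (\<lambda>x. f x + g x) \<in> smooth_alg"
| mult: "f \<in> smooth_alg \<Longrightarrow> g \<in> smooth_alg \<Longrightarrow> (\<lambda>x. f x * g x) \<in> smooth_alg"

lemma smooth_alg_smooth: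
  assumes "f \<in> smooth_alg" shows "smooth f"
proof (rule smooth_coinduct[of smooth_alg, OF _ _ assms])
  have d: "f differentiable (at x)" if "f \<in> smooth_alg" for f x
    using that by induction (auto simp: smooth_differentiable)
  show "f differentiable_on UNIV" if "f \<in> smooth_alg" for f
    using d[OF that] by (simp add: differentiable_on_def)
  show "partial i f \<in> smooth_alg" if "f \<in> smooth_alg" for f i
    using that
  proof induction
    case (base f) then show ?case by (simp add: smooth_alg.base smooth_partial)
  next
    case (add f g)
    then have "partial i (\<lambda>x. f x + g x) = (\<lambda>x. partial i f x + partial i g x)"
      by (auto simp: partial_add d)
    then show ?case using add by (simp add: smooth_alg.add)
  next
    case (mult f g)
    then have "partial i (\<lambda>x. f x * g x) = (\<lambda>x. partial i f x * g x + f x * partial i g x)"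
      by (auto simp: partial_mult d)
    then show ?case using mult by (simp add: smooth_alg.add smooth_alg.mult)
  qed
qed

lemma smooth_mult: "smooth f \<Longrightarrow> smooth g \<Longrightarrow> smooth (\<lambda>x. f x * g x)"
  by (rule smooth_alg_smooth[OF smooth_alg.mult[OF smooth_alg.base smooth_alg.base]])

section \<open>The period cell as a finite measure space, and translation invariance\<close>

locale flat_torus =
  fixes l :: real
  assumes l_pos: "0 < l"
begin

definition cell :: "(real^2) set" where
  "cell = {x. \<forall>i. 0 \<le> x $ i \<and> x $ i < l}"

lemma cell_sets[measurable]: "cell \<in> sets borel"
  unfolding cell_def by measurable

lemma torus_eq: "torus l = restrict_space lborel cell"
  by (simp add: torus_def cell_def)

lemma integral_torus:
  fixes f :: "real^2 \<Rightarrow> 'b::{banach, second_countable_topology}"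
  shows "(\<integral>x. f x \<partial>torus l) = (\<integral>x. indicator cell x *\<^sub>R f x \<partial>lborel)"
  unfolding torus_eq by (simp add: integral_restrict_space)

lemma integrable_torus:
  fixes f :: "real^2 \<Rightarrow> 'b::{banach, second_countable_topology}"
  shows "integrable (torus l) f \<longleftrightarrow> integrable lborel (\<lambda>x. indicator cell x *\<^sub>R f x)"
  unfolding torus_eq by (simp add: integrable_restrict_space)

lemma measurable_torus[measurable (raw)]: "f \<in> borel_measurable borel \<Longrightarrow> f \<in> borel_measurable (torus l)"
  unfolding torus_eq by (simp add: measurable_restrict_space1)

lemma space_torus: "space (torus l) = cell"
  by (simp add: torus_eq space_restrict_space)

text \<open>The half-open cell is squeezed between the open and the closed cube, whose Lebesgue
  measures agree.\<close>

lemma emeasure_torus: "emeasure (torus l) (space (torus l)) = ennreal (l\<^sup>2)"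
proof -
  let ?v = "\<chi> i. l :: real^2"
  have e: "emeasure (torus l) (space (torus l)) = emeasure lborel cell"
    unfolding space_torus unfolding torus_eq by (simp add: emeasure_restrict_space)
  have 1: "box 0 ?v \<subseteq> cell" "cell \<subseteq> cbox 0 ?v"
    by (auto simp: cell_def mem_box_cart less_imp_le)
  have c: "emeasure lborel (cbox 0 ?v) = ennreal (l\<^sup>2)" "emeasure lborel (box 0 ?v) = ennreal (l\<^sup>2)"
  proof -
    have "measure lborel (cbox 0 ?v) = l\<^sup>2"
      using l_pos by (subst content_cbox_cart) (auto simp: interval_ne_empty_cart power2_eq_square UNIV_2)
    then show "emeasure lborel (cbox 0 ?v) = ennreal (l\<^sup>2)"
      using emeasure_lborel_cbox_finite[of 0 ?v] by (subst emeasure_eq_ennreal_measure) auto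
    moreover have "emeasure lborel (box 0 ?v) = emeasure lborel (cbox 0 ?v)"
      by (simp add: emeasure_lborel_cbox_eq emeasure_lborel_box_eq)
    ultimately show "emeasure lborel (box 0 ?v) = ennreal (l\<^sup>2)" by simp
  qed
  have "emeasure lborel (box 0 ?v) \<le> emeasure lborel cell" "emeasure lborel cell \<le> emeasure lborel (cbox 0 ?v)"
    using 1 by (auto intro!: emeasure_mono)
  then show ?thesis using c e by auto
qed

sublocale T: finite_measure "torus l"
  by standard (simp add: emeasure_torus)

lemma measure_torus: "measure (torus l) (space (torus l)) = l\<^sup>2"
  by (simp add: measure_def emeasure_torus)

text \<open>No measurability is assumed: for a non-measurable \<open>f\<close> neither side is
  integrable, and both integrals take the default value 0.\<close>

lemma integral_lborel_shift:
  fixes f :: "real^2 \<Rightarrow> 'b::{banach, second_countable_topology}"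
  shows "(\<integral>x. f (x + c) \<partial>lborel) = (\<integral>x. f x \<partial>lborel)"
proof -
  have "(\<integral>x. f x \<partial>lborel) = (\<integral>x. f x \<partial>distr lborel borel ((+) c))"
    by (simp only: lborel_distr_plus)
  also have "\<dots> = (\<integral>x. f (c + x) \<partial>lborel)"
  proof (cases "f \<in> borel_measurable borel")
    case True then show ?thesis by (intro integral_distr) auto
  next
    case False
    then have "\<not> integrable lborel f" "\<not> integrable (distr lborel borel ((+) c)) f" 
      using borel_measurable_integrable by (auto simp: lborel_distr_plus)
    moreover have "\<not> integrable lborel (\<lambda>x. f (c + x))"
    proof
      assume "integrable lborel (\<lambda>x. f (c + x))"
      then have "(\<lambda>x. f (c + x)) \<in> borel_measurable borel" using borel_measurable_integrable by fastforce
      then have "(\<lambda>x. (\<lambda>x. f (c + x)) (x - c)) \<in> borel_measurable borel" by (rule measurable_compose_rev) simp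
      then show False using False by simp
    qed
    ultimately show ?thesis by (simp add: not_integrable_integral_eq)
  qed
  finally show ?thesis by (simp add: add.commute)
qed


text \<open>The shifted cell is cut at the face where coordinate \<open>i\<close> equals
  \<open>l\<close>. One piece is \<open>A\<close>, inside the cell; the overhang is \<open>B\<close>
  moved by a full period, and periodicity brings it back. Together \<open>A\<close> and
  \<open>B\<close> tile the cell.\<close>

lemma integral_torus_shift:
  fixes f :: "real^2 \<Rightarrow> 'b::{banach, second_countable_topology}"
  assumes int: "integrable (torus l) f" and per: "periodic l f" and s: "0 \<le> s" "s < l"
  shows "(\<integral>x. f (x + axis i s) \<partial>torus l) = (\<integral>x. f x \<partial>torus l)"
proof -
  define A where "A = {y \<in> cell. s \<le> y $ i}"
  define B where "B = {y \<in> cell. y $ i < s}"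
  have [measurable]: "A \<in> sets borel" "B \<in> sets borel" unfolding A_def B_def by measurable
  have int': "integrable lborel (\<lambda>x. indicator cell x *\<^sub>R f x)" using int by (simp add: integrable_torus)
  have iA: "integrable lborel (\<lambda>x. indicator A x *\<^sub>R f x)"
  proof -
    have "integrable lborel (\<lambda>x. indicator A x *\<^sub>R (indicator cell x *\<^sub>R f x))"
      by (rule integrable_mult_indicator[OF _ int']) simp
    moreover have "(\<lambda>x. indicator A x *\<^sub>R (indicator cell x *\<^sub>R f x)) = (\<lambda>x. indicator A x *\<^sub>R f x)"
      by (auto simp: A_def fun_eq_iff indicator_def)
    ultimately show ?thesis by simp
  qed
  have iB: "integrable lborel (\<lambda>x. indicator B x *\<^sub>R f x)"
  proof -
    have "integrable lborel (\<lambda>x. indicator B x *\<^sub>R (indicator cell x *\<^sub>R f x))"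
      by (rule integrable_mult_indicator[OF _ int']) simp
    moreover have "(\<lambda>x. indicator B x *\<^sub>R (indicator cell x *\<^sub>R f x)) = (\<lambda>x. indicator B x *\<^sub>R f x)"
      by (auto simp: B_def fun_eq_iff indicator_def)
    ultimately show ?thesis by simp
  qed
  have per': "f (x + axis i l) = f x" for x using per by (simp add: periodic_def)
  have per2: "f (x - axis i l) = f x" for x using per'[of "x - axis i l"] by simp
  have iB2: "integrable lborel (\<lambda>x. indicator B (x - axis i l) *\<^sub>R f x)"
  proof -
    have "integrable (distr lborel borel ((+) (- axis i l))) (\<lambda>x. indicator B x *\<^sub>R f x)"
      using iB by (simp add: lborel_distr_plus)
    then have "integrable lborel (\<lambda>x. indicator B (- axis i l + x) *\<^sub>R f (- axis i l + x))"
      by (subst (asm) integrable_distr_eq) (use iB borel_measurable_integrable in auto)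
    then show ?thesis by (simp add: add.commute[of "- axis i l"] per2)
  qed
  have ind: "indicator cell (y - axis i s) = (indicator A y + indicator B (y - axis i l) :: real)" for y
  proof -
    obtain j where j: "j \<noteq> i" "UNIV = {i, j}"
      by (metis (full_types) exhaust_2 UNIV_2 insert_commute zero_neq_one)
    have all: "(\<forall>a. P a) \<longleftrightarrow> P i \<and> P j" for P using j(2) by (metis UNIV_I insert_iff singletonD)
    show ?thesis using s l_pos j(1) by (auto simp: A_def B_def cell_def indicator_def all axis_def)
  qed
  have "(\<integral>x. f (x + axis i s) \<partial>torus l) = (\<integral>x. (\<lambda>y. indicator cell (y - axis i s) *\<^sub>R f y) (x + axis i s) \<partial>lborel)"
    by (simp add: integral_torus)
  also have "\<dots> = (\<integral>y. indicator cell (y - axis i s) *\<^sub>R f y \<partial>lborel)"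
    by (rule integral_lborel_shift)
  also have "\<dots> = (\<integral>y. indicator A y *\<^sub>R f y + indicator B (y - axis i l) *\<^sub>R f y \<partial>lborel)"
    by (simp add: ind scaleR_add_left)
  also have "\<dots> = (\<integral>y. indicator A y *\<^sub>R f y \<partial>lborel) + (\<integral>y. indicator B (y - axis i l) *\<^sub>R f y \<partial>lborel)"
    using iA iB2 by (rule Bochner_Integration.integral_add)
  also have "(\<integral>y. indicator B (y - axis i l) *\<^sub>R f y \<partial>lborel) = (\<integral>y. indicator B y *\<^sub>R f y \<partial>lborel)"
    using integral_lborel_shift[of "\<lambda>y. indicator B y *\<^sub>R f y" "- axis i l"] by (simp add: per2)
  also have "(\<integral>y. indicator A y *\<^sub>R f y \<partial>lborel) + (\<integral>y. indicator B y *\<^sub>R f y \<partial>lborel) = 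
     (\<integral>y. indicator A y *\<^sub>R f y + indicator B y *\<^sub>R f y \<partial>lborel)"
    using iA iB by simp
  also have "\<dots> = (\<integral>y. indicator cell y *\<^sub>R f y \<partial>lborel)"
    by (rule Bochner_Integration.integral_cong) (auto simp: A_def B_def indicator_def)
  finally show ?thesis by (simp add: integral_torus)
qed

lemma integrable_torus_bounded:
  fixes f :: "real^2 \<Rightarrow> 'b::{banach, second_countable_topology}"
  assumes "f \<in> borel_measurable borel" "\<And>x. x \<in> cell \<Longrightarrow> norm (f x) \<le> B"
  shows "integrable (torus l) f"
  by (rule T.integrable_const_bound[of _ B]) (use assms in \<open>auto simp: space_torus intro!: AE_I2\<close>)

lemma integrable_torus_continuous:
  fixes f :: "real^2 \<Rightarrow> 'b::{banach, second_countable_topology}"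
  assumes "continuous_on UNIV f"
  shows "integrable (torus l) f"
proof -
  let ?K = "cbox 0 (\<chi> i. l) :: (real^2) set"
  have "bounded (f ` ?K)"
    by (intro compact_imp_bounded compact_continuous_image continuous_on_subset[OF assms]) auto
  then obtain B where "\<And>x. x \<in> ?K \<Longrightarrow> norm (f x) \<le> B" unfolding bounded_iff by blast
  moreover have "cell \<subseteq> ?K" by (auto simp: cell_def mem_box_cart less_imp_le)
  ultimately show ?thesis
    using assms by (intro integrable_torus_bounded[of _ B] borel_measurable_continuous_onI) auto
qed

text \<open>Difference quotients of a periodic function have mean zero by translation invariance.
  The mean value theorem bounds them uniformly on the cell, so dominated convergence carries this
  over to the derivative.\<close>

lemma integral_partial_zero:
  fixes f :: sfield
  assumes d: "\<And>x. f differentiable (at x)" and c: "continuous_on UNIV (partial i f)" and per: "periodic l f"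
  shows "(\<integral>x. partial i f x \<partial>torus l) = 0"
proof -
  have fc: "continuous_on UNIV f" 
    by (simp add: continuous_at_imp_continuous_on differentiable_imp_continuous_within d)
  have fb[measurable]: "f \<in> borel_measurable borel" "partial i f \<in> borel_measurable borel"
    using fc c by (auto intro: borel_measurable_continuous_onI)
  have fi: "integrable (torus l) f" by (rule integrable_torus_continuous[OF fc])
  \<comment> \<open>Side \<open>2 * l\<close>, because points of the cell are moved by less than
    \<open>l\<close> before the derivative is evaluated.\<close>
  let ?K = "cbox 0 (\<chi> i. 2 * l) :: (real^2) set"
  have "bounded (partial i f ` ?K)"
    by (intro compact_imp_bounded compact_continuous_image continuous_on_subset[OF c]) auto
  then obtain B where B: "\<And>x. x \<in> ?K \<Longrightarrow> norm (partial i f x) \<le> B" unfolding bounded_iff by blast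
  have dv: "((\<lambda>s. f (x + axis i s)) has_real_derivative partial i f (x + axis i s)) (at s)" for x s
  proof -
    obtain f' where f': "(f has_derivative f') (at (x + axis i s))" using d unfolding differentiable_def by blast
    have e: "axis i s = s *\<^sub>R (axis i 1 :: real^2)" for s by (simp add: axis_def vec_eq_iff)
    have "((\<lambda>s. x + s *\<^sub>R axis i 1) has_derivative (\<lambda>h. h *\<^sub>R axis i 1)) (at s)"
      by (auto intro!: derivative_eq_intros)
    from has_derivative_compose[OF this, of f f'] f'
    have "((\<lambda>s. f (x + s *\<^sub>R axis i 1)) has_derivative (\<lambda>h. f' (h *\<^sub>R axis i 1))) (at s)"
      by (simp add: e[symmetric])
    moreover have "f' (h *\<^sub>R axis i 1) = h * partial i f (x + axis i s)" for h
      using partial_eqI[OF f'] has_derivative_linear[OF f'] by (simp add: linear_cmul)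
    ultimately show ?thesis
      unfolding has_field_derivative_def e[symmetric] by (simp add: mult_commute_abs)
  qed
  \<comment> \<open>The factor \<open>l / 2\<close> keeps every shift strictly below one period, as
    \<open>integral_torus_shift\<close> demands.\<close>
  define \<sigma> where "\<sigma> n = l / 2 * inverse (real (Suc n))" for n
  have \<sigma>: "0 < \<sigma> n" "\<sigma> n < l" for n using l_pos by (auto simp: \<sigma>_def field_simps add_pos_nonneg)
  have \<sigma>0: "\<sigma> \<longlonglongrightarrow> 0" unfolding \<sigma>_def by (rule tendsto_mult_right_zero[OF LIMSEQ_inverse_real_of_nat])
  have z: "(\<integral>x. (f (x + axis i (\<sigma> n)) - f x) / \<sigma> n \<partial>torus l) = 0" for n
  proof -
    have "continuous_on UNIV (\<lambda>x. f (x + axis i (\<sigma> n)))"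
      by (rule continuous_on_compose2[OF fc]) (auto intro!: continuous_intros)
    then have "integrable (torus l) (\<lambda>x. f (x + axis i (\<sigma> n)))" by (rule integrable_torus_continuous)
    then show ?thesis using fi integral_torus_shift[OF fi per, of "\<sigma> n" i] \<sigma>[of n] by simp
  qed
  have "(\<lambda>n. \<integral>x. (f (x + axis i (\<sigma> n)) - f x) / \<sigma> n \<partial>torus l) \<longlonglongrightarrow> (\<integral>x. partial i f x \<partial>torus l)"
  proof (rule integral_dominated_convergence[where w="\<lambda>_. B"])
    show "AE x in torus l. (\<lambda>n. (f (x + axis i (\<sigma> n)) - f x) / \<sigma> n) \<longlonglongrightarrow> partial i f x"
    proof (rule AE_I2)
      fix x
      have "((\<lambda>h. (f (x + axis i h) - f x) / h) \<longlongrightarrow> partial i f x) (at 0)"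
      proof -
        have a0: "axis i 0 = (0::real^2)" by (simp add: axis_def vec_eq_iff)
        show ?thesis using dv[of x 0] by (simp add: has_field_derivative_iff a0)
      qed
      moreover have "filterlim \<sigma> (at 0) sequentially"
        unfolding filterlim_at using \<sigma> \<sigma>0 by (simp add: less_imp_neq[symmetric])
      ultimately show "(\<lambda>n. (f (x + axis i (\<sigma> n)) - f x) / \<sigma> n) \<longlonglongrightarrow> partial i f x"
        by (rule filterlim_compose)
    qed
    show "AE x in torus l. norm ((f (x + axis i (\<sigma> n)) - f x) / \<sigma> n) \<le> B" for n
    proof (rule AE_I2)
      fix x assume "x \<in> space (torus l)"
      then have x: "x \<in> cell" by (simp add: space_torus)
      have a0: "axis i 0 = (0::real^2)" by (simp add: axis_def vec_eq_iff)
      obtain z where z: "0 < z" "z < \<sigma> n" "f (x + axis i (\<sigma> n)) - f x = \<sigma> n * partial i f (x + axis i z)"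
        using MVT2[of 0 "\<sigma> n" "\<lambda>s. f (x + axis i s)" "\<lambda>s. partial i f (x + axis i s)"] dv \<sigma>[of n] by (auto simp: a0)
      have "x + axis i z \<in> ?K"
        unfolding mem_box_cart
      proof 
        fix j
        have "0 \<le> x $ j" "x $ j < l" using x by (auto simp: cell_def)
        then show "0 $ j \<le> (x + axis i z) $ j \<and> (x + axis i z) $ j \<le> (\<chi> i. 2 * l) $ j"
          using z(1,2) \<sigma>(2)[of n] l_pos by (cases "j = i") (auto simp: axis_def)
      qed
      then show "norm ((f (x + axis i (\<sigma> n)) - f x) / \<sigma> n) \<le> B"
        using B z(3) \<sigma>[of n] by simp
    qed
  qed auto
  then show ?thesis unfolding z by (simp add: LIMSEQ_const_iff)
qed

section \<open>Fourier series\<close>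


definition phase :: "int \<times> int \<Rightarrow> real^2 \<Rightarrow> real" where
  "phase k x = 2 * pi * (real_of_int (fst k) * x $ 1 + real_of_int (snd k) * x $ 2) / l"

definition expo :: "int \<times> int \<Rightarrow> real^2 \<Rightarrow> complex" where
  "expo k x = cis (phase k x)"

text \<open>The Fourier symbol of a derivative up to the factor \<open>\<i>\<close>: differentiating
  \<open>expo k\<close> in direction \<open>i\<close> multiplies it by
  \<open>\<i> * wave i k\<close>.\<close>

definition wave :: "2 \<Rightarrow> int \<times> int \<Rightarrow> real" where
  "wave i k = 2 * pi * real_of_int (if i = 1 then fst k else snd k) / l"

lemma norm_expo[simp]: "cmod (expo k x) = 1" by (simp add: expo_def)

lemma phase_add: "phase (j + k) x = phase j x + phase k x"
  by (simp add: phase_def add_divide_distrib[symmetric] algebra_simps)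

lemma phase_minus: "phase (- k) x = - phase k x"
  unfolding phase_def minus_divide_left by (simp add: algebra_simps)

lemma expo_add: "expo (j + k) x = expo j x * expo k x"
  by (simp add: expo_def phase_add cis_mult)

lemma expo_minus: "expo (- k) x = cnj (expo k x)"
  by (simp add: expo_def phase_minus cis_cnj)

lemma expo_0[simp]: "expo 0 x = 1" by (simp add: expo_def phase_def)

lemma phase_shift: "phase k (x + axis i s) = phase k x + wave i k * s"
proof -
  consider "i = 1" | "i = 2" using exhaust_2 by blast
  then show ?thesis
    by cases (simp_all add: phase_def wave_def axis_def add_divide_distrib[symmetric] algebra_simps)
qed

lemma periodic_expo: "periodic l (expo k)"
proof -
  have "cis (phase k x + wave i k * l) = cis (phase k x)" for x i
  proof -
    have "wave i k * l = 2 * pi * real_of_int (if i = 1 then fst k else snd k)"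
      using l_pos by (simp add: wave_def)
    then have "cis (wave i k * l) = 1" using cis_multiple_2pi[of "real_of_int (if i = 1 then fst k else snd k)"] by simp
    then show ?thesis by (simp add: cis_mult[symmetric])
  qed
  then show ?thesis by (simp add: periodic_def expo_def phase_shift)
qed

lemma linear_phase: "linear (phase k)"
  by (rule linearI) (simp_all add: phase_def add_divide_distrib[symmetric] algebra_simps)

lemma has_derivative_phase: "(phase k has_derivative phase k) (at x)"
  by (simp add: linear_phase linear_imp_has_derivative)

lemma phase_axis: "phase k (axis i 1) = wave i k"
  using phase_shift[of k 0 i 1] linear_0[OF linear_phase[of k]] by simp

lemma has_derivative_expo: "(expo k has_derivative (\<lambda>h. phase k h *\<^sub>R (\<i> * expo k x))) (at x)"
proof -
  have "((\<lambda>t. exp (t *\<^sub>R \<i>)) has_vector_derivative (exp (t *\<^sub>R \<i>) * \<i>)) (at t)" for t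
    by (rule exp_scaleR_has_vector_derivative_right)
  then have "(cis has_vector_derivative (\<i> * cis t)) (at t)" for t
    by (simp add: cis_conv_exp scaleR_conv_of_real mult.commute flip: cis_conv_exp)
  then have "(cis has_derivative (\<lambda>h. h *\<^sub>R (\<i> * cis (phase k x)))) (at (phase k x))"
    by (simp add: has_vector_derivative_def)
  from has_derivative_compose[OF has_derivative_phase this] show ?thesis
    unfolding expo_def .
qed

lemma continuous_expo: "continuous_on UNIV (expo k)"
  by (rule has_derivative_continuous_on) (rule has_derivative_at_withinI[OF has_derivative_expo])

lemma borel_expo[measurable]: "expo k \<in> borel_measurable borel"
  by (intro borel_measurable_continuous_onI continuous_expo)

text \<open>The real part keeps the result a \<open>sfield\<close> without a symmetry condition on
  \<open>c\<close>. On a single frequency the coefficients 1 and \<open>- \<i>\<close> give cosine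
  and sine.\<close>

definition trig :: "(int \<times> int) set \<Rightarrow> (int \<times> int \<Rightarrow> complex) \<Rightarrow> sfield" where
  "trig A c x = Re (\<Sum>k\<in>A. c k * expo k x)"

lemma periodic_trig: "periodic l (trig A c)"
  using periodic_expo by (simp add: periodic_def trig_def)

lemma has_derivative_trig:
  "(trig A c has_derivative (\<lambda>h. Re (\<Sum>k\<in>A. c k * (phase k h *\<^sub>R (\<i> * expo k x))))) (at x)"
  unfolding trig_def
  by (intro has_derivative_Re has_derivative_sum has_derivative_mult_right has_derivative_expo)

lemma partial_trig: "partial i (trig A c) = trig A (\<lambda>k. \<i> * complex_of_real (wave i k) * c k)"
  by (rule ext) (simp add: partial_eqI[OF has_derivative_trig] phase_axis trig_def scaleR_conv_of_real mult_ac)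

lemma smooth_trig: "smooth (trig A c)"
proof (rule smooth_coinduct[where C="range (trig A)"])
  show "f differentiable_on UNIV" if "f \<in> range (trig A)" for f
    using that has_derivative_trig by (auto simp: differentiable_on_def differentiable_def)
  show "partial i f \<in> range (trig A)" if "f \<in> range (trig A)" for f i
    using that by (auto simp: partial_trig)
qed auto

text \<open>For \<open>k \<noteq> 0\<close>, a shift by half a wavelength along a direction with
  \<open>wave i k \<noteq> 0\<close> changes the sign of \<open>expo k\<close> but not its integral.
  The shift is at most half a period since a nonzero integer has modulus at least 1.\<close>

lemma integral_expo: "(\<integral>x. expo k x \<partial>torus l) = (if k = 0 then of_real (l\<^sup>2) else 0)"
proof (cases "k = 0")
  case True
  have "expo 0 = (\<lambda>x. 1)" by auto
  then show ?thesis using True by (simp add: measure_torus scaleR_conv_of_real)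
next
  case False
  then obtain i where i: "wave i k \<noteq> 0"
    using l_pos that[of 1] that[of 2] by (cases k) (auto simp: wave_def zero_prod_def)
  define s where "s = pi / \<bar>wave i k\<bar>"
  let ?n = "if i = 1 then fst k else snd k"
  have n: "?n \<noteq> 0" using i by (auto simp: wave_def)
  have "\<bar>real_of_int ?n\<bar> \<ge> 1" using n by linarith
  then have "s < l" unfolding s_def wave_def using l_pos n by (auto simp: abs_mult field_simps)
  have sgn: "wave i k * s = pi \<or> wave i k * s = - pi" using i by (auto simp: s_def abs_if)
  have s: "cis (wave i k * s) = -1" using sgn cis_pi by (metis cis_cnj complex_cnj_minus complex_cnj_one)
  have "0 \<le> s" using i by (simp add: s_def)
  have "(\<integral>x. expo k (x + axis i s) \<partial>torus l) = (\<integral>x. expo k x \<partial>torus l)"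
    by (intro integral_torus_shift integrable_torus_continuous continuous_expo periodic_expo \<open>s < l\<close> \<open>0 \<le> s\<close>)
  moreover have "expo k (x + axis i s) = - expo k x" for x
    by (simp add: expo_def phase_shift cis_mult[symmetric] s)
  ultimately have "(\<integral>x. expo k x \<partial>torus l) = 0" by simp
  then show ?thesis using False by simp
qed

lemma integral_expo_cnj: "(\<integral>x. expo j x * cnj (expo k x) \<partial>torus l) = (if j = k then of_real (l\<^sup>2) else 0)"
proof -
  have "expo j x * cnj (expo k x) = expo (j - k) x" for x
    by (simp add: expo_minus[symmetric] expo_add[symmetric])
  then show ?thesis by (simp add: integral_expo)
qed

definition fco :: "(real^2 \<Rightarrow> complex) \<Rightarrow> int \<times> int \<Rightarrow> complex" where
  "fco h k = (\<integral>x. h x * cnj (expo k x) \<partial>torus l) / of_real (l\<^sup>2)"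

text \<open>Fourier uniqueness: integrals against continuous functions of the embedding
  of the torus into \<open>\<complex>\<^sup>2\<close> vanish by Stone--Weierstrass; indicators of compact subsets of the cell are
  bounded limits of such functions.\<close>

definition embed :: "real^2 \<Rightarrow> complex \<times> complex" where
  "embed x = (expo (1,0) x, expo (0,1) x)"

lemma continuous_embed: "continuous_on UNIV embed"
  unfolding embed_def by (intro continuous_on_Pair continuous_expo)

lemma inj_on_embed: "inj_on embed cell"
proof (rule inj_onI)
  fix x y assume x: "x \<in> cell" and y: "y \<in> cell" and e: "embed x = embed y"
  have A: "Arg2pi (cis a) = a" if "0 \<le> a" "a < 2 * pi" for a
    using that by (intro Arg2pi_unique[of 1]) (auto simp: cis_conv_exp)
  have "x $ i = y $ i" for i
  proof -
    have "cis (2 * pi * x $ i / l) = cis (2 * pi * y $ i / l)"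
      using e exhaust_2[of i] by (auto simp: embed_def expo_def phase_def)
    moreover have "0 \<le> 2 * pi * x $ i / l" "2 * pi * x $ i / l < 2 * pi" "0 \<le> 2 * pi * y $ i / l" "2 * pi * y $ i / l < 2 * pi"
      using x y l_pos by (auto simp: cell_def field_simps)
    ultimately have "2 * pi * x $ i / l = 2 * pi * y $ i / l"
      using A by metis
    then show ?thesis using l_pos by simp
  qed
  then show "x = y" by (simp add: vec_eq_iff)
qed

text \<open>Real and imaginary parts of the two coordinates are combinations of four modes, Re z
  being (z + cnj z) / 2 and Im z being (z - cnj z) / (2 i); this gives the coefficients in the
  linear case. Products only add frequencies, so finite exponential sums form an algebra.\<close>

lemma real_polynomial_embed_trig:
  assumes "real_polynomial_function p"
  shows "\<exists>A c. finite A \<and> (\<forall>x. complex_of_real (p (embed x)) = (\<Sum>k\<in>A. c k * expo k x))"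
  using assms
proof induction
  case (linear f)
  define a where "a = f (1, 0)"
  define b where "b = f (\<i>, 0)"
  define a' where "a' = f (0, 1)"
  define b' where "b' = f (0, \<i>)"
  interpret f: bounded_linear f by fact
  have f: "f (z, w) = Re z * a + Im z * b + Re w * a' + Im w * b'" for z w
  proof -
    have "(z, w) = Re z *\<^sub>R (1, 0) + Im z *\<^sub>R (\<i>, 0) + Re w *\<^sub>R (0, 1) + Im w *\<^sub>R (0, \<i>)"
      by (simp add: complex_eq_iff)
    then show ?thesis unfolding a_def b_def a'_def b'_def by (simp only: f.add f.scaleR real_scaleR_def)
  qed
  define c where "c k = (if k = (1,0) then Complex (a/2) (-b/2) else if k = (-1,0) then Complex (a/2) (b/2)
     else if k = (0,1) then Complex (a'/2) (-b'/2) else Complex (a'/2) (b'/2))" for k :: "int \<times> int"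
  have m: "expo (-1,0) x = cnj (expo (1,0) x)" "expo (0,-1) x = cnj (expo (0,1) x)" for x
    using expo_minus[of "(1,0)" x] expo_minus[of "(0,1)" x] by simp_all
  have "complex_of_real (f (embed x)) = (\<Sum>k\<in>{(1,0),(-1,0),(0,1),(0,-1)}. c k * expo k x)" for x
    by (simp add: embed_def f c_def m complex_eq_iff algebra_simps)
  then show ?case
    by (intro exI[of _ "{(1,0),(-1,0),(0,1),(0,-1)}"] exI[of _ c]) simp
next
  case (const a)
  show ?case by (intro exI[of _ "{0}"] exI[of _ "\<lambda>_. of_real a"]) simp
next
  case (add f g)
  obtain A c where A: "finite A" "\<And>x. complex_of_real (f (embed x)) = (\<Sum>k\<in>A. c k * expo k x)"
    using add.IH(1) by blast
  obtain B d where B: "finite B" "\<And>x. complex_of_real (g (embed x)) = (\<Sum>k\<in>B. d k * expo k x)"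
    using add.IH(2) by blast
  have "complex_of_real (f (embed x) + g (embed x)) =
     (\<Sum>k\<in>A\<union>B. ((if k \<in> A then c k else 0) + (if k \<in> B then d k else 0)) * expo k x)" for x
  proof -
    have "(\<Sum>k\<in>A. c k * expo k x) = (\<Sum>k\<in>A\<union>B. (if k \<in> A then c k else 0) * expo k x)"
      "(\<Sum>k\<in>B. d k * expo k x) = (\<Sum>k\<in>A\<union>B. (if k \<in> B then d k else 0) * expo k x)"
      using A(1) B(1) by (auto intro!: sum.mono_neutral_cong_left)
    then show ?thesis by (simp add: A B sum.distrib distrib_right)
  qed
  moreover have "finite (A \<union> B)" using A(1) B(1) by simp
  ultimately show ?case
    by (intro exI[of _ "A \<union> B"] exI[of _ "\<lambda>k. (if k \<in> A then c k else 0) + (if k \<in> B then d k else 0)"]) simp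
next
  case (mult f g)
  obtain A c where A: "finite A" "\<And>x. complex_of_real (f (embed x)) = (\<Sum>k\<in>A. c k * expo k x)"
    using mult.IH(1) by blast
  obtain B d where B: "finite B" "\<And>x. complex_of_real (g (embed x)) = (\<Sum>k\<in>B. d k * expo k x)"
    using mult.IH(2) by blast
  define S where "S = (\<lambda>jk. fst jk + snd jk) ` (A \<times> B)"
  have "complex_of_real (f (embed x) * g (embed x)) =
     (\<Sum>n\<in>S. (\<Sum>jk\<in>{jk\<in>A \<times> B. fst jk + snd jk = n}. c (fst jk) * d (snd jk)) * expo n x)" for x
  proof -
    have "complex_of_real (f (embed x) * g (embed x)) = (\<Sum>jk\<in>A\<times>B. c (fst jk) * d (snd jk) * expo (fst jk + snd jk) x)"
      by (simp add: A B sum_product sum.cartesian_product case_prod_beta expo_add mult_ac)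
    also have "\<dots> = (\<Sum>n\<in>S. \<Sum>jk\<in>{jk\<in>A \<times> B. fst jk + snd jk = n}. c (fst jk) * d (snd jk) * expo (fst jk + snd jk) x)"
      using A(1) B(1) by (intro sum.group[symmetric]) (simp_all add: S_def)
    also have "\<dots> = (\<Sum>n\<in>S. (\<Sum>jk\<in>{jk\<in>A \<times> B. fst jk + snd jk = n}. c (fst jk) * d (snd jk)) * expo n x)"
      by (intro sum.cong refl) (simp add: sum_distrib_right)
    finally show ?thesis .
  qed
  moreover have "finite S" using A(1) B(1) by (simp add: S_def)
  ultimately show ?case
    by (intro exI[of _ S] exI[of _ "\<lambda>n. \<Sum>jk\<in>{jk\<in>A \<times> B. fst jk + snd jk = n}. c (fst jk) * d (snd jk)"]) simp
qed


lemma fourier_zero_polynomial: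
  fixes w :: "real^2 \<Rightarrow> complex"
  assumes w: "integrable (torus l) w" and z: "\<And>k. fco w k = 0" and p: "real_polynomial_function p"
  shows "(\<integral>x. w x * of_real (p (embed x)) \<partial>torus l) = 0"
proof -
  obtain A c where A: "finite A" "\<And>x. complex_of_real (p (embed x)) = (\<Sum>k\<in>A. c k * expo k x)"
    using real_polynomial_embed_trig[OF p] by metis
  have i: "integrable (torus l) (\<lambda>x. w x * expo k x)" for k
    by (rule Bochner_Integration.integrable_bound[OF w]) (use w in \<open>auto simp: norm_mult\<close>)
  have "(\<integral>x. w x * expo k x \<partial>torus l) = 0" for k
    using z[of "-k"] l_pos by (simp add: fco_def expo_minus)
  then have "(\<integral>x. (\<Sum>k\<in>A. c k * (w x * expo k x)) \<partial>torus l) = 0"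
    using i by (subst Bochner_Integration.integral_sum) auto
  then show ?thesis by (simp add: A sum_distrib_left mult_ac)
qed

lemma fourier_zero_continuous:
  fixes w :: "real^2 \<Rightarrow> complex"
  assumes w: "integrable (torus l) w" and z: "\<And>k. fco w k = 0" and F: "continuous_on UNIV (F :: _ \<Rightarrow> real)"
  shows "(\<integral>x. w x * of_real (F (embed x)) \<partial>torus l) = 0"
proof -
  let ?K = "sphere 0 1 \<times> sphere 0 1 :: (complex \<times> complex) set"
  have K: "compact ?K" by (intro compact_Times) auto
  have e: "embed x \<in> ?K" for x by (simp add: embed_def)
  have "\<exists>p. real_polynomial_function p \<and> (\<forall>x\<in>?K. \<bar>F x - p x\<bar> < inverse (real (Suc n)))" for n
    using Stone_Weierstrass_real_polynomial_function[OF K continuous_on_subset[OF F], of "inverse (real (Suc n))"]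
    by (metis inverse_positive_iff_positive of_nat_0_less_iff subset_UNIV zero_less_Suc)
  then obtain p where p: "\<And>n. real_polynomial_function (p n)" "\<And>n x. x \<in> ?K \<Longrightarrow> \<bar>F x - p n x\<bar> < inverse (real (Suc n))"
    by metis
  have Fe: "continuous_on UNIV (\<lambda>x. F (embed x))"
    by (rule continuous_on_compose2[OF F continuous_embed]) auto
  have pe: "continuous_on UNIV (\<lambda>x. p n (embed x))" for n
    by (rule continuous_on_compose2[OF continuous_on_polymonial_function continuous_embed])
       (use p(1) real_polynomial_function_eq in auto)
  have [measurable]: "(\<lambda>x. F (embed x)) \<in> borel_measurable borel" "\<And>n. (\<lambda>x. p n (embed x)) \<in> borel_measurable borel"
    using Fe pe by (auto intro: borel_measurable_continuous_onI)
  have [measurable]: "w \<in> borel_measurable (torus l)" using w by auto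
  have lim: "(\<lambda>n. p n (embed x)) \<longlonglongrightarrow> F (embed x)" for x
  proof -
    have "(\<lambda>n. F (embed x) - p n (embed x)) \<longlonglongrightarrow> 0"
      by (rule Lim_null_comparison[OF _ LIMSEQ_inverse_real_of_nat])
         (use p(2)[OF e] in \<open>auto intro!: always_eventually less_imp_le\<close>)
    from tendsto_diff[OF tendsto_const[of "F (embed x)"] this] show ?thesis by simp
  qed
  obtain B where B: "\<And>x. x \<in> ?K \<Longrightarrow> \<bar>F x\<bar> \<le> B"
    using compact_imp_bounded[OF compact_continuous_image[OF continuous_on_subset[OF F] K]]
    unfolding bounded_iff by auto
  have "(\<lambda>n. \<integral>x. w x * of_real (p n (embed x)) \<partial>torus l) \<longlonglongrightarrow> (\<integral>x. w x * of_real (F (embed x)) \<partial>torus l)"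
  proof (rule integral_dominated_convergence[where w="\<lambda>x. norm (w x) * (B + 1)"])
    show "integrable (torus l) (\<lambda>x. norm (w x) * (B + 1))" using w by auto
    show "AE x in torus l. (\<lambda>n. w x * of_real (p n (embed x))) \<longlonglongrightarrow> w x * of_real (F (embed x))"
      using lim by (auto intro!: AE_I2 tendsto_intros)
    show "AE x in torus l. norm (w x * of_real (p n (embed x))) \<le> norm (w x) * (B + 1)" for n
    proof (rule AE_I2)
      fix x
      have "inverse (real (Suc n)) \<le> 1" by (simp add: field_simps)
      then have "\<bar>p n (embed x)\<bar> \<le> B + 1" using p(2)[OF e, of x n] B[OF e, of x] by linarith
      then show "norm (w x * of_real (p n (embed x))) \<le> norm (w x) * (B + 1)"
        by (simp add: norm_mult mult_left_mono)
    qed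
  qed auto
  then show ?thesis by (simp add: fourier_zero_polynomial[OF w z p(1)] LIMSEQ_const_iff)
qed

lemma fourier_zero_compact:
  fixes w :: "real^2 \<Rightarrow> complex"
  assumes w: "integrable (torus l) w" and z: "\<And>k. fco w k = 0" and C: "compact C" "C \<subseteq> cell"
  shows "(\<integral>x. w x * indicator C x \<partial>torus l) = 0"
proof (cases "C = {}")
  case False
  define F where "F = embed ` C"
  have F: "compact F" "F \<noteq> {}" unfolding F_def using C(1) False
    by (auto intro!: compact_continuous_image continuous_on_subset[OF continuous_embed])
  \<comment> \<open>Injectivity of \<open>embed\<close> on the cell is what allows the indicator of
    \<open>C\<close> to be read off from its image \<open>F\<close>.\<close>
  have ind: "indicator C x = (indicator F (embed x) :: real)" if "x \<in> cell" for x
    using inj_on_image_mem_iff[OF inj_on_embed that C(2)] by (auto simp: F_def indicator_def)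
  \<comment> \<open>Lipschitz cut-offs equal to 1 on \<open>F\<close> that vanish once the distance
    to \<open>F\<close> is at least 1/n; since \<open>F\<close> is closed they tend pointwise to its
    indicator.\<close>
  define G where "G n y = max 0 (1 - real n * infdist y F)" for n y
  have Gc: "continuous_on UNIV (G n)" for n unfolding G_def by (intro continuous_intros)
  have lim: "(\<lambda>n. G n y) \<longlonglongrightarrow> indicator F y" for y
  proof (cases "y \<in> F")
    case True then show ?thesis by (simp add: G_def)
  next
    case False
    then have pos: "infdist y F > 0" 
      using F infdist_pos_not_in_closed[of F y] compact_imp_closed by blast
    obtain N where N: "real N * infdist y F > 1" using reals_Archimedean3[OF pos] by blast
    have "G n y = 0" if "n \<ge> N" for n
    proof -
      have "real N * infdist y F \<le> real n * infdist y F" using that pos by (intro mult_right_mono) auto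
      then show ?thesis using N by (simp add: G_def)
    qed
    then have "eventually (\<lambda>n. G n y = 0) sequentially" by (auto simp: eventually_sequentially)
    then show ?thesis using False by (simp add: tendsto_eventually)
  qed
  have [measurable]: "w \<in> borel_measurable (torus l)" using w by auto
  have [measurable]: "(\<lambda>x. G n (embed x)) \<in> borel_measurable borel" for n
    by (intro borel_measurable_continuous_onI continuous_on_compose2[OF Gc continuous_embed]) auto
  have [measurable]: "C \<in> sets borel" using C(1) by (simp add: borel_compact)
  have "(\<lambda>n. \<integral>x. w x * of_real (G n (embed x)) \<partial>torus l) \<longlonglongrightarrow> (\<integral>x. w x * of_real (indicator C x) \<partial>torus l)"
  proof (rule integral_dominated_convergence[where w="\<lambda>x. norm (w x)"])
    show "AE x in torus l. (\<lambda>n. w x * of_real (G n (embed x))) \<longlonglongrightarrow> w x * of_real (indicator C x)"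
    proof (rule AE_I2)
      fix x assume "x \<in> space (torus l)"
      then have "(\<lambda>n. G n (embed x)) \<longlonglongrightarrow> indicator C x" using lim[of "embed x"] ind by (simp add: space_torus)
      then show "(\<lambda>n. w x * of_real (G n (embed x))) \<longlonglongrightarrow> w x * of_real (indicator C x)"
        by (intro tendsto_mult tendsto_const tendsto_of_real)
    qed
    show "AE x in torus l. norm (w x * of_real (G n (embed x))) \<le> norm (w x)" for n
    proof (rule AE_I2)
      fix x
      have "\<bar>G n (embed x)\<bar> \<le> 1" by (auto simp: G_def infdist_nonneg)
      then show "norm (w x * of_real (G n (embed x))) \<le> norm (w x)"
        by (simp add: norm_mult mult_left_le)
    qed
  qed (use w in auto)
  then have "(\<integral>x. w x * of_real (indicator C x) \<partial>torus l) = 0"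
    unfolding fourier_zero_continuous[OF w z Gc] by (simp add: LIMSEQ_const_iff)
  moreover have "(\<lambda>x. w x * of_real (indicator C x)) = (\<lambda>x. w x * indicator C x)"
    by (auto simp: indicator_def)
  ultimately show ?thesis by simp
qed auto

text \<open>The cell is not compact, so a closed set is exhausted by its traces on the compact cubes
  \<open>Q n\<close>, which increase to the half-open cell.\<close>

lemma fourier_zero_closed:
  fixes w :: "real^2 \<Rightarrow> complex"
  assumes w: "integrable (torus l) w" and z: "\<And>k. fco w k = 0" and C: "closed C"
  shows "(\<integral>x. w x * indicator C x \<partial>torus l) = 0"
proof -
  define Q where "Q n = cbox 0 (\<chi> i. l - l / real (Suc n) :: real^2)" for n
  have Q: "compact (C \<inter> Q n)" "C \<inter> Q n \<subseteq> cell" for n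
  proof -
    show "compact (C \<inter> Q n)" using C by (simp add: Q_def closed_Int_compact)
    have "0 < l / real (Suc n)" using l_pos by simp
    then have "a < l" if "a \<le> l - l / real (Suc n)" for a using that by linarith
    then show "C \<inter> Q n \<subseteq> cell" by (auto simp: Q_def cell_def mem_box_cart)
  qed
  have lim: "(\<lambda>n. indicator (C \<inter> Q n) x :: complex) \<longlonglongrightarrow> indicator C x" if x: "x \<in> cell" for x
  proof -
    have "\<exists>N. \<forall>n\<ge>N. x $ i \<le> l - l / real (Suc n)" for i
    proof -
      have "(\<lambda>n. l - l * inverse (real (Suc n))) \<longlonglongrightarrow> l - 0"
        by (intro tendsto_diff tendsto_const tendsto_mult_right_zero LIMSEQ_inverse_real_of_nat)
      then have "eventually (\<lambda>n. x $ i < l - l * inverse (real (Suc n))) sequentially"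
        using x by (auto simp: cell_def dest: order_tendstoD(1))
      then show ?thesis by (auto simp: eventually_sequentially divide_inverse intro: less_imp_le)
    qed
    then obtain N where N: "\<And>i n. n \<ge> N i \<Longrightarrow> x $ i \<le> l - l / real (Suc n)" by metis
    have "x \<in> Q n" if "n \<ge> max (N 1) (N 2)" for n
    proof -
      have "x $ i \<le> l - l / real (Suc n)" for i using N[of i n] that exhaust_2[of i] by auto
      then show ?thesis using x by (simp add: Q_def mem_box_cart cell_def)
    qed
    then have "eventually (\<lambda>n. indicator (C \<inter> Q n) x = (indicator C x :: complex)) sequentially"
      unfolding eventually_sequentially by (intro exI[of _ "max (N 1) (N 2)"]) (auto simp: indicator_def)
    then show ?thesis by (rule tendsto_eventually)
  qed
  have [measurable]: "w \<in> borel_measurable (torus l)" using w by auto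
  have [measurable]: "C \<in> sets borel" "Q n \<in> sets borel" for n using C by (auto simp: Q_def)
  have "(\<lambda>n. \<integral>x. w x * indicator (C \<inter> Q n) x \<partial>torus l) \<longlonglongrightarrow> (\<integral>x. w x * indicator C x \<partial>torus l)"
  proof (rule integral_dominated_convergence[where w="\<lambda>x. norm (w x)"])
    show "AE x in torus l. (\<lambda>n. w x * indicator (C \<inter> Q n) x) \<longlonglongrightarrow> w x * indicator C x"
      using lim by (auto intro!: AE_I2 tendsto_intros simp: space_torus)
    show "AE x in torus l. norm (w x * indicator (C \<inter> Q n) x) \<le> norm (w x)" for n
      by (auto intro!: AE_I2 simp: indicator_def)
  qed (use w in auto)
  then show ?thesis by (simp add: fourier_zero_compact[OF w z Q] LIMSEQ_const_iff)
qed

text \<open>Closed sets form an intersection-stable generator of the Borel sets, so the vanishing of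
  the integrals spreads to all Borel sets by a Dynkin argument. It is then applied to the sets where
  \<open>w\<close> is positive and where it is negative.\<close>

lemma closed_integral_zero:
  fixes w :: "real^2 \<Rightarrow> real"
  assumes w: "integrable (torus l) w" and z: "\<And>C. closed C \<Longrightarrow> (\<integral>x. w x * indicator C x \<partial>torus l) = 0"
  shows "AE x in torus l. w x = 0"
proof -
  define P where "P A \<longleftrightarrow> (\<integral>x. w x * indicator A x \<partial>torus l) = 0" for A :: "(real^2) set"
  have [measurable]: "w \<in> borel_measurable (torus l)" using w by auto
  have i: "integrable (torus l) (\<lambda>x. w x * indicator A x)" if [measurable]: "A \<in> sets borel" for A
    by (rule Bochner_Integration.integrable_bound[OF w]) (auto simp: indicator_def)
  have P: "P A" if "A \<in> sets borel" for A
  proof -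
    have "Int_stable {C. closed C}" "{C. closed C} \<subseteq> Pow UNIV" "A \<in> sigma_sets UNIV {C. closed C}"
      using that by (auto simp: borel_eq_closed Int_stable_def)
    then show ?thesis
    proof (induction rule: sigma_sets_induct_disjoint)
      case (basic A) then show ?case using z by (simp add: P_def)
    next
      case empty show ?case by (simp add: P_def)
    next
      case (compl A)
      then have A: "A \<in> sets borel" by (simp add: borel_eq_closed)
      have "(\<integral>x. w x * indicator (UNIV - A) x \<partial>torus l) = (\<integral>x. w x * indicator UNIV x - w x * indicator A x \<partial>torus l)"
        by (rule Bochner_Integration.integral_cong) (auto simp: indicator_def)
      also have "\<dots> = 0" using i[OF A] i[of UNIV] compl z[of UNIV] by (simp add: P_def)
      finally show ?case by (simp add: P_def)
    next
      case (union A)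
      then have A: "A n \<in> sets borel" for n by (auto simp: borel_eq_closed)
      have [measurable]: "(\<Union>n. A n) \<in> sets borel" "A n \<in> sets borel" for n using A by auto
      have "(\<lambda>n. \<integral>x. w x * (\<Sum>k<n. indicator (A k) x) \<partial>torus l) \<longlonglongrightarrow> (\<integral>x. w x * indicator (\<Union>n. A n) x \<partial>torus l)"
      proof (rule integral_dominated_convergence[where w="\<lambda>x. norm (w x)"])
        have s: "(\<lambda>k. indicator (A k) x :: real) sums indicator (\<Union>n. A n) x" for x
          by (rule indicator_sums) (use union in \<open>auto simp: disjoint_family_on_def\<close>)
        show "AE x in torus l. (\<lambda>n. w x * (\<Sum>k<n. indicator (A k) x)) \<longlonglongrightarrow> w x * indicator (\<Union>n. A n) x"
          using s by (auto intro!: AE_I2 tendsto_intros simp: sums_def)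
        show "AE x in torus l. norm (w x * (\<Sum>k<n. indicator (A k) x)) \<le> norm (w x)" for n
        proof (rule AE_I2)
          fix x
          have "(\<Sum>k<n. indicator (A k) x :: real) \<le> indicator (\<Union>n. A n) x"
            using s[of x] by (metis indicator_pos_le sum_le_suminf sums_unique sums_summable finite_lessThan)
          also have "\<dots> \<le> 1" by (simp add: indicator_def)
          finally have "\<bar>\<Sum>k<n. indicator (A k) x :: real\<bar> \<le> 1" by (simp add: sum_nonneg)
          then show "norm (w x * (\<Sum>k<n. indicator (A k) x)) \<le> norm (w x)" by (simp add: abs_mult mult_left_le)
        qed
      qed (use w in auto)
      moreover have "(\<integral>x. w x * (\<Sum>k<n. indicator (A k) x) \<partial>torus l) = 0" for n
      proof -
        have "(\<integral>x. w x * (\<Sum>k<n. indicator (A k) x) \<partial>torus l) = (\<Sum>k<n. \<integral>x. w x * indicator (A k) x \<partial>torus l)"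
          unfolding sum_distrib_left by (rule Bochner_Integration.integral_sum[OF i[OF A]])
        then show ?thesis using union by (simp add: P_def)
      qed
      ultimately show ?case by (simp add: P_def LIMSEQ_const_iff)
    qed
  qed
  have "AE x in torus l. \<sigma> * w x \<le> 0" if \<sigma>: "\<sigma> = 1 \<or> \<sigma> = -1" for \<sigma>
  proof -
    define A where "A = {x \<in> space (torus l). \<sigma> * w x > 0}"
    have "A \<in> sets (torus l)" unfolding A_def by measurable
    then have A[measurable]: "A \<in> sets borel" by (auto simp: torus_eq sets_restrict_space)
    have n: "AE x in torus l. 0 \<le> \<sigma> * (w x * indicator A x)"
      by (rule AE_I2) (auto simp: A_def indicator_def)
    have "(\<integral>x. \<sigma> * (w x * indicator A x) \<partial>torus l) = 0" using P[OF A] by (simp add: P_def)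
    then have "AE x in torus l. \<sigma> * (w x * indicator A x) = 0"
      using integral_nonneg_eq_0_iff_AE[OF _ n] i[OF A] by auto
    then show ?thesis using AE_space by eventually_elim (use \<sigma> in \<open>auto simp: A_def indicator_def split: if_splits\<close>)
  qed
  from this[of 1] this[of "-1"] show ?thesis by auto
qed

theorem fourier_unique:
  fixes w :: "real^2 \<Rightarrow> complex"
  assumes w: "integrable (torus l) w" and z: "\<And>k. fco w k = 0"
  shows "AE x in torus l. w x = 0"
proof -
  have i: "integrable (torus l) (\<lambda>x. w x * indicator C x)" if C: "closed C" for C
  proof -
    have [measurable]: "C \<in> sets borel" "w \<in> borel_measurable (torus l)" using C w by auto
    show ?thesis by (rule Bochner_Integration.integrable_bound[OF w]) (auto simp: indicator_def)
  qed
  have "(\<integral>x. Re (w x) * indicator C x \<partial>torus l) = Re (\<integral>x. w x * indicator C x \<partial>torus l)" if "closed C" for C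
    by (subst integral_Re[OF i[OF that], symmetric]) (auto intro!: Bochner_Integration.integral_cong simp: indicator_def)
  then have 1: "AE x in torus l. Re (w x) = 0"
    using w by (intro closed_integral_zero) (auto simp: fourier_zero_closed[OF w z])
  have "(\<integral>x. Im (w x) * indicator C x \<partial>torus l) = Im (\<integral>x. w x * indicator C x \<partial>torus l)" if "closed C" for C
    by (subst integral_Im[OF i[OF that], symmetric]) (auto intro!: Bochner_Integration.integral_cong simp: indicator_def)
  then have 2: "AE x in torus l. Im (w x) = 0"
    using w by (intro closed_integral_zero) (auto simp: fourier_zero_closed[OF w z])
  from 1 2 show ?thesis by eventually_elim (simp add: complex_eq_iff)
qed

end

section \<open>Square-integrable functions, Cauchy-Schwarz and completeness\<close>

definition sq_int :: "'a measure \<Rightarrow> ('a \<Rightarrow> 'b::{banach, second_countable_topology}) \<Rightarrow> bool" where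
  "sq_int M f \<longleftrightarrow> f \<in> borel_measurable M \<and> integrable M (\<lambda>x. (norm (f x))\<^sup>2)"

lemma sq_int_measurable[measurable_dest]: "sq_int M f \<Longrightarrow> f \<in> borel_measurable M"
  by (simp add: sq_int_def)

lemma sq_int_integrable: "sq_int M f \<Longrightarrow> integrable M (\<lambda>x. (norm (f x))\<^sup>2)"
  by (simp add: sq_int_def)

lemma sq_int_add:
  assumes f: "sq_int M f" and g: "sq_int M g"
  shows "sq_int M (\<lambda>x. f x + g x)"
proof -
  have [measurable]: "f \<in> borel_measurable M" "g \<in> borel_measurable M" using f g by (auto simp: sq_int_def)
  have bd: "(norm (f x + g x))\<^sup>2 \<le> 2 * (norm (f x))\<^sup>2 + 2 * (norm (g x))\<^sup>2" for x
  proof -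
    have "(norm (f x + g x))\<^sup>2 \<le> (norm (f x) + norm (g x))\<^sup>2" by (simp add: norm_triangle_ineq power_mono)
    also have "\<dots> \<le> 2 * (norm (f x))\<^sup>2 + 2 * (norm (g x))\<^sup>2"
      using zero_le_power2[of "norm (f x) - norm (g x)"] by (simp add: power2_eq_square algebra_simps)
    finally show ?thesis .
  qed
  have "integrable M (\<lambda>x. (norm (f x + g x))\<^sup>2)"
    by (rule Bochner_Integration.integrable_bound[of M "\<lambda>x. 2 * (norm (f x))\<^sup>2 + 2 * (norm (g x))\<^sup>2"])
       (use f g bd in \<open>auto simp: sq_int_def\<close>)
  then show ?thesis by (simp add: sq_int_def)
qed

lemma sq_int_minus: "sq_int M f \<Longrightarrow> sq_int M (\<lambda>x. - f x)"
  by (simp add: sq_int_def)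

lemma sq_int_diff: "sq_int M f \<Longrightarrow> sq_int M g \<Longrightarrow> sq_int M (\<lambda>x. f x - g x)"
  using sq_int_add[of M f "\<lambda>x. - g x"] sq_int_minus by auto

lemma sq_int_zero[simp]: "sq_int M (\<lambda>x. 0)"
  by (simp add: sq_int_def)

lemma sq_int_sum: "(\<And>i. i \<in> I \<Longrightarrow> sq_int M (f i)) \<Longrightarrow> sq_int M (\<lambda>x. \<Sum>i\<in>I. f i x)"
  by (induction I rule: infinite_finite_induct) (auto intro!: sq_int_add)

lemma sq_int_bounded_mult:
  fixes f g :: "'a \<Rightarrow> 'b::{banach, second_countable_topology, real_normed_algebra}"
  assumes g: "sq_int M g" and [measurable]: "f \<in> borel_measurable M" and B: "AE x in M. norm (f x) \<le> B"
  shows "sq_int M (\<lambda>x. f x * g x)"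
proof -
  have [measurable]: "g \<in> borel_measurable M" using g by (auto simp: sq_int_def)
  have bd: "AE x in M. (norm (f x * g x))\<^sup>2 \<le> B\<^sup>2 * (norm (g x))\<^sup>2"
    using B
  proof eventually_elim
    case (elim x)
    have "norm (f x * g x) \<le> norm (f x) * norm (g x)" by (rule norm_mult_ineq)
    also have "\<dots> \<le> B * norm (g x)" using elim by (simp add: mult_right_mono)
    finally have "(norm (f x * g x))\<^sup>2 \<le> (B * norm (g x))\<^sup>2" by (simp add: power_mono)
    then show ?case by (simp add: power_mult_distrib)
  qed
  have "integrable M (\<lambda>x. (norm (f x * g x))\<^sup>2)"
    by (rule Bochner_Integration.integrable_bound[of M "\<lambda>x. B\<^sup>2 * (norm (g x))\<^sup>2"])
       (use g bd in \<open>auto simp: sq_int_def\<close>)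
  then show ?thesis by (simp add: sq_int_def)
qed

lemma sq_int_cmult:
  fixes g :: "'a \<Rightarrow> 'b::{banach, second_countable_topology, real_normed_algebra}"
  shows "sq_int M g \<Longrightarrow> sq_int M (\<lambda>x. c * g x)"
  by (rule sq_int_bounded_mult[where B="norm c"]) auto

lemma sq_int_cong_AE:
  assumes "sq_int M f" "g \<in> borel_measurable M" "AE x in M. f x = g x"
  shows "sq_int M g"
proof -
  have "integrable M (\<lambda>x. (norm (g x))\<^sup>2)"
    by (rule integrable_cong_AE_imp[of M "\<lambda>x. (norm (f x))\<^sup>2"]) (use assms in \<open>auto simp: sq_int_def\<close>)
  then show ?thesis using assms by (simp add: sq_int_def)
qed

lemma sq_int_norm: "sq_int M f \<Longrightarrow> sq_int M (\<lambda>x. norm (f x))"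
  by (auto simp: sq_int_def intro: borel_measurable_norm)

lemma integrable_sq_int_mult:
  fixes f g :: "'a \<Rightarrow> 'b::{banach, second_countable_topology, real_normed_algebra}"
  assumes f: "sq_int M f" and g: "sq_int M g"
  shows "integrable M (\<lambda>x. f x * g x)"
proof -
  have [measurable]: "f \<in> borel_measurable M" "g \<in> borel_measurable M" using f g by (auto simp: sq_int_def)
  have bd: "norm (f x * g x) \<le> (norm (f x))\<^sup>2 + (norm (g x))\<^sup>2" for x
  proof -
    have "norm (f x * g x) \<le> norm (f x) * norm (g x)" by (rule norm_mult_ineq)
    also have "\<dots> \<le> (norm (f x))\<^sup>2 + (norm (g x))\<^sup>2"
    proof -
      have "0 \<le> norm (f x) * norm (g x)" by simp
      moreover have "2 * (norm (f x) * norm (g x)) \<le> (norm (f x))\<^sup>2 + (norm (g x))\<^sup>2"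
        using zero_le_power2[of "norm (f x) - norm (g x)"] by (simp add: power2_eq_square algebra_simps)
      ultimately show ?thesis by linarith
    qed
    finally show ?thesis .
  qed
  show ?thesis
    by (rule Bochner_Integration.integrable_bound[of M "\<lambda>x. (norm (f x))\<^sup>2 + (norm (g x))\<^sup>2"])
       (use f g bd in \<open>auto simp: sq_int_def intro: order_trans\<close>)
qed

text \<open>The discriminant argument. For \<open>b > 0\<close> the minimising \<open>t\<close> is
  \<open>c / b\<close>; for \<open>b = 0\<close> the choice \<open>(a + 1) / (2 * c)\<close> would
  make the expression equal to -1.\<close>

lemma quadratic_nonneg_bound:
  fixes a b c :: real
  assumes "0 \<le> b" and "\<And>t. 0 \<le> a - 2 * t * c + t\<^sup>2 * b"
  shows "c\<^sup>2 \<le> a * b"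
proof (cases "b = 0")
  case True
  have "c = 0"
  proof (rule ccontr)
    assume "c \<noteq> 0"
    then show False using assms(2)[of "(a + 1) / (2 * c)"] True by simp
  qed
  then show ?thesis using True by simp
next
  case False
  then have b: "b > 0" using assms(1) by simp
  have "0 \<le> a - c\<^sup>2 / b" using assms(2)[of "c / b"] b by (simp add: power2_eq_square field_simps)
  then show ?thesis using b by (simp add: field_simps)
qed

lemma Cauchy_Schwarz_real:
  fixes f g :: "'a \<Rightarrow> real"
  assumes f: "sq_int M f" and g: "sq_int M g"
  shows "(\<integral>x. f x * g x \<partial>M)\<^sup>2 \<le> (\<integral>x. (f x)\<^sup>2 \<partial>M) * (\<integral>x. (g x)\<^sup>2 \<partial>M)"
proof (rule quadratic_nonneg_bound)
  show "0 \<le> (\<integral>x. (g x)\<^sup>2 \<partial>M)" by simp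
  fix t :: real
  have i: "integrable M (\<lambda>x. f x * g x)" "integrable M (\<lambda>x. (f x)\<^sup>2)" "integrable M (\<lambda>x. (g x)\<^sup>2)"
    using integrable_sq_int_mult[OF f g] sq_int_integrable[OF f] sq_int_integrable[OF g] by auto
  have "0 \<le> (\<integral>x. (f x - t * g x)\<^sup>2 \<partial>M)" by simp
  also have "(\<integral>x. (f x - t * g x)\<^sup>2 \<partial>M) = (\<integral>x. (f x)\<^sup>2 - (2 * t) * (f x * g x) + t\<^sup>2 * (g x)\<^sup>2 \<partial>M)"
    by (rule Bochner_Integration.integral_cong) (auto simp: power2_eq_square algebra_simps)
  also have "\<dots> = (\<integral>x. (f x)\<^sup>2 \<partial>M) - 2 * t * (\<integral>x. f x * g x \<partial>M) + t\<^sup>2 * (\<integral>x. (g x)\<^sup>2 \<partial>M)"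
    using i by simp
  finally show "0 \<le> (\<integral>x. (f x)\<^sup>2 \<partial>M) - 2 * t * (\<integral>x. f x * g x \<partial>M) + t\<^sup>2 * (\<integral>x. (g x)\<^sup>2 \<partial>M)" .
qed

definition l2norm :: "'a measure \<Rightarrow> ('a \<Rightarrow> 'b::real_normed_vector) \<Rightarrow> real" where
  "l2norm M f = sqrt (\<integral>x. (norm (f x))\<^sup>2 \<partial>M)"

lemma l2norm_nonneg[simp]: "0 \<le> l2norm M f"
  by (simp add: l2norm_def)

lemma l2norm_sq: "(l2norm M f)\<^sup>2 = (\<integral>x. (norm (f x))\<^sup>2 \<partial>M)"
  by (simp add: l2norm_def)

lemma Cauchy_Schwarz_norm:
  fixes f g :: "'a \<Rightarrow> 'b::{banach, second_countable_topology, real_normed_algebra}"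
  assumes f: "sq_int M f" and g: "sq_int M g"
  shows "(\<integral>x. norm (f x) * norm (g x) \<partial>M) \<le> l2norm M f * l2norm M g"
    "norm (\<integral>x. f x * g x \<partial>M) \<le> l2norm M f * l2norm M g"
proof -
  have *: "(\<integral>x. norm (f x) * norm (g x) \<partial>M)\<^sup>2 \<le> (l2norm M f * l2norm M g)\<^sup>2"
    using Cauchy_Schwarz_real[OF sq_int_norm[OF f] sq_int_norm[OF g]]
    by (simp add: l2norm_sq power_mult_distrib)
  then show 1: "(\<integral>x. norm (f x) * norm (g x) \<partial>M) \<le> l2norm M f * l2norm M g"
    using power2_le_imp_le by fastforce
  have "norm (\<integral>x. f x * g x \<partial>M) \<le> (\<integral>x. norm (f x * g x) \<partial>M)" by (rule integral_norm_bound)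
  also have "\<dots> \<le> (\<integral>x. norm (f x) * norm (g x) \<partial>M)"
    using integrable_sq_int_mult[OF f g] integrable_sq_int_mult[OF sq_int_norm[OF f] sq_int_norm[OF g]]
    by (intro integral_mono) (auto simp: norm_mult_ineq)
  finally show "norm (\<integral>x. f x * g x \<partial>M) \<le> l2norm M f * l2norm M g" using 1 by simp
qed

text \<open>Along a fast subsequence the increments have L^2 norm at most 2^-n. In a finite measure
  space they are then summable in L^1 too, hence absolutely summable at almost every point, which
  yields the limit function.\<close>

theorem (in finite_measure) Riesz_Fischer:
  fixes f :: "nat \<Rightarrow> 'a \<Rightarrow> 'b::{banach, second_countable_topology}"
  assumes f: "\<And>n. sq_int M (f n)"
    and cauchy: "\<And>e. e > 0 \<Longrightarrow> \<exists>N. \<forall>m\<ge>N. \<forall>n\<ge>N. (\<integral>x. (norm (f n x - f m x))\<^sup>2 \<partial>M) \<le> e"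
  shows "\<exists>g. sq_int M g \<and> (\<lambda>n. \<integral>x. (norm (f n x - g x))\<^sup>2 \<partial>M) \<longlonglongrightarrow> 0"
proof -
  have [measurable]: "f n \<in> borel_measurable M" for n using f by (simp add: sq_int_def)
  obtain N where N: "\<And>e m n. e > 0 \<Longrightarrow> m \<ge> N e \<Longrightarrow> n \<ge> N e \<Longrightarrow> (\<integral>x. (norm (f n x - f m x))\<^sup>2 \<partial>M) \<le> e"
    using cauchy by metis
  \<comment> \<open>\<open>N\<close> is evaluated at 4^-n because it controls squared norms. Adding
    all earlier thresholds and \<open>n\<close> itself makes \<open>r\<close> monotone and at least
    \<open>n\<close>.\<close>
  define r where "r n = n + (\<Sum>k\<le>n. N ((1/4)^k))" for n
  have r: "r n \<ge> N ((1/4)^n)" "r n \<le> r (Suc n)" "r n \<ge> n" for n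
    unfolding r_def by (auto intro!: trans_le_add2 member_le_sum)
  define d where "d n x = norm (f (r (Suc n)) x - f (r n) x)" for n x
  have [measurable]: "d n \<in> borel_measurable M" for n unfolding d_def by measurable
  have dn: "0 \<le> d n x" for n x by (simp add: d_def)
  have dsq: "sq_int M (d n)" for n unfolding d_def by (intro sq_int_norm sq_int_diff f)
  have d2: "l2norm M (d n) \<le> (1/2)^n" for n
  proof -
    have "(l2norm M (d n))\<^sup>2 \<le> (1/4)^n"
      using N[of "(1/4)^n" "r n" "r (Suc n)"] r[of n] by (simp add: l2norm_sq d_def)
    also have "(1/4)^n = ((1/2::real)^n)\<^sup>2" by (simp add: power2_eq_square flip: power_mult_distrib)
    finally show ?thesis by (rule power2_le_imp_le) simp
  qed
  define C where "C = l2norm M (\<lambda>_. 1::real)"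
  have d1: "(\<integral>\<^sup>+x. ennreal (d n x) \<partial>M) \<le> ennreal (C * (1/2)^n)" for n
  proof -
    have o: "sq_int M (\<lambda>_. 1::real)" by (simp add: sq_int_def)
    have "integrable M (d n)" using integrable_sq_int_mult[OF o dsq[of n]] by simp
    then have "(\<integral>\<^sup>+x. ennreal (d n x) \<partial>M) = ennreal (\<integral>x. d n x \<partial>M)"
      by (intro nn_integral_eq_integral) (auto simp: dn)
    also have "(\<integral>x. d n x \<partial>M) \<le> C * l2norm M (d n)"
      using Cauchy_Schwarz_norm(1)[OF o dsq[of n]] by (simp add: C_def d_def)
    also have "\<dots> \<le> C * (1/2)^n" using d2 by (intro mult_left_mono) (auto simp: C_def)
    finally show ?thesis by (simp add: ennreal_leI)
  qed
  have "(\<integral>\<^sup>+x. (\<Sum>n. ennreal (d n x)) \<partial>M) = (\<Sum>n. \<integral>\<^sup>+x. ennreal (d n x) \<partial>M)"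
    by (rule nn_integral_suminf) simp
  also have "\<dots> \<le> (\<Sum>n. ennreal (C * (1/2)^n))" by (intro suminf_le d1) auto
  also have "\<dots> = ennreal (\<Sum>n. C * (1/2)^n)"
    by (rule suminf_ennreal2) (auto simp: C_def intro!: summable_mult summable_geometric)
  also have "\<dots> < \<infinity>" by simp
  finally have "AE x in M. (\<Sum>n. ennreal (d n x)) \<noteq> \<infinity>" by (intro nn_integral_noteq_infinite) auto
  then have conv: "AE x in M. (\<lambda>n. f (r n) x) \<longlonglongrightarrow> lim (\<lambda>n. f (r n) x)"
  proof eventually_elim
    case (elim x)
    then have "summable (\<lambda>n. d n x)" by (intro summable_suminf_not_top) (auto simp: d_def)
    then have "summable (\<lambda>n. f (r (Suc n)) x - f (r n) x)" unfolding d_def by (rule summable_norm_cancel)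
    then have "convergent (\<lambda>n. (f (r n) x - f (r 0) x) + f (r 0) x)"
      by (intro convergent_add convergent_const)
         (simp add: summable_iff_convergent sum_lessThan_telescope[of "\<lambda>n. f (r n) x"])
    then have "convergent (\<lambda>n. f (r n) x)" by simp
    then show ?case by (simp add: convergent_LIMSEQ_iff)
  qed
  define g where "g x = lim (\<lambda>n. f (r n) x)" for x
  have [measurable]: "g \<in> borel_measurable M" unfolding g_def by measurable
  \<comment> \<open>Fatou's lemma along the subsequence: the Cauchy bound between \<open>f n\<close>
    and \<open>f (r m)\<close> survives the limit in \<open>m\<close>.\<close>
  have key: "(\<integral>\<^sup>+x. ennreal ((norm (f n x - g x))\<^sup>2) \<partial>M) \<le> ennreal e" if e: "e > 0" and n: "n \<ge> N e" for n e
  proof -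
    have "(\<integral>\<^sup>+x. ennreal ((norm (f n x - g x))\<^sup>2) \<partial>M) =
        (\<integral>\<^sup>+x. liminf (\<lambda>m. ennreal ((norm (f n x - f (r m) x))\<^sup>2)) \<partial>M)"
    proof (rule nn_integral_cong_AE, use conv in eventually_elim)
      case (elim x)
      then have "(\<lambda>m. ennreal ((norm (f n x - f (r m) x))\<^sup>2)) \<longlonglongrightarrow> ennreal ((norm (f n x - g x))\<^sup>2)"
        unfolding g_def by (intro tendsto_intros tendsto_ennrealI)
      then show ?case by (rule lim_imp_Liminf[OF sequentially_bot, symmetric])
    qed
    also have "\<dots> \<le> liminf (\<lambda>m. \<integral>\<^sup>+x. ennreal ((norm (f n x - f (r m) x))\<^sup>2) \<partial>M)"
      by (rule nn_integral_liminf) simp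
    also have "\<dots> \<le> ennreal e"
    proof (rule Liminf_le)
      show "\<forall>\<^sub>F m in sequentially. (\<integral>\<^sup>+x. ennreal ((norm (f n x - f (r m) x))\<^sup>2) \<partial>M) \<le> ennreal e"
        unfolding eventually_sequentially
      proof (intro exI allI impI)
        fix m assume "N e \<le> m"
        then have "r m \<ge> N e" using r(3)[of m] by linarith
        have "sq_int M (\<lambda>x. f n x - f (r m) x)" by (intro sq_int_diff f)
        then have "(\<integral>\<^sup>+x. ennreal ((norm (f n x - f (r m) x))\<^sup>2) \<partial>M) = ennreal (\<integral>x. (norm (f n x - f (r m) x))\<^sup>2 \<partial>M)"
          by (intro nn_integral_eq_integral) (auto simp: sq_int_def)
        then show "(\<integral>\<^sup>+x. ennreal ((norm (f n x - f (r m) x))\<^sup>2) \<partial>M) \<le> ennreal e"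
          using N[OF e \<open>r m \<ge> N e\<close> n] by (simp add: ennreal_leI)
      qed
    qed simp
    finally show ?thesis .
  qed
  have sqd: "sq_int M (\<lambda>x. f n x - g x)" and le: "(\<integral>x. (norm (f n x - g x))\<^sup>2 \<partial>M) \<le> e" if e: "e > 0" and n: "n \<ge> N e" for n e
  proof -
    have "integrable M (\<lambda>x. (norm (f n x - g x))\<^sup>2)"
      by (rule integrableI_bounded) (use key[OF e n] in \<open>auto simp: order.strict_trans1\<close>)
    then show "sq_int M (\<lambda>x. f n x - g x)" by (simp add: sq_int_def)
    then have "ennreal (\<integral>x. (norm (f n x - g x))\<^sup>2 \<partial>M) = (\<integral>\<^sup>+x. ennreal ((norm (f n x - g x))\<^sup>2) \<partial>M)"
      by (subst nn_integral_eq_integral) (auto simp: sq_int_def)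
    then show "(\<integral>x. (norm (f n x - g x))\<^sup>2 \<partial>M) \<le> e" using key[OF e n] e by (metis ennreal_le_iff less_imp_le)
  qed
  have "sq_int M (\<lambda>x. f (N 1) x - (f (N 1) x - g x))" by (rule sq_int_diff[OF f sqd[of 1]]) auto
  then have "sq_int M g" by simp
  moreover have "(\<lambda>n. \<integral>x. (norm (f n x - g x))\<^sup>2 \<partial>M) \<longlonglongrightarrow> 0"
  proof (rule LIMSEQ_I)
    fix e :: real assume "0 < e"
    then show "\<exists>no. \<forall>n\<ge>no. norm ((\<integral>x. (norm (f n x - g x))\<^sup>2 \<partial>M) - 0) < e"
      using le[of "e/2"] by (intro exI[of _ "N (e/2)"]) fastforce
  qed
  ultimately show ?thesis by blast
qed

text \<open>A sequence of finite sets exhausting the frequency lattice: it turns unordered sums into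
  sequential limits, to which dominated convergence applies. Its symmetry under negation keeps
  partial sums of real functions real.\<close>

definition box_set :: "nat \<Rightarrow> (int \<times> int) set" where
  "box_set N = {- int N..int N} \<times> {- int N..int N}"

lemma finite_box[simp]: "finite (box_set N)" by (simp add: box_set_def)

lemma box_mono: "m \<le> n \<Longrightarrow> box_set m \<subseteq> box_set n" by (auto simp: box_set_def)

lemma box_exhaust:
  assumes "finite F" shows "\<exists>N. \<forall>n\<ge>N. F \<subseteq> box_set n"
proof -
  define N where "N = (\<Sum>k\<in>F. nat \<bar>fst k\<bar> + nat \<bar>snd k\<bar>)"
  have "k \<in> box_set n" if "k \<in> F" "n \<ge> N" for k n
  proof -
    have "nat \<bar>fst k\<bar> + nat \<bar>snd k\<bar> \<le> N" unfolding N_def using assms that(1) by (rule member_le_sum[rotated 2]) auto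
    then show ?thesis using that(2) by (auto simp: box_set_def mem_Times_iff)
  qed
  then show ?thesis by blast
qed

lemma filterlim_box: "filterlim box_set (finite_subsets_at_top UNIV) sequentially"
  unfolding filterlim_finite_subsets_at_top eventually_sequentially using box_exhaust by auto

lemma has_sum_box:
  assumes "(f has_sum S) UNIV" shows "(\<lambda>N. \<Sum>k\<in>box_set N. f k) \<longlonglongrightarrow> S"
  using filterlim_compose[OF assms[unfolded has_sum_def] filterlim_box] .

lemma sum_box_Cauchy:
  fixes f :: "int \<times> int \<Rightarrow> real"
  assumes f: "f summable_on UNIV" "\<And>k. 0 \<le> f k" and e: "e > 0"
  shows "\<exists>N. \<forall>m\<ge>N. \<forall>n\<ge>m. (\<Sum>k\<in>box_set n - box_set m. f k) \<le> e"
proof -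
  have l: "(\<lambda>N. \<Sum>k\<in>box_set N. f k) \<longlonglongrightarrow> infsum f UNIV"
    by (rule has_sum_box) (use f(1) in simp)
  from LIMSEQ_D[OF l, of "e/2"] e obtain N where N: "\<And>n. n \<ge> N \<Longrightarrow> \<bar>(\<Sum>k\<in>box_set n. f k) - infsum f UNIV\<bar> < e/2" by auto
  have "(\<Sum>k\<in>box_set n - box_set m. f k) \<le> e" if "m \<ge> N" "n \<ge> m" for m n
    unfolding sum_diff[OF finite_box box_mono[OF that(2)]] using N[of m] N[of n] that by linarith
  then show ?thesis by blast
qed

lemma borel_measurable_cnj[measurable (raw)]:
  "f \<in> borel_measurable M \<Longrightarrow> (\<lambda>x. cnj (f x)) \<in> borel_measurable M"
  by (rule borel_measurable_continuous_on[of cnj]) (auto intro: continuous_intros)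

lemma mult_cnj_cmod: "z * cnj z = complex_of_real ((cmod z)\<^sup>2)"
  by (simp only: complex_norm_square)

context flat_torus
begin

abbreviation "TL \<equiv> torus l"

lemma sq_int_bounded:
  fixes f :: "real^2 \<Rightarrow> 'b::{banach, second_countable_topology}"
  assumes [measurable]: "f \<in> borel_measurable TL" and B: "AE x in TL. norm (f x) \<le> B"
  shows "sq_int TL f"
proof -
  have "integrable TL (\<lambda>x. (norm (f x))\<^sup>2)"
    by (rule T.integrable_const_bound[of _ "B\<^sup>2"])
       (use B in \<open>auto elim!: eventually_mono intro: power_mono\<close>)
  then show ?thesis by (simp add: sq_int_def)
qed

lemma sq_int_expo: "sq_int TL (expo k)"
  by (rule sq_int_bounded[where B=1]) auto

lemma integrable_sq_int:
  fixes f :: "real^2 \<Rightarrow> 'b::{banach, second_countable_topology}"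
  assumes f: "sq_int TL f" shows "integrable TL f"
proof -
  have "integrable TL (\<lambda>x. norm (f x) * 1)"
    by (rule integrable_sq_int_mult[OF sq_int_norm[OF f]], rule sq_int_bounded[where B=1]) auto
  moreover have "f \<in> borel_measurable TL" using f by (simp add: sq_int_def)
  ultimately show ?thesis by (simp add: integrable_norm_iff)
qed

lemma sq_int_exposum: "sq_int TL (\<lambda>x. \<Sum>k\<in>A. c k * expo k x)"
  by (intro sq_int_sum sq_int_cmult sq_int_expo)

lemma sq_int_cnj: "sq_int M f \<Longrightarrow> sq_int M (\<lambda>x. cnj (f x))"
  by (auto simp: sq_int_def)

lemma integrable_mult_expo:
  assumes "integrable TL f" shows "integrable TL (\<lambda>x. f x * cnj (expo k x))"
  by (rule Bochner_Integration.integrable_bound[OF assms]) (use assms in \<open>auto simp: norm_mult\<close>)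

lemma fco_diff:
  assumes "integrable TL f" "integrable TL g"
  shows "fco (\<lambda>x. f x - g x) k = fco f k - fco g k"
  using integrable_mult_expo[OF assms(1), of k] integrable_mult_expo[OF assms(2), of k]
  by (simp add: fco_def left_diff_distrib diff_divide_distrib)

lemma fco_add:
  assumes "integrable TL f" "integrable TL g"
  shows "fco (\<lambda>x. f x + g x) k = fco f k + fco g k"
  using integrable_mult_expo[OF assms(1), of k] integrable_mult_expo[OF assms(2), of k]
  by (simp add: fco_def distrib_right add_divide_distrib)

lemma fco_cmult: "fco (\<lambda>x. c * f x) k = c * fco f k"
  by (simp add: fco_def mult.assoc)

lemma fco_cong_AE:
  assumes "AE x in TL. f x = g x" "f \<in> borel_measurable TL" "g \<in> borel_measurable TL"
  shows "fco f k = fco g k"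
proof -
  have "(\<integral>x. f x * cnj (expo k x) \<partial>TL) = (\<integral>x. g x * cnj (expo k x) \<partial>TL)"
    by (rule integral_cong_AE) (use assms in \<open>auto elim!: eventually_mono\<close>)
  then show ?thesis by (simp add: fco_def)
qed

lemma fco_exposum:
  assumes "finite A"
  shows "fco (\<lambda>x. \<Sum>k\<in>A. c k * expo k x) j = (if j \<in> A then c j else 0)"
proof -
  have i: "integrable TL (\<lambda>x. c k * (expo k x * cnj (expo j x)))" for k
    by (intro integrable_mult_right integrable_mult_expo integrable_sq_int sq_int_expo)
  have "(\<integral>x. (\<Sum>k\<in>A. c k * expo k x) * cnj (expo j x) \<partial>TL) = (\<Sum>k\<in>A. \<integral>x. c k * (expo k x * cnj (expo j x)) \<partial>TL)"
    by (subst Bochner_Integration.integral_sum[symmetric, OF i]) (simp add: sum_distrib_right mult.assoc)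
  also have "\<dots> = (\<Sum>k\<in>A. if k = j then c j * of_real (l\<^sup>2) else 0)"
    by (intro sum.cong refl) (simp add: integral_expo_cnj)
  also have "\<dots> = (if j \<in> A then c j * of_real (l\<^sup>2) else 0)"
    using assms by simp
  finally show ?thesis using l_pos by (simp add: fco_def)
qed

lemma fco_bound:
  assumes "sq_int TL f" shows "cmod (fco f k) \<le> l2norm TL f / l"
proof -
  have e: "l2norm TL (\<lambda>x. cnj (expo k x)) = l"
    using l_pos by (simp add: l2norm_def measure_torus)
  have "cmod (\<integral>x. f x * cnj (expo k x) \<partial>TL) \<le> l2norm TL f * l"
    using Cauchy_Schwarz_norm(2)[OF assms sq_int_cnj[OF sq_int_expo[of k]]] by (simp add: e)
  then show ?thesis using l_pos by (simp add: fco_def norm_divide norm_mult power2_eq_square field_simps)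
qed

lemma integral_mult_exposum:
  assumes f: "integrable TL f"
  shows "(\<integral>x. f x * cnj (\<Sum>k\<in>A. c k * expo k x) \<partial>TL) = of_real (l\<^sup>2) * (\<Sum>k\<in>A. fco f k * cnj (c k))"
proof -
  have i: "integrable TL (\<lambda>x. cnj (c k) * (f x * cnj (expo k x)))" for k
    by (intro integrable_mult_right integrable_mult_expo f)
  have "(\<integral>x. f x * cnj (\<Sum>k\<in>A. c k * expo k x) \<partial>TL) = (\<Sum>k\<in>A. \<integral>x. cnj (c k) * (f x * cnj (expo k x)) \<partial>TL)"
    by (subst Bochner_Integration.integral_sum[symmetric, OF i]) (simp add: sum_distrib_left mult_ac)
  also have "\<dots> = (\<Sum>k\<in>A. cnj (c k) * (of_real (l\<^sup>2) * fco f k))"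
    using l_pos by (simp add: fco_def)
  also have "\<dots> = of_real (l\<^sup>2) * (\<Sum>k\<in>A. fco f k * cnj (c k))"
    by (simp add: sum_distrib_left mult_ac)
  finally show ?thesis .
qed

lemma norm_exposum:
  assumes "finite A"
  shows "(\<integral>x. (cmod (\<Sum>k\<in>A. c k * expo k x))\<^sup>2 \<partial>TL) = l\<^sup>2 * (\<Sum>k\<in>A. (cmod (c k))\<^sup>2)"
proof -
  let ?S = "\<lambda>x. \<Sum>k\<in>A. c k * expo k x"
  have "of_real (\<integral>x. (cmod (?S x))\<^sup>2 \<partial>TL) = (\<integral>x. ?S x * cnj (?S x) \<partial>TL)"
    unfolding mult_cnj_cmod integral_complex_of_real ..
  also have "\<dots> = of_real (l\<^sup>2) * (\<Sum>k\<in>A. c k * cnj (c k))"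
    by (subst integral_mult_exposum[OF integrable_sq_int[OF sq_int_exposum]]) (simp add: fco_exposum[OF assms])
  also have "\<dots> = of_real (l\<^sup>2 * (\<Sum>k\<in>A. (cmod (c k))\<^sup>2))"
    by (simp add: complex_norm_square[symmetric])
  finally show ?thesis using of_real_eq_iff by blast
qed

text \<open>Orthogonality makes the partial sums Cauchy in L^2. Each coefficient is L^2-continuous
  and eventually constant along the partial sums, so the limit has the prescribed coefficients. Weak
  derivatives are constructed from this.\<close>

lemma exists_fourier_series:
  assumes c: "(\<lambda>k. (cmod (c k))\<^sup>2) summable_on UNIV"
  shows "\<exists>h. sq_int TL h \<and> (\<forall>k. fco h k = c k) \<and>
    (\<lambda>N. \<integral>x. (cmod ((\<Sum>k\<in>box_set N. c k * expo k x) - h x))\<^sup>2 \<partial>TL) \<longlonglongrightarrow> 0"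
proof -
  define S where "S N x = (\<Sum>k\<in>box_set N. c k * expo k x)" for N x
  have S: "sq_int TL (S N)" for N unfolding S_def by (rule sq_int_exposum)
  have dS: "(\<integral>x. (cmod (S n x - S m x))\<^sup>2 \<partial>TL) = l\<^sup>2 * (\<Sum>k\<in>box_set n - box_set m. (cmod (c k))\<^sup>2)" if "m \<le> n" for m n
    unfolding S_def by (subst sum_diff[OF finite_box box_mono[OF that], symmetric]) (simp add: norm_exposum)
  have "\<exists>N. \<forall>m\<ge>N. \<forall>n\<ge>N. (\<integral>x. (norm (S n x - S m x))\<^sup>2 \<partial>TL) \<le> e" if e: "e > 0" for e
  proof -
    obtain N where N: "\<And>m n. m \<ge> N \<Longrightarrow> n \<ge> m \<Longrightarrow> (\<Sum>k\<in>box_set n - box_set m. (cmod (c k))\<^sup>2) \<le> e / l\<^sup>2"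
      using sum_box_Cauchy[OF c, of "e / l\<^sup>2"] e l_pos by auto
    have a: "(\<integral>x. (norm (S n x - S m x))\<^sup>2 \<partial>TL) \<le> e" if "m \<ge> N" "n \<ge> m" for m n
      using N[OF that] l_pos by (simp add: dS[OF that(2)] field_simps)
    have "(\<integral>x. (norm (S n x - S m x))\<^sup>2 \<partial>TL) \<le> e" if "m \<ge> N" "n \<ge> N" for m n
    proof (cases "m \<le> n")
      case True then show ?thesis using a that by simp
    next
      case False
      then show ?thesis using a[of n m] that by (simp add: norm_minus_commute)
    qed
    then show ?thesis by blast
  qed
  from T.Riesz_Fischer[OF S this] obtain h where h: "sq_int TL h" "(\<lambda>n. \<integral>x. (cmod (S n x - h x))\<^sup>2 \<partial>TL) \<longlonglongrightarrow> 0"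
    by blast
  have "fco h k = c k" for k
  proof -
    have lim: "(\<lambda>n. l2norm TL (\<lambda>x. S n x - h x) / l) \<longlonglongrightarrow> sqrt 0 / l"
      unfolding l2norm_def by (intro tendsto_divide tendsto_real_sqrt h(2) tendsto_const) (use l_pos in auto)
    have "(\<lambda>n. fco (S n) k - fco h k) \<longlonglongrightarrow> 0"
    proof (rule Lim_null_comparison[OF always_eventually])
      show "\<forall>n. norm (fco (S n) k - fco h k) \<le> l2norm TL (\<lambda>x. S n x - h x) / l"
        using fco_bound[OF sq_int_diff[OF S h(1)]] fco_diff[OF integrable_sq_int[OF S] integrable_sq_int[OF h(1)]] by simp
    qed (use lim in simp)
    moreover have "(\<lambda>n. fco (S n) k - fco h k) \<longlonglongrightarrow> c k - fco h k"
    proof (rule tendsto_eventually)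
      obtain N where "\<forall>n\<ge>N. {k} \<subseteq> box_set n" using box_exhaust[of "{k}"] by auto
      then show "\<forall>\<^sub>F n in sequentially. fco (S n) k - fco h k = c k - fco h k"
        unfolding eventually_sequentially S_def by (intro exI[of _ N]) (auto simp: fco_exposum)
    qed
    ultimately show ?thesis using LIMSEQ_unique by fastforce
  qed
  then show ?thesis using h unfolding S_def by blast
qed

text \<open>The pairing of \<open>f\<close> with its own partial sum equals the squared norm of that
  sum; Cauchy-Schwarz and division by the norm give the claim.\<close>

lemma bessel:
  assumes f: "sq_int TL f" and A: "finite A"
  shows "l\<^sup>2 * (\<Sum>k\<in>A. (cmod (fco f k))\<^sup>2) \<le> (\<integral>x. (cmod (f x))\<^sup>2 \<partial>TL)"
proof -
  let ?S = "\<lambda>x. \<Sum>k\<in>A. fco f k * expo k x"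
  let ?s = "\<Sum>k\<in>A. (cmod (fco f k))\<^sup>2"
  have S: "sq_int TL ?S" by (rule sq_int_exposum)
  have "(\<integral>x. f x * cnj (?S x) \<partial>TL) = of_real (l\<^sup>2 * ?s)"
    unfolding integral_mult_exposum[OF integrable_sq_int[OF f]] mult_cnj_cmod by simp
  then have "cmod (of_real (l\<^sup>2 * ?s)) \<le> l2norm TL f * l2norm TL (\<lambda>x. cnj (?S x))"
    using Cauchy_Schwarz_norm(2)[OF f sq_int_cnj[OF S]] by metis
  moreover have "l2norm TL (\<lambda>x. cnj (?S x)) = sqrt (l\<^sup>2 * ?s)"
    unfolding l2norm_def complex_mod_cnj by (simp only: norm_exposum[OF A])
  moreover have s: "0 \<le> l\<^sup>2 * ?s" by (simp add: sum_nonneg)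
  ultimately have "l\<^sup>2 * ?s \<le> l2norm TL f * sqrt (l\<^sup>2 * ?s)" by (simp only: norm_of_real abs_of_nonneg)
  then have "sqrt (l\<^sup>2 * ?s) * sqrt (l\<^sup>2 * ?s) \<le> l2norm TL f * sqrt (l\<^sup>2 * ?s)" using s by simp
  then have "sqrt (l\<^sup>2 * ?s) \<le> l2norm TL f"
    by (metis l2norm_nonneg mult_right_le_imp_le not_less real_sqrt_ge_zero s order_le_less)
  then show ?thesis unfolding l2norm_def by simp
qed

lemma fco_summable:
  assumes f: "sq_int TL f"
  shows "(\<lambda>k. (cmod (fco f k))\<^sup>2) summable_on UNIV"
proof (rule nonneg_bdd_above_summable_on)
  show "bdd_above (sum (\<lambda>k. (cmod (fco f k))\<^sup>2) ` {F. F \<subseteq> UNIV \<and> finite F})"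
    unfolding bdd_above_def using bessel[OF f] l_pos
    by (intro exI[of _ "(\<integral>x. (cmod (f x))\<^sup>2 \<partial>TL) / l\<^sup>2"]) (auto simp: field_simps)
qed simp

text \<open>The L^2 limit \<open>h\<close> of the series exists by Bessel and Riesz-Fischer and has
  the coefficients of \<open>f\<close>; \<open>fourier_unique\<close> identifies the two almost
  everywhere.\<close>

lemma fourier_series_L2:
  assumes f: "sq_int TL f"
  shows "(\<lambda>N. l2norm TL (\<lambda>x. f x - (\<Sum>k\<in>box_set N. fco f k * expo k x))) \<longlonglongrightarrow> 0"
proof -
  obtain h where h: "sq_int TL h" "\<And>k. fco h k = fco f k"
    "(\<lambda>N. \<integral>x. (cmod ((\<Sum>k\<in>box_set N. fco f k * expo k x) - h x))\<^sup>2 \<partial>TL) \<longlonglongrightarrow> 0"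
    using exists_fourier_series[OF fco_summable[OF f]] by blast
  have [measurable]: "f \<in> borel_measurable TL" "h \<in> borel_measurable TL" using f h by (auto simp: sq_int_def)
  have "AE x in TL. f x - h x = 0"
    using fco_diff[OF integrable_sq_int[OF f] integrable_sq_int[OF h(1)]] h(2)
    by (intro fourier_unique integrable_sq_int sq_int_diff f h(1)) simp
  then have "(\<integral>x. (cmod ((\<Sum>k\<in>box_set N. fco f k * expo k x) - h x))\<^sup>2 \<partial>TL) =
    (\<integral>x. (cmod (f x - (\<Sum>k\<in>box_set N. fco f k * expo k x)))\<^sup>2 \<partial>TL)" for N
    by (intro integral_cong_AE) (auto elim!: eventually_mono simp: norm_minus_commute)
  then have "(\<lambda>N. l2norm TL (\<lambda>x. f x - (\<Sum>k\<in>box_set N. fco f k * expo k x))) \<longlonglongrightarrow> sqrt 0"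
    unfolding l2norm_def using h(3) by (intro tendsto_real_sqrt) simp
  then show ?thesis by simp
qed

lemma parseval_box:
  assumes f: "sq_int TL f" and g: "sq_int TL g"
  shows "(\<lambda>N. of_real (l\<^sup>2) * (\<Sum>k\<in>box_set N. fco f k * cnj (fco g k))) \<longlonglongrightarrow> (\<integral>x. f x * cnj (g x) \<partial>TL)"
proof -
  let ?S = "\<lambda>N x. \<Sum>k\<in>box_set N. fco g k * expo k x"
  have "(\<lambda>N. (\<integral>x. f x * cnj (g x) \<partial>TL) - (\<integral>x. f x * cnj (?S N x) \<partial>TL)) \<longlonglongrightarrow> 0"
  proof (rule Lim_null_comparison[OF always_eventually])
    show "\<forall>N. norm ((\<integral>x. f x * cnj (g x) \<partial>TL) - (\<integral>x. f x * cnj (?S N x) \<partial>TL))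
       \<le> l2norm TL f * l2norm TL (\<lambda>x. g x - ?S N x)"
    proof
      fix N
      have S: "sq_int TL (?S N)" by (rule sq_int_exposum)
      have "(\<integral>x. f x * cnj (g x) \<partial>TL) - (\<integral>x. f x * cnj (?S N x) \<partial>TL) = (\<integral>x. f x * cnj (g x - ?S N x) \<partial>TL)"
        using integrable_sq_int_mult[OF f sq_int_cnj[OF g]] integrable_sq_int_mult[OF f sq_int_cnj[OF S]]
        by (simp add: right_diff_distrib)
      then show "norm ((\<integral>x. f x * cnj (g x) \<partial>TL) - (\<integral>x. f x * cnj (?S N x) \<partial>TL))
         \<le> l2norm TL f * l2norm TL (\<lambda>x. g x - ?S N x)"
        using Cauchy_Schwarz_norm(2)[OF f sq_int_cnj[OF sq_int_diff[OF g S]]]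
        by (simp add: l2norm_def del: complex_cnj_diff cnj_sum)
    qed
  qed (rule tendsto_mult_right_zero[OF fourier_series_L2[OF g]])
  from tendsto_diff[OF tendsto_const[of "\<integral>x. f x * cnj (g x) \<partial>TL"] this]
  show ?thesis by (simp only: integral_mult_exposum[OF integrable_sq_int[OF f]] diff_diff_eq2 add_diff_cancel_left' diff_zero)
qed

lemma parseval_norm:
  assumes f: "sq_int TL f"
  shows "((\<lambda>k. (cmod (fco f k))\<^sup>2) has_sum ((\<integral>x. (cmod (f x))\<^sup>2 \<partial>TL) / l\<^sup>2)) UNIV"
proof -
  have "(\<lambda>N. \<Sum>k\<in>box_set N. (cmod (fco f k))\<^sup>2) \<longlonglongrightarrow> infsum (\<lambda>k. (cmod (fco f k))\<^sup>2) UNIV"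
    by (rule has_sum_box) (use fco_summable[OF f] in simp)
  moreover have "(\<lambda>N. Re (of_real (l\<^sup>2) * (\<Sum>k\<in>box_set N. fco f k * cnj (fco f k)))) \<longlonglongrightarrow> Re (\<integral>x. f x * cnj (f x) \<partial>TL)"
    by (intro tendsto_Re parseval_box f)
  then have "(\<lambda>N. l\<^sup>2 * (\<Sum>k\<in>box_set N. (cmod (fco f k))\<^sup>2) / l\<^sup>2) \<longlonglongrightarrow> (\<integral>x. (cmod (f x))\<^sup>2 \<partial>TL) / l\<^sup>2"
    unfolding mult_cnj_cmod integral_complex_of_real of_real_sum[symmetric] of_real_mult[symmetric] Re_complex_of_real
    using l_pos by (intro tendsto_divide tendsto_const) simp_all
  ultimately have "infsum (\<lambda>k. (cmod (fco f k))\<^sup>2) UNIV = (\<integral>x. (cmod (f x))\<^sup>2 \<partial>TL) / l\<^sup>2"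
    using l_pos LIMSEQ_unique by force
  then show ?thesis using fco_summable[OF f] by (metis has_sum_infsum)
qed

end

section \<open>Lattice sums behind the embedding of H^2 into bounded functions\<close>

definition kk :: "int \<times> int \<Rightarrow> real" where
  "kk k = real_of_int ((fst k)\<^sup>2 + (snd k)\<^sup>2)"

lemma kk_nonneg[simp]: "0 \<le> kk k" by (simp add: kk_def)

lemma kk_ge_1: "k \<noteq> 0 \<Longrightarrow> 1 \<le> kk k"
proof -
  assume "k \<noteq> 0"
  then have "(fst k)\<^sup>2 + (snd k)\<^sup>2 > 0" by (cases k) (auto simp: zero_prod_def sum_power2_gt_zero_iff)
  then show ?thesis unfolding kk_def by linarith
qed

lemma kk_0[simp]: "kk 0 = 0" by (simp add: kk_def)

lemma summable_on_int_inverse_square: "(\<lambda>n::int. 1 / (1 + (real_of_int n)\<^sup>2)) summable_on UNIV"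
proof -
  let ?f = "\<lambda>n::int. 1 / (1 + (real_of_int n)\<^sup>2)"
  have s: "summable (\<lambda>n. 1 / (real n)\<^sup>2)" using inverse_power_summable[of 2] by (simp add: field_simps)
  have s1: "summable (\<lambda>n. 1 / (1 + (real n)\<^sup>2))"
    by (rule summable_comparison_test[OF _ s], rule exI[of _ 1]) (auto intro!: frac_le)
  have "?f summable_on (range int)"
    by (subst summable_on_reindex) (use s1 in \<open>auto simp: o_def summable_on_UNIV_nonneg_real_iff\<close>)
  moreover have "?f summable_on (range (\<lambda>n. - int n - 1))"
  proof (subst summable_on_reindex)
    have "summable (\<lambda>n. 1 / (1 + (real (Suc n))\<^sup>2))" using s1 by (subst summable_Suc_iff)
    moreover have "?f \<circ> (\<lambda>n. - int n - 1) = (\<lambda>n. 1 / (1 + (real (Suc n))\<^sup>2))"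
      by (auto simp: o_def power2_eq_square algebra_simps)
    ultimately show "?f \<circ> (\<lambda>n. - int n - 1) summable_on UNIV"
      by (simp only: summable_on_UNIV_nonneg_real_iff) (simp add: summable_on_UNIV_nonneg_real_iff)
  qed (auto simp: inj_on_def)
  ultimately have "?f summable_on (range int \<union> range (\<lambda>n. - int n - 1))"
    by (rule summable_on_Un_disjoint) auto
  moreover have "range int \<union> range (\<lambda>n. - int n - 1) = UNIV"
  proof -
    have "n \<in> range int \<union> range (\<lambda>n. - int n - 1)" for n
    proof (cases "n \<ge> 0")
      case True then show ?thesis by (metis UnI1 nat_0_le rangeI)
    next
      case False
      then have "n = - int (nat (- n - 1)) - 1" by simp
      then show ?thesis by blast
    qed
    then show ?thesis by blast
  qed
  ultimately show ?thesis by simp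
qed

text \<open>Comparison with a product of two summable series in one variable each. At
  \<open>k = 0\<close> the term is 1 / 0 = 0, so the sum effectively runs over nonzero
  frequencies.\<close>

lemma kk_inverse_summable: "(\<lambda>k. 1 / (kk k)\<^sup>2) summable_on UNIV"
proof (rule nonneg_bdd_above_summable_on)
  let ?f = "\<lambda>n::int. 1 / (1 + (real_of_int n)\<^sup>2)"
  have le: "1 / (kk k)\<^sup>2 \<le> 4 * (?f (fst k) * ?f (snd k))" for k
  proof (cases "k = 0")
    case False
    define a b where "a = (real_of_int (fst k))\<^sup>2" and "b = (real_of_int (snd k))\<^sup>2"
    have ab: "a \<ge> 0" "b \<ge> 0" "kk k = a + b" by (auto simp: a_def b_def kk_def)
    have 1: "1 \<le> a + b" using kk_ge_1[OF False] ab by simp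
    have "a + b \<le> (a + b)\<^sup>2" "1 \<le> (a + b)\<^sup>2" using 1 self_le_power[of "a + b" 2] one_le_power[of "a + b" 2] by auto
    moreover have "a * b \<le> (a + b)\<^sup>2" using ab by (simp add: power2_eq_square algebra_simps)
    ultimately have "(1 + a) * (1 + b) \<le> 4 * (a + b)\<^sup>2" by (simp add: algebra_simps)
    then have "1 / (a + b)\<^sup>2 \<le> 4 / ((1 + a) * (1 + b))"
      using 1 ab by (simp add: divide_simps add_pos_nonneg)
    then show ?thesis by (simp add: ab a_def[symmetric] b_def[symmetric])
  qed simp
  define S where "S = infsum ?f UNIV"
  have S: "sum ?f A \<le> S" if "finite A" for A
    unfolding S_def by (rule finite_sum_le_infsum[OF summable_on_int_inverse_square that]) auto
  have "sum (\<lambda>k. 1 / (kk k)\<^sup>2) F \<le> 4 * (S * S)" if F: "finite F" for F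
  proof -
    have "sum (\<lambda>k. 1 / (kk k)\<^sup>2) F \<le> (\<Sum>k\<in>F. 4 * (?f (fst k) * ?f (snd k)))" by (intro sum_mono le)
    also have "\<dots> \<le> (\<Sum>k\<in>fst ` F \<times> snd ` F. 4 * (?f (fst k) * ?f (snd k)))"
      using F subset_fst_snd[of F] by (intro sum_mono2) auto
    also have "\<dots> = 4 * (\<Sum>k\<in>fst ` F \<times> snd ` F. ?f (fst k) * ?f (snd k))"
      by (rule sum_distrib_left[symmetric])
    also have "\<dots> = 4 * (sum ?f (fst ` F) * sum ?f (snd ` F))"
      unfolding sum_product sum.cartesian_product case_prod_beta ..
    also have "\<dots> \<le> 4 * (S * S)"
      using S[of "fst ` F"] S[of "snd ` F"] S[of "{}"] F by (intro mult_left_mono mult_mono) (auto intro: sum_nonneg order_trans)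
    finally show ?thesis .
  qed
  then show "bdd_above (sum (\<lambda>k. 1 / (kk k)\<^sup>2) ` {F. F \<subseteq> UNIV \<and> finite F})"
    unfolding bdd_above_def by (intro exI[of _ "4 * (S * S)"]) auto
qed simp

text \<open>The embedding constant of mean-zero H^2 into L^infinity: the l^2 norm of the weights
  1/|k|^2 over nonzero frequencies.\<close>

definition Kemb :: real where "Kemb = sqrt (\<Sum>\<^sub>\<infinity>k. 1 / (kk k)\<^sup>2)"

lemma sum_inverse_kk_le: "finite A \<Longrightarrow> (\<Sum>k\<in>A. 1 / (kk k)\<^sup>2) \<le> Kemb\<^sup>2"
  unfolding Kemb_def by (subst real_sqrt_pow2) (auto intro!: finite_sum_le_infsum kk_inverse_summable infsum_nonneg)

lemma Kemb_nonneg: "0 \<le> Kemb" unfolding Kemb_def by (auto intro!: infsum_nonneg)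

context flat_torus
begin

lemma smooth_torus: "smooth f \<Longrightarrow> f \<in> borel_measurable TL"
  by (intro measurable_torus smooth_borel)

lemma trig_measurable[measurable]: "trig A c \<in> borel_measurable borel"
  by (intro smooth_borel smooth_trig)

definition fc :: "sfield \<Rightarrow> int \<times> int \<Rightarrow> complex" where
  "fc h k = fco (\<lambda>x. of_real (h x)) k"

lemma fourier_eq_fc: "fourier l u k j = fc (\<lambda>x. u x $ j) k"
proof -
  have "cis (- 2 * pi * (real_of_int (fst k) * x $ 1 + real_of_int (snd k) * x $ 2) / l) = cnj (expo k x)" for x
    by (simp add: expo_def phase_def cis_cnj)
  then show ?thesis by (simp add: fourier_def fc_def fco_def)
qed

lemma sq_int_of_real: "sq_int TL h \<Longrightarrow> sq_int TL (\<lambda>x. complex_of_real (h x))"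
  by (auto simp: sq_int_def)

lemma fc_add: "integrable TL f \<Longrightarrow> integrable TL g \<Longrightarrow> fc (\<lambda>x. f x + g x) k = fc f k + fc g k"
  by (simp add: fc_def fco_add)

lemma fc_diff: "integrable TL f \<Longrightarrow> integrable TL g \<Longrightarrow> fc (\<lambda>x. f x - g x) k = fc f k - fc g k"
  by (simp add: fc_def fco_diff)

lemma fc_cmult: "fc (\<lambda>x. c * f x) k = of_real c * fc f k"
  by (simp add: fc_def fco_cmult)

lemma fc_cong_AE:
  assumes "AE x in TL. f x = g x" "f \<in> borel_measurable TL" "g \<in> borel_measurable TL"
  shows "fc f k = fc g k"
  unfolding fc_def by (rule fco_cong_AE) (use assms in auto)

lemma fc_unique:
  assumes "integrable TL f" "integrable TL g" "\<And>k. fc f k = fc g k"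
  shows "AE x in TL. f x = g x"
proof -
  have "AE x in TL. complex_of_real (f x) - complex_of_real (g x) = 0"
    by (rule fourier_unique) (use assms in \<open>auto simp: fco_diff fc_def\<close>)
  then show ?thesis by eventually_elim simp
qed

text \<open>Smooth periodic approximants that commute with weak derivatives
  (\<open>partial_trunc\<close>). They let an integration by parts be done on smooth functions and
  then passed to the limit.\<close>

definition trunc :: "nat \<Rightarrow> sfield \<Rightarrow> sfield" where
  "trunc N h = trig (box_set N) (fc h)"

lemma sq_int_trig: "finite A \<Longrightarrow> sq_int TL (trig A c)"
proof -
  have "norm (trig A c x) \<le> cmod (\<Sum>k\<in>A. c k * expo k x)" for x
    unfolding trig_def real_norm_def by (rule abs_Re_le_cmod)
  then have b: "norm (trig A c x) \<le> (\<Sum>k\<in>A. cmod (c k))" for x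
    by (rule order_trans) (rule order_trans[OF norm_sum], simp add: norm_mult)
  show ?thesis by (rule sq_int_bounded[where B="\<Sum>k\<in>A. cmod (c k)"]) (use b in \<open>auto intro!: AE_I2\<close>)
qed

lemma sq_int_trunc: "sq_int TL (trunc N h)"
  by (simp add: trunc_def sq_int_trig)

lemma l2norm_mono:
  assumes "sq_int M g" "f \<in> borel_measurable M" "\<And>x. norm (f x) \<le> norm (g x)"
  shows "l2norm M f \<le> l2norm M g"
proof -
  have le: "(norm (f x))\<^sup>2 \<le> (norm (g x))\<^sup>2" for x using assms(3) by (simp add: power_mono)
  have "integrable M (\<lambda>x. (norm (f x))\<^sup>2)"
    by (rule Bochner_Integration.integrable_bound[of M "\<lambda>x. (norm (g x))\<^sup>2"]) (use assms le in \<open>auto simp: sq_int_def\<close>)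
  then show ?thesis unfolding l2norm_def using assms(1) le
    by (intro real_sqrt_le_mono integral_mono) (auto simp: sq_int_def)
qed

lemma trig_L2_limit:
  assumes H: "sq_int TL H" and lim: "(\<lambda>N. l2norm TL (\<lambda>x. H x - (\<Sum>k\<in>box_set N. c k * expo k x))) \<longlonglongrightarrow> 0"
  shows "(\<lambda>N. l2norm TL (\<lambda>x. Re (H x) - trig (box_set N) c x)) \<longlonglongrightarrow> 0"
proof (rule Lim_null_comparison[OF always_eventually lim], rule allI)
  fix N
  have "l2norm TL (\<lambda>x. Re (H x) - trig (box_set N) c x) \<le> l2norm TL (\<lambda>x. H x - (\<Sum>k\<in>box_set N. c k * expo k x))"
  proof (rule l2norm_mono)
    show "sq_int TL (\<lambda>x. H x - (\<Sum>k\<in>box_set N. c k * expo k x))" by (intro sq_int_diff H sq_int_exposum)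
    show "(\<lambda>x. Re (H x) - trig (box_set N) c x) \<in> borel_measurable TL"
      using H by (auto simp: sq_int_def)
    show "norm (Re (H x) - trig (box_set N) c x) \<le> norm (H x - (\<Sum>k\<in>box_set N. c k * expo k x))" for x
      unfolding trig_def minus_complex.sel[symmetric] real_norm_def by (rule abs_Re_le_cmod)
  qed
  then show "norm (l2norm TL (\<lambda>x. Re (H x) - trig (box_set N) c x)) \<le> l2norm TL (\<lambda>x. H x - (\<Sum>k\<in>box_set N. c k * expo k x))"
    by simp
qed

lemma trunc_L2: "sq_int TL h \<Longrightarrow> (\<lambda>N. l2norm TL (\<lambda>x. h x - trunc N h x)) \<longlonglongrightarrow> 0"
  using trig_L2_limit[OF sq_int_of_real fourier_series_L2[OF sq_int_of_real]]
  by (simp add: trunc_def fc_def[abs_def])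

lemma parseval_real:
  assumes f: "sq_int TL f" and g: "sq_int TL g"
  shows "(\<lambda>N. l\<^sup>2 * (\<Sum>k\<in>box_set N. Re (fc f k * cnj (fc g k)))) \<longlonglongrightarrow> (\<integral>x. f x * g x \<partial>TL)"
proof -
  have "(\<lambda>N. Re (of_real (l\<^sup>2) * (\<Sum>k\<in>box_set N. fc f k * cnj (fc g k)))) \<longlonglongrightarrow>
     Re (\<integral>x. complex_of_real (f x) * cnj (complex_of_real (g x)) \<partial>TL)"
    unfolding fc_def by (intro tendsto_Re parseval_box sq_int_of_real f g)
  moreover have "(\<integral>x. complex_of_real (f x) * cnj (complex_of_real (g x)) \<partial>TL) = of_real (\<integral>x. f x * g x \<partial>TL)"
    by (simp flip: of_real_mult)
  ultimately show ?thesis by (simp only: Re_sum Re_complex_of_real times_complex.sel(1)[of "complex_of_real _"] Im_complex_of_real mult_zero_left diff_zero)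
qed

lemma parseval_real_norm:
  assumes f: "sq_int TL f"
  shows "((\<lambda>k. (cmod (fc f k))\<^sup>2) has_sum ((l2norm TL f)\<^sup>2 / l\<^sup>2)) UNIV"
  using parseval_norm[OF sq_int_of_real[OF f]] by (simp add: fc_def l2norm_sq)

lemma tendsto_integral_mult_L2:
  fixes f g :: "real^2 \<Rightarrow> real"
  assumes f: "sq_int TL f" and g: "sq_int TL g" and gn: "\<And>n. sq_int TL (gn n)"
    and lim: "(\<lambda>n. l2norm TL (\<lambda>x. g x - gn n x)) \<longlonglongrightarrow> 0"
  shows "(\<lambda>n. \<integral>x. f x * gn n x \<partial>TL) \<longlonglongrightarrow> (\<integral>x. f x * g x \<partial>TL)"
proof -
  have "(\<lambda>n. (\<integral>x. f x * g x \<partial>TL) - (\<integral>x. f x * gn n x \<partial>TL)) \<longlonglongrightarrow> 0"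
  proof (rule Lim_null_comparison[OF always_eventually tendsto_mult_right_zero[OF lim, of "l2norm TL f"]], rule allI)
    fix n
    have "(\<integral>x. f x * g x \<partial>TL) - (\<integral>x. f x * gn n x \<partial>TL) = (\<integral>x. f x * (g x - gn n x) \<partial>TL)"
      using integrable_sq_int_mult[OF f g] integrable_sq_int_mult[OF f gn] by (simp add: right_diff_distrib)
    then show "norm ((\<integral>x. f x * g x \<partial>TL) - (\<integral>x. f x * gn n x \<partial>TL)) \<le> l2norm TL f * l2norm TL (\<lambda>x. g x - gn n x)"
      using Cauchy_Schwarz_norm(2)[OF f sq_int_diff[OF g gn]] by simp
  qed
  from tendsto_diff[OF tendsto_const[of "\<integral>x. f x * g x \<partial>TL"] this] show ?thesis by simp
qed

lemma integral_by_parts_smooth: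
  assumes "smooth f" "periodic l f" "smooth g" "periodic l g"
  shows "(\<integral>x. f x * partial i g x \<partial>TL) = - (\<integral>x. partial i f x * g x \<partial>TL)"
proof -
  have e: "partial i (\<lambda>x. f x * g x) = (\<lambda>x. partial i f x * g x + f x * partial i g x)"
    using assms by (auto simp: partial_mult smooth_differentiable)
  have s: "smooth (\<lambda>x. f x * g x)" by (intro smooth_mult assms)
  have "(\<integral>x. partial i (\<lambda>x. f x * g x) x \<partial>TL) = 0"
    by (rule integral_partial_zero)
       (use s assms in \<open>auto simp: smooth_differentiable smooth_partial smooth_continuous periodic_def\<close>)
  moreover have "integrable TL (\<lambda>x. partial i f x * g x)" "integrable TL (\<lambda>x. f x * partial i g x)"
    by (intro integrable_torus_continuous smooth_continuous smooth_mult smooth_partial assms)+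
  ultimately show ?thesis unfolding e by simp
qed

lemma sq_int_smooth: "smooth f \<Longrightarrow> sq_int TL f"
  unfolding sq_int_def
  using continuous_on_power[OF smooth_continuous, of f 2] by (auto simp: smooth_torus intro!: integrable_torus_continuous)

text \<open>Reduction modulo the period lattice into the half-open cell. Composition with it extends
  a function given on the cell to a periodic Borel function on the plane, the form in which
  \<open>is_weak_partial\<close> wants its derivative.\<close>

definition fold_cell :: "real^2 \<Rightarrow> real^2" where
  "fold_cell x = (\<chi> i. x $ i - l * of_int \<lfloor>x $ i / l\<rfloor>)"

lemma fold_cell_in: "fold_cell x \<in> cell"
proof -
  have "0 \<le> y - l * of_int \<lfloor>y / l\<rfloor>" "y - l * of_int \<lfloor>y / l\<rfloor> < l" for y
    using l_pos floor_divide_lower[OF l_pos, of y] floor_divide_upper[OF l_pos, of y] by (auto simp: algebra_simps)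
  then show ?thesis by (simp add: cell_def fold_cell_def)
qed

lemma fold_cell_id: "x \<in> cell \<Longrightarrow> fold_cell x = x"
proof -
  assume x: "x \<in> cell"
  have "\<lfloor>x $ i / l\<rfloor> = 0" for i using x l_pos by (auto simp: cell_def floor_eq_iff field_simps)
  then show ?thesis by (simp add: fold_cell_def vec_eq_iff)
qed

lemma fold_cell_periodic: "fold_cell (x + axis i l) = fold_cell x"
proof -
  have "\<lfloor>(y + l) / l\<rfloor> = \<lfloor>y / l\<rfloor> + 1" for y using l_pos by (simp add: add_divide_distrib)
  then show ?thesis by (simp add: fold_cell_def vec_eq_iff axis_def distrib_left)
qed

lemma fold_cell_measurable: "fold_cell \<in> borel \<rightarrow>\<^sub>M TL"
proof -
  have "fold_cell \<in> borel \<rightarrow>\<^sub>M borel"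
    unfolding fold_cell_def borel_measurable_euclidean_space[where 'c="real^2"]
    by (auto simp: Basis_vec_def inner_axis) measurable
  then show ?thesis
    unfolding torus_eq by (intro measurable_restrict_space2) (auto simp: fold_cell_in)
qed

lemma periodic_extension:
  fixes h :: "real^2 \<Rightarrow> 'b::topological_space"
  assumes "h \<in> borel_measurable TL"
  shows "\<exists>w. w \<in> borel_measurable borel \<and> periodic l w \<and> (\<forall>x\<in>cell. w x = h x)"
  by (rule exI[of _ "\<lambda>x. h (fold_cell x)"])
     (use measurable_compose[OF fold_cell_measurable assms] in \<open>auto simp: periodic_def fold_cell_periodic fold_cell_id\<close>)

section \<open>Sobolev spaces and weak derivatives\<close>


text \<open>The scalar version of \<open>L2dot\<close> without the mean-zero condition, which
  products of fields do not satisfy.\<close>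

definition L2p :: "sfield \<Rightarrow> bool" where
  "L2p h \<longleftrightarrow> h \<in> borel_measurable borel \<and> periodic l h \<and> sq_int TL h"

lemma L2p_sq_int: "L2p h \<Longrightarrow> sq_int TL h" by (simp add: L2p_def)
lemma L2p_borel[measurable_dest]: "L2p h \<Longrightarrow> h \<in> borel_measurable borel" by (simp add: L2p_def)
lemma L2p_integrable: "L2p h \<Longrightarrow> integrable TL h" by (simp add: L2p_def integrable_sq_int)

lemma L2p_add: "L2p f \<Longrightarrow> L2p g \<Longrightarrow> L2p (\<lambda>x. f x + g x)"
  by (auto simp: L2p_def periodic_def intro!: sq_int_add)
lemma L2p_cmult: "L2p f \<Longrightarrow> L2p (\<lambda>x. c * f x)"
  by (auto simp: L2p_def periodic_def intro!: sq_int_cmult)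

text \<open>Cosine and sine of frequency \<open>k\<close> are admissible test functions and together
  carry the complex coefficient; each differentiates into a multiple of the other.\<close>

lemma fc_weak_partial:
  assumes h: "integrable TL h" and w: "is_weak_partial l i h w"
  shows "fc w k = \<i> * of_real (wave i k) * fc h k"
proof -
  define C where "C = trig {k} (\<lambda>_. 1)"
  define S where "S = trig {k} (\<lambda>_. - \<i>)"
  have C: "C x = Re (expo k x)" and S: "S x = Im (expo k x)" for x by (auto simp: C_def S_def trig_def)
  have wi: "integrable TL w" using w by (simp add: is_weak_partial_def)
  have pC: "partial i C = (\<lambda>x. - wave i k * S x)" and pS: "partial i S = (\<lambda>x. wave i k * C x)"
    by (auto simp: C_def S_def partial_trig trig_def)
  have coef: "fc f k * of_real (l\<^sup>2) = Complex (\<integral>x. f x * C x \<partial>TL) (- (\<integral>x. f x * S x \<partial>TL))"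
    if f: "integrable TL f" for f :: sfield
  proof -
    have i: "integrable TL (\<lambda>x. complex_of_real (f x) * cnj (expo k x))"
      using f by (intro integrable_mult_expo) auto
    have "Re (\<integral>x. complex_of_real (f x) * cnj (expo k x) \<partial>TL) = (\<integral>x. f x * C x \<partial>TL)"
      "Im (\<integral>x. complex_of_real (f x) * cnj (expo k x) \<partial>TL) = - (\<integral>x. f x * S x \<partial>TL)"
      unfolding integral_Re[OF i, symmetric] integral_Im[OF i, symmetric] by (simp_all add: C S)
    then show ?thesis using l_pos by (simp add: fc_def fco_def complex_eq_iff)
  qed
  have "smooth C" "periodic l C" "smooth S" "periodic l S" by (auto simp: C_def S_def smooth_trig periodic_trig)
  then have "(\<integral>x. h x * partial i C x \<partial>TL) = - (\<integral>x. w x * C x \<partial>TL)" "(\<integral>x. h x * partial i S x \<partial>TL) = - (\<integral>x. w x * S x \<partial>TL)"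
    using w unfolding is_weak_partial_def by blast+
  then have "(\<integral>x. w x * C x \<partial>TL) = wave i k * (\<integral>x. h x * S x \<partial>TL)" "(\<integral>x. w x * S x \<partial>TL) = - wave i k * (\<integral>x. h x * C x \<partial>TL)"
    unfolding pC pS by (simp_all add: mult.left_commute[of "h _"])
  then have "fc w k * of_real (l\<^sup>2) = \<i> * of_real (wave i k) * (fc h k * of_real (l\<^sup>2))"
    unfolding coef[OF wi] coef[OF h] by (simp add: complex_eq_iff)
  then show ?thesis using l_pos by simp
qed

lemma weak_partial_unique:
  assumes h: "integrable TL h" and "is_weak_partial l i h w" "is_weak_partial l i h w'"
  shows "AE x in TL. w x = w' x"
  by (rule fc_unique) (use assms fc_weak_partial[OF h] in \<open>auto simp: is_weak_partial_def\<close>)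

lemma wpartial_weak: "is_weak_partial l i h w \<Longrightarrow> is_weak_partial l i h (wpartial l i h)"
  unfolding wpartial_def by (rule someI[of "is_weak_partial l i h"])

lemma wpartial_AE:
  assumes "integrable TL h" "is_weak_partial l i h w"
  shows "AE x in TL. wpartial l i h x = w x"
  using weak_partial_unique[OF assms(1) wpartial_weak[OF assms(2)] assms(2)] .

text \<open>The predicate below the choice operator depends on the function only through integrals,
  so both functions yield the same predicate and hence literally the same chosen derivative.
  Operators built from \<open>wpartial\<close> therefore respect almost-everywhere equality.\<close>

lemma wpartial_cong_AE:
  assumes "AE x in TL. f x = g x" "f \<in> borel_measurable TL" "g \<in> borel_measurable TL"
  shows "wpartial l i f = wpartial l i g"
proof -
  have "(\<integral>x. f x * partial i \<theta> x \<partial>TL) = (\<integral>x. g x * partial i \<theta> x \<partial>TL)" if "smooth \<theta>" for \<theta>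
    by (rule integral_cong_AE) (use assms smooth_torus[OF smooth_partial[OF that, of i]] in \<open>auto elim!: eventually_mono\<close>)
  then have "is_weak_partial l i f w = is_weak_partial l i g w" for w
    unfolding is_weak_partial_def by auto
  then show ?thesis unfolding wpartial_def by presburger
qed

text \<open>The derivative is the real part of the L^2 function with coefficients
  \<open>\<i> * wave i k * fc h k\<close>, extended periodically. The defining identity holds
  classically for truncations and passes to the L^2 limit on both sides.\<close>

lemma weak_partial_exists:
  assumes h: "L2p h" and s: "(\<lambda>k. (wave i k)\<^sup>2 * (cmod (fc h k))\<^sup>2) summable_on UNIV"
  shows "\<exists>w. is_weak_partial l i h w \<and> L2p w"
proof -
  define c where "c k = \<i> * of_real (wave i k) * fc h k" for k
  have "(\<lambda>k. (cmod (c k))\<^sup>2) summable_on UNIV" using s by (simp add: c_def norm_mult power_mult_distrib)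
  then obtain H where H: "sq_int TL H" "(\<lambda>N. \<integral>x. (cmod ((\<Sum>k\<in>box_set N. c k * expo k x) - H x))\<^sup>2 \<partial>TL) \<longlonglongrightarrow> 0"
    using exists_fourier_series by blast
  have "(\<lambda>x. Re (H x)) \<in> borel_measurable TL" using H(1) by (auto simp: sq_int_def)
  then obtain w where w: "w \<in> borel_measurable borel" "periodic l w" "\<And>x. x \<in> cell \<Longrightarrow> w x = Re (H x)"
    using periodic_extension by blast
  have wsq: "sq_int TL w"
  proof -
    have "integrable TL (\<lambda>x. (norm (Re (H x)))\<^sup>2)"
      by (rule Bochner_Integration.integrable_bound[OF sq_int_integrable[OF H(1)]])
         (use H(1) in \<open>auto simp: sq_int_def cmod_power2\<close>)
    then have "integrable TL (\<lambda>x. (norm (w x))\<^sup>2)"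
      by (subst Bochner_Integration.integrable_cong[OF refl, of _ _ "\<lambda>x. (norm (Re (H x)))\<^sup>2"]) (auto simp: space_torus w)
    then show ?thesis using w by (simp add: sq_int_def)
  qed
  have "(\<lambda>N. l2norm TL (\<lambda>x. H x - (\<Sum>k\<in>box_set N. c k * expo k x))) \<longlonglongrightarrow> sqrt 0"
    unfolding l2norm_def using H(2) by (intro tendsto_real_sqrt) (simp add: norm_minus_commute)
  then have "(\<lambda>N. l2norm TL (\<lambda>x. Re (H x) - trig (box_set N) c x)) \<longlonglongrightarrow> 0"
    using trig_L2_limit[OF H(1), of c] by simp
  moreover have "l2norm TL (\<lambda>x. Re (H x) - trig (box_set N) c x) = l2norm TL (\<lambda>x. w x - trig (box_set N) c x)" for N
    unfolding l2norm_def by (intro arg_cong[of _ _ sqrt] Bochner_Integration.integral_cong) (auto simp: space_torus w)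
  ultimately have lim: "(\<lambda>N. l2norm TL (\<lambda>x. w x - trig (box_set N) c x)) \<longlonglongrightarrow> 0" by simp
  have "(\<integral>x. h x * partial i \<theta> x \<partial>TL) = - (\<integral>x. w x * \<theta> x \<partial>TL)" if \<theta>: "smooth \<theta>" "periodic l \<theta>" for \<theta>
  proof -
    have c: "partial i (trunc N h) = trig (box_set N) c" for N
      unfolding trunc_def partial_trig c_def ..
    have "(\<lambda>N. \<integral>x. partial i \<theta> x * trunc N h x \<partial>TL) \<longlonglongrightarrow> (\<integral>x. partial i \<theta> x * h x \<partial>TL)"
      by (rule tendsto_integral_mult_L2[OF sq_int_smooth[OF smooth_partial[OF \<theta>(1)]] L2p_sq_int[OF h] sq_int_trunc trunc_L2[OF L2p_sq_int[OF h]]])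
    moreover have "(\<integral>x. partial i \<theta> x * trunc N h x \<partial>TL) = - (\<integral>x. \<theta> x * trig (box_set N) c x \<partial>TL)" for N
      using integral_by_parts_smooth[of \<theta> "trunc N h" i] \<theta> unfolding c by (simp add: smooth_trig periodic_trig trunc_def)
    moreover have "(\<lambda>N. - (\<integral>x. \<theta> x * trig (box_set N) c x \<partial>TL)) \<longlonglongrightarrow> - (\<integral>x. \<theta> x * w x \<partial>TL)"
      by (intro tendsto_minus tendsto_integral_mult_L2[OF sq_int_smooth[OF \<theta>(1)] wsq sq_int_trig lim]) simp
    ultimately have "(\<integral>x. partial i \<theta> x * h x \<partial>TL) = - (\<integral>x. \<theta> x * w x \<partial>TL)"
      using LIMSEQ_unique by fastforce
    then show ?thesis by (simp add: mult.commute)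
  qed
  then have "is_weak_partial l i h w" unfolding is_weak_partial_def using w wsq by (auto intro: integrable_sq_int)
  then show ?thesis using w wsq by (auto simp: L2p_def)
qed

text \<open>The condition \<open>fc h 0 = 0\<close> controls the zero mode, which the weights
  \<open>kk k ^ s\<close> with \<open>s > 0\<close> do not see. It makes \<open>hn s\<close>
  increase with \<open>s\<close>, since all other frequencies have
  \<open>kk k \<ge> 1\<close>.\<close>

definition sob :: "nat \<Rightarrow> sfield \<Rightarrow> bool" where
  "sob s h \<longleftrightarrow> L2p h \<and> fc h 0 = 0 \<and> (\<lambda>k. kk k ^ s * (cmod (fc h k))\<^sup>2) summable_on UNIV"

definition hn :: "nat \<Rightarrow> sfield \<Rightarrow> real" where
  "hn s h = sqrt (\<Sum>\<^sub>\<infinity>k. kk k ^ s * (cmod (fc h k))\<^sup>2)"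

lemma hn_nonneg[simp]: "0 \<le> hn s h" unfolding hn_def by (auto intro!: infsum_nonneg)

lemma hn_sq: "(hn s h)\<^sup>2 = (\<Sum>\<^sub>\<infinity>k. kk k ^ s * (cmod (fc h k))\<^sup>2)"
  unfolding hn_def by (auto intro!: real_sqrt_pow2 infsum_nonneg)

lemma sob_L2p: "sob s h \<Longrightarrow> L2p h" by (simp add: sob_def)
lemma sob_sq_int: "sob s h \<Longrightarrow> sq_int TL h" by (simp add: sob_def L2p_def)

lemma kk_pow_fc_mono:
  assumes "fc h 0 = 0" "s \<le> t" shows "kk k ^ s * (cmod (fc h k))\<^sup>2 \<le> kk k ^ t * (cmod (fc h k))\<^sup>2"
  using assms kk_ge_1[of k] by (cases "k = 0") (auto intro!: mult_right_mono power_increasing)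

lemma sob_mono:
  assumes h: "sob t h" and "s \<le> t" shows "sob s h" "hn s h \<le> hn t h"
proof -
  note le = kk_pow_fc_mono[OF _ assms(2), of h]
  show s: "sob s h"
    unfolding sob_def using h le
    by (auto simp: sob_def intro: summable_on_comparison_test[of "\<lambda>k. kk k ^ t * (cmod (fc h k))\<^sup>2"])
  show "hn s h \<le> hn t h" unfolding hn_def
    using h s le by (intro real_sqrt_le_mono infsum_mono) (auto simp: sob_def)
qed

lemma l2norm_eq_hn: "sq_int TL h \<Longrightarrow> l2norm TL h = l * hn 0 h"
  using parseval_real_norm[of h] l_pos unfolding hn_def
  by (simp add: infsumI real_sqrt_divide)

lemma wave_le: "(wave i k)\<^sup>2 \<le> (2 * pi / l)\<^sup>2 * kk k"
proof -
  have "(real_of_int (if i = 1 then fst k else snd k))\<^sup>2 \<le> kk k" by (simp add: kk_def)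
  then show ?thesis unfolding wave_def by (simp add: power_mult_distrib power_divide mult_left_mono divide_right_mono)
qed

lemma sum_wave: "(\<Sum>i\<in>UNIV. (wave i k)\<^sup>2) = (2 * pi / l)\<^sup>2 * kk k"
  by (simp add: UNIV_2 wave_def kk_def power_mult_distrib power_divide add_divide_distrib[symmetric] distrib_left)

lemma sob_weak_partial:
  assumes h: "sob (Suc s) h"
  shows "is_weak_partial l i h (wpartial l i h)" "sob s (wpartial l i h)"
    "hn s (wpartial l i h) \<le> 2 * pi / l * hn (Suc s) h"
    "fc (wpartial l i h) k = \<i> * of_real (wave i k) * fc h k"
proof -
  have hL: "L2p h" using h by (rule sob_L2p)
  have h1: "sob 1 h" using sob_mono(1)[OF h, of 1] by simp
  have "(\<lambda>k. (2 * pi / l)\<^sup>2 * (kk k ^ 1 * (cmod (fc h k))\<^sup>2)) summable_on UNIV"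
    using h1 unfolding sob_def by (intro summable_on_cmult_right) auto
  then have "(\<lambda>k. (wave i k)\<^sup>2 * (cmod (fc h k))\<^sup>2) summable_on UNIV"
    by (rule summable_on_comparison_test) (auto simp: mult.assoc[symmetric] intro!: mult_right_mono wave_le)
  then obtain w where w: "is_weak_partial l i h w" "L2p w" using weak_partial_exists[OF hL] by blast
  show wk: "is_weak_partial l i h (wpartial l i h)" by (rule wpartial_weak[OF w(1)])
  have "AE x in TL. w x = wpartial l i h x"
    using wpartial_AE[OF L2p_integrable[OF hL] w(1)] by eventually_elim simp
  then have "sq_int TL (wpartial l i h)"
    by (intro sq_int_cong_AE[OF L2p_sq_int[OF w(2)]]) (use wk in \<open>auto simp: is_weak_partial_def\<close>)
  then have L: "L2p (wpartial l i h)" using wk by (auto simp: L2p_def is_weak_partial_def)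
  show f: "fc (wpartial l i h) k = \<i> * of_real (wave i k) * fc h k" for k
    by (rule fc_weak_partial[OF L2p_integrable[OF hL] wk])
  have le: "kk k ^ s * (cmod (fc (wpartial l i h) k))\<^sup>2 \<le> (2 * pi / l)\<^sup>2 * (kk k ^ Suc s * (cmod (fc h k))\<^sup>2)" for k
  proof -
    have "kk k ^ s * (cmod (fc (wpartial l i h) k))\<^sup>2 = (wave i k)\<^sup>2 * (kk k ^ s * (cmod (fc h k))\<^sup>2)"
      by (simp add: f norm_mult power_mult_distrib mult_ac)
    also have "\<dots> \<le> ((2 * pi / l)\<^sup>2 * kk k) * (kk k ^ s * (cmod (fc h k))\<^sup>2)"
      by (intro mult_right_mono wave_le) auto
    finally show ?thesis by (simp add: mult_ac)
  qed
  have sm: "(\<lambda>k. (2 * pi / l)\<^sup>2 * (kk k ^ Suc s * (cmod (fc h k))\<^sup>2)) summable_on UNIV"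
    using h unfolding sob_def by (intro summable_on_cmult_right) auto
  have sw: "(\<lambda>k. kk k ^ s * (cmod (fc (wpartial l i h) k))\<^sup>2) summable_on UNIV"
    by (rule summable_on_comparison_test[OF sm]) (use le in auto)
  show "sob s (wpartial l i h)" unfolding sob_def using L sw f[of 0] h by (simp add: sob_def)
  have "(hn s (wpartial l i h))\<^sup>2 \<le> (2 * pi / l * hn (Suc s) h)\<^sup>2"
    unfolding power_mult_distrib hn_sq infsum_cmult_right'[symmetric] by (intro infsum_mono sw sm le)
  then show "hn s (wpartial l i h) \<le> 2 * pi / l * hn (Suc s) h"
    by (rule power2_le_imp_le) (use l_pos in auto)
qed

lemma sob_add: assumes "sob s f" "sob s g" shows "sob s (\<lambda>x. f x + g x)"
proof -
  have fc: "fc (\<lambda>x. f x + g x) k = fc f k + fc g k" for k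
    using assms by (intro fc_add L2p_integrable sob_L2p)
  have "(cmod (a + b))\<^sup>2 \<le> 2 * (cmod a)\<^sup>2 + 2 * (cmod b)\<^sup>2" for a b :: complex
  proof -
    have "(cmod (a + b))\<^sup>2 \<le> (cmod a + cmod b)\<^sup>2" by (simp add: norm_triangle_ineq power_mono)
    also have "\<dots> \<le> 2 * (cmod a)\<^sup>2 + 2 * (cmod b)\<^sup>2"
      using zero_le_power2[of "cmod a - cmod b"] by (simp add: power2_eq_square algebra_simps)
    finally show ?thesis .
  qed
  then have le: "kk k ^ s * (cmod (fc (\<lambda>x. f x + g x) k))\<^sup>2 \<le> 2 * (kk k ^ s * (cmod (fc f k))\<^sup>2) + 2 * (kk k ^ s * (cmod (fc g k))\<^sup>2)" for k
    unfolding fc by (metis (no_types, lifting) kk_nonneg mult.left_commute mult_left_mono ring_class.ring_distribs(1) zero_le_power)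
  have "(\<lambda>k. kk k ^ s * (cmod (fc (\<lambda>x. f x + g x) k))\<^sup>2) summable_on UNIV"
    by (rule summable_on_comparison_test[of "\<lambda>k. 2 * (kk k ^ s * (cmod (fc f k))\<^sup>2) + 2 * (kk k ^ s * (cmod (fc g k))\<^sup>2)"])
       (use le assms in \<open>auto simp: sob_def intro!: summable_on_add summable_on_cmult_right\<close>)
  then show ?thesis using assms fc by (simp add: sob_def L2p_add)
qed

lemma sob_cmult: assumes "sob s f" shows "sob s (\<lambda>x. c * f x)"
proof -
  have "(\<lambda>k. c\<^sup>2 * (kk k ^ s * (cmod (fc f k))\<^sup>2)) summable_on UNIV"
    using assms unfolding sob_def by (intro summable_on_cmult_right) auto
  then show ?thesis using assms by (simp add: sob_def L2p_cmult fc_cmult norm_mult power_mult_distrib mult_ac)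
qed

lemma sob_diff: "sob s f \<Longrightarrow> sob s g \<Longrightarrow> sob s (\<lambda>x. f x - g x)"
  using sob_add[of s f "\<lambda>x. (-1) * g x"] sob_cmult[of s g "-1"] by simp

lemma sob_zero: "sob s (\<lambda>x. 0)"
  by (simp add: sob_def L2p_def periodic_def fc_def fco_def)

lemma sob_sum: "(\<And>i. i \<in> I \<Longrightarrow> sob s (f i)) \<Longrightarrow> sob s (\<lambda>x. \<Sum>i\<in>I. f i x)"
  by (induction I rule: infinite_finite_induct) (auto intro!: sob_add sob_zero)

text \<open>On the Fourier side both orders multiply by the same product of symbols;
  \<open>fc_unique\<close> does the rest.\<close>

lemma wpartial_commute:
  assumes h: "sob 2 h"
  shows "AE x in TL. wpartial l i (wpartial l j h) x = wpartial l j (wpartial l i h) x"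
proof -
  have h2: "sob (Suc (Suc 0)) h" using h by (simp add: numeral_2_eq_2)
  note 1 = sob_weak_partial[OF h2] and 2 = sob_weak_partial[OF sob_weak_partial(2)[OF h2]]
  show ?thesis
    by (rule fc_unique) (use 1 2 in \<open>auto intro!: L2p_integrable sob_L2p\<close>)
qed

lemma partial_trunc: "sob (Suc s) h \<Longrightarrow> partial i (trunc N h) = trunc N (wpartial l i h)"
  unfolding trunc_def partial_trig by (simp add: sob_weak_partial(4) trig_def[abs_def])

text \<open>Cauchy-Schwarz with the weights 1/|k|^2 and |k|^2: the coefficients of an H^2 function
  are absolutely summable. The zero frequency, where the weight is undefined, carries no
  coefficient.\<close>

lemma sob2_sum_fc:
  assumes h: "sob 2 h" and A: "finite A"
  shows "(\<Sum>k\<in>A. cmod (fc h k)) \<le> Kemb * hn 2 h"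
proof -
  have "(\<Sum>k\<in>A. cmod (fc h k)) = (\<Sum>k\<in>A. (1 / kk k) * (kk k * cmod (fc h k)))"
  proof (intro sum.cong refl)
    fix k show "cmod (fc h k) = (1 / kk k) * (kk k * cmod (fc h k))"
      using h kk_ge_1[of k] by (cases "k = 0") (auto simp: sob_def)
  qed
  also have "\<dots> \<le> sqrt (\<Sum>k\<in>A. (1 / kk k)\<^sup>2) * sqrt (\<Sum>k\<in>A. (kk k * cmod (fc h k))\<^sup>2)"
    using L2_set_mult_ineq[of "\<lambda>k. 1 / kk k" "\<lambda>k. kk k * cmod (fc h k)" A] unfolding L2_set_def by simp
  also have "\<dots> \<le> Kemb * hn 2 h"
  proof (rule mult_mono)
    show "sqrt (\<Sum>k\<in>A. (1 / kk k)\<^sup>2) \<le> Kemb"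
      using sum_inverse_kk_le[OF A] Kemb_nonneg by (simp add: power_divide real_le_lsqrt sum_nonneg)
    have "(\<Sum>k\<in>A. (kk k)^2 * (cmod (fc h k))\<^sup>2) \<le> (hn 2 h)\<^sup>2" unfolding hn_sq
      by (rule finite_sum_le_infsum) (use h A in \<open>auto simp: sob_def\<close>)
    then show "sqrt (\<Sum>k\<in>A. (kk k * cmod (fc h k))\<^sup>2) \<le> hn 2 h"
      by (simp add: power_mult_distrib real_le_lsqrt sum_nonneg)
  qed (auto simp: Kemb_nonneg sum_nonneg)
  finally show ?thesis .
qed

lemma trunc_bound: "sob 2 h \<Longrightarrow> \<bar>trunc N h x\<bar> \<le> Kemb * hn 2 h"
proof -
  assume h: "sob 2 h"
  have "\<bar>trunc N h x\<bar> \<le> cmod (\<Sum>k\<in>box_set N. fc h k * expo k x)"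
    unfolding trunc_def trig_def by (rule abs_Re_le_cmod)
  also have "\<dots> \<le> (\<Sum>k\<in>box_set N. cmod (fc h k))" by (rule order_trans[OF norm_sum]) (simp add: norm_mult)
  also have "\<dots> \<le> Kemb * hn 2 h" by (rule sob2_sum_fc[OF h]) simp
  finally show ?thesis .
qed

text \<open>Absolute summability gives a limit \<open>g\<close> of the truncations at every point.
  To see \<open>g = h\<close> almost everywhere, \<open>h - g\<close> is integrated against its own
  sign; the L^2 convergence of the truncations makes this integral vanish.\<close>

lemma trunc_AE:
  assumes h: "sob 2 h" shows "AE x in TL. (\<lambda>N. trunc N h x) \<longlonglongrightarrow> h x"
proof -
  have abs: "(\<lambda>k. cmod (fc h k)) summable_on UNIV"
    by (rule nonneg_bdd_above_summable_on) (use sob2_sum_fc[OF h] in \<open>auto simp: bdd_above_def\<close>)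
  have s: "(\<lambda>k. fc h k * expo k x) summable_on UNIV" for x
    by (rule abs_summable_summable) (use abs in \<open>simp add: norm_mult\<close>)
  define g where "g x = Re (infsum (\<lambda>k. fc h k * expo k x) UNIV)" for x
  have lim: "(\<lambda>N. trunc N h x) \<longlonglongrightarrow> g x" for x
    unfolding trunc_def trig_def g_def by (intro tendsto_Re has_sum_box) (use s in simp)
  have [measurable]: "trunc N h \<in> borel_measurable TL" for N unfolding trunc_def by (intro measurable_torus smooth_borel smooth_trig)
  have [measurable]: "h \<in> borel_measurable TL" using sob_sq_int[OF h] by (simp add: sq_int_def)
  have [measurable]: "g \<in> borel_measurable TL" by (rule borel_measurable_LIMSEQ_real[OF lim]) simp
  have "(\<lambda>N. \<integral>x. (h x - trunc N h x) * \<theta> x \<partial>TL) \<longlonglongrightarrow> (\<integral>x. (h x - g x) * \<theta> x \<partial>TL)"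
    if \<theta>[measurable]: "\<theta> \<in> borel_measurable TL" "\<And>x. \<bar>\<theta> x\<bar> \<le> 1" for \<theta>
  proof (rule integral_dominated_convergence[where w="\<lambda>x. \<bar>h x\<bar> + Kemb * hn 2 h"])
    show "integrable TL (\<lambda>x. \<bar>h x\<bar> + Kemb * hn 2 h)" using integrable_sq_int[OF sob_sq_int[OF h]] by auto
    show "AE x in TL. (\<lambda>N. (h x - trunc N h x) * \<theta> x) \<longlonglongrightarrow> (h x - g x) * \<theta> x"
      using lim by (auto intro!: AE_I2 tendsto_intros)
    show "AE x in TL. norm ((h x - trunc N h x) * \<theta> x) \<le> \<bar>h x\<bar> + Kemb * hn 2 h" for N
    proof (rule AE_I2)
      fix x
      have "\<bar>h x - trunc N h x\<bar> * \<bar>\<theta> x\<bar> \<le> \<bar>h x - trunc N h x\<bar>" using \<theta>(2)[of x] by (simp add: mult_left_le)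
      then show "norm ((h x - trunc N h x) * \<theta> x) \<le> \<bar>h x\<bar> + Kemb * hn 2 h"
        using trunc_bound[OF h, of N x] by (simp add: abs_mult)
    qed
  qed auto
  note dom = this
  have gb: "\<bar>g x\<bar> \<le> Kemb * hn 2 h" for x
    by (rule tendsto_upperbound[OF tendsto_rabs[OF lim]]) (auto simp: trunc_bound[OF h])
  have gs: "sq_int TL g" by (rule sq_int_bounded[where B="Kemb * hn 2 h"]) (auto simp: gb)
  have hg: "sq_int TL (\<lambda>x. h x - g x)" by (intro sq_int_diff gs sob_sq_int[OF h])
  have "AE x in TL. h x = g x"
  proof -
    define \<theta> where "\<theta> x = sgn (h x - g x)" for x
    have t: "\<theta> \<in> borel_measurable TL" "\<bar>\<theta> x\<bar> \<le> 1" for x unfolding \<theta>_def by (auto simp: sgn_if)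
    have ts: "sq_int TL \<theta>" by (rule sq_int_bounded[where B=1]) (use t in auto)
    have "(\<lambda>N. \<integral>x. (h x - trunc N h x) * \<theta> x \<partial>TL) \<longlonglongrightarrow> 0"
    proof (rule Lim_null_comparison[OF always_eventually tendsto_mult_left_zero[OF trunc_L2[OF sob_sq_int[OF h]], of "l2norm TL \<theta>"]], rule allI)
      fix N
      show "norm (\<integral>x. (h x - trunc N h x) * \<theta> x \<partial>TL) \<le> l2norm TL (\<lambda>x. h x - trunc N h x) * l2norm TL \<theta>"
        by (rule Cauchy_Schwarz_norm(2)[OF sq_int_diff[OF sob_sq_int[OF h] sq_int_trunc] ts])
    qed
    then have "(\<integral>x. (h x - g x) * \<theta> x \<partial>TL) = 0" using LIMSEQ_unique[OF dom[OF t]] by blast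
    then have "(\<integral>x. \<bar>h x - g x\<bar> \<partial>TL) = 0" by (simp add: \<theta>_def abs_sgn[symmetric])
    then have "AE x in TL. \<bar>h x - g x\<bar> = 0"
      using integral_nonneg_eq_0_iff_AE[of TL "\<lambda>x. \<bar>h x - g x\<bar>"] integrable_sq_int[OF hg] by simp
    then show ?thesis by eventually_elim simp
  qed
  then show ?thesis using lim by (auto elim!: eventually_mono)
qed

lemma sob2_bound:
  assumes h: "sob 2 h" shows "AE x in TL. \<bar>h x\<bar> \<le> Kemb * hn 2 h"
  using trunc_AE[OF h]
proof eventually_elim
  case (elim x)
  then show ?case by (intro tendsto_upperbound[OF tendsto_rabs[OF elim]]) (auto simp: trunc_bound[OF h])
qed


section \<open>Integration by parts and products for weak derivatives\<close>

lemma smooth_bounded: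
  assumes "smooth \<theta>" shows "\<exists>B. \<forall>x\<in>cell. \<bar>\<theta> x\<bar> \<le> B"
proof -
  let ?K = "cbox 0 (\<chi> i. l) :: (real^2) set"
  have "bounded (\<theta> ` ?K)"
    by (intro compact_imp_bounded compact_continuous_image continuous_on_subset[OF smooth_continuous[OF assms]]) auto
  then obtain B where "\<And>x. x \<in> ?K \<Longrightarrow> norm (\<theta> x) \<le> B" unfolding bounded_iff by blast
  moreover have "cell \<subseteq> ?K" by (auto simp: cell_def mem_box_cart less_imp_le)
  ultimately show ?thesis by (intro exI[of _ B]) auto
qed

lemma integrable_bounded_mult:
  fixes F \<phi> :: sfield
  assumes F: "integrable TL F" and [measurable]: "\<phi> \<in> borel_measurable TL" and B: "AE x in TL. \<bar>\<phi> x\<bar> \<le> B"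
  shows "integrable TL (\<lambda>x. \<phi> x * F x)"
proof (rule Bochner_Integration.integrable_bound)
  show "integrable TL (\<lambda>x. B * F x)" using F by simp
  show "(\<lambda>x. \<phi> x * F x) \<in> borel_measurable TL" using F by auto
  show "AE x in TL. norm (\<phi> x * F x) \<le> norm (B * F x)" using B
  proof eventually_elim
    case (elim x)
    then show ?case by (auto simp: abs_mult intro!: mult_right_mono)
  qed
qed

lemma integrable_smooth_mult:
  assumes "integrable TL F" "smooth \<theta>" shows "integrable TL (\<lambda>x. F x * \<theta> x)"
proof -
  obtain B where "\<forall>x\<in>cell. \<bar>\<theta> x\<bar> \<le> B" using smooth_bounded[OF assms(2)] by blast
  then have "integrable TL (\<lambda>x. \<theta> x * F x)"
    by (intro integrable_bounded_mult[OF assms(1), of _ B] smooth_torus assms(2)) (auto intro!: AE_I2 simp: space_torus)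
  then show ?thesis by (simp add: mult.commute)
qed

lemma sq_int_smooth_mult:
  assumes "sq_int TL F" "smooth \<theta>" shows "sq_int TL (\<lambda>x. F x * \<theta> x)"
proof -
  obtain B where "\<forall>x\<in>cell. \<bar>\<theta> x\<bar> \<le> B" using smooth_bounded[OF assms(2)] by blast
  then have "sq_int TL (\<lambda>x. \<theta> x * F x)"
    by (intro sq_int_bounded_mult[OF assms(1), of _ B] smooth_torus assms(2)) (auto intro!: AE_I2 simp: space_torus)
  then show ?thesis by (simp add: mult.commute)
qed

lemma sob_measurable: "sob s f \<Longrightarrow> f \<in> borel_measurable TL"
  using sob_sq_int by (simp add: sq_int_def)

lemma integrable_sob2_mult:
  assumes "integrable TL F" "sob 2 f" shows "integrable TL (\<lambda>x. f x * F x)"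
  by (rule integrable_bounded_mult[OF assms(1) sob_measurable[OF assms(2)] sob2_bound[OF assms(2)]])

lemma sq_int_sob2_mult:
  assumes "sq_int TL F" "sob 2 f" shows "sq_int TL (\<lambda>x. f x * F x)"
  by (rule sq_int_bounded_mult[OF assms(1) sob_measurable[OF assms(2)], of "Kemb * hn 2 f"])
     (use sob2_bound[OF assms(2)] in simp)

lemma L2p_sob2_mult:
  assumes "L2p F" "sob 2 f" shows "L2p (\<lambda>x. f x * F x)"
  using sq_int_sob2_mult[OF L2p_sq_int[OF assms(1)] assms(2)] assms
  by (auto simp: L2p_def sob_def periodic_def)

lemma smooth_trunc: "smooth (trunc N f)" "periodic l (trunc N f)"
  by (simp_all add: trunc_def smooth_trig periodic_trig)

lemma tendsto_integral_trunc:
  assumes F: "integrable TL F" and f: "sob 2 f"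
  shows "(\<lambda>N. \<integral>x. F x * trunc N f x \<partial>TL) \<longlonglongrightarrow> (\<integral>x. F x * f x \<partial>TL)"
proof (rule integral_dominated_convergence[where w="\<lambda>x. \<bar>F x\<bar> * (Kemb * hn 2 f)"])
  show "integrable TL (\<lambda>x. \<bar>F x\<bar> * (Kemb * hn 2 f))" using F by auto
  show "(\<lambda>x. F x * f x) \<in> borel_measurable TL" using F sob_measurable[OF f] by auto
  show "(\<lambda>x. F x * trunc N f x) \<in> borel_measurable TL" for N using F smooth_torus[OF smooth_trunc(1)] by auto
  show "AE x in TL. (\<lambda>N. F x * trunc N f x) \<longlonglongrightarrow> F x * f x"
    using trunc_AE[OF f] by eventually_elim (intro tendsto_intros)
  show "AE x in TL. norm (F x * trunc N f x) \<le> \<bar>F x\<bar> * (Kemb * hn 2 f)" for N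
    using trunc_bound[OF f] by (auto intro!: AE_I2 mult_left_mono simp: abs_mult)
qed

lemma sob_SucI: "sob 2 f \<Longrightarrow> sob (Suc 1) f" "sob 1 f \<Longrightarrow> sob (Suc 0) f" "sob 3 f \<Longrightarrow> sob (Suc 2) f"
  by (simp_all add: numeral_2_eq_2 numeral_3_eq_3)

text \<open>Here \<open>W\<close> is only integrable, so the term \<open>W * f\<close> needs a
  bounded \<open>f\<close>: truncations of an H^2 function are uniformly bounded and converge almost
  everywhere.\<close>

lemma weak_ibp_sob2:
  assumes M: "L2p M" and W: "is_weak_partial l i M W" and f: "sob 2 f"
  shows "(\<integral>x. M x * wpartial l i f x \<partial>TL) = - (\<integral>x. W x * f x \<partial>TL)"
proof -
  have Wi: "integrable TL W" using W by (simp add: is_weak_partial_def)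
  note f' = sob_weak_partial[OF sob_SucI(1)[OF f], of i]
  have "(\<lambda>N. \<integral>x. M x * trunc N (wpartial l i f) x \<partial>TL) \<longlonglongrightarrow> (\<integral>x. M x * wpartial l i f x \<partial>TL)"
    by (rule tendsto_integral_mult_L2[OF L2p_sq_int[OF M] sob_sq_int[OF f'(2)] sq_int_trunc trunc_L2[OF sob_sq_int[OF f'(2)]]])
  moreover have "(\<integral>x. M x * trunc N (wpartial l i f) x \<partial>TL) = - (\<integral>x. W x * trunc N f x \<partial>TL)" for N
    using W smooth_trunc unfolding is_weak_partial_def partial_trunc[OF sob_SucI(1)[OF f], symmetric] by blast
  moreover have "(\<lambda>N. - (\<integral>x. W x * trunc N f x \<partial>TL)) \<longlonglongrightarrow> - (\<integral>x. W x * f x \<partial>TL)"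
    by (intro tendsto_minus tendsto_integral_trunc Wi f)
  ultimately show ?thesis using LIMSEQ_unique by fastforce
qed

text \<open>The counterpart of \<open>weak_ibp_sob2\<close> with the regularity shifted: a
  square-integrable \<open>W\<close> allows \<open>f\<close> to be merely H^1, as L^2 convergence of
  its truncations suffices.\<close>

lemma weak_ibp_sob1:
  assumes M: "L2p M" and W: "is_weak_partial l i M W" "sq_int TL W" and f: "sob 1 f"
  shows "(\<integral>x. M x * wpartial l i f x \<partial>TL) = - (\<integral>x. W x * f x \<partial>TL)"
proof -
  note f' = sob_weak_partial[OF sob_SucI(2)[OF f], of i]
  have "(\<lambda>N. \<integral>x. M x * trunc N (wpartial l i f) x \<partial>TL) \<longlonglongrightarrow> (\<integral>x. M x * wpartial l i f x \<partial>TL)"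
    by (rule tendsto_integral_mult_L2[OF L2p_sq_int[OF M] sob_sq_int[OF f'(2)] sq_int_trunc trunc_L2[OF sob_sq_int[OF f'(2)]]])
  moreover have "(\<integral>x. M x * trunc N (wpartial l i f) x \<partial>TL) = - (\<integral>x. W x * trunc N f x \<partial>TL)" for N
    using W smooth_trunc unfolding is_weak_partial_def partial_trunc[OF sob_SucI(2)[OF f], symmetric] by blast
  moreover have "(\<lambda>N. - (\<integral>x. W x * trunc N f x \<partial>TL)) \<longlonglongrightarrow> - (\<integral>x. W x * f x \<partial>TL)"
    by (intro tendsto_minus tendsto_integral_mult_L2[OF W(2) sob_sq_int[OF f] sq_int_trunc trunc_L2[OF sob_sq_int[OF f]]])
  ultimately show ?thesis using LIMSEQ_unique by fastforce
qed

text \<open>The product of a truncation of \<open>f\<close> with a test function is itself a test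
  function for \<open>g\<close>. In the limit the terms carrying \<open>f\<close> converge
  boundedly, against integrable factors, and the term carrying its derivative converges in L^2. The
  resulting derivative is in general only integrable.\<close>

lemma weak_partial_mult:
  assumes f: "sob 2 f" and g: "L2p g" and w: "is_weak_partial l i g w"
  shows "is_weak_partial l i (\<lambda>x. f x * g x) (\<lambda>x. wpartial l i f x * g x + f x * w x)"
proof -
  note f' = sob_weak_partial[OF sob_SucI(1)[OF f], of i]
  have wi: "integrable TL w" using w by (simp add: is_weak_partial_def)
  have i1: "integrable TL (\<lambda>x. wpartial l i f x * g x)"
    by (rule integrable_sq_int_mult[OF sob_sq_int[OF f'(2)] L2p_sq_int[OF g]])
  have i2: "integrable TL (\<lambda>x. f x * w x)" by (rule integrable_sob2_mult[OF wi f])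
  have eq: "(\<integral>x. f x * g x * partial i \<theta> x \<partial>TL) = - (\<integral>x. (wpartial l i f x * g x + f x * w x) * \<theta> x \<partial>TL)"
    if \<theta>: "smooth \<theta>" "periodic l \<theta>" for \<theta>
  proof -
    have gi: "integrable TL g" by (rule L2p_integrable[OF g])
    have j1: "integrable TL (\<lambda>x. g x * partial i \<theta> x)" by (intro integrable_smooth_mult smooth_partial gi \<theta>)
    have j2: "integrable TL (\<lambda>x. w x * \<theta> x)" by (intro integrable_smooth_mult wi \<theta>)
    have j3: "sq_int TL (\<lambda>x. g x * \<theta> x)" by (intro sq_int_smooth_mult L2p_sq_int g \<theta>)
    have N: "(\<integral>x. g x * partial i \<theta> x * trunc N f x \<partial>TL) =
       - (\<integral>x. w x * \<theta> x * trunc N f x \<partial>TL) - (\<integral>x. g x * \<theta> x * trunc N (wpartial l i f) x \<partial>TL)" for N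
    proof -
      have p: "partial i (\<lambda>x. trunc N f x * \<theta> x) = (\<lambda>x. trunc N (wpartial l i f) x * \<theta> x + trunc N f x * partial i \<theta> x)"
        using smooth_trunc(1)[of N f] \<theta>(1) partial_trunc[OF sob_SucI(1)[OF f], of i N]
        by (auto simp: partial_mult smooth_differentiable)
      have "(\<integral>x. g x * partial i (\<lambda>x. trunc N f x * \<theta> x) x \<partial>TL) = - (\<integral>x. w x * (trunc N f x * \<theta> x) \<partial>TL)"
        using w smooth_mult[OF smooth_trunc(1) \<theta>(1)] smooth_trunc(2) \<theta>(2)
        unfolding is_weak_partial_def by (simp add: periodic_def)
      moreover have "(\<integral>x. g x * partial i (\<lambda>x. trunc N f x * \<theta> x) x \<partial>TL) =
         (\<integral>x. g x * \<theta> x * trunc N (wpartial l i f) x + g x * partial i \<theta> x * trunc N f x \<partial>TL)"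
        unfolding p by (rule Bochner_Integration.integral_cong) (auto simp: algebra_simps)
      moreover have "\<dots> = (\<integral>x. g x * \<theta> x * trunc N (wpartial l i f) x \<partial>TL) + (\<integral>x. g x * partial i \<theta> x * trunc N f x \<partial>TL)"
        using integrable_smooth_mult[OF j1 smooth_trunc(1)] integrable_smooth_mult[OF integrable_sq_int[OF j3] smooth_trunc(1)] by simp
      ultimately show ?thesis by (simp add: mult_ac)
    qed
    have "(\<lambda>N. \<integral>x. g x * partial i \<theta> x * trunc N f x \<partial>TL) \<longlonglongrightarrow> (\<integral>x. g x * partial i \<theta> x * f x \<partial>TL)"
      by (rule tendsto_integral_trunc[OF j1 f])
    moreover have "(\<lambda>N. \<integral>x. g x * partial i \<theta> x * trunc N f x \<partial>TL) \<longlonglongrightarrow>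
       - (\<integral>x. w x * \<theta> x * f x \<partial>TL) - (\<integral>x. g x * \<theta> x * wpartial l i f x \<partial>TL)"
      unfolding N
      by (intro tendsto_diff tendsto_minus tendsto_integral_trunc[OF j2 f]
          tendsto_integral_mult_L2[OF j3 sob_sq_int[OF f'(2)] sq_int_trunc trunc_L2[OF sob_sq_int[OF f'(2)]]])
    ultimately have "(\<integral>x. g x * partial i \<theta> x * f x \<partial>TL) = - (\<integral>x. w x * \<theta> x * f x \<partial>TL) - (\<integral>x. g x * \<theta> x * wpartial l i f x \<partial>TL)"
      using LIMSEQ_unique by blast
    moreover have "(\<integral>x. (wpartial l i f x * g x + f x * w x) * \<theta> x \<partial>TL) =
       (\<integral>x. g x * \<theta> x * wpartial l i f x \<partial>TL) + (\<integral>x. w x * \<theta> x * f x \<partial>TL)"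
    proof -
      have "(\<integral>x. (wpartial l i f x * g x + f x * w x) * \<theta> x \<partial>TL) =
        (\<integral>x. wpartial l i f x * g x * \<theta> x \<partial>TL) + (\<integral>x. f x * w x * \<theta> x \<partial>TL)"
        using integrable_smooth_mult[OF i1 \<theta>(1)] integrable_smooth_mult[OF i2 \<theta>(1)] by (simp add: distrib_right)
      then show ?thesis by (simp add: mult_ac)
    qed
    ultimately show ?thesis by (simp add: mult_ac)
  qed
  have [measurable]: "f \<in> borel_measurable borel" "g \<in> borel_measurable borel" "w \<in> borel_measurable borel"
      "wpartial l i f \<in> borel_measurable borel"
    using f g w f'(1) by (auto simp: sob_def L2p_def is_weak_partial_def)
  show ?thesis
    unfolding is_weak_partial_def
  proof (intro conjI allI impI)
    show "periodic l (\<lambda>x. wpartial l i f x * g x + f x * w x)"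
      using f g w f'(1) by (auto simp: sob_def L2p_def is_weak_partial_def periodic_def)
  qed (use i1 i2 eq in auto)
qed

lemma weak_partial_add:
  assumes "is_weak_partial l i f f'" "is_weak_partial l i g g'" "L2p f" "L2p g"
  shows "is_weak_partial l i (\<lambda>x. f x + g x) (\<lambda>x. f' x + g' x)"
proof -
  have "(\<integral>x. (f x + g x) * partial i \<theta> x \<partial>TL) = - (\<integral>x. (f' x + g' x) * \<theta> x \<partial>TL)"
    if \<theta>: "smooth \<theta>" "periodic l \<theta>" for \<theta>
  proof -
    have i: "integrable TL f" "integrable TL g" "integrable TL f'" "integrable TL g'"
      using assms by (auto simp: is_weak_partial_def intro: L2p_integrable)
    have "(\<integral>x. (f x + g x) * partial i \<theta> x \<partial>TL) = (\<integral>x. f x * partial i \<theta> x \<partial>TL) + (\<integral>x. g x * partial i \<theta> x \<partial>TL)"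
      using integrable_smooth_mult[OF i(1) smooth_partial[OF \<theta>(1)]] integrable_smooth_mult[OF i(2) smooth_partial[OF \<theta>(1)]]
      by (simp add: distrib_right)
    also have "\<dots> = - (\<integral>x. f' x * \<theta> x \<partial>TL) + - (\<integral>x. g' x * \<theta> x \<partial>TL)"
      using assms \<theta> by (simp add: is_weak_partial_def)
    also have "\<dots> = - (\<integral>x. (f' x + g' x) * \<theta> x \<partial>TL)"
      using integrable_smooth_mult[OF i(3) \<theta>(1)] integrable_smooth_mult[OF i(4) \<theta>(1)] by (simp add: distrib_right)
    finally show ?thesis .
  qed
  then show ?thesis using assms by (auto simp: is_weak_partial_def periodic_def)
qed

text \<open>Coefficients of a real function are conjugate symmetric and the box is invariant under
  negation, so the complex partial sum is already real and taking its real part loses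
  nothing.\<close>

lemma trunc_complex: 
  assumes h: "L2p h"
  shows "complex_of_real (trunc N h x) = (\<Sum>k\<in>box_set N. fc h k * expo k x)"
proof -
  let ?S = "\<Sum>k\<in>box_set N. fc h k * expo k x"
  have c: "cnj (fc h k) = fc h (- k)" for k
  proof -
    have "cnj (\<integral>x. complex_of_real (h x) * cnj (expo k x) \<partial>TL) = (\<integral>x. cnj (complex_of_real (h x) * cnj (expo k x)) \<partial>TL)"
      by (rule Bochner_Integration.integral_cnj[symmetric])
    then show ?thesis by (simp add: fc_def fco_def expo_minus)
  qed
  have "cnj ?S = (\<Sum>k\<in>box_set N. fc h (- k) * expo (- k) x)" by (simp add: c expo_minus)
  also have "\<dots> = ?S"
    by (rule sum.reindex_bij_witness[of _ uminus uminus]) (auto simp: box_set_def)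
  finally have "?S \<in> \<real>" by (simp add: Reals_cnj_iff)
  then show ?thesis unfolding trunc_def trig_def by (rule of_real_Re)
qed

lemma trilinear_trunc:
  assumes f: "sob 1 f" and g: "sob 1 g" and h: "sq_int TL h"
  shows "\<bar>\<integral>x. h x * trunc N f x * trunc M g x \<partial>TL\<bar> \<le> l * Kemb * hn 1 f * hn 1 g * l2norm TL h"
proof -
  let ?B = "box_set N \<times> box_set M"
  define H where "H p = cmod (fc h (- (fst p) - snd p))" for p
  have hi: "integrable TL (\<lambda>x. complex_of_real (h x))" using integrable_sq_int[OF h] by simp
  have i: "integrable TL (\<lambda>x. fc f (fst p) * fc g (snd p) * (complex_of_real (h x) * cnj (expo (- (fst p) - snd p) x)))" for p
    by (intro integrable_mult_right integrable_mult_expo hi)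
  have "complex_of_real (\<integral>x. h x * trunc N f x * trunc M g x \<partial>TL) = (\<integral>x. complex_of_real (h x * trunc N f x * trunc M g x) \<partial>TL)"
    by (rule integral_complex_of_real[symmetric])
  also have "\<dots> = (\<integral>x. (\<Sum>p\<in>?B. fc f (fst p) * fc g (snd p) * (complex_of_real (h x) * cnj (expo (- (fst p) - snd p) x))) \<partial>TL)"
  proof (rule Bochner_Integration.integral_cong[OF refl])
    fix x
    have e: "cnj (expo (- j - k) x) = expo j x * expo k x" for j k
      using expo_minus[of "- j - k" x] by (simp add: expo_add[symmetric] add.commute)
    show "complex_of_real (h x * trunc N f x * trunc M g x) = (\<Sum>p\<in>?B. fc f (fst p) * fc g (snd p) * (complex_of_real (h x) * cnj (expo (- (fst p) - snd p) x)))"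
    proof -
      have "(\<Sum>k\<in>box_set N. fc f k * expo k x) * (\<Sum>k\<in>box_set M. fc g k * expo k x) =
        (\<Sum>p\<in>?B. (fc f (fst p) * expo (fst p) x) * (fc g (snd p) * expo (snd p) x))"
        unfolding sum_product sum.cartesian_product case_prod_beta ..
      then have "complex_of_real (h x * trunc N f x * trunc M g x) =
        of_real (h x) * (\<Sum>p\<in>?B. (fc f (fst p) * expo (fst p) x) * (fc g (snd p) * expo (snd p) x))"
        unfolding of_real_mult trunc_complex[OF sob_L2p[OF f]] trunc_complex[OF sob_L2p[OF g]] mult.assoc by (simp only:)
      then show ?thesis unfolding e sum_distrib_left by (simp only: mult_ac)
    qed
  qed
  also have "\<dots> = (\<Sum>p\<in>?B. fc f (fst p) * fc g (snd p) * (\<integral>x. complex_of_real (h x) * cnj (expo (- (fst p) - snd p) x) \<partial>TL))"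
    by (subst Bochner_Integration.integral_sum[OF i]) simp
  also have "\<dots> = of_real (l\<^sup>2) * (\<Sum>p\<in>?B. fc f (fst p) * fc g (snd p) * fc h (- (fst p) - snd p))"
    unfolding fc_def[of h] fco_def using l_pos by (simp add: sum_distrib_left)
  finally have E: "complex_of_real (\<integral>x. h x * trunc N f x * trunc M g x \<partial>TL) =
    of_real (l\<^sup>2) * (\<Sum>p\<in>?B. fc f (fst p) * fc g (snd p) * fc h (- (fst p) - snd p))" .
  have "\<bar>\<integral>x. h x * trunc N f x * trunc M g x \<partial>TL\<bar> = l\<^sup>2 * cmod (\<Sum>p\<in>?B. fc f (fst p) * fc g (snd p) * fc h (- (fst p) - snd p))"
    using arg_cong[OF E, of cmod] unfolding norm_mult norm_of_real by simp
  also have "\<dots> \<le> l\<^sup>2 * (\<Sum>p\<in>?B. cmod (fc f (fst p)) * cmod (fc g (snd p)) * H p)"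
    by (intro mult_left_mono order_trans[OF norm_sum]) (auto simp: norm_mult H_def)
  \<comment> \<open>Where \<open>fst p\<close> or \<open>snd p\<close> is 0 the division is by zero,
    but a coefficient of \<open>f\<close> or \<open>g\<close> vanishes there, so both sides are
    0.\<close>
  also have "(\<Sum>p\<in>?B. cmod (fc f (fst p)) * cmod (fc g (snd p)) * H p) =
     (\<Sum>p\<in>?B. (sqrt (kk (fst p)) * cmod (fc f (fst p)) * (sqrt (kk (snd p)) * cmod (fc g (snd p)))) * (H p / (sqrt (kk (fst p)) * sqrt (kk (snd p)))))"
  proof (rule sum.cong[OF refl])
    fix p :: "(int \<times> int) \<times> (int \<times> int)"
    show "cmod (fc f (fst p)) * cmod (fc g (snd p)) * H p =
       (sqrt (kk (fst p)) * cmod (fc f (fst p)) * (sqrt (kk (snd p)) * cmod (fc g (snd p)))) * (H p / (sqrt (kk (fst p)) * sqrt (kk (snd p))))"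
      using f g kk_ge_1[of "fst p"] kk_ge_1[of "snd p"]
      by (cases "fst p = 0"; cases "snd p = 0") (auto simp: sob_def)
  qed
  also have "\<dots> \<le> sqrt (\<Sum>p\<in>?B. (sqrt (kk (fst p)) * cmod (fc f (fst p)) * (sqrt (kk (snd p)) * cmod (fc g (snd p))))\<^sup>2) *
       sqrt (\<Sum>p\<in>?B. (H p / (sqrt (kk (fst p)) * sqrt (kk (snd p))))\<^sup>2)"
    by (rule order_trans[OF sum_mono L2_set_mult_ineq[unfolded L2_set_def]]) (simp add: abs_mult H_def)
  also have "\<dots> \<le> (hn 1 f * hn 1 g) * (Kemb * (l2norm TL h / l))"
  proof (rule mult_mono)
    have s: "(\<Sum>k\<in>A. kk k ^ 1 * (cmod (fc f k))\<^sup>2) \<le> (hn 1 f)\<^sup>2" if "finite A" "sob 1 f" for A f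
      unfolding hn_sq by (rule finite_sum_le_infsum) (use that in \<open>auto simp: sob_def\<close>)
    have "(\<Sum>p\<in>?B. (sqrt (kk (fst p)) * cmod (fc f (fst p)) * (sqrt (kk (snd p)) * cmod (fc g (snd p))))\<^sup>2) =
       (\<Sum>k\<in>box_set N. kk k * (cmod (fc f k))\<^sup>2) * (\<Sum>k\<in>box_set M. kk k * (cmod (fc g k))\<^sup>2)"
      by (simp add: sum_product sum.cartesian_product case_prod_beta power_mult_distrib)
    also have "\<dots> \<le> (hn 1 f)\<^sup>2 * (hn 1 g)\<^sup>2"
      using s[OF _ f, of "box_set N"] s[OF _ g, of "box_set M"] by (intro mult_mono) (auto intro: sum_nonneg)
    finally show "sqrt (\<Sum>p\<in>?B. (sqrt (kk (fst p)) * cmod (fc f (fst p)) * (sqrt (kk (snd p)) * cmod (fc g (snd p))))\<^sup>2) \<le> hn 1 f * hn 1 g"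
      by (intro real_le_lsqrt) (auto simp: power_mult_distrib intro: sum_nonneg)
    define S where "S = (l2norm TL h / l)\<^sup>2"
    have hs: "(\<Sum>k\<in>A. (cmod (fc h k))\<^sup>2) \<le> S" if "finite A" for A
    proof -
      have "(\<Sum>k\<in>A. (cmod (fc h k))\<^sup>2) \<le> infsum (\<lambda>k. (cmod (fc h k))\<^sup>2) UNIV"
        using parseval_real_norm[OF h] by (intro finite_sum_le_infsum that) (auto simp: summable_on_def)
      then show ?thesis using parseval_real_norm[OF h] by (simp add: infsumI S_def power_divide)
    qed
    have S0: "0 \<le> S" by (simp add: S_def)
    have 1: "(\<Sum>k\<in>box_set M. (cmod (fc h (- j - k)))\<^sup>2) \<le> S" for j
    proof -
      have "(\<Sum>k\<in>box_set M. (cmod (fc h (- j - k)))\<^sup>2) = (\<Sum>k\<in>(\<lambda>k. - j - k) ` box_set M. (cmod (fc h k))\<^sup>2)"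
        by (subst sum.reindex) (auto simp: inj_on_def)
      then show ?thesis using hs by simp
    qed
    have 2: "(\<Sum>j\<in>box_set N. (cmod (fc h (- j - k)))\<^sup>2) \<le> S" for k
    proof -
      have "(\<Sum>j\<in>box_set N. (cmod (fc h (- j - k)))\<^sup>2) = (\<Sum>k\<in>(\<lambda>j. - j - k) ` box_set N. (cmod (fc h k))\<^sup>2)"
        by (subst sum.reindex) (auto simp: inj_on_def)
      then show ?thesis using hs by simp
    qed
    have "(\<Sum>p\<in>?B. (H p / (sqrt (kk (fst p)) * sqrt (kk (snd p))))\<^sup>2) \<le>
       (\<Sum>p\<in>?B. (H p)\<^sup>2 * (1 / (kk (fst p))\<^sup>2) / 2 + (H p)\<^sup>2 * (1 / (kk (snd p))\<^sup>2) / 2)"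
    proof (rule sum_mono)
      fix p :: "(int \<times> int) \<times> (int \<times> int)"
      define a b where "a = 1 / kk (fst p)" and "b = 1 / kk (snd p)"
      have "a * b \<le> a\<^sup>2 / 2 + b\<^sup>2 / 2" using zero_le_power2[of "a - b"] by (simp add: power2_eq_square algebra_simps)
      then have "(H p)\<^sup>2 * (a * b) \<le> (H p)\<^sup>2 * (a\<^sup>2 / 2 + b\<^sup>2 / 2)" by (intro mult_left_mono) auto
      then show "(H p / (sqrt (kk (fst p)) * sqrt (kk (snd p))))\<^sup>2 \<le> (H p)\<^sup>2 * (1 / (kk (fst p))\<^sup>2) / 2 + (H p)\<^sup>2 * (1 / (kk (snd p))\<^sup>2) / 2"
        by (simp add: a_def b_def power_divide power_mult_distrib distrib_left)
    qed
    also have "\<dots> = (\<Sum>j\<in>box_set N. (1 / (kk j)\<^sup>2) * (\<Sum>k\<in>box_set M. (cmod (fc h (- j - k)))\<^sup>2)) / 2 +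
        (\<Sum>k\<in>box_set M. (1 / (kk k)\<^sup>2) * (\<Sum>j\<in>box_set N. (cmod (fc h (- j - k)))\<^sup>2)) / 2"
    proof -
      have "(\<Sum>p\<in>?B. (H p)\<^sup>2 * (1 / (kk (fst p))\<^sup>2)) = (\<Sum>j\<in>box_set N. \<Sum>k\<in>box_set M. (1 / (kk j)\<^sup>2) * (cmod (fc h (- j - k)))\<^sup>2)"
        unfolding sum.cartesian_product by (rule sum.cong) (auto simp: H_def)
      moreover have "(\<Sum>p\<in>?B. (H p)\<^sup>2 * (1 / (kk (snd p))\<^sup>2)) = (\<Sum>k\<in>box_set M. \<Sum>j\<in>box_set N. (1 / (kk k)\<^sup>2) * (cmod (fc h (- j - k)))\<^sup>2)"
        by (subst sum.swap, unfold sum.cartesian_product, rule sum.cong) (auto simp: H_def)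
      ultimately show ?thesis by (simp only: sum.distrib sum_divide_distrib[symmetric] sum_distrib_left[symmetric])
    qed
    also have "\<dots> \<le> (\<Sum>j\<in>box_set N. (1 / (kk j)\<^sup>2) * S) / 2 + (\<Sum>k\<in>box_set M. (1 / (kk k)\<^sup>2) * S) / 2"
      by (intro add_mono divide_right_mono sum_mono mult_left_mono 1 2) auto
    also have "\<dots> \<le> (Kemb\<^sup>2 * S) / 2 + (Kemb\<^sup>2 * S) / 2"
      unfolding sum_distrib_right[symmetric]
      by (intro add_mono divide_right_mono mult_right_mono sum_inverse_kk_le S0) auto
    also have "\<dots> = (Kemb * (l2norm TL h / l))\<^sup>2" by (simp add: S_def power_mult_distrib power_divide)
    finally show "sqrt (\<Sum>p\<in>?B. (H p / (sqrt (kk (fst p)) * sqrt (kk (snd p))))\<^sup>2) \<le> Kemb * (l2norm TL h / l)"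
      using Kemb_nonneg l_pos by (intro real_le_lsqrt) (auto intro: sum_nonneg)
  qed (auto intro: sum_nonneg)
  finally have "\<bar>\<integral>x. h x * trunc N f x * trunc M g x \<partial>TL\<bar> \<le> l\<^sup>2 * ((hn 1 f * hn 1 g) * (Kemb * (l2norm TL h / l)))"
    by (simp add: mult_left_mono)
  then show ?thesis using l_pos by (simp add: power2_eq_square mult_ac)
qed

text \<open>The bound sees only H^1 norms of \<open>f\<close> and \<open>g\<close>. The regularity
  H^2 of \<open>f\<close> makes the triple product integrable and removes the truncation of
  \<open>f\<close> by bounded convergence, after that of \<open>g\<close> was removed in
  L^2.\<close>

lemma trilinear_bound:
  assumes f: "sob 2 f" and g: "sob 1 g" and h: "sq_int TL h"
  shows "\<bar>\<integral>x. f x * g x * h x \<partial>TL\<bar> \<le> l * Kemb * hn 1 f * hn 1 g * l2norm TL h"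
proof -
  let ?C = "l * Kemb * hn 1 f * hn 1 g * l2norm TL h"
  have f1: "sob 1 f" using sob_mono[OF f, of 1] by simp
  have 1: "\<bar>\<integral>x. h x * trunc N f x * g x \<partial>TL\<bar> \<le> ?C" for N
  proof (rule tendsto_upperbound[OF tendsto_rabs])
    show "(\<lambda>M. \<integral>x. h x * trunc N f x * trunc M g x \<partial>TL) \<longlonglongrightarrow> (\<integral>x. h x * trunc N f x * g x \<partial>TL)"
      by (rule tendsto_integral_mult_L2[OF sq_int_smooth_mult[OF h smooth_trunc(1)] sob_sq_int[OF g] sq_int_trunc trunc_L2[OF sob_sq_int[OF g]]])
  qed (intro always_eventually allI trilinear_trunc f1 g h, simp)
  have "\<bar>\<integral>x. h x * g x * f x \<partial>TL\<bar> \<le> ?C"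
  proof (rule tendsto_upperbound[OF tendsto_rabs])
    show "(\<lambda>N. \<integral>x. h x * g x * trunc N f x \<partial>TL) \<longlonglongrightarrow> (\<integral>x. h x * g x * f x \<partial>TL)"
      by (rule tendsto_integral_trunc[OF integrable_sq_int_mult[OF h sob_sq_int[OF g]] f])
    show "\<forall>\<^sub>F N in sequentially. \<bar>\<integral>x. h x * g x * trunc N f x \<partial>TL\<bar> \<le> ?C"
    proof (intro always_eventually allI)
      fix N
      have "(\<integral>x. h x * g x * trunc N f x \<partial>TL) = (\<integral>x. h x * trunc N f x * g x \<partial>TL)"
        by (simp only: mult.assoc mult.commute[of "g _"])
      then show "\<bar>\<integral>x. h x * g x * trunc N f x \<partial>TL\<bar> \<le> ?C" using 1[of N] by (simp only:)
    qed
  qed auto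
  then show ?thesis by (simp add: mult_ac)
qed

end

section \<open>The linearized operator and its adjoint\<close>

declare One_nat_def [simp del]

lemma frob_eq: "frob A B = (\<Sum>i\<in>UNIV. \<Sum>j\<in>UNIV. A $ i $ j * B $ i $ j)"
  by (simp add: frob_def trace_def matrix_matrix_mult_def transpose_def)

context flat_torus
begin

abbreviation cp :: "vfield \<Rightarrow> 2 \<Rightarrow> sfield" where "cp u j \<equiv> (\<lambda>x. u x $ j)"

definition vsob :: "nat \<Rightarrow> vfield \<Rightarrow> bool" where
  "vsob s u \<longleftrightarrow> (\<forall>j. sob s (cp u j))"

definition dvf :: "vfield \<Rightarrow> bool" where
  "dvf u \<longleftrightarrow> (AE x in TL. (\<Sum>i\<in>UNIV. wpartial l i (cp u i) x) = 0)"

text \<open>Weakly differentiable with derivatives that are only integrable. This is the class of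
  the stress products of the adjoint equation: differentiating a product of \<open>symgrad\<close>
  of an H^3 field and of an H^2 field produces products of two L^2 functions.\<close>

definition wd :: "sfield \<Rightarrow> bool" where
  "wd h \<longleftrightarrow> L2p h \<and> (\<forall>i. \<exists>w. is_weak_partial l i h w)"

text \<open>The stronger class with square-integrable derivatives, needed for the transported fields
  on which \<open>Upsilon_pair\<close> acts.\<close>

definition wd2 :: "sfield \<Rightarrow> bool" where
  "wd2 h \<longleftrightarrow> L2p h \<and> (\<forall>i. \<exists>w. is_weak_partial l i h w \<and> sq_int TL w)"

lemma vsobD: "vsob s u \<Longrightarrow> sob s (cp u j)" by (simp add: vsob_def)

lemma sob_partial:
  "sob 1 f \<Longrightarrow> sob 0 (wpartial l i f)" "sob 2 f \<Longrightarrow> sob 1 (wpartial l i f)" "sob 3 f \<Longrightarrow> sob 2 (wpartial l i f)"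
  using sob_weak_partial(2)[OF sob_SucI(1), of f i] sob_weak_partial(2)[OF sob_SucI(2), of f i] sob_weak_partial(2)[OF sob_SucI(3), of f i]
  by simp_all

lemma sob_down: "sob 3 f \<Longrightarrow> sob 2 f" "sob 2 f \<Longrightarrow> sob 1 f" "sob 3 f \<Longrightarrow> sob 1 f"
  using sob_mono(1)[of 3 f 2] sob_mono(1)[of 2 f 1] sob_mono(1)[of 3 f 1] by simp_all

lemma wd_add: "wd f \<Longrightarrow> wd g \<Longrightarrow> wd (\<lambda>x. f x + g x)"
  unfolding wd_def using weak_partial_add[of _ f _ g] L2p_add[of f g] by blast

lemma wd2_add: "wd2 f \<Longrightarrow> wd2 g \<Longrightarrow> wd2 (\<lambda>x. f x + g x)"
  unfolding wd2_def using weak_partial_add[of _ f _ g] L2p_add[of f g] sq_int_add[of TL] by blast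

lemma wd_zero: "wd (\<lambda>x. 0)" and wd2_zero: "wd2 (\<lambda>x. 0)"
proof -
  have "is_weak_partial l i (\<lambda>x. 0) (\<lambda>x. 0)" for i by (simp add: is_weak_partial_def periodic_def)
  then show "wd (\<lambda>x. 0)" "wd2 (\<lambda>x. 0)"
    using sob_L2p[OF sob_zero] unfolding wd_def wd2_def by (auto intro!: exI[of _ "\<lambda>x. 0"])
qed

lemma wd_sum: "(\<And>i. i \<in> I \<Longrightarrow> wd (f i)) \<Longrightarrow> wd (\<lambda>x. \<Sum>i\<in>I. f i x)"
  by (induction I rule: infinite_finite_induct) (auto intro!: wd_add wd_zero)

lemma wd2_sum: "(\<And>i. i \<in> I \<Longrightarrow> wd2 (f i)) \<Longrightarrow> wd2 (\<lambda>x. \<Sum>i\<in>I. f i x)"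
  by (induction I rule: infinite_finite_induct) (auto intro!: wd2_add wd2_zero)

lemma wd_mult: "sob 2 f \<Longrightarrow> wd g \<Longrightarrow> wd (\<lambda>x. f x * g x)"
  unfolding wd_def using weak_partial_mult L2p_sob2_mult by blast

lemma sob_wd: "sob 1 f \<Longrightarrow> wd f"
  using sob_weak_partial(1)[OF sob_SucI(2), of f] sob_L2p[of 1 f] unfolding wd_def by blast

lemma wd2_mult_31:
  assumes f: "sob 3 f" and g: "sob 1 g" shows "wd2 (\<lambda>x. f x * g x)"
proof -
  have "sq_int TL (\<lambda>x. wpartial l i f x * g x + f x * wpartial l i g x)" for i
    by (intro sq_int_add sq_int_sob2_mult sob_partial(3)[OF f] sob_sq_int[OF g] sob_sq_int[OF sob_partial(1)[OF g]] sob_down f)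
  then show ?thesis
    unfolding wd2_def
    using weak_partial_mult[OF sob_down(1)[OF f] sob_L2p[OF g] sob_weak_partial(1)[OF sob_SucI(2)[OF g]]]
      L2p_sob2_mult[OF sob_L2p[OF g] sob_down(1)[OF f]] by blast
qed

lemma wd2_mult_22:
  assumes f: "sob 2 f" and g: "sob 2 g" shows "wd2 (\<lambda>x. f x * g x)"
proof -
  have "sq_int TL (\<lambda>x. wpartial l i f x * g x + f x * wpartial l i g x)" for i
    using sq_int_sob2_mult[OF sob_sq_int[OF sob_partial(2)[OF f, of i]] g] sq_int_sob2_mult[OF sob_sq_int[OF sob_partial(2)[OF g, of i]] f]
    by (intro sq_int_add) (auto simp: mult.commute)
  then show ?thesis
    unfolding wd2_def
    using weak_partial_mult[OF f sob_L2p[OF g] sob_weak_partial(1)[OF sob_SucI(1)[OF g]]]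
      L2p_sob2_mult[OF sob_L2p[OF g] f] by blast
qed

lemma int3:
  assumes "sob 2 f" "sq_int TL g" "sq_int TL h"
  shows "integrable TL (\<lambda>x. f x * g x * h x)"
  using integrable_sob2_mult[OF integrable_sq_int_mult[OF assms(2,3)] assms(1)] by (simp add: mult.assoc)

text \<open>The product \<open>b * U\<close> is integrated by parts against each component of
  \<open>a\<close>; summed over the components, the left side contains the divergence of
  \<open>a\<close>. As \<open>U\<close> is only H^1, the derivative of the product is only
  integrable, and the boundedness of \<open>a\<close> is what makes the step legitimate.\<close>

lemma advection_skew:
  assumes a: "vsob 2 a" "dvf a" and b: "sob 2 b" and U: "sob 1 U"
  shows "(\<Sum>i\<in>UNIV. \<integral>x. a x $ i * wpartial l i b x * U x \<partial>TL) = - (\<Sum>i\<in>UNIV. \<integral>x. a x $ i * b x * wpartial l i U x \<partial>TL)"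
proof -
  have bU: "L2p (\<lambda>x. b x * U x)" by (rule L2p_sob2_mult[OF sob_L2p[OF U] b])
  note ai = vsobD[OF a(1)]
  have i1: "integrable TL (\<lambda>x. a x $ i * wpartial l i b x * U x)" for i
    by (rule int3[OF ai sob_sq_int[OF sob_partial(2)[OF b]] sob_sq_int[OF U]])
  have i2: "integrable TL (\<lambda>x. a x $ i * b x * wpartial l i U x)" for i
    by (rule int3[OF ai sob_sq_int[OF b] sob_sq_int[OF sob_partial(1)[OF U]]])
  have i3: "integrable TL (\<lambda>x. b x * U x * wpartial l i (cp a i) x)" for i
    by (rule int3[OF b sob_sq_int[OF U] sob_sq_int[OF sob_partial(2)[OF ai]]])
  have 1: "(\<integral>x. b x * U x * wpartial l i (cp a i) x \<partial>TL) =
     - (\<integral>x. a x $ i * wpartial l i b x * U x \<partial>TL) - (\<integral>x. a x $ i * b x * wpartial l i U x \<partial>TL)" for i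
  proof -
    have "(\<integral>x. b x * U x * wpartial l i (cp a i) x \<partial>TL) = - (\<integral>x. (wpartial l i b x * U x + b x * wpartial l i U x) * a x $ i \<partial>TL)"
      by (rule weak_ibp_sob2[OF bU weak_partial_mult[OF b sob_L2p[OF U] sob_weak_partial(1)[OF sob_SucI(2)[OF U]]] ai])
    also have "(\<integral>x. (wpartial l i b x * U x + b x * wpartial l i U x) * a x $ i \<partial>TL) =
       (\<integral>x. a x $ i * wpartial l i b x * U x + a x $ i * b x * wpartial l i U x \<partial>TL)"
      by (rule Bochner_Integration.integral_cong) (auto simp: algebra_simps)
    also have "\<dots> = (\<integral>x. a x $ i * wpartial l i b x * U x \<partial>TL) + (\<integral>x. a x $ i * b x * wpartial l i U x \<partial>TL)"
      by (rule Bochner_Integration.integral_add[OF i1 i2])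
    finally show ?thesis by simp
  qed
  have "(\<Sum>i\<in>UNIV. \<integral>x. b x * U x * wpartial l i (cp a i) x \<partial>TL) = (\<integral>x. (\<Sum>i\<in>UNIV. b x * U x * wpartial l i (cp a i) x) \<partial>TL)"
    by (rule Bochner_Integration.integral_sum[symmetric]) (rule i3)
  also have "\<dots> = (\<integral>x. 0 \<partial>TL)"
  proof (rule integral_cong_AE)
    show "(\<lambda>x. \<Sum>i\<in>UNIV. b x * U x * wpartial l i (cp a i) x) \<in> borel_measurable TL"
      by (intro borel_measurable_sum borel_measurable_integrable i3)
    show "AE x in TL. (\<Sum>i\<in>UNIV. b x * U x * wpartial l i (cp a i) x) = 0"
      using a(2) unfolding dvf_def by eventually_elim (simp add: sum_distrib_left[symmetric])
  qed simp
  finally show ?thesis unfolding 1 by (simp add: sum_subtractf sum_negf)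
qed

lemma ip_sum:
  assumes "\<And>j. sq_int TL (cp u j)" "\<And>j. sq_int TL (cp w j)"
  shows "ip l u w = (\<Sum>j\<in>UNIV. \<integral>x. u x $ j * w x $ j \<partial>TL)"
  unfolding ip_def inner_vec_def inner_real_def
  by (rule Bochner_Integration.integral_sum) (rule integrable_sq_int_mult[OF assms])

lemma ipm_sum:
  assumes "\<And>i j. integrable TL (\<lambda>x. M x $ i $ j * K x $ i $ j)"
  shows "ipm l M K = (\<Sum>i\<in>UNIV. \<Sum>j\<in>UNIV. \<integral>x. M x $ i $ j * K x $ i $ j \<partial>TL)"
  unfolding ipm_def frob_eq
  by (subst Bochner_Integration.integral_sum) (auto intro!: Bochner_Integration.integrable_sum assms sum.cong Bochner_Integration.integral_sum)

lemma Upsilon_nth: "Upsilon l \<alpha> u x $ j = u x $ j - \<alpha> * (\<Sum>i\<in>UNIV. wpartial l i (wpartial l i (cp u j)) x)"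
  by (simp add: Upsilon_def laplace_def)

lemma sob_Upsilon: "sob 3 (cp u j) \<Longrightarrow> sob 1 (cp (Upsilon l \<alpha> u) j)"
  unfolding Upsilon_nth by (intro sob_diff sob_cmult sob_sum sob_partial sob_down(3))

lemma sob0_Upsilon: "sob 2 (cp u j) \<Longrightarrow> sob 0 (cp (Upsilon l \<alpha> u) j)"
  unfolding Upsilon_nth by (intro sob_diff sob_cmult sob_sum sob_partial) (auto intro: sob_mono(1)[of 2 _ 0])

lemma grad_nth: "grad l u x $ i $ j = wpartial l j (cp u i) x"
  by (simp add: grad_def)

lemma symgrad_nth: "symgrad l u x $ i $ j = wpartial l j (cp u i) x + wpartial l i (cp u j) x"
  by (simp add: symgrad_def grad_def transpose_def)

lemma sob_symgrad: "vsob 3 u \<Longrightarrow> sob 2 (\<lambda>x. symgrad l u x $ i $ j)" "vsob 2 u \<Longrightarrow> sob 1 (\<lambda>x. symgrad l u x $ i $ j)"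
  unfolding symgrad_nth by (auto intro!: sob_add sob_partial simp: vsob_def)

text \<open>The weak Laplacian of \<open>h\<close> is moved entirely onto the H^2 field
  \<open>m\<close>. This turns the transport terms of the adjoint equation, weak functionals of H^1
  fields, into the trilinear forms of the linearized equation.\<close>

lemma Upsilon_pair_eq_ip:
  assumes h: "\<And>j. wd2 (cp h j)" and m: "vsob 2 m"
  shows "Upsilon_pair l \<alpha> h m = ip l h (Upsilon l \<alpha> m)"
proof -
  have hs: "sq_int TL (cp h j)" for j using h by (auto simp: wd2_def L2p_sq_int)
  have ms: "sq_int TL (cp m j)" for j using vsobD[OF m] by (rule sob_sq_int)
  have dm: "sob 1 (wpartial l k (cp m j))" for j k by (rule sob_partial(2)[OF vsobD[OF m]])
  have ddm: "sq_int TL (wpartial l k (wpartial l k (cp m j)))" for j k by (rule sob_sq_int[OF sob_partial(1)[OF dm]])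
  \<comment> \<open>\<open>wd2\<close> speaks of some square-integrable derivative; uniqueness
    almost everywhere transfers this to the chosen \<open>wpartial\<close>.\<close>
  have wh: "is_weak_partial l k (cp h j) (wpartial l k (cp h j)) \<and> sq_int TL (wpartial l k (cp h j))" for j k
  proof -
    obtain w where w: "is_weak_partial l k (cp h j) w" "sq_int TL w" using h unfolding wd2_def by blast
    have L: "integrable TL (cp h j)" using hs by (rule integrable_sq_int)
    have "AE x in TL. w x = wpartial l k (cp h j) x" using wpartial_AE[OF L w(1)] by eventually_elim simp
    moreover have wk: "is_weak_partial l k (cp h j) (wpartial l k (cp h j))" by (rule wpartial_weak[OF w(1)])
    moreover have "wpartial l k (cp h j) \<in> borel_measurable TL"
      using wk unfolding is_weak_partial_def by (blast intro: measurable_torus)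
    ultimately show ?thesis using sq_int_cong_AE[OF w(2)] by blast
  qed
  have ibp: "(\<integral>x. h x $ j * wpartial l k (wpartial l k (cp m j)) x \<partial>TL) = - (\<integral>x. wpartial l k (cp h j) x * wpartial l k (cp m j) x \<partial>TL)" for j k
    by (rule weak_ibp_sob1) (use h wh dm in \<open>auto simp: wd2_def\<close>)
  have "ipm l (grad l h) (grad l m) = (\<Sum>j\<in>UNIV. \<Sum>k\<in>UNIV. \<integral>x. wpartial l k (cp h j) x * wpartial l k (cp m j) x \<partial>TL)"
    by (subst ipm_sum) (auto simp: grad_nth intro!: integrable_sq_int_mult sob_sq_int[OF dm] wh[THEN conjunct2])
  also have "\<dots> = - (\<Sum>j\<in>UNIV. \<Sum>k\<in>UNIV. \<integral>x. h x $ j * wpartial l k (wpartial l k (cp m j)) x \<partial>TL)"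
    unfolding ibp by (simp add: sum_negf)
  finally have g: "ipm l (grad l h) (grad l m) = - (\<Sum>j\<in>UNIV. \<Sum>k\<in>UNIV. \<integral>x. h x $ j * wpartial l k (wpartial l k (cp m j)) x \<partial>TL)" .
  have Us: "sq_int TL (cp (Upsilon l \<alpha> m) j)" for j by (rule sob_sq_int[OF sob0_Upsilon[OF vsobD[OF m]]])
  have "ip l h (Upsilon l \<alpha> m) = (\<Sum>j\<in>UNIV. \<integral>x. h x $ j * Upsilon l \<alpha> m x $ j \<partial>TL)" by (rule ip_sum[OF hs Us])
  also have "\<dots> = (\<Sum>j\<in>UNIV. (\<integral>x. h x $ j * m x $ j \<partial>TL) - \<alpha> * (\<Sum>k\<in>UNIV. \<integral>x. h x $ j * wpartial l k (wpartial l k (cp m j)) x \<partial>TL))"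
  proof (rule sum.cong[OF refl])
    fix j
    have i: "integrable TL (\<lambda>x. h x $ j * m x $ j)" "integrable TL (\<lambda>x. h x $ j * wpartial l k (wpartial l k (cp m j)) x)" for k
      by (intro integrable_sq_int_mult hs ms ddm)+
    have "(\<integral>x. h x $ j * Upsilon l \<alpha> m x $ j \<partial>TL) =
      (\<integral>x. h x $ j * m x $ j - \<alpha> * (\<Sum>k\<in>UNIV. h x $ j * wpartial l k (wpartial l k (cp m j)) x) \<partial>TL)"
      unfolding Upsilon_nth by (rule Bochner_Integration.integral_cong) (auto simp: algebra_simps sum_distrib_left)
    also have "\<dots> = (\<integral>x. h x $ j * m x $ j \<partial>TL) - \<alpha> * (\<integral>x. (\<Sum>k\<in>UNIV. h x $ j * wpartial l k (wpartial l k (cp m j)) x) \<partial>TL)"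
      using i by simp
    also have "(\<integral>x. (\<Sum>k\<in>UNIV. h x $ j * wpartial l k (wpartial l k (cp m j)) x) \<partial>TL) = (\<Sum>k\<in>UNIV. \<integral>x. h x $ j * wpartial l k (wpartial l k (cp m j)) x \<partial>TL)"
      by (rule Bochner_Integration.integral_sum) (rule i)
    finally show "(\<integral>x. h x $ j * Upsilon l \<alpha> m x $ j \<partial>TL) = (\<integral>x. h x $ j * m x $ j \<partial>TL) - \<alpha> * (\<Sum>k\<in>UNIV. \<integral>x. h x $ j * wpartial l k (wpartial l k (cp m j)) x \<partial>TL)" .
  qed
  also have "\<dots> = ip l h m + \<alpha> * ipm l (grad l h) (grad l m)"
    unfolding g ip_sum[OF hs ms] by (simp add: sum_subtractf sum_distrib_left)
  finally show ?thesis by (simp add: Upsilon_pair_def)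
qed

lemma ip_convect:
  assumes a: "vsob 2 a" and b: "vsob 1 b" and w: "\<And>j. sq_int TL (cp w j)"
  shows "ip l (convect l a b) w = trib l a b w"
proof -
  have s: "sq_int TL (\<lambda>x. a x $ i * wpartial l i (cp b j) x)" for i j
    by (rule sq_int_sob2_mult[OF sob_sq_int[OF sob_partial(1)[OF vsobD[OF b]]] vsobD[OF a]])
  have c: "cp (convect l a b) j = (\<lambda>x. \<Sum>i\<in>UNIV. a x $ i * wpartial l i (cp b j) x)" for j
    by (simp add: convect_def)
  have cs: "sq_int TL (cp (convect l a b) j)" for j unfolding c by (intro sq_int_sum s)
  have "ip l (convect l a b) w = (\<Sum>j\<in>UNIV. \<integral>x. convect l a b x $ j * w x $ j \<partial>TL)" by (rule ip_sum[OF cs w])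
  also have "\<dots> = (\<Sum>j\<in>UNIV. \<Sum>i\<in>UNIV. \<integral>x. a x $ i * wpartial l i (cp b j) x * w x $ j \<partial>TL)"
    unfolding convect_def vec_lambda_beta sum_distrib_right
    by (intro sum.cong refl Bochner_Integration.integral_sum integrable_sq_int_mult s w)
  also have "\<dots> = trib l a b w" unfolding trib_def by (rule sum.swap)
  finally show ?thesis .
qed

text \<open>Either the transporting field has the third derivative and multiplies an H^1 gradient,
  or the transported one has it and both factors of the product are H^2.\<close>

lemma wd2_convect:
  "vsob 3 a \<Longrightarrow> vsob 2 b \<Longrightarrow> wd2 (cp (convect l a b) j)"
  "vsob 2 a \<Longrightarrow> vsob 3 b \<Longrightarrow> wd2 (cp (convect l a b) j)"
  unfolding convect_def vec_lambda_beta
   apply (intro wd2_sum wd2_mult_31 sob_partial(2); erule vsobD)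
  apply (intro wd2_sum wd2_mult_22 sob_partial(3); erule vsobD)
  done

text \<open>Once the derivative sits on \<open>U\<close>, the expression a^i b^j d_i U^j can be read
  as the convective term of \<open>U\<close> paired with \<open>b\<close> or as the cogradient term
  paired with \<open>a\<close>. These are the two adjoint terms that involve a derivative of
  \<open>Upsilon\<close> of the state.\<close>

lemma trib_skew:
  assumes a: "vsob 2 a" "dvf a" and b: "vsob 2 b" and U: "vsob 1 U"
  shows "trib l a b U = - ip l (convect l a U) b" "trib l a b U = - ip l (cograd l b U) a"
proof -
  have s2: "sq_int TL (\<lambda>x. b x $ j * wpartial l i (cp U j) x)" for i j
    by (rule sq_int_sob2_mult[OF sob_sq_int[OF sob_partial(1)[OF vsobD[OF U]]] vsobD[OF b]])
  have as: "sq_int TL (cp a j)" "sq_int TL (cp b j)" for j using a b by (auto intro: sob_sq_int vsobD)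
  have "trib l a b U = (\<Sum>j\<in>UNIV. \<Sum>i\<in>UNIV. \<integral>x. a x $ i * wpartial l i (cp b j) x * U x $ j \<partial>TL)"
    unfolding trib_def by (rule sum.swap)
  also have "\<dots> = - (\<Sum>j\<in>UNIV. \<Sum>i\<in>UNIV. \<integral>x. a x $ i * b x $ j * wpartial l i (cp U j) x \<partial>TL)"
    using advection_skew[OF a vsobD[OF b] vsobD[OF U]] by (simp add: sum_negf)
  finally have 1: "trib l a b U = - (\<Sum>j\<in>UNIV. \<Sum>i\<in>UNIV. \<integral>x. a x $ i * b x $ j * wpartial l i (cp U j) x \<partial>TL)" .
  have "ip l (convect l a U) b = trib l a U b" by (rule ip_convect[OF a(1) U as(2)])
  also have "\<dots> = (\<Sum>j\<in>UNIV. \<Sum>i\<in>UNIV. \<integral>x. a x $ i * wpartial l i (cp U j) x * b x $ j \<partial>TL)"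
    unfolding trib_def by (rule sum.swap)
  finally show "trib l a b U = - ip l (convect l a U) b" unfolding 1 by (simp add: mult_ac)
  have "ip l (cograd l b U) a = (\<Sum>i\<in>UNIV. \<integral>x. cograd l b U x $ i * a x $ i \<partial>TL)"
    by (rule ip_sum[OF _ as(1)]) (auto simp: cograd_def intro!: sq_int_add sq_int_sum s2)
  also have "\<dots> = (\<Sum>i\<in>UNIV. \<Sum>j\<in>UNIV. \<integral>x. b x $ j * wpartial l i (cp U j) x * a x $ i \<partial>TL)"
    unfolding cograd_def vec_lambda_beta sum_distrib_right
    by (intro sum.cong refl Bochner_Integration.integral_sum integrable_sq_int_mult s2 as)
  also have "\<dots> = (\<Sum>j\<in>UNIV. \<Sum>i\<in>UNIV. \<integral>x. b x $ j * wpartial l i (cp U j) x * a x $ i \<partial>TL)" by (rule sum.swap)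
  finally show "trib l a b U = - ip l (cograd l b U) a" unfolding 1 by (simp add: mult_ac)
qed

text \<open>The divergence of \<open>M\<close> is only integrable; the pairing makes sense because
  the H^2 field \<open>m\<close> is bounded.\<close>

lemma ip_divm:
  assumes M: "\<And>i j. wd (\<lambda>x. M x $ i $ j)" and m: "vsob 2 m"
  shows "ip l (divm l M) m = - ipm l M (grad l m)"
proof -
  have W: "is_weak_partial l j (\<lambda>x. M x $ i $ j) (wpartial l j (\<lambda>x. M x $ i $ j))" for i j
    using M[of i j] wpartial_weak unfolding wd_def by blast
  have Ms: "L2p (\<lambda>x. M x $ i $ j)" for i j using M[of i j] by (simp add: wd_def)
  have i: "integrable TL (\<lambda>x. wpartial l j (\<lambda>x. M x $ i $ j) x * m x $ i)" for i j
  proof -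
    have "integrable TL (wpartial l j (\<lambda>x. M x $ i $ j))" using W[of j i] by (simp add: is_weak_partial_def)
    from integrable_sob2_mult[OF this vsobD[OF m, of i]] show ?thesis by (simp add: mult.commute)
  qed
  have "ip l (divm l M) m = (\<integral>x. (\<Sum>i\<in>UNIV. \<Sum>j\<in>UNIV. wpartial l j (\<lambda>x. M x $ i $ j) x * m x $ i) \<partial>TL)"
    unfolding ip_def inner_vec_def inner_real_def divm_def vec_lambda_beta sum_distrib_right ..
  also have "\<dots> = (\<Sum>i\<in>UNIV. \<Sum>j\<in>UNIV. \<integral>x. wpartial l j (\<lambda>x. M x $ i $ j) x * m x $ i \<partial>TL)"
    by (subst Bochner_Integration.integral_sum)
       (auto intro!: Bochner_Integration.integrable_sum i sum.cong Bochner_Integration.integral_sum)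
  also have "\<dots> = - (\<Sum>i\<in>UNIV. \<Sum>j\<in>UNIV. \<integral>x. M x $ i $ j * wpartial l j (cp m i) x \<partial>TL)"
    unfolding weak_ibp_sob2[OF Ms W vsobD[OF m]] by (simp add: sum_negf)
  also have "(\<Sum>i\<in>UNIV. \<Sum>j\<in>UNIV. \<integral>x. M x $ i $ j * wpartial l j (cp m i) x \<partial>TL) = ipm l M (grad l m)"
    by (subst ipm_sum) (auto simp: grad_nth intro!: integrable_sq_int_mult L2p_sq_int Ms sob_L2p[OF sob_partial(2)[OF vsobD[OF m]]])
  finally show ?thesis .
qed

text \<open>The right-hand side of the linearized equation without its source: \<open>u\<close> is
  the state, \<open>m\<close> the unknown and \<open>\<phi>\<close> the test field.\<close>

definition Lform :: "real \<Rightarrow> real \<Rightarrow> real \<Rightarrow> real \<Rightarrow> vfield \<Rightarrow> vfield \<Rightarrow> vfield \<Rightarrow> real" where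
  "Lform \<nu> \<alpha>\<^sub>1 \<alpha>\<^sub>2 \<beta> u m \<phi> =
    - \<nu> * ipm l (grad l m) (grad l \<phi>)
    + trib l u \<phi> (Upsilon l \<alpha>\<^sub>1 m) + trib l m \<phi> (Upsilon l \<alpha>\<^sub>1 u)
    - trib l \<phi> u (Upsilon l \<alpha>\<^sub>1 m) - trib l \<phi> m (Upsilon l \<alpha>\<^sub>1 u)
    - (\<alpha>\<^sub>1 + \<alpha>\<^sub>2) * ipm l (\<lambda>x. symgrad l u x ** symgrad l m x + symgrad l m x ** symgrad l u x) (grad l \<phi>)
    - \<beta> * ipm l (\<lambda>x. frob (symgrad l u x) (symgrad l u x) *\<^sub>R symgrad l m x) (grad l \<phi>)
    - 2 * \<beta> * ipm l (\<lambda>x. frob (symgrad l m x) (symgrad l u x) *\<^sub>R symgrad l u x) (grad l \<phi>)"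

lemma wd_matrices:
  assumes u: "vsob 3 u" and q: "vsob 2 q"
  shows "wd (\<lambda>x. (symgrad l u x ** symgrad l q x + symgrad l q x ** symgrad l u x) $ i $ j)" (is "wd ?A")
    "wd (\<lambda>x. (frob (symgrad l u x) (symgrad l u x) *\<^sub>R symgrad l q x) $ i $ j)" (is "wd ?B")
    "wd (\<lambda>x. (frob (symgrad l q x) (symgrad l u x) *\<^sub>R symgrad l u x) $ i $ j)" (is "wd ?C")
proof -
  define U Q where "U i j x = symgrad l u x $ i $ j" and "Q i j x = symgrad l q x $ i $ j" for i j x
  have U: "sob 2 (U i j)" and Q: "wd (Q i j)" for i j
    unfolding U_def Q_def using sob_symgrad(1)[OF u] sob_wd[OF sob_symgrad(2)[OF q]] by auto
  have "?A = (\<lambda>x. \<Sum>k\<in>UNIV. U i k x * Q k j x + U k j x * Q i k x)"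
    by (auto simp: matrix_matrix_mult_def U_def Q_def sum.distrib mult.commute)
  then show "wd ?A" by (auto intro!: wd_sum wd_add wd_mult U Q)
  have "?B = (\<lambda>x. \<Sum>a\<in>UNIV. \<Sum>b\<in>UNIV. U a b x * (U a b x * Q i j x))"
    by (auto simp: frob_eq U_def Q_def sum_distrib_right mult.assoc)
  then show "wd ?B" by (auto intro!: wd_sum wd_mult U Q)
  have "?C = (\<lambda>x. \<Sum>a\<in>UNIV. \<Sum>b\<in>UNIV. U i j x * (U a b x * Q a b x))"
    by (auto simp: frob_eq U_def Q_def sum_distrib_left mult_ac)
  then show "wd ?C" by (auto intro!: wd_sum wd_mult U Q)
qed

text \<open>Pointwise self-adjointness of the three stress terms. Each matrix paired with
  \<open>G\<close> is symmetric, so only half of \<open>B\<close> is seen, and what results is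
  symmetric in \<open>B\<close> and \<open>C\<close>. Written out in the entries it is a polynomial
  identity.\<close>

lemma frob_symmetry:
  fixes U G Q :: "real^2^2"
  defines "A \<equiv> U + transpose U" and "B \<equiv> G + transpose G" and "C \<equiv> Q + transpose Q"
  shows "frob (A ** C + C ** A) G = frob (A ** B + B ** A) Q"
    "frob (frob A A *\<^sub>R C) G = frob (frob A A *\<^sub>R B) Q"
    "frob (frob C A *\<^sub>R A) G = frob (frob B A *\<^sub>R A) Q"
  unfolding A_def B_def C_def
  by (simp_all add: frob_eq matrix_matrix_mult_def transpose_def UNIV_2 algebra_simps)

text \<open>The Stokes identity enters as the hypothesis \<open>st\<close>, since it involves the
  Leray projection and is settled in \<open>stokes_ip\<close> through the Fourier description of the
  spaces. The other terms match one by one: viscosity aside, transport by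
  \<open>Upsilon_pair_eq_ip\<close>, the terms with \<open>Upsilon\<close> of the state by
  \<open>trib_skew\<close>, stresses by \<open>frob_symmetry\<close>.\<close>

theorem adjoint_duality:
  assumes u: "vsob 3 u" and q: "vsob 2 q" "dvf q" and m: "vsob 2 m" "dvf m"
    and st: "ip l (stokes l q) m = ipm l (grad l m) (grad l q)"
  shows "- \<nu> * ip l (stokes l q) m
     + Upsilon_pair l \<alpha>\<^sub>1 (convect l u q) m
     - ip l (cograd l q (Upsilon l \<alpha>\<^sub>1 u)) m
     - Upsilon_pair l \<alpha>\<^sub>1 (convect l q u) m
     + ip l (convect l q (Upsilon l \<alpha>\<^sub>1 u)) m
     + (\<alpha>\<^sub>1 + \<alpha>\<^sub>2) * ip l (divm l (\<lambda>x. symgrad l u x ** symgrad l q x + symgrad l q x ** symgrad l u x)) m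
     + \<beta> * ip l (divm l (\<lambda>x. frob (symgrad l u x) (symgrad l u x) *\<^sub>R symgrad l q x)) m
     + 2 * \<beta> * ip l (divm l (\<lambda>x. frob (symgrad l q x) (symgrad l u x) *\<^sub>R symgrad l u x)) m
     = Lform \<nu> \<alpha>\<^sub>1 \<alpha>\<^sub>2 \<beta> u m q"
proof -
  have u2: "vsob 2 u" "vsob 1 u" using u by (auto simp: vsob_def intro: sob_down)
  have q1: "vsob 1 q" using q by (auto simp: vsob_def intro: sob_down)
  have Um: "sq_int TL (cp (Upsilon l \<alpha>\<^sub>1 m) j)" for j by (rule sob_sq_int[OF sob0_Upsilon[OF vsobD[OF m(1)]]])
  have Uu: "vsob 1 (Upsilon l \<alpha>\<^sub>1 u)" unfolding vsob_def by (auto intro!: sob_Upsilon vsobD[OF u])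
  have 1: "Upsilon_pair l \<alpha>\<^sub>1 (convect l u q) m = trib l u q (Upsilon l \<alpha>\<^sub>1 m)"
    using Upsilon_pair_eq_ip[OF wd2_convect(1)[OF u q(1)] m(1)] ip_convect[OF u2(1) q1 Um] by simp
  have 2: "Upsilon_pair l \<alpha>\<^sub>1 (convect l q u) m = trib l q u (Upsilon l \<alpha>\<^sub>1 m)"
    using Upsilon_pair_eq_ip[OF wd2_convect(2)[OF q(1) u] m(1)] ip_convect[OF q(1) u2(2) Um] by simp
  have 3: "ip l (cograd l q (Upsilon l \<alpha>\<^sub>1 u)) m = - trib l m q (Upsilon l \<alpha>\<^sub>1 u)"
    using trib_skew(2)[OF m q(1) Uu] by simp
  have 4: "ip l (convect l q (Upsilon l \<alpha>\<^sub>1 u)) m = - trib l q m (Upsilon l \<alpha>\<^sub>1 u)"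
    using trib_skew(1)[OF q m(1) Uu] by simp
  have 5: "ip l (divm l (\<lambda>x. symgrad l u x ** symgrad l q x + symgrad l q x ** symgrad l u x)) m =
     - ipm l (\<lambda>x. symgrad l u x ** symgrad l m x + symgrad l m x ** symgrad l u x) (grad l q)"
    unfolding ip_divm[OF wd_matrices(1)[OF u q(1)] m(1)] unfolding ipm_def symgrad_def frob_symmetry(1)[of "grad l u _" "grad l q _" "grad l m _"] ..
  have 6: "ip l (divm l (\<lambda>x. frob (symgrad l u x) (symgrad l u x) *\<^sub>R symgrad l q x)) m =
     - ipm l (\<lambda>x. frob (symgrad l u x) (symgrad l u x) *\<^sub>R symgrad l m x) (grad l q)"
    unfolding ip_divm[OF wd_matrices(2)[OF u q(1)] m(1)] unfolding ipm_def symgrad_def frob_symmetry(2)[of "grad l u _" "grad l q _" "grad l m _"] ..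
  have 7: "ip l (divm l (\<lambda>x. frob (symgrad l q x) (symgrad l u x) *\<^sub>R symgrad l u x)) m =
     - ipm l (\<lambda>x. frob (symgrad l m x) (symgrad l u x) *\<^sub>R symgrad l u x) (grad l q)"
    unfolding ip_divm[OF wd_matrices(3)[OF u q(1)] m(1)] unfolding ipm_def symgrad_def
    by (simp only: frob_symmetry(3)[of "grad l q _" "grad l u _" "grad l m _"])
  show ?thesis unfolding Lform_def 1 2 3 4 5 6 7 st by simp
qed

end

section \<open>Bound of the quadratic form in the H^1 norm\<close>

lemma abs_sum2_le:
  fixes f :: "2 \<Rightarrow> real"
  assumes "\<And>j. \<bar>f j\<bar> \<le> K" shows "\<bar>\<Sum>j\<in>UNIV. f j\<bar> \<le> 2 * K"
  using sum_abs[of f UNIV] assms[of 1] assms[of 2] by (simp add: UNIV_2)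

lemma abs_mult_le: "\<bar>a\<bar> \<le> A \<Longrightarrow> \<bar>b\<bar> \<le> B \<Longrightarrow> \<bar>a * b\<bar> \<le> A * (B::real)"
  unfolding abs_mult by (rule mult_mono) auto

text \<open>Crude entry counts: symmetrised entries cost a factor 2, a matrix product 2, a Frobenius
  product 4. This gives 4 * 16 = 64 for the quadratic stress and 4 * 16 * 2 = 128 for the cubic
  ones.\<close>

lemma frob_bounds:
  fixes U G :: "real^2^2"
  defines "A \<equiv> U + transpose U" and "C \<equiv> G + transpose G"
  assumes B: "\<And>i j. \<bar>U $ i $ j\<bar> \<le> B"
  shows "\<bar>frob (A ** C + C ** A) G\<bar> \<le> 64 * B * (\<Sum>i\<in>UNIV. \<Sum>j\<in>UNIV. (G $ i $ j)\<^sup>2)"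
    "\<bar>frob (frob A A *\<^sub>R C) G\<bar> \<le> 128 * B\<^sup>2 * (\<Sum>i\<in>UNIV. \<Sum>j\<in>UNIV. (G $ i $ j)\<^sup>2)"
    "\<bar>frob (frob C A *\<^sub>R A) G\<bar> \<le> 128 * B\<^sup>2 * (\<Sum>i\<in>UNIV. \<Sum>j\<in>UNIV. (G $ i $ j)\<^sup>2)"
proof -
  define g where "g = sqrt (\<Sum>i\<in>UNIV. \<Sum>j\<in>UNIV. (G $ i $ j)\<^sup>2)"
  have g2: "g\<^sup>2 = (\<Sum>i\<in>UNIV. \<Sum>j\<in>UNIV. (G $ i $ j)\<^sup>2)"
    unfolding g_def by (intro real_sqrt_pow2 sum_nonneg) auto
  have G: "\<bar>G $ i $ j\<bar> \<le> g" for i j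
  proof -
    have "(G $ i $ j)\<^sup>2 \<le> (\<Sum>j\<in>UNIV. (G $ i $ j)\<^sup>2)" by (rule member_le_sum) auto
    also have "\<dots> \<le> (\<Sum>i\<in>UNIV. \<Sum>j\<in>UNIV. (G $ i $ j)\<^sup>2)"
      by (rule member_le_sum[where f="\<lambda>i. \<Sum>j\<in>UNIV. (G $ i $ j)\<^sup>2"]) (auto intro: sum_nonneg)
    finally have "\<bar>G $ i $ j\<bar>\<^sup>2 \<le> g\<^sup>2" by (simp add: g2)
    then show ?thesis by (rule power2_le_imp_le) (auto simp: g_def intro!: sum_nonneg)
  qed
  have A: "\<bar>A $ i $ j\<bar> \<le> 2 * B" and C: "\<bar>C $ i $ j\<bar> \<le> 2 * g" for i j
    using B[of i j] B[of j i] G[of i j] G[of j i] by (auto simp: A_def C_def transpose_def)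
  have fr: "\<bar>frob M K\<bar> \<le> 4 * (\<mu> * \<kappa>)" if "\<And>i j. \<bar>M $ i $ j\<bar> \<le> \<mu>" "\<And>i j. \<bar>K $ i $ j\<bar> \<le> \<kappa>" for M K :: "real^2^2" and \<mu> \<kappa>
  proof -
    have "\<bar>frob M K\<bar> \<le> 2 * (2 * (\<mu> * \<kappa>))" unfolding frob_eq by (intro abs_sum2_le abs_mult_le that)
    then show ?thesis by simp
  qed
  have mm: "\<bar>(M ** K) $ i $ j\<bar> \<le> 2 * (\<mu> * \<kappa>)" if "\<And>i j. \<bar>M $ i $ j\<bar> \<le> \<mu>" "\<And>i j. \<bar>K $ i $ j\<bar> \<le> \<kappa>" for M K :: "real^2^2" and \<mu> \<kappa> i j
    unfolding matrix_matrix_mult_def vec_lambda_beta by (intro abs_sum2_le abs_mult_le that)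
  have "\<bar>(A ** C + C ** A) $ i $ j\<bar> \<le> 16 * B * g" for i j
    using mm[of A "2 * B" C "2 * g" i j, OF A C] mm[of C "2 * g" A "2 * B" i j, OF C A] by (simp add: mult_ac)
  from fr[of _ _ G g, OF this G] show "\<bar>frob (A ** C + C ** A) G\<bar> \<le> 64 * B * (\<Sum>i\<in>UNIV. \<Sum>j\<in>UNIV. (G $ i $ j)\<^sup>2)"
    unfolding g2[symmetric] by (simp add: power2_eq_square mult_ac)
  have "\<bar>frob A A\<bar> \<le> 16 * B\<^sup>2" using fr[of A "2 * B" A "2 * B", OF A A] by (simp add: power2_eq_square)
  then have "\<bar>(frob A A *\<^sub>R C) $ i $ j\<bar> \<le> 16 * B\<^sup>2 * (2 * g)" for i j
    by (simp only: vector_scaleR_component real_scaleR_def) (intro abs_mult_le C)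
  from fr[of _ _ G g, OF this G] show "\<bar>frob (frob A A *\<^sub>R C) G\<bar> \<le> 128 * B\<^sup>2 * (\<Sum>i\<in>UNIV. \<Sum>j\<in>UNIV. (G $ i $ j)\<^sup>2)"
    unfolding g2[symmetric] by (simp add: power2_eq_square mult_ac)
  have "\<bar>frob C A\<bar> \<le> 16 * B * g" using fr[of C "2 * g" A "2 * B", OF C A] by (simp add: mult_ac)
  then have "\<bar>(frob C A *\<^sub>R A) $ i $ j\<bar> \<le> 16 * B * g * (2 * B)" for i j
    by (simp only: vector_scaleR_component real_scaleR_def) (intro abs_mult_le A)
  from fr[of _ _ G g, OF this G] show "\<bar>frob (frob C A *\<^sub>R A) G\<bar> \<le> 128 * B\<^sup>2 * (\<Sum>i\<in>UNIV. \<Sum>j\<in>UNIV. (G $ i $ j)\<^sup>2)"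
    unfolding g2[symmetric] by (simp add: power2_eq_square mult_ac)
qed

context flat_torus
begin

lemma bound3:
  assumes f: "f \<in> borel_measurable TL" "AE x in TL. \<bar>f x\<bar> \<le> B" and g: "sq_int TL g" "l2norm TL g \<le> D" and h: "sq_int TL h" "l2norm TL h \<le> E"
    and B: "0 \<le> B"
  shows "\<bar>\<integral>x. f x * g x * h x \<partial>TL\<bar> \<le> B * D * (E::real)"
proof -
  have gh: "integrable TL (\<lambda>x. norm (g x) * norm (h x))"
    by (rule integrable_sq_int_mult[OF sq_int_norm[OF g(1)] sq_int_norm[OF h(1)]])
  have fgh: "integrable TL (\<lambda>x. f x * (g x * h x))"
    by (rule integrable_bounded_mult[OF integrable_sq_int_mult[OF g(1) h(1)] f])
  have "\<bar>\<integral>x. f x * (g x * h x) \<partial>TL\<bar> \<le> (\<integral>x. \<bar>f x * (g x * h x)\<bar> \<partial>TL)" by (rule integral_abs_bound)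
  also have "\<dots> \<le> (\<integral>x. B * (norm (g x) * norm (h x)) \<partial>TL)"
  proof (rule integral_mono_AE)
    show "AE x in TL. \<bar>f x * (g x * h x)\<bar> \<le> B * (norm (g x) * norm (h x))"
      using f(2) by eventually_elim (auto simp: abs_mult intro!: mult_right_mono)
  qed (use gh fgh in auto)
  also have "\<dots> = B * (\<integral>x. norm (g x) * norm (h x) \<partial>TL)" by simp
  also have "\<dots> \<le> B * (l2norm TL g * l2norm TL h)" by (intro mult_left_mono Cauchy_Schwarz_norm g h B)
  also have "\<dots> \<le> B * (D * E)"
    using g(2) h(2) order_trans[OF l2norm_nonneg g(2)] by (intro mult_left_mono mult_mono B) auto
  finally show ?thesis by (simp add: mult.assoc)
qed

text \<open>Advection by a divergence-free field is antisymmetric, so its quadratic form vanishes.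
  \<open>G\<close> is only H^1, which is the regularity of a first derivative of an H^2 solution;
  the bounded derivatives of the H^3 field \<open>u\<close> make the integration by parts
  possible.\<close>

lemma transport_zero:
  assumes u: "vsob 3 u" "dvf u" and G: "sob 1 G"
  shows "(\<Sum>i\<in>UNIV. \<integral>x. u x $ i * wpartial l i G x * G x \<partial>TL) = 0"
proof -
  have u3: "sob 3 (cp u i)" and u2: "sob 2 (cp u i)" for i using u by (auto simp: vsob_def intro: sob_down)
  have du: "sob 2 (wpartial l i (cp u i))" for i by (rule sob_partial(3)[OF u3])
  have Gs: "sq_int TL G" and dG: "sq_int TL (wpartial l i G)" for i using G by (auto intro: sob_sq_int sob_partial)
  have i1: "integrable TL (\<lambda>x. u x $ i * wpartial l i G x * G x)" for i by (rule int3[OF u2 dG Gs])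
  have i2: "integrable TL (\<lambda>x. wpartial l i (cp u i) x * G x * G x)" for i by (rule int3[OF du Gs Gs])
  have 1: "2 * (\<integral>x. u x $ i * wpartial l i G x * G x \<partial>TL) = - (\<integral>x. wpartial l i (cp u i) x * G x * G x \<partial>TL)" for i
  proof -
    have "(\<integral>x. u x $ i * G x * wpartial l i G x \<partial>TL) = - (\<integral>x. (wpartial l i (cp u i) x * G x + u x $ i * wpartial l i G x) * G x \<partial>TL)"
      by (rule weak_ibp_sob1[OF L2p_sob2_mult[OF sob_L2p[OF G] u2] weak_partial_mult[OF u2 sob_L2p[OF G] sob_weak_partial(1)[OF sob_SucI(2)[OF G]]] _ G])
         (intro sq_int_add sq_int_sob2_mult Gs dG du u2)
    also have "(\<integral>x. (wpartial l i (cp u i) x * G x + u x $ i * wpartial l i G x) * G x \<partial>TL) =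
       (\<integral>x. wpartial l i (cp u i) x * G x * G x \<partial>TL) + (\<integral>x. u x $ i * wpartial l i G x * G x \<partial>TL)"
      unfolding distrib_right by (rule Bochner_Integration.integral_add[OF i2 i1])
    finally show ?thesis by (simp add: mult_ac)
  qed
  have "(\<Sum>i\<in>UNIV. \<integral>x. wpartial l i (cp u i) x * G x * G x \<partial>TL) = (\<integral>x. (\<Sum>i\<in>UNIV. wpartial l i (cp u i) x * G x * G x) \<partial>TL)"
    by (rule Bochner_Integration.integral_sum[symmetric]) (rule i2)
  also have "\<dots> = (\<integral>x. 0 \<partial>TL)"
  proof (rule integral_cong_AE)
    show "(\<lambda>x. \<Sum>i\<in>UNIV. wpartial l i (cp u i) x * G x * G x) \<in> borel_measurable TL"
      by (intro borel_measurable_sum borel_measurable_integrable i2)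
    show "AE x in TL. (\<Sum>i\<in>UNIV. wpartial l i (cp u i) x * G x * G x) = 0"
      using u(2) unfolding dvf_def by eventually_elim (simp add: sum_distrib_right[symmetric])
  qed simp
  finally have "(\<Sum>i\<in>UNIV. 2 * (\<integral>x. u x $ i * wpartial l i G x * G x \<partial>TL)) = 0"
    unfolding 1 by (simp add: sum_negf)
  then show ?thesis by (simp add: sum_distrib_left[symmetric])
qed

text \<open>Separates the zeroth-order part from the Laplacian part. In the latter the sums are
  reordered so that the advection index \<open>i\<close> is innermost, where
  \<open>transport_zero\<close> can act.\<close>

lemma trib_Upsilon:
  assumes s: "\<And>i j. sq_int TL (\<lambda>x. a x $ i * wpartial l i (cp b j) x)" and m: "vsob 2 m"
  shows "trib l a b (Upsilon l \<alpha> m) = (\<Sum>i\<in>UNIV. \<Sum>j\<in>UNIV. \<integral>x. a x $ i * wpartial l i (cp b j) x * m x $ j \<partial>TL)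
     - \<alpha> * (\<Sum>j\<in>UNIV. \<Sum>k\<in>UNIV. \<Sum>i\<in>UNIV. \<integral>x. a x $ i * wpartial l i (cp b j) x * wpartial l k (wpartial l k (cp m j)) x \<partial>TL)"
proof -
  have ms: "sq_int TL (cp m j)" and ddm: "sq_int TL (wpartial l k (wpartial l k (cp m j)))" for j k
    using vsobD[OF m] by (auto intro!: sob_sq_int[OF sob_partial(1)[OF sob_partial(2)]] intro: sob_sq_int)
  have "trib l a b (Upsilon l \<alpha> m) = (\<Sum>i\<in>UNIV. \<Sum>j\<in>UNIV. (\<integral>x. a x $ i * wpartial l i (cp b j) x * m x $ j \<partial>TL)
     - \<alpha> * (\<Sum>k\<in>UNIV. \<integral>x. a x $ i * wpartial l i (cp b j) x * wpartial l k (wpartial l k (cp m j)) x \<partial>TL))"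
    unfolding trib_def
  proof (intro sum.cong refl)
    fix i j
    let ?f = "\<lambda>x. a x $ i * wpartial l i (cp b j) x"
    have i1: "integrable TL (\<lambda>x. ?f x * m x $ j)" by (rule integrable_sq_int_mult[OF s ms])
    have i2: "integrable TL (\<lambda>x. ?f x * wpartial l k (wpartial l k (cp m j)) x)" for k by (rule integrable_sq_int_mult[OF s ddm])
    have "(\<integral>x. ?f x * Upsilon l \<alpha> m x $ j \<partial>TL) = (\<integral>x. ?f x * m x $ j - \<alpha> * (\<Sum>k\<in>UNIV. ?f x * wpartial l k (wpartial l k (cp m j)) x) \<partial>TL)"
      unfolding Upsilon_nth by (rule Bochner_Integration.integral_cong) (auto simp: algebra_simps sum_distrib_left)
    also have "\<dots> = (\<integral>x. ?f x * m x $ j \<partial>TL) - \<alpha> * (\<integral>x. (\<Sum>k\<in>UNIV. ?f x * wpartial l k (wpartial l k (cp m j)) x) \<partial>TL)"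
      using i1 i2 by simp
    also have "(\<integral>x. (\<Sum>k\<in>UNIV. ?f x * wpartial l k (wpartial l k (cp m j)) x) \<partial>TL) = (\<Sum>k\<in>UNIV. \<integral>x. ?f x * wpartial l k (wpartial l k (cp m j)) x \<partial>TL)"
      by (rule Bochner_Integration.integral_sum) (rule i2)
    finally show "(\<integral>x. ?f x * Upsilon l \<alpha> m x $ j \<partial>TL) = (\<integral>x. ?f x * m x $ j \<partial>TL) - \<alpha> * (\<Sum>k\<in>UNIV. \<integral>x. ?f x * wpartial l k (wpartial l k (cp m j)) x \<partial>TL)" .
  qed
  also have "\<dots> = (\<Sum>i\<in>UNIV. \<Sum>j\<in>UNIV. \<integral>x. a x $ i * wpartial l i (cp b j) x * m x $ j \<partial>TL)
     - \<alpha> * (\<Sum>i\<in>UNIV. \<Sum>j\<in>UNIV. \<Sum>k\<in>UNIV. \<integral>x. a x $ i * wpartial l i (cp b j) x * wpartial l k (wpartial l k (cp m j)) x \<partial>TL)"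
    by (simp only: sum_subtractf sum_distrib_left)
  also have "(\<Sum>i\<in>UNIV. \<Sum>j\<in>UNIV. \<Sum>k\<in>UNIV. \<integral>x. a x $ i * wpartial l i (cp b j) x * wpartial l k (wpartial l k (cp m j)) x \<partial>TL) =
     (\<Sum>j\<in>UNIV. \<Sum>k\<in>UNIV. \<Sum>i\<in>UNIV. \<integral>x. a x $ i * wpartial l i (cp b j) x * wpartial l k (wpartial l k (cp m j)) x \<partial>TL)"
    by (subst sum.swap, rule sum.cong[OF refl], rule sum.swap)
  finally show ?thesis .
qed

text \<open>Only the H^1 norm of \<open>m\<close> may appear on the right, although the form
  contains \<open>Upsilon l \<alpha>\<^sub>1 m\<close>; and the growth in the H^3 norm of
  \<open>u\<close> must be at most quadratic, which the cubic stress attains.\<close>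

theorem Lform_bound:
  fixes \<nu> \<alpha>\<^sub>1 \<alpha>\<^sub>2 \<beta> :: real
  shows "\<exists>C\<ge>0. \<forall>u m a b. vsob 3 u \<longrightarrow> dvf u \<longrightarrow> vsob 2 m \<longrightarrow> (\<forall>j. hn 3 (cp u j) \<le> a) \<longrightarrow> (\<forall>j. hn 1 (cp m j) \<le> b) \<longrightarrow>
    \<bar>Lform \<nu> \<alpha>\<^sub>1 \<alpha>\<^sub>2 \<beta> u m m\<bar> \<le> C * (1 + a\<^sup>2) * b\<^sup>2"
proof -
  define c where "c = 2 * pi / l"
  have c0: "0 \<le> c" using l_pos by (simp add: c_def)
  note K0 = Kemb_nonneg
  \<comment> \<open>\<open>P\<close>, \<open>Q\<close> and \<open>R\<close> collect the coefficients
    of b^2, a b^2 and a^2 b^2; at the end a \<le> 1 + a^2 merges the three.\<close>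
  define P where "P = \<bar>\<nu>\<bar> * (4 * (l * c)\<^sup>2)"
  define Q where "Q = 4 * (Kemb * (l * c) * l) + \<bar>\<alpha>\<^sub>1\<bar> * (8 * (Kemb * c * (l * c)\<^sup>2))
      + (4 * (Kemb * c * l\<^sup>2) + \<bar>\<alpha>\<^sub>1\<bar> * (8 * (Kemb * c * (l * c)\<^sup>2 + l * Kemb * c\<^sup>2 * (l * c))))
      + \<bar>\<alpha>\<^sub>1 + \<alpha>\<^sub>2\<bar> * (64 * (Kemb * c) * (4 * (l * c)\<^sup>2))"
  define R where "R = \<bar>\<beta>\<bar> * (128 * (Kemb * c)\<^sup>2 * (4 * (l * c)\<^sup>2)) + \<bar>2 * \<beta>\<bar> * (128 * (Kemb * c)\<^sup>2 * (4 * (l * c)\<^sup>2))"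
  have PQR: "0 \<le> P" "0 \<le> Q" "0 \<le> R" using c0 K0 l_pos by (auto simp: P_def Q_def R_def intro!: add_nonneg_nonneg mult_nonneg_nonneg)
  have "\<bar>Lform \<nu> \<alpha>\<^sub>1 \<alpha>\<^sub>2 \<beta> u m m\<bar> \<le> (P + Q + R) * (1 + a\<^sup>2) * b\<^sup>2"
    if u: "vsob 3 u" "dvf u" and m: "vsob 2 m" and a: "\<And>j. hn 3 (cp u j) \<le> a" and b: "\<And>j. hn 1 (cp m j) \<le> b" for u m a b
  proof -
    have a0: "0 \<le> a" using order_trans[OF hn_nonneg a] .
    have b0: "0 \<le> b" using order_trans[OF hn_nonneg b] .
    have u3: "sob 3 (cp u i)" and u2: "sob 2 (cp u i)" and m2: "sob 2 (cp m i)" and m1: "sob 1 (cp m i)" for i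
      using u m by (auto simp: vsob_def intro: sob_down)
    have du: "sob 2 (wpartial l k (cp u i))" for i k by (rule sob_partial(3)[OF u3])
    have dm: "sob 1 (wpartial l k (cp m i))" for i k by (rule sob_partial(2)[OF m2])
    have ddu: "sob 1 (wpartial l j (wpartial l k (cp u i)))" for i j k by (rule sob_partial(2)[OF du])
    have ddm: "sob 0 (wpartial l j (wpartial l k (cp m i)))" for i j k by (rule sob_partial(1)[OF dm])
    \<comment> \<open>\<open>B\<close> bounds the first derivatives of \<open>u\<close> in the
      supremum norm and \<open>D\<close> those of \<open>m\<close> in L^2; each derivative costs a
      factor \<open>c\<close>.\<close>
    define B D where "B = Kemb * (c * a)" and "D = l * (c * b)"
    have B0: "0 \<le> B" "0 \<le> D" using K0 c0 a0 b0 l_pos by (auto simp: B_def D_def)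
    have Bu: "AE x in TL. \<bar>wpartial l k (cp u i) x\<bar> \<le> B" for i k
    proof -
      have "hn 2 (wpartial l k (cp u i)) \<le> c * hn 3 (cp u i)"
        using sob_weak_partial(3)[OF sob_SucI(3)[OF u3], of k i] by (simp add: c_def numeral_3_eq_3 numeral_2_eq_2)
      also have "\<dots> \<le> c * a" by (intro mult_left_mono a c0)
      finally have "Kemb * hn 2 (wpartial l k (cp u i)) \<le> B" unfolding B_def by (intro mult_left_mono K0)
      then show ?thesis using sob2_bound[OF du[of k i]] by (auto elim!: eventually_mono)
    qed
    have Au: "AE x in TL. \<bar>u x $ i\<bar> \<le> Kemb * a" for i
    proof -
      have "hn 2 (cp u i) \<le> a" using sob_mono(2)[OF u3, of 2 i] a[of i] by simp
      then have "Kemb * hn 2 (cp u i) \<le> Kemb * a" by (intro mult_left_mono K0)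
      then show ?thesis using sob2_bound[OF u2[of i]] by (auto elim!: eventually_mono)
    qed
    have Dm: "l2norm TL (wpartial l k (cp m i)) \<le> D" for i k
    proof -
      have "hn 0 (wpartial l k (cp m i)) \<le> c * hn 1 (cp m i)"
        using sob_weak_partial(3)[OF sob_SucI(2)[OF m1], of k i] by (simp add: c_def One_nat_def)
      also have "\<dots> \<le> c * b" by (intro mult_left_mono b c0)
      finally show ?thesis unfolding D_def l2norm_eq_hn[OF sob_sq_int[OF dm]] using l_pos by (intro mult_left_mono) auto
    qed
    have Lm: "l2norm TL (cp m i) \<le> l * b" for i
    proof -
      have "hn 0 (cp m i) \<le> b" using sob_mono(2)[OF m1, of 0 i] b[of i] by simp
      then show ?thesis unfolding l2norm_eq_hn[OF sob_sq_int[OF m1]] using l_pos by (intro mult_left_mono) auto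
    qed
    have Hu: "hn 1 (wpartial l j (wpartial l k (cp u i))) \<le> c\<^sup>2 * a" for i j k
    proof -
      have "hn 1 (wpartial l j (wpartial l k (cp u i))) \<le> c * hn 2 (wpartial l k (cp u i))"
        using sob_weak_partial(3)[OF sob_SucI(1)[OF du], of j k i] by (simp add: c_def numeral_2_eq_2 One_nat_def)
      also have "\<dots> \<le> c * (c * hn 3 (cp u i))"
        using sob_weak_partial(3)[OF sob_SucI(3)[OF u3], of k i] c0
        by (intro mult_left_mono) (simp_all add: c_def numeral_3_eq_3 numeral_2_eq_2)
      also have "\<dots> \<le> c * (c * a)" by (intro mult_left_mono a c0)
      finally show ?thesis by (simp add: power2_eq_square)
    qed
    note meas = sob_measurable[OF u2] sob_measurable[OF du]
    note sq = sob_sq_int[OF m1] sob_sq_int[OF dm]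
    have grad2: "integrable TL (\<lambda>x. \<Sum>i\<in>UNIV. \<Sum>j\<in>UNIV. (grad l m x $ i $ j)\<^sup>2)"
      "(\<integral>x. (\<Sum>i\<in>UNIV. \<Sum>j\<in>UNIV. (grad l m x $ i $ j)\<^sup>2) \<partial>TL) \<le> 4 * D\<^sup>2"
    proof -
      have i: "integrable TL (\<lambda>x. (grad l m x $ i $ j)\<^sup>2)" for i j
        using sob_sq_int[OF dm[of j i]] by (simp add: grad_nth sq_int_def)
      then show "integrable TL (\<lambda>x. \<Sum>i\<in>UNIV. \<Sum>j\<in>UNIV. (grad l m x $ i $ j)\<^sup>2)"
        by (intro Bochner_Integration.integrable_sum)
      have "(\<integral>x. (grad l m x $ i $ j)\<^sup>2 \<partial>TL) \<le> D\<^sup>2" for i j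
        using power_mono[OF Dm[of j i] l2norm_nonneg, of 2] by (simp add: l2norm_sq grad_nth)
      then have "(\<Sum>i\<in>UNIV. \<Sum>j\<in>UNIV. \<integral>x. (grad l m x $ i $ j)\<^sup>2 \<partial>TL) \<le> (\<Sum>i\<in>(UNIV::2 set). \<Sum>j\<in>(UNIV::2 set). D\<^sup>2)"
        by (intro sum_mono)
      then show "(\<integral>x. (\<Sum>i\<in>UNIV. \<Sum>j\<in>UNIV. (grad l m x $ i $ j)\<^sup>2) \<partial>TL) \<le> 4 * D\<^sup>2"
        using i by simp
    qed
    have mat: "\<bar>ipm l M (grad l m)\<bar> \<le> \<kappa> * (4 * D\<^sup>2)" if M: "\<And>i j. wd (\<lambda>x. M x $ i $ j)"
      and ae: "AE x in TL. \<bar>frob (M x) (grad l m x)\<bar> \<le> \<kappa> * (\<Sum>i\<in>UNIV. \<Sum>j\<in>UNIV. (grad l m x $ i $ j)\<^sup>2)" and k0: "0 \<le> \<kappa>" for M \<kappa>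
    proof -
      have "integrable TL (\<lambda>x. M x $ i $ j * grad l m x $ i $ j)" for i j
        unfolding grad_nth using M[of i j] by (intro integrable_sq_int_mult sq) (auto simp: wd_def L2p_sq_int)
      then have i: "integrable TL (\<lambda>x. frob (M x) (grad l m x))"
        unfolding frob_eq by (intro Bochner_Integration.integrable_sum)
      have "\<bar>ipm l M (grad l m)\<bar> \<le> (\<integral>x. \<bar>frob (M x) (grad l m x)\<bar> \<partial>TL)" unfolding ipm_def by (rule integral_abs_bound)
      also have "\<dots> \<le> (\<integral>x. \<kappa> * (\<Sum>i\<in>UNIV. \<Sum>j\<in>UNIV. (grad l m x $ i $ j)\<^sup>2) \<partial>TL)"
        by (rule integral_mono_AE) (use i grad2(1) ae in auto)
      also have "\<dots> = \<kappa> * (\<integral>x. (\<Sum>i\<in>UNIV. \<Sum>j\<in>UNIV. (grad l m x $ i $ j)\<^sup>2) \<partial>TL)" by simp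
      also have "\<dots> \<le> \<kappa> * (4 * D\<^sup>2)" by (rule mult_left_mono[OF grad2(2) k0])
      finally show ?thesis .
    qed
    have gu: "AE x in TL. \<forall>i j. \<bar>grad l u x $ i $ j\<bar> \<le> B"
      unfolding grad_nth by (intro AE_all_countable[THEN iffD2] allI Bu)
    have t5: "\<bar>ipm l (\<lambda>x. symgrad l u x ** symgrad l m x + symgrad l m x ** symgrad l u x) (grad l m)\<bar> \<le> 64 * B * (4 * D\<^sup>2)"
      by (rule mat[OF wd_matrices(1)[OF u(1) m]])
         (use gu B0 in \<open>auto elim!: eventually_mono simp: symgrad_def intro!: frob_bounds\<close>)
    have t6: "\<bar>ipm l (\<lambda>x. frob (symgrad l u x) (symgrad l u x) *\<^sub>R symgrad l m x) (grad l m)\<bar> \<le> 128 * B\<^sup>2 * (4 * D\<^sup>2)"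
      by (rule mat[OF wd_matrices(2)[OF u(1) m]])
         (use gu B0 in \<open>auto elim!: eventually_mono simp: symgrad_def intro!: frob_bounds\<close>)
    have t7: "\<bar>ipm l (\<lambda>x. frob (symgrad l m x) (symgrad l u x) *\<^sub>R symgrad l u x) (grad l m)\<bar> \<le> 128 * B\<^sup>2 * (4 * D\<^sup>2)"
      by (rule mat[OF wd_matrices(3)[OF u(1) m]])
         (use gu B0 in \<open>auto elim!: eventually_mono simp: symgrad_def intro!: frob_bounds\<close>)
    have t1: "\<bar>ipm l (grad l m) (grad l m)\<bar> \<le> 4 * D\<^sup>2"
      using mat[of "grad l m" 1] sob_wd[OF dm] by (simp add: grad_nth frob_eq power2_eq_square sum_nonneg)
    have s1: "sq_int TL (\<lambda>x. u x $ i * wpartial l i (cp m j) x)" for i j by (rule sq_int_sob2_mult[OF sq(2) u2])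
    have s2: "sq_int TL (\<lambda>x. m x $ i * wpartial l i (cp u j) x)" for i j by (rule sq_int_sob2_mult[OF sob_sq_int[OF du] m2])
    \<comment> \<open>One derivative d_k is integrated away from the Laplacian. If it falls on
      \<open>u\<close> the term is bounded; if it falls on the gradient of \<open>m\<close>, what
      arises is advection of d_k m paired with itself, which vanishes after summation over
      \<open>i\<close>.\<close>
    have X: "\<bar>\<Sum>i\<in>UNIV. \<integral>x. u x $ i * wpartial l i (cp m j) x * wpartial l k (wpartial l k (cp m j)) x \<partial>TL\<bar> \<le> 2 * (B * D * D)" for j k
    proof -
      have e: "(\<integral>x. u x $ i * wpartial l i (cp m j) x * wpartial l k (wpartial l k (cp m j)) x \<partial>TL) =
        - (\<integral>x. wpartial l k (cp u i) x * wpartial l i (cp m j) x * wpartial l k (cp m j) x \<partial>TL)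
        - (\<integral>x. u x $ i * wpartial l i (wpartial l k (cp m j)) x * wpartial l k (cp m j) x \<partial>TL)" for i
      proof -
        let ?G = "wpartial l i (cp m j)"
        have i1: "integrable TL (\<lambda>x. wpartial l k (cp u i) x * ?G x * wpartial l k (cp m j) x)" by (rule int3[OF du sq(2) sq(2)])
        have i2: "integrable TL (\<lambda>x. u x $ i * wpartial l k ?G x * wpartial l k (cp m j) x)" by (rule int3[OF u2 sob_sq_int[OF ddm] sq(2)])
        have i3: "integrable TL (\<lambda>x. u x $ i * wpartial l i (wpartial l k (cp m j)) x * wpartial l k (cp m j) x)" by (rule int3[OF u2 sob_sq_int[OF ddm] sq(2)])
        have "(\<integral>x. u x $ i * ?G x * wpartial l k (wpartial l k (cp m j)) x \<partial>TL) =
          - (\<integral>x. (wpartial l k (cp u i) x * ?G x + u x $ i * wpartial l k ?G x) * wpartial l k (cp m j) x \<partial>TL)"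
          by (rule weak_ibp_sob1[OF L2p_sob2_mult[OF sob_L2p[OF dm] u2] weak_partial_mult[OF u2 sob_L2p[OF dm] sob_weak_partial(1)[OF sob_SucI(2)[OF dm]]] _ dm])
             (intro sq_int_add sq_int_sob2_mult sq sob_sq_int[OF ddm] du u2)
        also have "\<dots> = - (\<integral>x. wpartial l k (cp u i) x * ?G x * wpartial l k (cp m j) x \<partial>TL) - (\<integral>x. u x $ i * wpartial l k ?G x * wpartial l k (cp m j) x \<partial>TL)"
          unfolding distrib_right Bochner_Integration.integral_add[OF i1 i2] by simp
        also have "(\<integral>x. u x $ i * wpartial l k ?G x * wpartial l k (cp m j) x \<partial>TL) = (\<integral>x. u x $ i * wpartial l i (wpartial l k (cp m j)) x * wpartial l k (cp m j) x \<partial>TL)"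
          using wpartial_commute[OF m2, of k i j]
          by (intro integral_cong_AE borel_measurable_integrable i2 i3) (auto elim!: eventually_mono)
        finally show ?thesis .
      qed
      have "(\<Sum>i\<in>UNIV. \<integral>x. u x $ i * wpartial l i (cp m j) x * wpartial l k (wpartial l k (cp m j)) x \<partial>TL) =
        - (\<Sum>i\<in>UNIV. \<integral>x. wpartial l k (cp u i) x * wpartial l i (cp m j) x * wpartial l k (cp m j) x \<partial>TL)"
        unfolding e using transport_zero[OF u dm[of k j]] by (simp add: sum_subtractf sum_negf)
      also have "\<bar>\<dots>\<bar> \<le> 2 * (B * D * D)"
        unfolding abs_minus by (intro abs_sum2_le bound3 meas Bu sq Dm B0)
      finally show ?thesis .
    qed
    have t2: "\<bar>trib l u m (Upsilon l \<alpha>\<^sub>1 m)\<bar> \<le> 4 * (Kemb * a * D * (l * b)) + \<bar>\<alpha>\<^sub>1\<bar> * (8 * (B * D * D))"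
    proof -
      have "\<bar>\<Sum>i\<in>UNIV. \<Sum>j\<in>UNIV. \<integral>x. u x $ i * wpartial l i (cp m j) x * m x $ j \<partial>TL\<bar> \<le> 2 * (2 * (Kemb * a * D * (l * b)))"
        by (intro abs_sum2_le bound3 meas Au sq Dm Lm mult_nonneg_nonneg K0 a0)
      moreover have "\<bar>\<Sum>j\<in>UNIV. \<Sum>k\<in>UNIV. \<Sum>i\<in>UNIV. \<integral>x. u x $ i * wpartial l i (cp m j) x * wpartial l k (wpartial l k (cp m j)) x \<partial>TL\<bar> \<le> 2 * (2 * (2 * (B * D * D)))"
        by (intro abs_sum2_le X)
      then have "\<bar>\<alpha>\<^sub>1 * (\<Sum>j\<in>UNIV. \<Sum>k\<in>UNIV. \<Sum>i\<in>UNIV. \<integral>x. u x $ i * wpartial l i (cp m j) x * wpartial l k (wpartial l k (cp m j)) x \<partial>TL)\<bar> \<le> \<bar>\<alpha>\<^sub>1\<bar> * (8 * (B * D * D))"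
        unfolding abs_mult by (intro mult_left_mono) auto
      ultimately show ?thesis unfolding trib_Upsilon[OF s1 m] by linarith
    qed
    \<comment> \<open>When the derivative falls on the gradient of \<open>u\<close>, a second
      derivative of \<open>u\<close> appears that is only H^1, next to \<open>m\<close> measured in
      H^1: the case for \<open>trilinear_bound\<close>.\<close>
    have Y: "\<bar>\<integral>x. m x $ i * wpartial l i (cp u j) x * wpartial l k (wpartial l k (cp m j)) x \<partial>TL\<bar> \<le> B * D * D + l * Kemb * b * (c\<^sup>2 * a) * D" for i j k
    proof -
      let ?G = "wpartial l i (cp u j)"
      have i1: "integrable TL (\<lambda>x. wpartial l k (cp m i) x * ?G x * wpartial l k (cp m j) x)"
        using int3[OF du sq(2) sq(2)] by (simp add: mult_ac)
      have i2: "integrable TL (\<lambda>x. m x $ i * wpartial l k ?G x * wpartial l k (cp m j) x)" by (rule int3[OF m2 sob_sq_int[OF ddu] sq(2)])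
      have "sq_int TL (\<lambda>x. wpartial l k (cp m i) x * ?G x + m x $ i * wpartial l k ?G x)"
        using sq_int_sob2_mult[OF sq(2)[of k i] du[of i j]] by (intro sq_int_add sq_int_sob2_mult[OF sob_sq_int[OF ddu] m2]) (simp add: mult.commute)
      then have "(\<integral>x. m x $ i * ?G x * wpartial l k (wpartial l k (cp m j)) x \<partial>TL) =
          - (\<integral>x. (wpartial l k (cp m i) x * ?G x + m x $ i * wpartial l k ?G x) * wpartial l k (cp m j) x \<partial>TL)"
        by (rule weak_ibp_sob1[OF L2p_sob2_mult[OF sob_L2p[OF du] m2] weak_partial_mult[OF m2 sob_L2p[OF du] sob_weak_partial(1)[OF sob_SucI(1)[OF du]]] _ dm])
      also have "\<dots> = - (\<integral>x. wpartial l k (cp m i) x * ?G x * wpartial l k (cp m j) x \<partial>TL) - (\<integral>x. m x $ i * wpartial l k ?G x * wpartial l k (cp m j) x \<partial>TL)"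
        unfolding distrib_right Bochner_Integration.integral_add[OF i1 i2] by simp
      finally have e: "(\<integral>x. m x $ i * ?G x * wpartial l k (wpartial l k (cp m j)) x \<partial>TL) =
        - (\<integral>x. wpartial l k (cp m i) x * ?G x * wpartial l k (cp m j) x \<partial>TL) - (\<integral>x. m x $ i * wpartial l k ?G x * wpartial l k (cp m j) x \<partial>TL)" .
      have "\<bar>\<integral>x. ?G x * wpartial l k (cp m i) x * wpartial l k (cp m j) x \<partial>TL\<bar> \<le> B * D * D"
        by (intro bound3 meas Bu sq Dm B0)
      moreover have "\<bar>\<integral>x. m x $ i * wpartial l k ?G x * wpartial l k (cp m j) x \<partial>TL\<bar> \<le> l * Kemb * b * (c\<^sup>2 * a) * D"
      proof (rule order_trans[OF trilinear_bound[OF m2 ddu sq(2)]])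
        show "l * Kemb * hn 1 (cp m i) * hn 1 (wpartial l k ?G) * l2norm TL (wpartial l k (cp m j)) \<le> l * Kemb * b * (c\<^sup>2 * a) * D"
          using l_pos K0 a0 b0 c0 by (intro mult_mono b Hu Dm mult_left_mono) auto
      qed
      ultimately show ?thesis unfolding e by (simp add: mult.commute[of "?G _"])
    qed
    have t4: "\<bar>trib l m u (Upsilon l \<alpha>\<^sub>1 m)\<bar> \<le> 4 * (B * (l * b) * (l * b)) + \<bar>\<alpha>\<^sub>1\<bar> * (8 * (B * D * D + l * Kemb * b * (c\<^sup>2 * a) * D))"
    proof -
      have "\<bar>\<integral>x. m x $ i * wpartial l i (cp u j) x * m x $ j \<partial>TL\<bar> \<le> B * (l * b) * (l * b)" for i j
      proof -
        have "\<bar>\<integral>x. wpartial l i (cp u j) x * m x $ i * m x $ j \<partial>TL\<bar> \<le> B * (l * b) * (l * b)"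
          by (intro bound3 meas Bu sq Lm B0)
        then show ?thesis by (simp add: mult.commute[of "wpartial l i (cp u j) _"])
      qed
      then have "\<bar>\<Sum>i\<in>UNIV. \<Sum>j\<in>UNIV. \<integral>x. m x $ i * wpartial l i (cp u j) x * m x $ j \<partial>TL\<bar> \<le> 2 * (2 * (B * (l * b) * (l * b)))"
        by (intro abs_sum2_le)
      moreover have "\<bar>\<Sum>j\<in>UNIV. \<Sum>k\<in>UNIV. \<Sum>i\<in>UNIV. \<integral>x. m x $ i * wpartial l i (cp u j) x * wpartial l k (wpartial l k (cp m j)) x \<partial>TL\<bar> \<le> 2 * (2 * (2 * (B * D * D + l * Kemb * b * (c\<^sup>2 * a) * D)))"
        by (intro abs_sum2_le Y)
      then have "\<bar>\<alpha>\<^sub>1 * (\<Sum>j\<in>UNIV. \<Sum>k\<in>UNIV. \<Sum>i\<in>UNIV. \<integral>x. m x $ i * wpartial l i (cp u j) x * wpartial l k (wpartial l k (cp m j)) x \<partial>TL)\<bar> \<le> \<bar>\<alpha>\<^sub>1\<bar> * (8 * (B * D * D + l * Kemb * b * (c\<^sup>2 * a) * D))"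
        unfolding abs_mult by (intro mult_left_mono) auto
      ultimately show ?thesis unfolding trib_Upsilon[OF s2 m] by linarith
    qed
    have cm: "\<bar>r * t\<bar> \<le> \<bar>r\<bar> * s" if "\<bar>t\<bar> \<le> s" for r t s :: real unfolding abs_mult using that by (intro mult_left_mono) auto
    \<comment> \<open>\<open>x3\<close> occurs with both signs: for the test field \<open>m\<close>
      itself the two terms with \<open>Upsilon\<close> of the state cancel and leave no trace in the
      bound.\<close>
    have tri: "\<bar>x1 + x2 + x3 - x4 - x3 - x5 - x6 - x7\<bar> \<le> y1 + y2 + y4 + y5 + y6 + y7"
      if "\<bar>x1\<bar> \<le> y1" "\<bar>x2\<bar> \<le> y2" "\<bar>x4\<bar> \<le> y4" "\<bar>x5\<bar> \<le> y5" "\<bar>x6\<bar> \<le> y6" "\<bar>x7\<bar> \<le> y7"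
      for x1 x2 x3 x4 x5 x6 x7 y1 y2 y4 y5 y6 y7 :: real
      using that unfolding abs_le_iff by linarith
    have "\<bar>Lform \<nu> \<alpha>\<^sub>1 \<alpha>\<^sub>2 \<beta> u m m\<bar> \<le> \<bar>\<nu>\<bar> * (4 * D\<^sup>2)
      + (4 * (Kemb * a * D * (l * b)) + \<bar>\<alpha>\<^sub>1\<bar> * (8 * (B * D * D)))
      + (4 * (B * (l * b) * (l * b)) + \<bar>\<alpha>\<^sub>1\<bar> * (8 * (B * D * D + l * Kemb * b * (c\<^sup>2 * a) * D)))
      + \<bar>\<alpha>\<^sub>1 + \<alpha>\<^sub>2\<bar> * (64 * B * (4 * D\<^sup>2)) + \<bar>\<beta>\<bar> * (128 * B\<^sup>2 * (4 * D\<^sup>2)) + \<bar>2 * \<beta>\<bar> * (128 * B\<^sup>2 * (4 * D\<^sup>2))"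
      unfolding Lform_def
      by (rule tri[OF cm[OF t1, of "- \<nu>", unfolded abs_minus] t2 t4 cm[OF t5] cm[OF t6] cm[OF t7]])
    also have "\<dots> = P * b\<^sup>2 + Q * (a * b\<^sup>2) + R * (a\<^sup>2 * b\<^sup>2)"
      unfolding P_def Q_def R_def B_def D_def by (simp add: power2_eq_square algebra_simps)
    also have "\<dots> \<le> P * ((1 + a\<^sup>2) * b\<^sup>2) + Q * ((1 + a\<^sup>2) * b\<^sup>2) + R * ((1 + a\<^sup>2) * b\<^sup>2)"
    proof (intro add_mono mult_left_mono PQR)
      have "a \<le> 1 + a\<^sup>2" using zero_le_power2[of "a - 1"] a0 by (simp add: power2_eq_square algebra_simps)
      then show "a * b\<^sup>2 \<le> (1 + a\<^sup>2) * b\<^sup>2" by (intro mult_right_mono) auto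
      show "b\<^sup>2 \<le> (1 + a\<^sup>2) * b\<^sup>2" "a\<^sup>2 * b\<^sup>2 \<le> (1 + a\<^sup>2) * b\<^sup>2" by (simp_all add: distrib_right)
    qed
    finally show ?thesis by (simp add: algebra_simps)
  qed
  then show ?thesis using PQR by (intro exI[of _ "P + Q + R"]) auto
qed

end

section \<open>Function spaces in terms of Fourier coefficients\<close>

lemma borel_measurable_vec_nth[measurable (raw)]:
  fixes f :: "'a \<Rightarrow> real^2"
  shows "f \<in> borel_measurable M \<Longrightarrow> (\<lambda>x. f x $ j) \<in> borel_measurable M"
  by (rule borel_measurable_continuous_on[where f="\<lambda>x. x $ j"]) (auto intro: continuous_intros)

lemma borel_measurable_vecI:
  fixes f :: "'a \<Rightarrow> real^2"
  assumes "\<And>j. (\<lambda>x. f x $ j) \<in> borel_measurable M"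
  shows "f \<in> borel_measurable M"
  unfolding borel_measurable_euclidean_space[where 'c="real^2"]
  using assms by (auto simp: Basis_vec_def inner_axis)

lemma norm_vec2_sq: "(norm (v :: real^2))\<^sup>2 = (\<Sum>j\<in>UNIV. (v $ j)\<^sup>2)"
  by (simp add: norm_vec_def L2_set_def sum_nonneg)

context flat_torus
begin

lemma fc_zero_iff: "integrable TL h \<Longrightarrow> fc h 0 = 0 \<longleftrightarrow> (\<integral>x. h x \<partial>TL) = 0"
  using l_pos by (simp add: fc_def fco_def)

lemma L2dot_comp:
  assumes "u \<in> L2dot l" shows "L2p (cp u j)" "fc (cp u j) 0 = 0"
proof -
  have [measurable]: "u \<in> borel_measurable borel" and i: "integrable TL (\<lambda>x. (norm (u x))\<^sup>2)" and z: "(\<integral>x. u x \<partial>TL) = 0" and p: "periodic l u"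
    using assms by (auto simp: L2dot_def)
  have us: "sq_int TL u" unfolding sq_int_def using i by (auto intro: measurable_torus)
  have le: "(norm (u x $ j))\<^sup>2 \<le> (norm (u x))\<^sup>2" for x by (rule power_mono[OF component_le_norm_cart[folded real_norm_def]]) simp
  have m: "cp u j \<in> borel_measurable borel" by measurable
  have "integrable TL (\<lambda>x. (norm (u x $ j))\<^sup>2)"
    by (rule Bochner_Integration.integrable_bound[OF i]) (use measurable_torus[OF m] le in auto)
  then have s: "sq_int TL (cp u j)" unfolding sq_int_def using measurable_torus[OF m] by blast
  then show "L2p (cp u j)" using m p by (auto simp: L2p_def periodic_def)
  have "(\<integral>x. u x $ j \<partial>TL) = (\<integral>x. u x \<partial>TL) $ j"
    by (rule integral_bounded_linear[OF bounded_linear_vec_nth integrable_sq_int[OF us]])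
  then show "fc (cp u j) 0 = 0" using fc_zero_iff[OF integrable_sq_int[OF s]] z by simp
qed

lemma L2dotI:
  assumes L: "\<And>j. L2p (cp u j)" and z: "\<And>j. fc (cp u j) 0 = 0" shows "u \<in> L2dot l"
proof -
  have m: "u \<in> borel_measurable borel" by (rule borel_measurable_vecI) (use L in \<open>auto simp: L2p_def\<close>)
  have "integrable TL (\<lambda>x. (u x $ j)\<^sup>2)" for j using L2p_sq_int[OF L[of j]] by (simp add: sq_int_def)
  then have i: "integrable TL (\<lambda>x. (norm (u x))\<^sup>2)" unfolding norm_vec2_sq by (intro Bochner_Integration.integrable_sum)
  have us: "sq_int TL u" unfolding sq_int_def using i measurable_torus[OF m] by blast
  have "(\<integral>x. u x \<partial>TL) $ j = 0" for j
    using integral_bounded_linear[OF bounded_linear_vec_nth integrable_sq_int[OF us], of j] z[of j] fc_zero_iff[OF L2p_integrable[OF L[of j]]] by simp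
  then have "(\<integral>x. u x \<partial>TL) = 0" by (simp add: vec_eq_iff)
  moreover have "periodic l u" using L by (auto simp: L2p_def periodic_def vec_eq_iff)
  ultimately show ?thesis using m i by (simp add: L2dot_def)
qed

lemma sobolev_term_eq: "sobolev_term l s u k = (\<Sum>j\<in>UNIV. kk k ^ s * (cmod (fc (cp u j) k))\<^sup>2)"
  by (simp add: sobolev_term_def kk_def fourier_eq_fc sum_distrib_left)

lemma Hdot_iff: "u \<in> Hdot l s \<longleftrightarrow> vsob s u"
proof
  assume u: "u \<in> Hdot l s"
  have "(\<lambda>k. kk k ^ s * (cmod (fc (cp u j) k))\<^sup>2) summable_on UNIV" for j
    by (rule summable_on_comparison_test[of "sobolev_term l s u"])
       (use u in \<open>auto simp: Hdot_def sobolev_term_eq intro!: member_le_sum[where f="\<lambda>j. kk _ ^ s * (cmod (fc (cp u j) _))\<^sup>2"]\<close>)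
  then show "vsob s u" using L2dot_comp[of u] u by (auto simp: vsob_def sob_def Hdot_def)
next
  assume u: "vsob s u"
  then have "(\<lambda>k. \<Sum>j\<in>UNIV. kk k ^ s * (cmod (fc (cp u j) k))\<^sup>2) summable_on UNIV"
    unfolding UNIV_2 by (auto simp: vsob_def sob_def intro!: summable_on_add)
  then have "sobolev_term l s u summable_on UNIV" by (simp add: sobolev_term_eq[abs_def])
  moreover have "u \<in> L2dot l" by (rule L2dotI) (use u in \<open>auto simp: vsob_def sob_def\<close>)
  ultimately show "u \<in> Hdot l s" by (simp add: Hdot_def)
qed

lemma vsob_L2dot: "vsob s u \<Longrightarrow> u \<in> L2dot l"
  by (rule L2dotI) (auto simp: vsob_def sob_def)

lemma L2dot_iff: "u \<in> L2dot l \<longleftrightarrow> vsob 0 u"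
proof
  assume u: "u \<in> L2dot l"
  show "vsob 0 u" unfolding vsob_def sob_def
    using L2dot_comp[OF u] parseval_real_norm[OF L2p_sq_int[OF L2dot_comp(1)[OF u]]] by (auto simp: summable_on_def)
qed (rule vsob_L2dot)

lemma Hnorm_nonneg: "0 \<le> Hnorm l s u"
  unfolding Hnorm_def sobolev_term_eq by (auto intro!: infsum_nonneg sum_nonneg)

lemma Hnorm_sq:
  assumes "vsob s u" shows "(Hnorm l s u)\<^sup>2 = (\<Sum>j\<in>UNIV. (hn s (cp u j))\<^sup>2)"
proof -
  have "(Hnorm l s u)\<^sup>2 = (\<Sum>\<^sub>\<infinity>k. \<Sum>j\<in>UNIV. kk k ^ s * (cmod (fc (cp u j) k))\<^sup>2)"
    unfolding Hnorm_def sobolev_term_eq by (auto intro!: real_sqrt_pow2 infsum_nonneg sum_nonneg)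
  also have "\<dots> = (\<Sum>j\<in>UNIV. \<Sum>\<^sub>\<infinity>k. kk k ^ s * (cmod (fc (cp u j) k))\<^sup>2)"
    unfolding UNIV_2 using assms by (simp add: vsob_def sob_def infsum_add)
  finally show ?thesis by (simp add: hn_sq)
qed

lemma hn_le_Hnorm: "vsob s u \<Longrightarrow> hn s (cp u j) \<le> Hnorm l s u"
proof -
  assume u: "vsob s u"
  have "(hn s (cp u j))\<^sup>2 \<le> (Hnorm l s u)\<^sup>2"
    unfolding Hnorm_sq[OF u] by (rule member_le_sum[where f="\<lambda>j. (hn s (cp u j))\<^sup>2"]) auto
  then show ?thesis by (rule power2_le_imp_le[OF _ Hnorm_nonneg])
qed

lemma DAhalf_iff: "u \<in> DAhalf l s \<longleftrightarrow> vsob s u \<and> dvf u"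
  by (simp add: DAhalf_def Hdot_iff dvf_def)

lemma norm2_sq:
  assumes "\<And>j. sq_int TL (cp u j)" shows "(norm2 l u)\<^sup>2 = (\<Sum>j\<in>UNIV. (l2norm TL (cp u j))\<^sup>2)"
proof -
  have "ip l u u = (\<Sum>j\<in>UNIV. (l2norm TL (cp u j))\<^sup>2)"
    unfolding ip_sum[OF assms assms] l2norm_sq by (simp add: power2_eq_square)
  moreover have "0 \<le> ip l u u" by (simp add: ip_def)
  ultimately show ?thesis by (simp add: norm2_def)
qed

lemma norm2_nonneg[simp]: "0 \<le> norm2 l u" by (simp add: norm2_def ip_def)

lemma vsob_sq_int: "vsob s u \<Longrightarrow> sq_int TL (cp u j)" by (rule sob_sq_int[OF vsobD])

lemma norm2_le_Hnorm: assumes u: "vsob 1 u" shows "norm2 l u \<le> l * Hnorm l 1 u"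
proof -
  have "(norm2 l u)\<^sup>2 = (\<Sum>j\<in>UNIV. (l * hn 0 (cp u j))\<^sup>2)"
    unfolding norm2_sq[OF vsob_sq_int[OF u]] by (simp add: l2norm_eq_hn[OF vsob_sq_int[OF u]])
  also have "\<dots> \<le> (\<Sum>j\<in>UNIV. (l * hn 1 (cp u j))\<^sup>2)"
    using l_pos sob_mono(2)[OF vsobD[OF u], of 0] by (intro sum_mono power_mono mult_left_mono) auto
  also have "\<dots> = (l * Hnorm l 1 u)\<^sup>2"
    unfolding power_mult_distrib Hnorm_sq[OF u] by (simp add: sum_distrib_left)
  finally show ?thesis by (rule power2_le_imp_le) (use l_pos Hnorm_nonneg in auto)
qed

text \<open>\<open>in_Linf\<close> grants regularity to a representative that agrees with the path
  only up to null sets in space. Fourier coefficients and chosen derivatives do not notice the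
  difference, so the regularity passes to the path itself.\<close>

lemma same_field_DAhalf:
  assumes s: "same_field l w v" and v: "v \<in> L2dot l" and w: "w \<in> DAhalf l s"
  shows "v \<in> DAhalf l s" "Hnorm l t v = Hnorm l t w"
proof -
  have wv: "vsob s w" "dvf w" using w by (auto simp: DAhalf_iff)
  have m: "cp w j \<in> borel_measurable TL" "cp v j \<in> borel_measurable TL" for j
    using vsob_sq_int[OF wv(1)] L2p_sq_int[OF L2dot_comp(1)[OF v]] by (auto simp: sq_int_def)
  have ae: "AE x in TL. w x $ j = v x $ j" for j using s unfolding same_field_def by eventually_elim simp
  have f: "fc (cp w j) k = fc (cp v j) k" for j k by (rule fc_cong_AE[OF ae m])
  have p: "wpartial l i (cp w j) = wpartial l i (cp v j)" for i j by (rule wpartial_cong_AE[OF ae m])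
  have "vsob s v" using wv(1) L2dot_comp[OF v] by (simp add: vsob_def sob_def f)
  moreover have "dvf v" using wv(2) by (simp add: dvf_def p)
  ultimately show "v \<in> DAhalf l s" by (simp add: DAhalf_iff)
  show "Hnorm l t v = Hnorm l t w" by (simp add: Hnorm_def sobolev_term_eq[abs_def] f)
qed

section \<open>Divergence-free fields and the Stokes pairing\<close>

lemma smooth_sob1:
  assumes h: "smooth h" "periodic l h" and z: "fc h 0 = 0" shows "sob 1 h"
proof -
  have L: "L2p h" using h by (simp add: L2p_def smooth_borel sq_int_smooth)
  have pp: "periodic l (partial i h)" for i
  proof -
    have "partial i h (x + axis j l) = partial i h x" for x j
    proof -
      obtain D where D: "(h has_derivative D) (at (x + axis j l))" using smooth_differentiable[OF h(1)] by (auto simp: differentiable_def)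
      have "((\<lambda>x. h (x + axis j l)) has_derivative D) (at x)"
        by (rule has_derivative_compose[of "\<lambda>x. x + axis j l" "\<lambda>x. x", OF _ D]) (auto intro!: derivative_eq_intros)
      then have "(h has_derivative D) (at x)" using h(2) by (simp add: periodic_def)
      from partial_eqI[OF this, of i] partial_eqI[OF D, of i] show ?thesis by simp
    qed
    then show ?thesis by (simp add: periodic_def)
  qed
  have "is_weak_partial l i h (partial i h)" for i
    unfolding is_weak_partial_def
    using integral_by_parts_smooth[OF h] pp smooth_borel[OF smooth_partial[OF h(1)]] integrable_torus_continuous[OF smooth_continuous[OF smooth_partial[OF h(1)]]] by auto
  then have f: "fc (partial i h) k = \<i> * of_real (wave i k) * fc h k" for i k
    by (rule fc_weak_partial[OF L2p_integrable[OF L]])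
  have "(\<lambda>k. (cmod (fc (partial i h) k))\<^sup>2) summable_on UNIV" for i
    using parseval_real_norm[OF sq_int_smooth[OF smooth_partial[OF h(1)]]] by (auto simp: summable_on_def)
  then have "(\<lambda>k. \<Sum>i\<in>UNIV. (wave i k)\<^sup>2 * (cmod (fc h k))\<^sup>2) summable_on UNIV"
    unfolding UNIV_2 f by (auto simp: norm_mult power_mult_distrib intro!: summable_on_add)
  then have "(\<lambda>k. (1 / (2 * pi / l)\<^sup>2) * ((2 * pi / l)\<^sup>2 * kk k * (cmod (fc h k))\<^sup>2)) summable_on UNIV"
    unfolding sum_distrib_right[symmetric] sum_wave by (rule summable_on_cmult_right)
  moreover have "(\<lambda>k. (1 / (2 * pi / l)\<^sup>2) * ((2 * pi / l)\<^sup>2 * kk k * (cmod (fc h k))\<^sup>2)) = (\<lambda>k. kk k ^ 1 * (cmod (fc h k))\<^sup>2)"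
    using l_pos by auto
  ultimately show ?thesis using L z by (simp add: sob_def)
qed

text \<open>\<open>Hnorm\<close> of a field outside H^1 is the root of a divergent
  \<open>infsum\<close>, hence 0. The approximation condition in \<open>spaceV\<close> therefore
  carries information only once the approximating smooth fields are known to lie in H^1.\<close>

lemma smooth_divfree_vsob: assumes w: "w \<in> smooth_divfree l" shows "vsob 1 w"
  unfolding vsob_def
proof
  fix j
  have s: "\<And>j. smooth (cp w j)" "\<And>j. periodic l (cp w j)" "(\<integral>x. w x \<partial>TL) = 0" using w by (auto simp: smooth_divfree_def periodic_def)
  have "w \<in> borel_measurable borel" by (rule borel_measurable_vecI) (use smooth_borel[OF s(1)] in auto)
  moreover have "integrable TL (\<lambda>x. (norm (w x))\<^sup>2)"
    unfolding norm_vec2_sq using sq_int_smooth[OF s(1)] by (intro Bochner_Integration.integrable_sum) (auto simp: sq_int_def)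
  ultimately have "w \<in> L2dot l" using w by (auto simp: L2dot_def smooth_divfree_def)
  then show "sob 1 (cp w j)" using L2dot_comp(2) by (intro smooth_sob1 s) auto
qed

lemma vsob_diff: "vsob s u \<Longrightarrow> vsob s w \<Longrightarrow> vsob s (u - w)"
  by (auto simp: vsob_def intro!: sob_diff)

lemma spaceV_vsob: "u \<in> spaceV l \<Longrightarrow> vsob 1 u"
  by (simp add: spaceV_def Hdot_iff)

lemma spaceV_spaceH: assumes u: "u \<in> spaceV l" shows "u \<in> spaceH l"
proof -
  have "\<exists>w\<in>smooth_divfree l. norm2 l (u - w) < e" if e: "e > 0" for e
  proof -
    have "e / l > 0" using e l_pos by simp
    then obtain w where w: "w \<in> smooth_divfree l" "Hnorm l 1 (u - w) < e / l" using u unfolding spaceV_def by blast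
    have "norm2 l (u - w) \<le> l * Hnorm l 1 (u - w)"
      by (rule norm2_le_Hnorm[OF vsob_diff[OF spaceV_vsob[OF u] smooth_divfree_vsob[OF w(1)]]])
    also have "\<dots> < e" using w(2) l_pos by (simp add: field_simps)
    finally show ?thesis using w(1) by blast
  qed
  then show ?thesis using vsob_L2dot[OF spaceV_vsob[OF u]] by (simp add: spaceH_def)
qed

lemma laplace_nth: "laplace l u x $ j = (\<Sum>i\<in>UNIV. wpartial l i (wpartial l i (cp u j)) x)"
  by (simp add: laplace_def)

lemma sob_laplace: "vsob 2 q \<Longrightarrow> sob 0 (cp (laplace l q) j)"
  unfolding laplace_nth by (intro sob_sum sob_partial vsobD)

lemma fc_sum:
  assumes "\<And>i. i \<in> I \<Longrightarrow> integrable TL (f i)"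
  shows "fc (\<lambda>x. \<Sum>i\<in>I. f i x) k = (\<Sum>i\<in>I. fc (f i) k)"
  using assms
proof (induction I rule: infinite_finite_induct)
  case (insert i I)
  then show ?case by (simp add: fc_add)
qed (auto simp: fc_def fco_def)

text \<open>The divergence condition mode by mode: each coefficient vector is orthogonal to its wave
  vector.\<close>

lemma dvf_fc:
  assumes q: "vsob 1 q" "dvf q" shows "(\<Sum>i\<in>UNIV. of_real (wave i k) * fc (cp q i) k) = 0"
proof -
  have i: "integrable TL (wpartial l i (cp q i))" for i
    by (rule integrable_sq_int[OF sob_sq_int[OF sob_partial(1)[OF vsobD[OF q(1)]]]])
  have "fc (\<lambda>x. \<Sum>i\<in>UNIV. wpartial l i (cp q i) x) k = fc (\<lambda>x. 0) k"
    by (rule fc_cong_AE) (use q(2) i in \<open>auto simp: dvf_def\<close>)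
  then have "(\<Sum>i\<in>UNIV. fc (wpartial l i (cp q i)) k) = 0"
    using i by (subst (asm) fc_sum) (auto simp: fc_def fco_def)
  then have "\<i> * (\<Sum>i\<in>UNIV. of_real (wave i k) * fc (cp q i) k) = 0"
    using sob_weak_partial(4)[OF sob_SucI(2)[OF vsobD[OF q(1)]]] by (simp add: sum_distrib_left mult.assoc)
  then show ?thesis by simp
qed

text \<open>The Laplacian multiplies each coefficient vector by a scalar, so it keeps orthogonality
  to the wave vector. Its truncations are smooth mean-zero divergence-free fields converging to it
  in L^2.\<close>

lemma laplace_spaceH:
  assumes q: "vsob 2 q" "dvf q" shows "laplace l q \<in> spaceH l"
proof -
  have q1: "vsob 1 q" using q(1) by (auto simp: vsob_def intro: sob_down)
  note s0 = sob_laplace[OF q(1)]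
  have f: "fc (cp (laplace l q) j) k = - (\<Sum>i\<in>UNIV. (of_real (wave i k))\<^sup>2) * fc (cp q j) k" for j k
  proof -
    have "fc (cp (laplace l q) j) k = (\<Sum>i\<in>UNIV. fc (wpartial l i (wpartial l i (cp q j))) k)"
      unfolding laplace_nth by (rule fc_sum) (rule integrable_sq_int[OF sob_sq_int[OF sob_partial(1)[OF sob_partial(2)[OF vsobD[OF q(1)]]]]])
    also have "\<dots> = (\<Sum>i\<in>UNIV. \<i> * of_real (wave i k) * (\<i> * of_real (wave i k) * fc (cp q j) k))"
      using sob_weak_partial(4)[OF sob_SucI(2)[OF sob_partial(2)[OF vsobD[OF q(1)]]]] sob_weak_partial(4)[OF sob_SucI(1)[OF vsobD[OF q(1)]]] by simp
    also have "\<dots> = (\<Sum>i\<in>UNIV. - ((of_real (wave i k))\<^sup>2 * fc (cp q j) k))"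
      by (intro sum.cong refl) (simp add: power2_eq_square algebra_simps)
    finally show ?thesis by (simp add: sum_negf sum_distrib_right)
  qed
  define w where "w N = (\<lambda>x. \<chi> j. trunc N (cp (laplace l q) j) x)" for N
  have wj: "cp (w N) j = trunc N (cp (laplace l q) j)" for N j by (auto simp: w_def)
  have tz: "fc (trunc N h) 0 = 0" if h: "L2p h" "fc h 0 = 0" for N h
    unfolding fc_def trunc_complex[OF h(1)] fco_exposum[OF finite_box] using h(2) by (simp add: fc_def)
  have wL: "w N \<in> L2dot l" for N
    by (rule L2dotI) (use s0 tz in \<open>auto simp: wj L2p_def smooth_trunc smooth_borel sq_int_trunc sob_def\<close>)
  have div: "(\<Sum>i\<in>UNIV. partial i (\<lambda>y. w N y $ i) x) = 0" for N x
  proof -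
    have "(\<Sum>i\<in>UNIV. partial i (\<lambda>y. w N y $ i) x) = Re (\<Sum>k\<in>box_set N. (\<Sum>i\<in>UNIV. \<i> * of_real (wave i k) * fc (cp (laplace l q) i) k) * expo k x)"
      unfolding wj trunc_def partial_trig trig_def Re_sum[symmetric]
      by (subst sum.swap) (simp add: sum_distrib_right)
    also have "\<dots> = 0"
    proof -
      have "(\<Sum>i\<in>UNIV. \<i> * of_real (wave i k) * fc (cp (laplace l q) i) k) = 
         - \<i> * (\<Sum>i\<in>UNIV. (of_real (wave i k))\<^sup>2) * (\<Sum>i\<in>UNIV. of_real (wave i k) * fc (cp q i) k)" (is "_ = - \<i> * ?S * _") for k
      proof -
        have "(\<Sum>i\<in>UNIV. \<i> * of_real (wave i k) * fc (cp (laplace l q) i) k) = (\<Sum>i\<in>UNIV. (- \<i> * ?S) * (of_real (wave i k) * fc (cp q i) k))"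
          unfolding f by (intro sum.cong refl) (simp only: mult_minus_left mult_minus_right mult_ac)
        then show ?thesis by (simp only: sum_distrib_left)
      qed
      then show ?thesis by (simp add: dvf_fc[OF q1 q(2)])
    qed
    finally show ?thesis .
  qed
  have wsd: "w N \<in> smooth_divfree l" for N
    unfolding smooth_divfree_def using wL[of N] div smooth_trunc(1) by (auto simp: wj L2dot_def)
  have lim: "(\<lambda>N. norm2 l (laplace l q - w N)) \<longlonglongrightarrow> 0"
  proof -
    have "norm2 l (laplace l q - w N) = sqrt (\<Sum>j\<in>UNIV. (l2norm TL (\<lambda>x. laplace l q x $ j - trunc N (cp (laplace l q) j) x))\<^sup>2)" for N
    proof -
      have c: "cp (laplace l q - w N) j = (\<lambda>x. laplace l q x $ j - trunc N (cp (laplace l q) j) x)" for j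
        by (auto simp: w_def)
      have "sq_int TL (cp (laplace l q - w N) j)" for j unfolding c by (intro sq_int_diff sq_int_trunc sob_sq_int[OF s0])
      from norm2_sq[OF this] show ?thesis unfolding c by (metis norm2_nonneg real_sqrt_unique)
    qed
    moreover have "(\<lambda>N. sqrt (\<Sum>j\<in>UNIV. (l2norm TL (\<lambda>x. laplace l q x $ j - trunc N (cp (laplace l q) j) x))\<^sup>2)) \<longlonglongrightarrow> sqrt (\<Sum>j\<in>(UNIV::2 set). 0\<^sup>2)"
      by (intro tendsto_real_sqrt tendsto_sum tendsto_power trunc_L2 sob_sq_int[OF s0])
    ultimately show ?thesis by simp
  qed
  have "\<exists>w\<in>smooth_divfree l. norm2 l (laplace l q - w) < e" if "e > 0" for e
  proof -
    have "\<forall>\<^sub>F N in sequentially. norm2 l (laplace l q - w N) < e" using order_tendstoD(2)[OF lim that] .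
    then obtain N where "norm2 l (laplace l q - w N) < e" by (auto simp: eventually_sequentially)
    then show ?thesis using wsd by blast
  qed
  moreover have "laplace l q \<in> L2dot l" by (rule L2dotI) (use s0 in \<open>auto simp: sob_def\<close>)
  ultimately show ?thesis by (simp add: spaceH_def)
qed

lemma spaceH_sq_int: "u \<in> spaceH l \<Longrightarrow> sq_int TL (cp u j)"
  by (rule L2p_sq_int[OF L2dot_comp(1)]) (simp add: spaceH_def)

lemma ip_diff_left:
  assumes "\<And>j. sq_int TL (cp a j)" "\<And>j. sq_int TL (cp b j)" "\<And>j. sq_int TL (cp w j)"
  shows "ip l (a - b) w = ip l a w - ip l b w"
proof -
  have d: "sq_int TL (cp (a - b) j)" for j using sq_int_diff[OF assms(1,2)] by simp
  show ?thesis unfolding ip_sum[OF d assms(3)] ip_sum[OF assms(1,3)] ip_sum[OF assms(2,3)]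
    using integrable_sq_int_mult[OF assms(1,3)] integrable_sq_int_mult[OF assms(2,3)]
    by (simp add: left_diff_distrib sum_subtractf)
qed

text \<open>\<open>leray\<close> is a choice: the Laplacian of \<open>q\<close> witnesses that a
  projection exists, and afterwards only the orthogonality characterising the chosen one is used,
  with \<open>m\<close> as test field since V is contained in H.\<close>

lemma stokes_ip:
  assumes q: "vsob 2 q" "dvf q" and m: "m \<in> spaceV l"
  shows "ip l (stokes l q) m = ipm l (grad l m) (grad l q)"
proof -
  let ?w = "leray l (laplace l q)"
  have m1: "vsob 1 m" by (rule spaceV_vsob[OF m])
  note ms = vsob_sq_int[OF m1]
  have "\<exists>w. w \<in> spaceH l \<and> (\<forall>\<phi>\<in>spaceH l. ip l (laplace l q - w) \<phi> = 0)"
    by (rule exI[of _ "laplace l q"]) (simp add: laplace_spaceH[OF q] ip_def)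
  then have "?w \<in> spaceH l \<and> (\<forall>\<phi>\<in>spaceH l. ip l (laplace l q - ?w) \<phi> = 0)"
    unfolding leray_def by (rule someI_ex)
  then have w: "?w \<in> spaceH l" "\<And>\<phi>. \<phi> \<in> spaceH l \<Longrightarrow> ip l (laplace l q - ?w) \<phi> = 0"
    by auto
  note ls = sob_sq_int[OF sob_laplace[OF q(1)]]
  have "ip l (laplace l q) m = ip l ?w m"
    using w(2)[OF spaceV_spaceH[OF m]] ip_diff_left[OF ls spaceH_sq_int[OF w(1)] ms] by simp
  moreover have "ip l (stokes l q) m = - ip l ?w m" by (simp add: stokes_def ip_def)
  moreover have "ip l (laplace l q) m = - ipm l (grad l m) (grad l q)"
  proof -
    have dq: "sob 1 (wpartial l i (cp q j))" for i j by (rule sob_partial(2)[OF vsobD[OF q(1)]])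
    have dm: "sq_int TL (wpartial l i (cp m j))" for i j by (rule sob_sq_int[OF sob_partial(1)[OF vsobD[OF m1]]])
    have ddq: "sq_int TL (wpartial l i (wpartial l i (cp q j)))" for i j by (rule sob_sq_int[OF sob_partial(1)[OF dq]])
    have "ip l (laplace l q) m = (\<Sum>j\<in>UNIV. \<Sum>i\<in>UNIV. \<integral>x. wpartial l i (wpartial l i (cp q j)) x * m x $ j \<partial>TL)"
      unfolding ip_sum[OF ls ms] laplace_nth sum_distrib_right
      by (intro sum.cong refl Bochner_Integration.integral_sum integrable_sq_int_mult ddq ms)
    also have "\<dots> = (\<Sum>j\<in>UNIV. \<Sum>i\<in>UNIV. - (\<integral>x. wpartial l i (cp q j) x * wpartial l i (cp m j) x \<partial>TL))"
      using weak_ibp_sob1[OF sob_L2p[OF dq] sob_weak_partial(1)[OF sob_SucI(2)[OF dq]] ddq vsobD[OF m1]] by simp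
    also have "\<dots> = - ipm l (grad l m) (grad l q)"
      by (subst ipm_sum) (auto simp: grad_nth sum_negf mult.commute intro!: integrable_sq_int_mult dm sob_sq_int[OF dq])
    finally show ?thesis .
  qed
  ultimately show ?thesis by simp
qed

end

section \<open>Weak derivatives in time\<close>

definition smooth1 :: "(real \<Rightarrow> real) \<Rightarrow> bool" where
  "smooth1 f \<longleftrightarrow> (\<forall>n. (deriv ^^ n) f differentiable_on UNIV)"

lemma smooth1_coinduct:
  assumes C: "\<And>f. f \<in> C \<Longrightarrow> \<exists>f'\<in>C. \<forall>x. (f has_real_derivative f' x) (at x)" and f: "f \<in> C"
  shows "smooth1 f"
proof -
  have d: "deriv f \<in> C" "f differentiable_on UNIV" if "f \<in> C" for f
  proof -
    obtain f' where f': "f' \<in> C" "\<And>x. (f has_real_derivative f' x) (at x)" using C[OF \<open>f \<in> C\<close>] by blast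
    then have "deriv f = f'" by (auto intro: DERIV_imp_deriv)
    then show "deriv f \<in> C" using f' by simp
    show "f differentiable_on UNIV" using f'(2) by (auto simp: differentiable_on_def real_differentiable_def)
  qed
  have "(deriv ^^ n) f \<in> C" for n by (induction n) (use d f in auto)
  then show ?thesis using d by (auto simp: smooth1_def)
qed

lemma smooth1_deriv: "smooth1 f \<Longrightarrow> smooth1 (deriv f)"
  unfolding smooth1_def by (metis funpow_Suc_right o_apply)

lemma smooth1_DERIV: "smooth1 f \<Longrightarrow> (f has_real_derivative deriv f x) (at x)"
proof -
  assume "smooth1 f"
  then have "f differentiable (at x)" unfolding smooth1_def differentiable_on_def by (metis UNIV_I funpow_0)
  then show ?thesis by (metis DERIV_deriv_iff_real_differentiable)
qed

lemma smooth1_const: "smooth1 (\<lambda>x. c)"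
proof (rule smooth1_coinduct[of "range (\<lambda>c x. c)"])
  show "\<exists>f'\<in>range (\<lambda>c x. c). \<forall>x. (f has_real_derivative f' x) (at x)" if "f \<in> range (\<lambda>c x. c)" for f :: "real \<Rightarrow> real"
    using that by (intro bexI[of _ "\<lambda>x. 0"]) auto
qed auto

text \<open>The device of \<open>smooth_alg\<close> with one reciprocal added, as required by the
  quotient in \<open>step\<close>: the derivative of 1/d is again built from d' and 1/d.\<close>

inductive_set smooth1_alg :: "(real \<Rightarrow> real) \<Rightarrow> (real \<Rightarrow> real) set" for d where
  base: "smooth1 f \<Longrightarrow> f \<in> smooth1_alg d"
| inv: "(\<lambda>x. inverse (d x)) \<in> smooth1_alg d"
| add: "f \<in> smooth1_alg d \<Longrightarrow> g \<in> smooth1_alg d \<Longrightarrow> (\<lambda>x. f x + g x) \<in> smooth1_alg d"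
| mult: "f \<in> smooth1_alg d \<Longrightarrow> g \<in> smooth1_alg d \<Longrightarrow> (\<lambda>x. f x * g x) \<in> smooth1_alg d"

lemma smooth1_alg_smooth1:
  assumes d: "smooth1 d" "\<And>x. d x \<noteq> 0" and f: "f \<in> smooth1_alg d" shows "smooth1 f"
proof (rule smooth1_coinduct[OF _ f])
  have neg: "(\<lambda>x. -1) \<in> smooth1_alg d" by (rule smooth1_alg.base[OF smooth1_const])
  show "\<exists>f'\<in>smooth1_alg d. \<forall>x. (f has_real_derivative f' x) (at x)" if "f \<in> smooth1_alg d" for f
    using that
  proof induction
    case (base f) then show ?case using smooth1_DERIV smooth1_deriv smooth1_alg.base by blast
  next
    case inv
    have "(\<lambda>x. (-1) * (deriv d x * (inverse (d x) * inverse (d x)))) \<in> smooth1_alg d"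
      by (rule smooth1_alg.mult[OF neg smooth1_alg.mult[OF smooth1_alg.base[OF smooth1_deriv[OF d(1)]] smooth1_alg.mult[OF smooth1_alg.inv smooth1_alg.inv]]])
    moreover have "((\<lambda>x. inverse (d x)) has_real_derivative (-1) * (deriv d x * (inverse (d x) * inverse (d x)))) (at x)" for x
      using DERIV_inverse_fun[OF smooth1_DERIV[OF d(1)] d(2)] by (simp add: power2_eq_square mult_ac)
    ultimately show ?case
      by (intro bexI[of _ "\<lambda>x. (-1) * (deriv d x * (inverse (d x) * inverse (d x)))"] allI)
  next
    case (add f g)
    then obtain f' g' where "f' \<in> smooth1_alg d" "\<And>x. (f has_real_derivative f' x) (at x)"
      "g' \<in> smooth1_alg d" "\<And>x. (g has_real_derivative g' x) (at x)" by blast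
    then show ?case by (intro bexI[of _ "\<lambda>x. f' x + g' x"] allI DERIV_add smooth1_alg.add)
  next
    case (mult f g)
    then obtain f' g' where f: "f' \<in> smooth1_alg d" "\<And>x. (f has_real_derivative f' x) (at x)"
      and g: "g' \<in> smooth1_alg d" "\<And>x. (g has_real_derivative g' x) (at x)" by blast
    have "(\<lambda>x. f' x * g x + g' x * f x) \<in> smooth1_alg d"
      using mult.hyps f g by (intro smooth1_alg.add smooth1_alg.mult[of f' d g] smooth1_alg.mult[of g' d f])
    moreover have "((\<lambda>x. f x * g x) has_real_derivative f' x * g x + g' x * f x) (at x)" for x by (rule DERIV_mult[OF f(2) g(2)])
    ultimately show ?case by (intro bexI[of _ "\<lambda>x. f' x * g x + g' x * f x"] allI)
  qed
qed

lemma smooth1_affine: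
  assumes "smooth1 f" shows "smooth1 (\<lambda>x. c * f (a * x + b))"
proof (rule smooth1_coinduct[of "{\<lambda>x. c * f (a * x + b) | c f. smooth1 f}"])
  fix h assume "h \<in> {\<lambda>x. c * f (a * x + b) | c f. smooth1 f}"
  then obtain c f where f: "smooth1 f" "h = (\<lambda>x. c * f (a * x + b))" by blast
  have "(h has_real_derivative c * a * deriv f (a * x + b)) (at x)" for x
    unfolding f(2) by (rule derivative_eq_intros DERIV_chain2[OF smooth1_DERIV[OF f(1)]] refl | simp)+
  then show "\<exists>f'\<in>{\<lambda>x. c * f (a * x + b) | c f. smooth1 f}. \<forall>x. (h has_real_derivative f' x) (at x)"
    using smooth1_deriv[OF f(1)] by (intro bexI[of _ "\<lambda>x. c * a * deriv f (a * x + b)"]) auto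
qed (use assms in auto)

lemma smooth1_diff:
  assumes "smooth1 f" "smooth1 g" shows "smooth1 (\<lambda>x. f x - g x)"
proof (rule smooth1_coinduct[of "{\<lambda>x. f x - g x | f g. smooth1 f \<and> smooth1 g}"])
  fix h assume "h \<in> {\<lambda>x. f x - g x | f g. smooth1 f \<and> smooth1 g}"
  then obtain f g where f: "smooth1 f" "smooth1 g" "h = (\<lambda>x. f x - g x)" by blast
  have "(h has_real_derivative deriv f x - deriv g x) (at x)" for x
    unfolding f(3) by (intro DERIV_diff smooth1_DERIV f)
  then show "\<exists>f'\<in>{\<lambda>x. f x - g x | f g. smooth1 f \<and> smooth1 g}. \<forall>x. (h has_real_derivative f' x) (at x)"
    using smooth1_deriv f by (intro bexI[of _ "\<lambda>x. deriv f x - deriv g x"]) auto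
qed (use assms in auto)

text \<open>The functions p(1/x) exp(-1/x) for positive x, continued by 0. The family is closed
  under differentiation, with \<open>p\<close> replaced by X^2 (p - p'), which makes smoothness a
  coinduction.\<close>

definition bexp :: "real poly \<Rightarrow> real \<Rightarrow> real" where
  "bexp p x = (if x > 0 then poly p (1 / x) * exp (- (1 / x)) else 0)"

lemma poly_exp_limit: "((\<lambda>y. poly p y * exp (- y)) \<longlongrightarrow> 0) at_top" for p :: "real poly"
proof -
  have "((\<lambda>y. \<Sum>i\<le>degree p. coeff p i * (y ^ i / exp y)) \<longlongrightarrow> (\<Sum>i\<le>degree p. coeff p i * 0)) at_top"
    by (intro tendsto_sum tendsto_mult tendsto_const tendsto_power_div_exp_0)
  then show ?thesis by (simp add: poly_altdef exp_minus divide_inverse sum_distrib_right mult.assoc)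
qed

lemma bexp_DERIV: "(bexp p has_real_derivative bexp (monom 1 2 * (p - pderiv p)) x) (at x)"
proof -
  consider "x > 0" | "x < 0" | "x = 0" by linarith
  then show ?thesis
  proof cases
    case 1
    have "((\<lambda>x. poly p (1 / x) * exp (- (1 / x))) has_real_derivative bexp (monom 1 2 * (p - pderiv p)) x) (at x)"
      using 1 by (auto intro!: derivative_eq_intros DERIV_chain2[OF poly_DERIV] simp: bexp_def poly_monom divide_simps power2_eq_square algebra_simps)
    then show ?thesis
      by (rule DERIV_cong_ev[THEN iffD1, OF refl _ refl, rotated])
         (use 1 in \<open>auto simp: bexp_def eventually_nhds intro!: exI[of _ "{0<..}"]\<close>)
  next
    case 2
    have "((\<lambda>x. 0) has_real_derivative bexp (monom 1 2 * (p - pderiv p)) x) (at x)"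
      using 2 by (simp add: bexp_def)
    then show ?thesis
      by (rule DERIV_cong_ev[THEN iffD1, OF refl _ refl, rotated])
         (use 2 in \<open>auto simp: bexp_def eventually_nhds intro!: exI[of _ "{..<0}"]\<close>)
  next
    case 3
    \<comment> \<open>At the origin the difference quotient is again of the form polynomial times
      exp(-y) with y = 1/h: the extra division by \<open>h\<close> multiplies the polynomial by
      X.\<close>
    have r: "((\<lambda>h. poly (monom 1 1 * p) (inverse h) * exp (- inverse h)) \<longlongrightarrow> 0) (at_right 0)"
      by (rule filterlim_compose[OF poly_exp_limit filterlim_inverse_at_top_right])
    have "((\<lambda>h. bexp p h / h) \<longlongrightarrow> 0) (at_right 0)"
      by (rule Lim_transform_eventually[OF r])
         (auto simp: eventually_at_right_field bexp_def poly_monom divide_inverse mult_ac intro!: exI[of _ 1])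
    moreover have "((\<lambda>h. bexp p h / h) \<longlongrightarrow> 0) (at_left 0)"
      by (rule Lim_transform_eventually[OF tendsto_const])
         (auto simp: eventually_at_left_field bexp_def intro!: exI[of _ "-1"])
    ultimately have "((\<lambda>h. bexp p h / h) \<longlongrightarrow> 0) (at 0)" by (simp add: filterlim_at_split)
    then show ?thesis using 3 by (simp add: has_field_derivative_iff bexp_def)
  qed
qed

lemma smooth1_bexp: "smooth1 (bexp p)"
proof (rule smooth1_coinduct[of "range bexp"])
  fix f assume "f \<in> range bexp"
  then obtain p where "f = bexp p" by blast
  then show "\<exists>f'\<in>range bexp. \<forall>x. (f has_real_derivative f' x) (at x)"
    using bexp_DERIV[of p] by blast
qed simp

text \<open>A smooth transition from 0 to 1 on the unit interval. The denominator never vanishes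
  because x and 1 - x cannot both be nonpositive. The derivative serves as a one-sided mollifier of
  mass 1.\<close>

definition step :: "real \<Rightarrow> real" where
  "step x = bexp 1 x * inverse (bexp 1 x + bexp 1 (1 - x))"

lemma bexp1: "0 \<le> bexp 1 x" "x > 0 \<Longrightarrow> 0 < bexp 1 x" "x \<le> 0 \<Longrightarrow> bexp 1 x = 0"
  by (auto simp: bexp_def)

lemma smooth1_step: "smooth1 step"
proof -
  define d where "d x = bexp 1 x + bexp 1 (1 - x)" for x
  have pos: "d x > 0" for x
    unfolding d_def using bexp1[of x] bexp1[of "1 - x"] by (cases "x > 0") (auto intro: add_pos_nonneg add_nonneg_pos)
  have r: "smooth1 (\<lambda>x. bexp 1 (1 - x))" using smooth1_affine[OF smooth1_bexp, of 1 1 "-1" 1] by (simp add: algebra_simps)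
  have one: "smooth1 (\<lambda>x. 1)"
    by (rule smooth1_const)
  have d: "smooth1 d"
    using smooth1_alg_smooth1[OF one _ smooth1_alg.add[OF smooth1_alg.base[OF smooth1_bexp] smooth1_alg.base[OF r]]]
    by (simp add: d_def[abs_def])
  have "(\<lambda>x. bexp 1 x * inverse (d x)) \<in> smooth1_alg d"
    by (rule smooth1_alg.mult[OF smooth1_alg.base[OF smooth1_bexp] smooth1_alg.inv])
  from smooth1_alg_smooth1[OF d _ this] show ?thesis using pos by (simp add: step_def[abs_def] d_def less_imp_neq[symmetric])
qed

lemma step_values: "x \<le> 0 \<Longrightarrow> step x = 0" "x \<ge> 1 \<Longrightarrow> step x = 1" "0 \<le> step x" "step x \<le> 1"
proof -
  show "x \<le> 0 \<Longrightarrow> step x = 0" by (simp add: step_def bexp1)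
  show "x \<ge> 1 \<Longrightarrow> step x = 1" using bexp1(2)[of x] by (simp add: step_def bexp1 less_imp_neq[symmetric])
  show "0 \<le> step x" by (simp add: step_def bexp1)
  have "bexp 1 x + bexp 1 (1 - x) > 0"
    using bexp1[of x] bexp1[of "1 - x"] by (cases "x > 0") (auto intro: add_pos_nonneg add_nonneg_pos)
  then show "step x \<le> 1" using bexp1(1)[of "1 - x"] by (simp add: step_def divide_simps flip: divide_inverse)
qed

lemma step_deriv_zero: "x \<notin> {0..1} \<Longrightarrow> deriv step x = 0"
proof -
  assume "x \<notin> {0..1}"
  then consider "x < 0" | "x > 1" by fastforce
  then show ?thesis
  proof cases
    case 1
    have "deriv step x = deriv (\<lambda>_. 0) x"
      by (rule deriv_cong_ev) (use 1 in \<open>auto simp: step_values eventually_nhds intro!: exI[of _ "{..<0}"]\<close>)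
    then show ?thesis by simp
  next
    case 2
    have "deriv step x = deriv (\<lambda>_. 1) x"
      by (rule deriv_cong_ev) (use 2 in \<open>auto simp: step_values eventually_nhds intro!: exI[of _ "{1<..}"]\<close>)
    then show ?thesis by simp
  qed
qed

lemma smooth1_continuous: "smooth1 f \<Longrightarrow> continuous_on S f"
  by (meson DERIV_continuous_on has_field_derivative_at_within smooth1_DERIV)

lemma step_deriv_integral:
  "integrable lborel (\<lambda>x. deriv step x)" "(\<integral>x. deriv step x \<partial>lborel) = 1"
proof -
  have c: "continuous_on S (deriv step)" for S by (rule smooth1_continuous[OF smooth1_deriv[OF smooth1_step]])
  have "has_bochner_integral lborel (\<lambda>x. indicator {0..1} x *\<^sub>R deriv step x) (step 1 - step 0)"
    by (rule has_bochner_integral_FTC_Icc) (auto intro!: c smooth1_DERIV[OF smooth1_step, THEN DERIV_subset, unfolded has_real_derivative_iff_has_vector_derivative])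
  moreover have "(\<lambda>x. indicator {0..1} x *\<^sub>R deriv step x) = deriv step"
    using step_deriv_zero by (auto simp: indicator_def fun_eq_iff)
  ultimately have "has_bochner_integral lborel (deriv step) 1" by (simp add: step_values)
  then show "integrable lborel (\<lambda>x. deriv step x)" "(\<integral>x. deriv step x \<partial>lborel) = 1"
    by (auto simp: has_bochner_integral_iff)
qed

section \<open>Absolutely continuous functions of time and Gronwall's inequality\<close>

lemma integral_time:
  fixes f :: "real \<Rightarrow> 'b::{banach, second_countable_topology}"
  shows "(\<integral>s. f s \<partial>time_interval t) = (\<integral>s. indicator {0..t} s *\<^sub>R f s \<partial>lborel)"
  unfolding time_interval_def by (simp add: integral_restrict_space)

lemma integrable_time:
  fixes f :: "real \<Rightarrow> 'b::{banach, second_countable_topology}"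
  shows "integrable (time_interval t) f \<longleftrightarrow> integrable lborel (\<lambda>s. indicator {0..t} s *\<^sub>R f s)"
  unfolding time_interval_def by (simp add: integrable_restrict_space)

lemma AE_time: "(AE s in time_interval t. P s) \<longleftrightarrow> (AE s in lborel. s \<in> {0..t} \<longrightarrow> P s)"
  unfolding time_interval_def by (simp add: AE_restrict_space_iff)

lemma space_time: "space (time_interval t) = {0..t}"
  by (simp add: time_interval_def space_restrict_space)

lemma finite_measure_time: "finite_measure (time_interval t)"
  by (rule finite_measureI) (simp add: time_interval_def emeasure_restrict_space space_restrict_space emeasure_lborel_Icc_eq)

lemma measurable_time_sub:
  assumes "s \<le> t" "f \<in> borel_measurable (time_interval t)" shows "f \<in> borel_measurable (time_interval s)"
proof -
  have "f \<in> borel_measurable (restrict_space (time_interval t) {0..s})" by (rule measurable_restrict_space1[OF assms(2)])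
  moreover have "restrict_space (time_interval t) {0..s} = time_interval s"
    unfolding time_interval_def using assms(1) by (subst restrict_restrict_space) (auto simp: Int_absorb1)
  ultimately show ?thesis by simp
qed

lemma integrable_time_sub:
  fixes f :: "real \<Rightarrow> 'b::{banach, second_countable_topology}"
  assumes "s \<le> t" "integrable (time_interval t) f" shows "integrable (time_interval s) f"
proof -
  have "integrable lborel (\<lambda>x. indicator {0..s} x *\<^sub>R (indicator {0..t} x *\<^sub>R f x))"
    by (rule integrable_mult_indicator) (use assms in \<open>auto simp: integrable_time\<close>)
  moreover have "(\<lambda>x. indicator {0..s} x *\<^sub>R (indicator {0..t} x *\<^sub>R f x)) = (\<lambda>x. indicator {0..s} x *\<^sub>R f x)"
    using assms(1) by (auto simp: indicator_def)
  ultimately show ?thesis by (simp add: integrable_time)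
qed

lemma integral_time_0:
  fixes g :: "real \<Rightarrow> real"
  assumes "integrable (time_interval T) g" "0 \<le> T" shows "(\<integral>s. g s \<partial>time_interval 0) = 0"
proof -
  have "(\<integral>s. g s \<partial>time_interval 0) = (\<integral>s. 0 \<partial>(lborel :: real measure))"
    unfolding integral_time
  proof (rule integral_cong_AE)
    show "(\<lambda>s. indicator {0..0} s *\<^sub>R g s) \<in> borel_measurable lborel"
      using integrable_time_sub[OF assms(2,1)] by (auto simp: integrable_time)
    show "AE s in lborel. indicator {0..0} s *\<^sub>R g s = 0"
      using AE_lborel_singleton[of 0] by eventually_elim (auto simp: indicator_def)
  qed simp
  then show ?thesis by simp
qed

lemma continuous_time_measurable:
  fixes f :: "real \<Rightarrow> real"
  assumes "continuous_on {0..T} f" shows "f \<in> borel_measurable (time_interval T)"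
proof -
  have "sets (time_interval T) = sets (restrict_space borel {0..T})"
    unfolding time_interval_def by (rule sets_restrict_space_cong) simp
  then show ?thesis using borel_measurable_continuous_on_restrict[OF assms] measurable_cong_sets by blast
qed

lemma continuous_time_bounded:
  fixes f :: "real \<Rightarrow> real"
  assumes "continuous_on {0..T} f" shows "\<exists>B. \<forall>s\<in>{0..T}. \<bar>f s\<bar> \<le> B"
proof -
  have "bounded (f ` {0..T})" by (intro compact_imp_bounded compact_continuous_image assms) simp
  then show ?thesis unfolding bounded_iff by auto
qed

lemma time_bounded_mult:
  fixes f g :: "real \<Rightarrow> real"
  assumes f: "continuous_on {0..T} f" and g: "integrable (time_interval T) g"
  shows "integrable (time_interval T) (\<lambda>s. f s * g s)"
proof -
  obtain B where B: "\<And>s. s \<in> {0..T} \<Longrightarrow> \<bar>f s\<bar> \<le> B"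
    using continuous_time_bounded[OF f] by blast
  show ?thesis
  proof (rule Bochner_Integration.integrable_bound)
    show "integrable (time_interval T) (\<lambda>s. B * g s)" using g by simp
    show "(\<lambda>s. f s * g s) \<in> borel_measurable (time_interval T)" using continuous_time_measurable[OF f] g by auto
    show "AE s in time_interval T. norm (f s * g s) \<le> norm (B * g s)"
    proof (rule AE_I2)
      fix s assume "s \<in> space (time_interval T)"
      then show "norm (f s * g s) \<le> norm (B * g s)"
        using B[of s] by (auto simp: space_time abs_mult intro!: mult_right_mono)
    qed
  qed
qed

lemma continuous_integral_time:
  fixes g :: "real \<Rightarrow> real"
  assumes g: "integrable (time_interval T) g"
  shows "continuous_on {0..T} (\<lambda>t. \<integral>s. g s \<partial>time_interval t)"
proof -
  have s: "set_integrable lborel {0..t} g" if "t \<le> T" for t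
    using integrable_time_sub[OF that g] by (simp add: integrable_time set_integrable_def)
  have "continuous_on {0..T} (\<lambda>t. integral {0..t} g)"
    by (rule indefinite_integral_continuous_1[OF set_borel_integral_eq_integral(1)[OF s]]) simp
  moreover have "integral {0..t} g = (\<integral>s. g s \<partial>time_interval t)" if "t \<in> {0..T}" for t
    using set_borel_integral_eq_integral(2)[OF s, of t] that unfolding integral_time set_lebesgue_integral_def by simp
  ultimately show ?thesis by (rule continuous_on_eq)
qed

text \<open>Absolute continuity with density \<open>g\<close>, in integrated form. No pointwise
  derivative is involved, and the form is stable under sums and products.\<close>

definition ac :: "real \<Rightarrow> (real \<Rightarrow> real) \<Rightarrow> (real \<Rightarrow> real) \<Rightarrow> bool" where
  "ac T f g \<longleftrightarrow> integrable (time_interval T) g \<and> (\<forall>t\<in>{0..T}. f t = f 0 + (\<integral>s. g s \<partial>time_interval t))"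

lemma acD: "ac T f g \<Longrightarrow> t \<in> {0..T} \<Longrightarrow> f t = f 0 + (\<integral>s. g s \<partial>time_interval t)"
  unfolding ac_def by blast

lemma ac_integrable: "ac T f g \<Longrightarrow> integrable (time_interval T) g"
  unfolding ac_def by blast

lemma ac_continuous: assumes "ac T f g" shows "continuous_on {0..T} f"
proof -
  have "continuous_on {0..T} (\<lambda>t. f 0 + (\<integral>s. g s \<partial>time_interval t))"
    by (intro continuous_intros continuous_integral_time ac_integrable[OF assms])
  then show ?thesis by (rule continuous_on_eq) (rule acD[OF assms, symmetric])
qed

text \<open>The test function is a difference of two rescaled steps and tends to the indicator of
  (s,t], while its derivative is a difference of mollifiers concentrating at s and t. Continuity of
  \<open>f\<close> turns the weak identity into f(t) - f(s) as an integral for interior times;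
  continuity up to the boundary adds the endpoints.\<close>

lemma weak_time_derivative_ac:
  fixes f g :: "real \<Rightarrow> real"
  assumes T: "0 < T" and f: "continuous_on {0..T} f" and g: "integrable (time_interval T) g"
    and weak: "\<And>\<eta>. smooth1 \<eta> \<Longrightarrow> (\<exists>a b. 0 < a \<and> b < T \<and> (\<forall>t. t \<notin> {a..b} \<longrightarrow> \<eta> t = 0)) \<Longrightarrow>
      (\<integral>t. deriv \<eta> t * f t \<partial>time_interval T) = - (\<integral>t. \<eta> t * g t \<partial>time_interval T)"
  shows "ac T f g"
proof -
  define F where "F x = indicator {0..T} x * f x" for x
  define Gi where "Gi x = indicator {0..T} x * g x" for x
  have Gi: "integrable lborel Gi" using g by (simp add: integrable_time Gi_def[abs_def])
  have [measurable]: "F \<in> borel_measurable borel"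
    unfolding F_def[abs_def] using borel_measurable_continuous_on_indicator[OF _ f] by simp
  obtain B where B: "\<And>x. \<bar>F x\<bar> \<le> B"
  proof -
    obtain B where "\<And>s. s \<in> {0..T} \<Longrightarrow> \<bar>f s\<bar> \<le> B"
      using continuous_time_bounded[OF f] by blast
    then have "\<bar>F x\<bar> \<le> max B 0" for x by (auto simp: F_def indicator_def le_max_iff_disj)
    then show ?thesis using that by blast
  qed
  have [measurable]: "deriv step \<in> borel_measurable borel" using step_deriv_integral(1) by auto
  have [measurable]: "step \<in> borel_measurable borel"
    by (intro borel_measurable_continuous_onI smooth1_continuous smooth1_step)
  define \<epsilon> where "\<epsilon> d n = d * inverse (real (Suc n))" for d :: real and n
  have \<epsilon>0: "(\<epsilon> d) \<longlonglongrightarrow> 0" for d unfolding \<epsilon>_def by (rule tendsto_mult_right_zero[OF LIMSEQ_inverse_real_of_nat])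
  have \<epsilon>: "0 < \<epsilon> d n" "\<epsilon> d n \<le> d" if "0 < d" for d n using that by (auto simp: \<epsilon>_def field_simps)
  have avg: "(\<lambda>n. \<integral>x. deriv step ((x - s) / \<epsilon> d n) / \<epsilon> d n * F x \<partial>lborel) \<longlonglongrightarrow> f s"
    and avgi: "integrable lborel (\<lambda>x. deriv step ((x - s) / \<epsilon> d n) / \<epsilon> d n * F x)"
    if s: "0 < s" "s < T" and d: "0 < d" for s d n
  proof -
    have eq: "(\<integral>x. deriv step ((x - s) / \<epsilon> d n) / \<epsilon> d n * F x \<partial>lborel) = (\<integral>y. deriv step y * F (s + \<epsilon> d n * y) \<partial>lborel)" for n
      using lborel_integral_real_affine[of "\<epsilon> d n" "\<lambda>x. deriv step ((x - s) / \<epsilon> d n) / \<epsilon> d n * F x" s] \<epsilon>[OF d, of n]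
      by (simp add: mult.assoc)
    have bd: "norm (deriv step y * F z) \<le> B * norm (deriv step y)" for y z
      using mult_left_mono[OF B[of z], of "\<bar>deriv step y\<bar>"] by (simp add: abs_mult mult.commute)
    have i: "integrable lborel (\<lambda>y. deriv step y * F (s + \<epsilon> d n * y))" for n
      by (rule Bochner_Integration.integrable_bound[of _ "\<lambda>y. B * norm (deriv step y)"])
         (use step_deriv_integral(1) in \<open>auto intro!: AE_I2 order_trans[OF bd[unfolded real_norm_def]]\<close>)
    show "integrable lborel (\<lambda>x. deriv step ((x - s) / \<epsilon> d n) / \<epsilon> d n * F x)"
    proof -
      have "integrable lborel (\<lambda>y. (\<lambda>x. deriv step ((x - s) / \<epsilon> d n) / \<epsilon> d n * F x) (s + \<epsilon> d n * y))"
        using \<epsilon>[OF d, of n] integrable_mult_right[OF i[of n], of "1 / \<epsilon> d n"] by (simp add: field_simps)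
      moreover have "\<epsilon> d n \<noteq> 0" using \<epsilon>[OF d, of n] by simp
      ultimately show ?thesis
        using lborel_integrable_real_affine_iff[of "\<epsilon> d n" "\<lambda>x. deriv step ((x - s) / \<epsilon> d n) / \<epsilon> d n * F x" s] by blast
    qed
    have "(\<lambda>n. \<integral>y. deriv step y * F (s + \<epsilon> d n * y) \<partial>lborel) \<longlonglongrightarrow> (\<integral>y. deriv step y * F s \<partial>lborel)"
    proof (rule integral_dominated_convergence[where w="\<lambda>y. B * norm (deriv step y)"])
      show "integrable lborel (\<lambda>y. B * norm (deriv step y))" using step_deriv_integral(1) by simp
      show "AE y in lborel. norm (deriv step y * F (s + \<epsilon> d n * y)) \<le> B * norm (deriv step y)" for n
        by (intro AE_I2 bd)
      show "AE y in lborel. (\<lambda>n. deriv step y * F (s + \<epsilon> d n * y)) \<longlonglongrightarrow> deriv step y * F s"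
      proof (rule AE_I2, intro tendsto_mult tendsto_const)
        fix y :: real
        have "isCont F s"
        proof -
          have "continuous_on {0<..<T} F"
            by (rule continuous_on_eq[OF continuous_on_subset[OF f]]) (auto simp: F_def)
          then show ?thesis using s by (simp add: continuous_on_eq_continuous_at)
        qed
        moreover have "(\<lambda>n. s + \<epsilon> d n * y) \<longlonglongrightarrow> s + 0 * y" by (intro tendsto_intros \<epsilon>0)
        ultimately show "(\<lambda>n. F (s + \<epsilon> d n * y)) \<longlonglongrightarrow> F s"
          using isCont_tendsto_compose[of s F "\<lambda>n. s + \<epsilon> d n * y"] by simp
      qed
    qed auto
    moreover have "(\<integral>y. deriv step y * F s \<partial>lborel) = f s" using step_deriv_integral(2) s by (simp add: F_def)
    ultimately show "(\<lambda>n. \<integral>x. deriv step ((x - s) / \<epsilon> d n) / \<epsilon> d n * F x \<partial>lborel) \<longlonglongrightarrow> f s" unfolding eq by simp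
  qed
  have mid: "f t - f s = (\<integral>x. indicator {s<..t} x * Gi x \<partial>lborel)" if st: "0 < s" "s < t" "t < T" for s t
  proof -
    \<comment> \<open>The steps act to the right, so the support is contained in [s, t + d]; half of
      the distance from \<open>t\<close> to \<open>T\<close> keeps it compactly inside
      (0,T).\<close>
    define d where "d = (T - t) / 2"
    have d: "0 < d" "t + d < T" using st by (auto simp: d_def field_simps)
    define \<eta> where "\<eta> n x = step ((x - s) / \<epsilon> d n) - step ((x - t) / \<epsilon> d n)" for n x
    have e: "step ((x - r) / \<epsilon> d n) = 1 * step ((1 / \<epsilon> d n) * x + (- r / \<epsilon> d n))" for x r n by (simp add: diff_divide_distrib)
    have sm1: "smooth1 (\<lambda>x. step ((x - r) / \<epsilon> d n))" for r n unfolding e by (rule smooth1_affine[OF smooth1_step])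
    have sm: "smooth1 (\<eta> n)" for n unfolding \<eta>_def by (intro smooth1_diff sm1)
    have D1: "((\<lambda>x. step ((x - r) / \<epsilon> d n)) has_real_derivative deriv step ((x - r) / \<epsilon> d n) / \<epsilon> d n) (at x)" for r n x
    proof -
      have "((\<lambda>x. (x - r) / \<epsilon> d n) has_real_derivative 1 / \<epsilon> d n) (at x)"
        using \<epsilon>[OF d(1), of n] by (auto intro!: derivative_eq_intros)
      from DERIV_chain2[OF smooth1_DERIV[OF smooth1_step] this] show ?thesis by simp
    qed
    have dv: "deriv (\<eta> n) x = deriv step ((x - s) / \<epsilon> d n) / \<epsilon> d n - deriv step ((x - t) / \<epsilon> d n) / \<epsilon> d n" for n x
      unfolding \<eta>_def by (rule DERIV_imp_deriv[OF DERIV_diff[OF D1 D1]])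
    have supp: "\<eta> n x = 0" if "x \<notin> {s..t + d}" for n x
    proof (cases "x < s")
      case True
      then have "(x - s) / \<epsilon> d n \<le> 0" "(x - t) / \<epsilon> d n \<le> 0" using st \<epsilon>[OF d(1), of n] by (auto simp: divide_nonpos_pos)
      then show ?thesis by (simp add: \<eta>_def step_values)
    next
      case False
      then have "x - t \<ge> \<epsilon> d n" "x - s \<ge> \<epsilon> d n" using that st \<epsilon>[OF d(1), of n] by auto
      then show ?thesis using \<epsilon>[OF d(1), of n] by (simp add: \<eta>_def step_values)
    qed
    have "(\<integral>x. deriv (\<eta> n) x * f x \<partial>time_interval T) = - (\<integral>x. \<eta> n x * g x \<partial>time_interval T)" for n
    proof (rule weak[OF sm])
      show "\<exists>a b. 0 < a \<and> b < T \<and> (\<forall>x. x \<notin> {a..b} \<longrightarrow> \<eta> n x = 0)"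
        using st(1) d(2) supp[of _ n] by blast
    qed
    moreover have "(\<integral>x. deriv (\<eta> n) x * f x \<partial>time_interval T) =
       (\<integral>x. deriv step ((x - s) / \<epsilon> d n) / \<epsilon> d n * F x \<partial>lborel) - (\<integral>x. deriv step ((x - t) / \<epsilon> d n) / \<epsilon> d n * F x \<partial>lborel)" for n
      using avgi[of s d n] avgi[of t d n] st d
      by (subst Bochner_Integration.integral_diff[symmetric]) (auto simp: integral_time dv F_def algebra_simps intro!: Bochner_Integration.integral_cong)
    moreover have "(\<integral>x. \<eta> n x * g x \<partial>time_interval T) = (\<integral>x. \<eta> n x * Gi x \<partial>lborel)" for n
      by (simp add: integral_time Gi_def mult_ac)
    ultimately have eq: "(\<integral>x. deriv step ((x - s) / \<epsilon> d n) / \<epsilon> d n * F x \<partial>lborel) - (\<integral>x. deriv step ((x - t) / \<epsilon> d n) / \<epsilon> d n * F x \<partial>lborel)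
       = - (\<integral>x. \<eta> n x * Gi x \<partial>lborel)" for n by simp
    have "(\<lambda>n. - (\<integral>x. \<eta> n x * Gi x \<partial>lborel)) \<longlonglongrightarrow> - (\<integral>x. indicator {s<..t} x * Gi x \<partial>lborel)"
    proof (intro tendsto_minus integral_dominated_convergence[where w="\<lambda>x. norm (Gi x)"])
      have [measurable]: "Gi \<in> borel_measurable borel" using Gi by auto
      show "(\<lambda>x. indicator {s<..t} x * Gi x) \<in> borel_measurable lborel" by measurable
      show "(\<lambda>x. \<eta> n x * Gi x) \<in> borel_measurable lborel" for n unfolding \<eta>_def by measurable
      show "integrable lborel (\<lambda>x. norm (Gi x))" using Gi by simp
      show "AE x in lborel. norm (\<eta> n x * Gi x) \<le> norm (Gi x)" for n
      proof (rule AE_I2)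
        fix x
        have "\<bar>\<eta> n x\<bar> \<le> 1" unfolding \<eta>_def using step_values(3,4)[of "(x - s) / \<epsilon> d n"] step_values(3,4)[of "(x - t) / \<epsilon> d n"] by linarith
        then show "norm (\<eta> n x * Gi x) \<le> norm (Gi x)" by (simp add: abs_mult mult_left_le_one_le)
      qed
      have lim: "(\<lambda>n. step ((x - r) / \<epsilon> d n)) \<longlonglongrightarrow> (if r < x then 1 else 0)" for x r
      proof (cases "r < x")
        case True
        have "\<forall>\<^sub>F n in sequentially. \<epsilon> d n < x - r" using order_tendstoD(2)[OF \<epsilon>0, of "x - r"] True by simp
        then have "\<forall>\<^sub>F n in sequentially. step ((x - r) / \<epsilon> d n) = 1"
          by eventually_elim (use \<epsilon>[OF d(1)] in \<open>auto intro!: step_values simp: field_simps less_imp_le\<close>)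
        then show ?thesis using True by (simp add: tendsto_eventually)
      next
        case False
        then have "step ((x - r) / \<epsilon> d n) = 0" for n using \<epsilon>[OF d(1), of n] by (intro step_values) (simp add: divide_nonpos_pos)
        then show ?thesis using False by simp
      qed
      have "(\<lambda>n. \<eta> n x) \<longlonglongrightarrow> indicator {s<..t} x" for x
        using tendsto_diff[OF lim[of x s] lim[of x t]] st by (auto simp: \<eta>_def indicator_def split: if_splits)
      then show "AE x in lborel. (\<lambda>n. \<eta> n x * Gi x) \<longlonglongrightarrow> indicator {s<..t} x * Gi x"
        by (intro AE_I2 tendsto_mult tendsto_const)
    qed
    moreover have "(\<lambda>n. - (\<integral>x. \<eta> n x * Gi x \<partial>lborel)) \<longlonglongrightarrow> f s - f t"
      unfolding eq[symmetric] using st d by (intro tendsto_diff avg) auto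
    ultimately have "f s - f t = - (\<integral>x. indicator {s<..t} x * Gi x \<partial>lborel)" using LIMSEQ_unique by blast
    then show ?thesis by simp
  qed
  \<comment> \<open>The defect between \<open>f\<close> and its presumed integral: constant at
    interior times and continuous on the closed interval, hence constant up to the
    endpoints.\<close>
  define H where "H t = f t - (\<integral>s. g s \<partial>time_interval t)" for t
  have Hc: "continuous_on {0..T} H" unfolding H_def by (intro continuous_intros f continuous_integral_time g)
  have Hconst: "H t = H s" if st: "0 < s" "s < t" "t < T" for s t
  proof -
    have i: "integrable lborel (\<lambda>x. indicator {0..r} x * Gi x)" for r
      using integrable_mult_indicator[OF _ Gi, of "{0..r}"] by simp
    have "(\<integral>x. indicator {0..t} x * Gi x \<partial>lborel) - (\<integral>x. indicator {0..s} x * Gi x \<partial>lborel) = (\<integral>x. indicator {s<..t} x * Gi x \<partial>lborel)"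
      by (subst Bochner_Integration.integral_diff[OF i i, symmetric]) (rule Bochner_Integration.integral_cong, use st in \<open>auto simp: indicator_def\<close>)
    moreover have "(\<integral>x. g x \<partial>time_interval r) = (\<integral>x. indicator {0..r} x * Gi x \<partial>lborel)" if "r \<le> T" for r
      unfolding integral_time by (rule Bochner_Integration.integral_cong) (use that in \<open>auto simp: indicator_def Gi_def\<close>)
    ultimately show ?thesis unfolding H_def using mid[OF st] st by simp
  qed
  define c where "c = H (T / 2)"
  have "H t = c" if "t \<in> {0<..<T}" for t
    unfolding c_def using Hconst[of t "T/2"] Hconst[of "T/2" t] that T by (cases t "T/2" rule: linorder_cases) auto
  moreover have cl: "closure {0<..<T} = {0..T}" using T by simp
  ultimately have Hc': "H t = c" if "t \<in> {0..T}" for t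
    using continuous_constant_on_closure[of "{0<..<T}" H c t] Hc that by simp
  have "f t = f 0 + (\<integral>s. g s \<partial>time_interval t)" if "t \<in> {0..T}" for t
  proof -
    have "(\<integral>s. g s \<partial>time_interval 0) = 0" by (rule integral_time_0[OF g]) (use T in simp)
    then show ?thesis using Hc'[OF that] Hc'[of 0] T unfolding H_def by simp
  qed
  then show ?thesis using g unfolding ac_def by blast
qed

lemma measurable_time_id[measurable]: "(\<lambda>x. x) \<in> borel_measurable (time_interval t)"
  unfolding time_interval_def by (rule measurable_restrict_space1) simp

lemma integral_time_restrict:
  fixes g :: "real \<Rightarrow> real"
  assumes "s \<in> {0..t}"
  shows "(\<integral>r. indicator {..s} r * g r \<partial>time_interval t) = (\<integral>r. g r \<partial>time_interval s)"
  unfolding integral_time by (rule Bochner_Integration.integral_cong) (use assms in \<open>auto simp: indicator_def\<close>)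

lemma integral_time_restrict_strict:
  fixes g :: "real \<Rightarrow> real"
  assumes "s \<in> {0..t}" "integrable (time_interval t) g"
  shows "(\<integral>r. indicator {..<s} r * g r \<partial>time_interval t) = (\<integral>r. g r \<partial>time_interval s)"
proof -
  have [measurable]: "g \<in> borel_measurable (time_interval t)" using assms(2) by auto
  have "(\<integral>r. indicator {..<s} r * g r \<partial>time_interval t) = (\<integral>r. indicator {..s} r * g r \<partial>time_interval t)"
  proof (rule integral_cong_AE)
    show "AE r in time_interval t. indicator {..<s} r * g r = indicator {..s} r * g r"
      unfolding AE_time using AE_lborel_singleton[of s] by eventually_elim (auto simp: indicator_def)
  qed measurable
  then show ?thesis using integral_time_restrict[OF assms(1)] by simp
qed

text \<open>The product of the two primitives is the integral of \<open>a' s * b' r\<close> over a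
  square. Splitting the square along its diagonal and applying Fubini to one triangle gives the
  product rule for merely integrable densities.\<close>

lemma ac_mult:
  assumes a: "ac T a a'" and b: "ac T b b'"
  shows "ac T (\<lambda>t. a t * b t) (\<lambda>s. a' s * b s + a s * b' s)"
proof -
  note ai = ac_integrable[OF a] and bi = ac_integrable[OF b]
  note acn = ac_continuous[OF a] and bcn = ac_continuous[OF b]
  have i1: "integrable (time_interval T) (\<lambda>s. a' s * b s)" using time_bounded_mult[OF bcn ai] by (simp add: mult.commute)
  have i2: "integrable (time_interval T) (\<lambda>s. a s * b' s)" by (rule time_bounded_mult[OF acn bi])
  have "a t * b t = a 0 * b 0 + (\<integral>s. a' s * b s + a s * b' s \<partial>time_interval t)" if t: "t \<in> {0..T}" for t
  proof -
    let ?M = "time_interval t"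
    interpret M: finite_measure ?M by (rule finite_measure_time)
    interpret P: pair_sigma_finite ?M ?M ..
    have ai': "integrable ?M a'" and bi': "integrable ?M b'" using t by (auto intro: integrable_time_sub[OF _ ai] integrable_time_sub[OF _ bi])
    have [measurable]: "a' \<in> borel_measurable ?M" "b' \<in> borel_measurable ?M" using ai' bi' by auto
    define A B where "A s = (\<integral>r. a' r \<partial>time_interval s)" and "B s = (\<integral>r. b' r \<partial>time_interval s)" for s
    have AB: "a s = a 0 + A s" "b s = b 0 + B s" if "s \<in> {0..t}" for s
      unfolding A_def B_def using that t by (auto intro!: acD[OF a] acD[OF b])
    have cA: "continuous_on {0..t} A" "continuous_on {0..t} B"
      unfolding A_def B_def by (auto intro!: continuous_integral_time ai' bi')
    have iB: "integrable ?M (\<lambda>s. a' s * B s)" using time_bounded_mult[OF cA(2) ai'] by (simp add: mult.commute)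
    have iA: "integrable ?M (\<lambda>s. A s * b' s)" by (rule time_bounded_mult[OF cA(1) bi'])
    \<comment> \<open>The strict triangle \<open>s < r\<close>. Integrating over \<open>s\<close>
      leaves a half-open time interval, and the missing endpoint is a null set.\<close>
    define h where "h s r = (if s < r then a' s * b' r else 0)" for s r
    have hm: "case_prod h \<in> borel_measurable (?M \<Otimes>\<^sub>M ?M)" unfolding h_def by measurable
    have pi: "integrable (?M \<Otimes>\<^sub>M ?M) (\<lambda>(s, r). a' s * b' r)"
      by (rule P.Fubini_integrable) (use ai' bi' in \<open>auto simp: abs_mult\<close>)
    have hi: "integrable (?M \<Otimes>\<^sub>M ?M) (case_prod h)"
      by (rule Bochner_Integration.integrable_bound[OF pi hm]) (auto simp: h_def)
    have F: "(\<integral>r. (\<integral>s. h s r \<partial>?M) \<partial>?M) = (\<integral>s. (\<integral>r. h s r \<partial>?M) \<partial>?M)" by (rule P.Fubini_integral[OF hi])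
    have "(\<integral>r. (\<integral>s. h s r \<partial>?M) \<partial>?M) = (\<integral>r. A r * b' r \<partial>?M)"
    proof (rule Bochner_Integration.integral_cong[OF refl])
      fix r assume "r \<in> space ?M"
      then have r: "r \<in> {0..t}" by (simp add: space_time)
      have "(\<integral>s. h s r \<partial>?M) = (\<integral>s. indicator {..<r} s * a' s * b' r \<partial>?M)"
        by (rule Bochner_Integration.integral_cong) (auto simp: h_def indicator_def)
      also have "\<dots> = A r * b' r" using integral_time_restrict_strict[OF r ai'] by (simp add: A_def)
      finally show "(\<integral>s. h s r \<partial>?M) = A r * b' r" .
    qed
    moreover have "(\<integral>s. (\<integral>r. h s r \<partial>?M) \<partial>?M) = (\<integral>s. a' s * B t - a' s * B s \<partial>?M)"
    proof (rule Bochner_Integration.integral_cong[OF refl])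
      fix s assume "s \<in> space ?M"
      then have s: "s \<in> {0..t}" by (simp add: space_time)
      have j: "integrable ?M (\<lambda>r. indicator {..s} r * b' r)"
        by (rule Bochner_Integration.integrable_bound[OF bi']) (auto simp: indicator_def)
      have "(\<integral>r. h s r \<partial>?M) = (\<integral>r. a' s * (b' r - indicator {..s} r * b' r) \<partial>?M)"
        by (rule Bochner_Integration.integral_cong) (auto simp: h_def indicator_def)
      also have "\<dots> = a' s * (B t - B s)"
        using j bi' integral_time_restrict[OF s, of b'] by (simp add: B_def)
      finally show "(\<integral>r. h s r \<partial>?M) = a' s * B t - a' s * B s" by (simp add: algebra_simps)
    qed
    moreover have "(\<integral>s. a' s * B t - a' s * B s \<partial>?M) = A t * B t - (\<integral>s. a' s * B s \<partial>?M)"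
      using iB ai' by (simp add: A_def)
    ultimately have key: "(\<integral>r. A r * b' r \<partial>?M) + (\<integral>s. a' s * B s \<partial>?M) = A t * B t" using F by simp
    have "(\<integral>s. a' s * b s + a s * b' s \<partial>?M) = (\<integral>s. b 0 * a' s + a 0 * b' s + (A s * b' s + a' s * B s) \<partial>?M)"
    proof (rule Bochner_Integration.integral_cong[OF refl])
      fix s assume "s \<in> space ?M"
      then have s: "s \<in> {0..t}" by (simp add: space_time)
      show "a' s * b s + a s * b' s = b 0 * a' s + a 0 * b' s + (A s * b' s + a' s * B s)"
        unfolding AB[OF s] by (simp add: algebra_simps)
    qed
    also have "\<dots> = b 0 * A t + a 0 * B t + A t * B t"
      using ai' bi' iA iB key by (simp add: A_def B_def)
    finally show ?thesis using AB[of t] t by (simp add: algebra_simps)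
  qed
  moreover have "integrable (time_interval T) (\<lambda>s. a' s * b s + a s * b' s)" using i1 i2 by simp
  ultimately show ?thesis unfolding ac_def by blast
qed

lemma ac_const_0: "ac T (\<lambda>t. c) (\<lambda>t. 0)"
  by (simp add: ac_def)

lemma ac_add: assumes a: "ac T a a'" and b: "ac T b b'" shows "ac T (\<lambda>t. a t + b t) (\<lambda>s. a' s + b' s)"
proof -
  have "a t + b t = a 0 + b 0 + (\<integral>s. a' s + b' s \<partial>time_interval t)" if t: "t \<in> {0..T}" for t
    unfolding acD[OF a t] acD[OF b t]
    using integrable_time_sub[OF _ ac_integrable[OF a], of t] integrable_time_sub[OF _ ac_integrable[OF b], of t] t by simp
  moreover have "integrable (time_interval T) (\<lambda>s. a' s + b' s)" using ac_integrable[OF a] ac_integrable[OF b] by simp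
  ultimately show ?thesis unfolding ac_def by blast
qed

lemma ac_cmult: assumes a: "ac T a a'" shows "ac T (\<lambda>t. c * a t) (\<lambda>s. c * a' s)"
proof -
  have "c * a t = c * a 0 + (\<integral>s. c * a' s \<partial>time_interval t)" if t: "t \<in> {0..T}" for t
    unfolding acD[OF a t] by (simp add: distrib_left)
  moreover have "integrable (time_interval T) (\<lambda>s. c * a' s)" using ac_integrable[OF a] by simp
  ultimately show ?thesis unfolding ac_def by blast
qed

lemma ac_sum: "(\<And>i. i \<in> I \<Longrightarrow> ac T (f i) (f' i)) \<Longrightarrow> ac T (\<lambda>t. \<Sum>i\<in>I. f i t) (\<lambda>t. \<Sum>i\<in>I. f' i t)"
  by (induction I rule: infinite_finite_induct) (auto intro!: ac_add ac_const_0)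

lemma integral_time_mono:
  fixes f g :: "real \<Rightarrow> real"
  assumes "integrable (time_interval t) f" "integrable (time_interval t) g" "\<And>s. s \<in> {0..t} \<Longrightarrow> f s \<le> g s"
  shows "(\<integral>s. f s \<partial>time_interval t) \<le> (\<integral>s. g s \<partial>time_interval t)"
  using assms by (intro integral_mono) (auto simp: space_time)

text \<open>The rate \<open>k\<close> is only integrable, so the inequality is iterated. By the
  product rule the n-fold iterated integrals of \<open>k\<close> are K^n / n!, and the remainder,
  which carries a bound \<open>C\<close> of \<open>E\<close>, tends to 0 against the exponential
  series.\<close>

theorem gronwall:
  fixes E k :: "real \<Rightarrow> real"
  assumes E: "continuous_on {0..T} E" and k: "integrable (time_interval T) k" "\<And>t. t \<in> {0..T} \<Longrightarrow> 0 \<le> k t"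
    and le: "\<And>t. t \<in> {0..T} \<Longrightarrow> E t \<le> A + (\<integral>s. k s * E s \<partial>time_interval t)" and A: "0 \<le> A" and t: "t \<in> {0..T}"
  shows "E t \<le> A * exp (\<integral>s. k s \<partial>time_interval t)"
proof -
  define K where "K t = (\<integral>s. k s \<partial>time_interval t)" for t
  have K00: "K 0 = 0" if "0 \<le> T" unfolding K_def by (rule integral_time_0[OF k(1) that])
  have T0: "0 \<le> T" using t by auto
  have Kac: "ac T K k" using k(1) unfolding ac_def K00[OF T0] by (simp add: K_def)
  have Kn: "ac T (\<lambda>t. K t ^ Suc n) (\<lambda>s. real (Suc n) * (k s * K s ^ n))" for n
  proof (induction n)
    case 0 then show ?case using Kac by simp
  next
    case (Suc n)
    from ac_mult[OF Kac Suc.IH] show ?case by (simp add: algebra_simps)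
  qed
  have KI: "(\<integral>s. k s * (c * (K s ^ n / fact n)) \<partial>time_interval t) = c * (K t ^ Suc n / fact (Suc n))" if "t \<in> {0..T}" for n t c
  proof -
    have "K t ^ Suc n = (\<integral>s. real (Suc n) * (k s * K s ^ n) \<partial>time_interval t)"
      using acD[OF Kn[of n] that] K00[OF T0] by simp
    then have e: "K t ^ Suc n = real (Suc n) * (\<integral>s. k s * K s ^ n \<partial>time_interval t)"
      by (simp only: integral_mult_right_zero)
    have "(\<integral>s. k s * (c * (K s ^ n / fact n)) \<partial>time_interval t) = (\<integral>s. (c / fact n) * (k s * K s ^ n) \<partial>time_interval t)"
      by (rule Bochner_Integration.integral_cong) auto
    also have "\<dots> = (c / fact n) * (\<integral>s. k s * K s ^ n \<partial>time_interval t)" by (rule integral_mult_right_zero)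
    also have "\<dots> = c * (K t ^ Suc n / fact (Suc n))" unfolding e fact_Suc of_nat_mult by simp
    finally show ?thesis .
  qed
  obtain C where C: "\<And>s. s \<in> {0..T} \<Longrightarrow> \<bar>E s\<bar> \<le> C" using continuous_time_bounded[OF E] by blast
  have Kc: "continuous_on {0..T} K" by (rule ac_continuous[OF Kac])
  have iE: "integrable (time_interval t) (\<lambda>s. k s * E s)" if "t \<in> {0..T}" for t
    using integrable_time_sub[OF _ time_bounded_mult[OF E k(1)], of t] that by (simp add: mult.commute)
  have iK: "integrable (time_interval t) (\<lambda>s. k s * (c * (K s ^ n / fact n)))" if "t \<in> {0..T}" for t c n
  proof -
    have "continuous_on {0..T} (\<lambda>s. c * (K s ^ n / fact n))" by (intro continuous_intros Kc) auto
    from integrable_time_sub[OF _ time_bounded_mult[OF this k(1)], of t] that show ?thesis by (simp add: mult.commute)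
  qed
  have step: "E t \<le> (\<Sum>j<n. A * (K t ^ j / fact j)) + C * (K t ^ n / fact n)" if "t \<in> {0..T}" for n t
    using that
  proof (induction n arbitrary: t)
    case 0 then show ?case using C[of t] by simp
  next
    case (Suc n)
    have "E t \<le> A + (\<integral>s. k s * E s \<partial>time_interval t)" by (rule le[OF Suc.prems])
    also have "(\<integral>s. k s * E s \<partial>time_interval t) \<le> (\<integral>s. (\<Sum>j<n. k s * (A * (K s ^ j / fact j))) + k s * (C * (K s ^ n / fact n)) \<partial>time_interval t)"
    proof (rule integral_time_mono[OF iE[OF Suc.prems]])
      show "integrable (time_interval t) (\<lambda>s. (\<Sum>j<n. k s * (A * (K s ^ j / fact j))) + k s * (C * (K s ^ n / fact n)))"
        by (intro Bochner_Integration.integrable_add Bochner_Integration.integrable_sum iK Suc.prems)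
      fix s assume s: "s \<in> {0..t}"
      then have s': "s \<in> {0..T}" using Suc.prems by auto
      have "k s * E s \<le> k s * ((\<Sum>j<n. A * (K s ^ j / fact j)) + C * (K s ^ n / fact n))"
        by (intro mult_left_mono Suc.IH[OF s'] k(2)[OF s'])
      then show "k s * E s \<le> (\<Sum>j<n. k s * (A * (K s ^ j / fact j))) + k s * (C * (K s ^ n / fact n))"
        by (simp only: distrib_left sum_distrib_left)
    qed
    also have "\<dots> = (\<integral>s. (\<Sum>j<n. k s * (A * (K s ^ j / fact j))) \<partial>time_interval t) + (\<integral>s. k s * (C * (K s ^ n / fact n)) \<partial>time_interval t)"
      by (intro Bochner_Integration.integral_add Bochner_Integration.integrable_sum iK Suc.prems)
    also have "(\<integral>s. (\<Sum>j<n. k s * (A * (K s ^ j / fact j))) \<partial>time_interval t) = (\<Sum>j<n. \<integral>s. k s * (A * (K s ^ j / fact j)) \<partial>time_interval t)"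
      by (rule Bochner_Integration.integral_sum) (rule iK[OF Suc.prems])
    finally have "E t \<le> (A + (\<Sum>j<n. A * (K t ^ Suc j / fact (Suc j)))) + C * (K t ^ Suc n / fact (Suc n))"
      unfolding KI[OF Suc.prems] by (simp only: add.assoc)
    also have "A + (\<Sum>j<n. A * (K t ^ Suc j / fact (Suc j))) = (\<Sum>j<Suc n. A * (K t ^ j / fact j))"
      by (subst sum.lessThan_Suc_shift) simp
    finally show ?case .
  qed
  have "(\<lambda>n. (\<Sum>j<n. A * (K t ^ j / fact j)) + C * (K t ^ n / fact n)) \<longlonglongrightarrow> A * exp (K t) + C * 0"
  proof (intro tendsto_add tendsto_mult tendsto_const)
    have "(\<lambda>j. A * (K t ^ j / fact j)) sums (A * exp (K t))"
      using exp_converges[of "K t"] by (intro sums_mult) (simp add: scaleR_conv_of_real divide_inverse mult.commute)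
    then show "(\<lambda>n. \<Sum>j<n. A * (K t ^ j / fact j)) \<longlonglongrightarrow> A * exp (K t)" by (simp add: sums_def)
    show "(\<lambda>n. K t ^ n / fact n) \<longlonglongrightarrow> 0"
      using summable_LIMSEQ_zero[OF summable_exp[of "K t"]] by (simp add: field_simps)
  qed
  then show ?thesis unfolding K_def[symmetric] using step[OF t] by (intro tendsto_lowerbound[of _ "A * exp (K t)"]) auto
qed

section \<open>Continuous paths of fields\<close>

lemma space_borel_sn: "space (borel_sn S N) = S"
  unfolding borel_sn_def by (rule space_measure_of) auto

text \<open>A Lipschitz map pulls open sets back to sets open for \<open>N\<close>, the generators
  of \<open>borel_sn\<close>. Only nonnegativity of \<open>N\<close> enters; the radius uses
  \<open>\<bar>C\<bar> + 1\<close> so that no sign of \<open>C\<close> is needed.\<close>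

lemma borel_sn_lipschitz:
  fixes F :: "'b::minus \<Rightarrow> 'c::real_normed_vector"
  assumes L: "\<And>u w. u \<in> S \<Longrightarrow> w \<in> S \<Longrightarrow> norm (F w - F u) \<le> C * N (w - u)"
    and N: "\<And>u. 0 \<le> N u"
  shows "F \<in> borel_measurable (borel_sn S N)"
proof (rule borel_measurableI)
  fix O' :: "'c set" assume O: "open O'"
  define U where "U = F -` O' \<inter> S"
  have "\<exists>r>0. \<forall>w\<in>S. N (w - u) < r \<longrightarrow> w \<in> U" if u: "u \<in> U" for u
  proof -
    have uS: "u \<in> S" "F u \<in> O'" using u by (auto simp: U_def)
    then obtain e where e: "e > 0" "\<And>y. dist y (F u) < e \<Longrightarrow> y \<in> O'" using O unfolding open_dist by blast
    have "w \<in> U" if w: "w \<in> S" "N (w - u) < e / (\<bar>C\<bar> + 1)" for w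
    proof -
      have "norm (F w - F u) < e"
      proof -
        have "norm (F w - F u) \<le> C * N (w - u)" by (rule L[OF uS(1) w(1)])
        also have "\<dots> \<le> (\<bar>C\<bar> + 1) * N (w - u)" using N by (intro mult_right_mono) auto
        also have "\<dots> < e" using w(2) by (simp add: field_simps)
        finally show ?thesis .
      qed
      then show ?thesis using e(2) w(1) by (simp add: U_def dist_norm)
    qed
    moreover have "e / (\<bar>C\<bar> + 1) > 0" using e(1) by (simp add: add_nonneg_pos)
    ultimately show ?thesis by blast
  qed
  then have "U \<in> {U. U \<subseteq> S \<and> (\<forall>u\<in>U. \<exists>r>0. \<forall>w\<in>S. N (w - u) < r \<longrightarrow> w \<in> U)}" by (auto simp: U_def)
  then have "U \<in> sets (borel_sn S N)" unfolding borel_sn_def by (intro in_measure_of) auto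
  then show "F -` O' \<inter> space (borel_sn S N) \<in> sets (borel_sn S N)" by (simp add: space_borel_sn U_def)
qed

context flat_torus
begin

text \<open>The truncated Sobolev norm written as a finite l^2 norm over pairs of frequency and
  component, so that the finite Minkowski and Cauchy-Schwarz inequalities apply before the limit is
  taken.\<close>

definition lset :: "nat \<Rightarrow> nat \<Rightarrow> vfield \<Rightarrow> real" where
  "lset s N u = L2_set (\<lambda>p. sqrt (kk (fst p) ^ s) * cmod (fc (cp u (snd p)) (fst p))) (box_set N \<times> UNIV)"

lemma lset_sq: "lset s N u = sqrt (\<Sum>k\<in>box_set N. sobolev_term l s u k)"
  unfolding lset_def L2_set_def sobolev_term_eq sum.cartesian_product
  by (simp add: power_mult_distrib case_prod_beta)

lemma lset_limit: "vsob s u \<Longrightarrow> (\<lambda>N. lset s N u) \<longlonglongrightarrow> Hnorm l s u"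
  unfolding lset_sq Hnorm_def
  by (intro tendsto_real_sqrt has_sum_box) (simp add: Hdot_iff[symmetric] Hdot_def)

lemma lset_le: assumes "vsob s u" shows "lset s N u \<le> Hnorm l s u"
  unfolding lset_sq Hnorm_def
  by (intro real_sqrt_le_mono finite_sum_le_infsum) (use assms in \<open>auto simp: Hdot_iff[symmetric] Hdot_def sobolev_term_eq intro!: sum_nonneg\<close>)

lemma lset_nonneg: "0 \<le> lset s N u" by (simp add: lset_def L2_set_nonneg)

lemma fc_diff_field: "vsob s u \<Longrightarrow> vsob s w \<Longrightarrow> fc (cp (u - w) j) k = fc (cp u j) k - fc (cp w j) k"
  using fc_diff[OF integrable_sq_int[OF vsob_sq_int[of s u j]] integrable_sq_int[OF vsob_sq_int[of s w j]], of k] by simp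

lemma Hnorm_triangle_diff: assumes u: "vsob s u" and w: "vsob s w" shows "Hnorm l s u \<le> Hnorm l s w + Hnorm l s (u - w)"
proof (rule LIMSEQ_le[OF lset_limit[OF u] tendsto_add[OF lset_limit[OF w] lset_limit[OF vsob_diff[OF u w]]]], intro exI allI impI)
  fix N :: nat
  let ?f = "\<lambda>u p. sqrt (kk (fst p) ^ s) * cmod (fc (cp u (snd p)) (fst p))"
  have "lset s N u \<le> L2_set (\<lambda>p. ?f w p + ?f (u - w) p) (box_set N \<times> UNIV)"
    unfolding lset_def
  proof (rule L2_set_mono)
    fix p :: "(int \<times> int) \<times> 2"
    have "cmod (fc (cp u (snd p)) (fst p)) \<le> cmod (fc (cp w (snd p)) (fst p)) + cmod (fc (cp (u - w) (snd p)) (fst p))"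
      using norm_triangle_ineq[of "fc (cp w (snd p)) (fst p)" "fc (cp (u - w) (snd p)) (fst p)"] fc_diff_field[OF u w, of "snd p" "fst p"] by simp
    then have "?f u p \<le> sqrt (kk (fst p) ^ s) * (cmod (fc (cp w (snd p)) (fst p)) + cmod (fc (cp (u - w) (snd p)) (fst p)))"
      by (intro mult_left_mono) auto
    then show "?f u p \<le> ?f w p + ?f (u - w) p" by (simp add: distrib_left)
  qed auto
  also have "\<dots> \<le> lset s N w + lset s N (u - w)" unfolding lset_def by (rule L2_set_triangle_ineq)
  finally show "lset s N u \<le> lset s N w + lset s N (u - w)" .
qed

lemma Hnorm_minus_commute: assumes u: "vsob s u" and w: "vsob s w" shows "Hnorm l s (u - w) = Hnorm l s (w - u)"
proof -
  have "sobolev_term l s (u - w) k = sobolev_term l s (w - u) k" for k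
    unfolding sobolev_term_eq fc_diff_field[OF u w] fc_diff_field[OF w u] by (simp add: norm_minus_commute)
  then show ?thesis by (simp add: Hnorm_def)
qed

lemma Hnorm_diff_abs: assumes u: "vsob s u" and w: "vsob s w" shows "\<bar>Hnorm l s u - Hnorm l s w\<bar> \<le> Hnorm l s (u - w)"
  using Hnorm_triangle_diff[OF u w] Hnorm_triangle_diff[OF w u] Hnorm_minus_commute[OF u w] by linarith

lemma norm2_eq_Hnorm: assumes u: "vsob 0 u" shows "norm2 l u = l * Hnorm l 0 u"
proof -
  have "(norm2 l u)\<^sup>2 = (l * Hnorm l 0 u)\<^sup>2"
    unfolding norm2_sq[OF vsob_sq_int[OF u]] power_mult_distrib Hnorm_sq[OF u] l2norm_eq_hn[OF vsob_sq_int[OF u]]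
    by (simp add: sum_distrib_left)
  then show ?thesis using l_pos Hnorm_nonneg by (simp add: power2_eq_iff_nonneg)
qed

text \<open>The Fourier truncation of \<open>Upsilon_pair\<close>, with the symbol of I - \<alpha>
  Laplace as weight; \<alpha> = 0 gives the L^2 product. It involves finitely many coefficients, so
  regularity in time and measurability are inherited from them.\<close>

definition pr :: "real \<Rightarrow> nat \<Rightarrow> vfield \<Rightarrow> vfield \<Rightarrow> real" where
  "pr \<alpha> N h \<phi> = l\<^sup>2 * (\<Sum>k\<in>box_set N. (1 + \<alpha> * ((2 * pi / l)\<^sup>2 * kk k)) *
      (\<Sum>j\<in>UNIV. Re (fc (cp h j) k * cnj (fc (cp \<phi> j) k))))"

lemma pr_ip:
  assumes h: "vsob 0 h" and p: "vsob 0 \<phi>" shows "(\<lambda>N. pr 0 N h \<phi>) \<longlonglongrightarrow> ip l h \<phi>"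
proof -
  have "(\<lambda>N. \<Sum>j\<in>UNIV. l\<^sup>2 * (\<Sum>k\<in>box_set N. Re (fc (cp h j) k * cnj (fc (cp \<phi> j) k)))) \<longlonglongrightarrow> (\<Sum>j\<in>UNIV. \<integral>x. h x $ j * \<phi> x $ j \<partial>TL)"
    by (intro tendsto_sum parseval_real vsob_sq_int[OF h] vsob_sq_int[OF p])
  moreover have "(\<Sum>j\<in>UNIV. l\<^sup>2 * (\<Sum>k\<in>box_set N. Re (fc (cp h j) k * cnj (fc (cp \<phi> j) k)))) = pr 0 N h \<phi>" for N
    unfolding pr_def sum_distrib_left[symmetric] by (subst sum.swap) simp
  ultimately show ?thesis by (simp add: ip_sum[OF vsob_sq_int[OF h] vsob_sq_int[OF p]])
qed

lemma vsob_mono: "vsob t u \<Longrightarrow> s \<le> t \<Longrightarrow> vsob s u"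
  unfolding vsob_def using sob_mono(1) by blast

lemma pr_Upsilon_pair:
  assumes h: "vsob 1 h" and p: "vsob 1 \<phi>" shows "(\<lambda>N. pr \<alpha> N h \<phi>) \<longlonglongrightarrow> Upsilon_pair l \<alpha> h \<phi>"
proof -
  have dh: "sq_int TL (wpartial l i (cp h j))" and dp: "sq_int TL (wpartial l i (cp \<phi> j))" for i j
    using vsobD[OF h] vsobD[OF p] by (auto intro!: sob_sq_int sob_partial)
  have g: "ipm l (grad l h) (grad l \<phi>) = (\<Sum>j\<in>UNIV. \<Sum>i\<in>UNIV. \<integral>x. wpartial l i (cp h j) x * wpartial l i (cp \<phi> j) x \<partial>TL)"
    by (subst ipm_sum) (auto simp: grad_nth intro!: integrable_sq_int_mult dh dp)
  have "(\<lambda>N. \<Sum>j\<in>UNIV. \<Sum>i\<in>UNIV. l\<^sup>2 * (\<Sum>k\<in>box_set N. Re (fc (wpartial l i (cp h j)) k * cnj (fc (wpartial l i (cp \<phi> j)) k))))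
     \<longlonglongrightarrow> ipm l (grad l h) (grad l \<phi>)"
    unfolding g by (intro tendsto_sum parseval_real dh dp)
  moreover have "Re (fc (wpartial l i (cp h j)) k * cnj (fc (wpartial l i (cp \<phi> j)) k)) = (wave i k)\<^sup>2 * Re (fc (cp h j) k * cnj (fc (cp \<phi> j) k))" for i j k
    using sob_weak_partial(4)[OF sob_SucI(2)[OF vsobD[OF h]], of i j k] sob_weak_partial(4)[OF sob_SucI(2)[OF vsobD[OF p]], of i j k]
    by (simp add: power2_eq_square algebra_simps)
  moreover have "(\<Sum>j\<in>UNIV. \<Sum>i\<in>UNIV. l\<^sup>2 * (\<Sum>k\<in>box_set N. (wave i k)\<^sup>2 * Re (fc (cp h j) k * cnj (fc (cp \<phi> j) k)))) =
     l\<^sup>2 * (\<Sum>k\<in>box_set N. ((2 * pi / l)\<^sup>2 * kk k) * (\<Sum>j\<in>UNIV. Re (fc (cp h j) k * cnj (fc (cp \<phi> j) k))))" for N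
  proof -
    have "(\<Sum>j\<in>UNIV. \<Sum>i\<in>UNIV. l\<^sup>2 * (\<Sum>k\<in>box_set N. (wave i k)\<^sup>2 * Re (fc (cp h j) k * cnj (fc (cp \<phi> j) k)))) =
      l\<^sup>2 * (\<Sum>j\<in>UNIV. \<Sum>i\<in>UNIV. \<Sum>k\<in>box_set N. (wave i k)\<^sup>2 * Re (fc (cp h j) k * cnj (fc (cp \<phi> j) k)))"
      by (simp only: sum_distrib_left)
    also have "(\<Sum>j\<in>UNIV. \<Sum>i\<in>UNIV. \<Sum>k\<in>box_set N. (wave i k)\<^sup>2 * Re (fc (cp h j) k * cnj (fc (cp \<phi> j) k))) =
      (\<Sum>j\<in>UNIV. \<Sum>k\<in>box_set N. \<Sum>i\<in>UNIV. (wave i k)\<^sup>2 * Re (fc (cp h j) k * cnj (fc (cp \<phi> j) k)))"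
      by (rule sum.cong[OF refl], rule sum.swap)
    also have "\<dots> = (\<Sum>k\<in>box_set N. \<Sum>j\<in>UNIV. \<Sum>i\<in>UNIV. (wave i k)\<^sup>2 * Re (fc (cp h j) k * cnj (fc (cp \<phi> j) k)))"
      by (rule sum.swap)
    also have "\<dots> = (\<Sum>k\<in>box_set N. ((2 * pi / l)\<^sup>2 * kk k) * (\<Sum>j\<in>UNIV. Re (fc (cp h j) k * cnj (fc (cp \<phi> j) k))))"
      unfolding sum_distrib_right[symmetric] sum_wave by (simp only: sum_distrib_left)
    finally show ?thesis .
  qed
  ultimately have "(\<lambda>N. l\<^sup>2 * (\<Sum>k\<in>box_set N. ((2 * pi / l)\<^sup>2 * kk k) * (\<Sum>j\<in>UNIV. Re (fc (cp h j) k * cnj (fc (cp \<phi> j) k))))) \<longlonglongrightarrow> ipm l (grad l h) (grad l \<phi>)"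
    by (simp only:)
  from tendsto_add[OF pr_ip[OF vsob_mono[OF h] vsob_mono[OF p]] tendsto_mult[OF tendsto_const[of \<alpha>] this]]
  have "(\<lambda>N. pr 0 N h \<phi> + \<alpha> * (l\<^sup>2 * (\<Sum>k\<in>box_set N. ((2 * pi / l)\<^sup>2 * kk k) * (\<Sum>j\<in>UNIV. Re (fc (cp h j) k * cnj (fc (cp \<phi> j) k)))))) \<longlonglongrightarrow> Upsilon_pair l \<alpha> h \<phi>"
    by (simp add: Upsilon_pair_def)
  moreover have "pr 0 N h \<phi> + \<alpha> * (l\<^sup>2 * (\<Sum>k\<in>box_set N. ((2 * pi / l)\<^sup>2 * kk k) * (\<Sum>j\<in>UNIV. Re (fc (cp h j) k * cnj (fc (cp \<phi> j) k))))) = pr \<alpha> N h \<phi>" for N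
    unfolding pr_def by (simp add: distrib_left distrib_right sum.distrib sum_distrib_left mult_ac)
  ultimately show ?thesis by simp
qed

text \<open>The alternative of a vanishing coefficient covers the zero mode, where the symbol is 1
  but \<open>kk k ^ s\<close> is 0 for \<open>s > 0\<close>.\<close>

lemma pr_bound_gen:
  assumes w: "\<And>k j. 1 + \<alpha> * ((2 * pi / l)\<^sup>2 * kk k) \<le> W * kk k ^ s \<or> (fc (cp h j) k = 0)" and \<alpha>: "0 \<le> \<alpha>"
  shows "\<bar>pr \<alpha> N h \<phi>\<bar> \<le> l\<^sup>2 * W * (lset s N h * lset s N \<phi>)"
proof -
  let ?f = "\<lambda>u p. sqrt (kk (fst p) ^ s) * cmod (fc (cp u (snd p)) (fst p))"
  have W0: "0 \<le> W" if "fc (cp h j) k \<noteq> 0" for j k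
  proof -
    have "0 < 1 + \<alpha> * ((2 * pi / l)\<^sup>2 * kk k)" using \<alpha> by (intro add_pos_nonneg) auto
    then have "0 < W * kk k ^ s" using w[of k j] that by (meson order_less_le_trans)
    then show ?thesis by (metis kk_nonneg less_eq_real_def linorder_not_le mult_nonpos_nonneg zero_le_power)
  qed
  have "\<bar>\<Sum>k\<in>box_set N. (1 + \<alpha> * ((2 * pi / l)\<^sup>2 * kk k)) * (\<Sum>j\<in>UNIV. Re (fc (cp h j) k * cnj (fc (cp \<phi> j) k)))\<bar>
    = \<bar>\<Sum>p\<in>box_set N \<times> UNIV. (1 + \<alpha> * ((2 * pi / l)\<^sup>2 * kk (fst p))) * Re (fc (cp h (snd p)) (fst p) * cnj (fc (cp \<phi> (snd p)) (fst p)))\<bar>"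
    unfolding sum_distrib_left sum.cartesian_product by (simp add: case_prod_beta)
  also have "\<dots> \<le> (\<Sum>p\<in>box_set N \<times> UNIV. W * (\<bar>?f h p\<bar> * \<bar>?f \<phi> p\<bar>))"
  proof (rule order_trans[OF sum_abs sum_mono])
    fix p :: "(int \<times> int) \<times> 2"
    let ?a = "fc (cp h (snd p)) (fst p)" and ?b = "fc (cp \<phi> (snd p)) (fst p)"
    show "\<bar>(1 + \<alpha> * ((2 * pi / l)\<^sup>2 * kk (fst p))) * Re (?a * cnj ?b)\<bar> \<le> W * (\<bar>?f h p\<bar> * \<bar>?f \<phi> p\<bar>)"
    proof (cases "?a = 0")
      case False
      have "\<bar>(1 + \<alpha> * ((2 * pi / l)\<^sup>2 * kk (fst p))) * Re (?a * cnj ?b)\<bar> = (1 + \<alpha> * ((2 * pi / l)\<^sup>2 * kk (fst p))) * \<bar>Re (?a * cnj ?b)\<bar>"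
        using \<alpha> by (simp add: abs_mult del: times_complex.sel)
      also have "\<dots> \<le> (W * kk (fst p) ^ s) * (cmod ?a * cmod ?b)"
        using w[of "fst p" "snd p"] False abs_Re_le_cmod[of "?a * cnj ?b"] W0[OF False]
        by (intro mult_mono) (auto simp: norm_mult simp del: times_complex.sel)
      also have "\<dots> = W * (\<bar>?f h p\<bar> * \<bar>?f \<phi> p\<bar>)"
      proof -
        have "sqrt (kk (fst p) ^ s) * sqrt (kk (fst p) ^ s) = kk (fst p) ^ s" by simp
        then have "\<bar>?f h p\<bar> * \<bar>?f \<phi> p\<bar> = kk (fst p) ^ s * (cmod ?a * cmod ?b)"
          by (simp only: abs_mult abs_norm_cancel real_sqrt_abs2 mult_ac) (simp add: abs_mult mult_ac)
        then show ?thesis by (simp add: mult.assoc)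
      qed
      finally show ?thesis .
    qed simp
  qed
  also have "\<dots> = W * (\<Sum>p\<in>box_set N \<times> UNIV. \<bar>?f h p\<bar> * \<bar>?f \<phi> p\<bar>)" by (simp only: sum_distrib_left)
  also have "\<dots> \<le> W * (lset s N h * lset s N \<phi>)"
  proof (cases "\<exists>j k. fc (cp h j) k \<noteq> 0")
    case True
    then show ?thesis using W0 unfolding lset_def by (intro mult_left_mono L2_set_mult_ineq) auto
  next
    case False
    then have "fc (cp h j) k = 0" for j k by blast
    then show ?thesis by (simp add: lset_def L2_set_def)
  qed
  finally have "\<bar>\<Sum>k\<in>box_set N. (1 + \<alpha> * ((2 * pi / l)\<^sup>2 * kk k)) * (\<Sum>j\<in>UNIV. Re (fc (cp h j) k * cnj (fc (cp \<phi> j) k)))\<bar> \<le> W * (lset s N h * lset s N \<phi>)" .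
  then have "l\<^sup>2 * \<bar>\<Sum>k\<in>box_set N. (1 + \<alpha> * ((2 * pi / l)\<^sup>2 * kk k)) * (\<Sum>j\<in>UNIV. Re (fc (cp h j) k * cnj (fc (cp \<phi> j) k)))\<bar> \<le> l\<^sup>2 * (W * (lset s N h * lset s N \<phi>))"
    by (intro mult_left_mono) auto
  then show ?thesis unfolding pr_def by (simp only: abs_mult abs_power2 mult.assoc)
qed

lemma pr_bound1:
  assumes h: "vsob 1 h" and p: "vsob 1 \<phi>" and \<alpha>: "0 \<le> \<alpha>"
  shows "\<bar>pr \<alpha> N h \<phi>\<bar> \<le> l\<^sup>2 * (1 + \<alpha> * (2 * pi / l)\<^sup>2) * (Hnorm l 1 h * Hnorm l 1 \<phi>)"
proof -
  have "\<bar>pr \<alpha> N h \<phi>\<bar> \<le> l\<^sup>2 * (1 + \<alpha> * (2 * pi / l)\<^sup>2) * (lset 1 N h * lset 1 N \<phi>)"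
  proof (rule pr_bound_gen[OF _ \<alpha>])
    fix k j
    show "1 + \<alpha> * ((2 * pi / l)\<^sup>2 * kk k) \<le> (1 + \<alpha> * (2 * pi / l)\<^sup>2) * kk k ^ 1 \<or> fc (cp h j) k = 0"
      using kk_ge_1[of k] vsobD[OF h, of j] by (cases "k = 0") (auto simp: sob_def distrib_right)
  qed
  also have "\<dots> \<le> l\<^sup>2 * (1 + \<alpha> * (2 * pi / l)\<^sup>2) * (Hnorm l 1 h * Hnorm l 1 \<phi>)"
    using \<alpha> by (intro mult_left_mono mult_mono lset_le h p lset_nonneg Hnorm_nonneg mult_nonneg_nonneg add_nonneg_nonneg) auto
  finally show ?thesis .
qed

lemma pr_bound0:
  assumes h: "vsob 0 h" and p: "vsob 0 \<phi>"
  shows "\<bar>pr 0 N h \<phi>\<bar> \<le> norm2 l h * norm2 l \<phi>"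
proof -
  have "\<bar>pr 0 N h \<phi>\<bar> \<le> l\<^sup>2 * 1 * (lset 0 N h * lset 0 N \<phi>)" by (rule pr_bound_gen) auto
  also have "\<dots> \<le> l\<^sup>2 * 1 * (Hnorm l 0 h * Hnorm l 0 \<phi>)"
    by (intro mult_left_mono mult_mono lset_le h p lset_nonneg Hnorm_nonneg) auto
  finally show ?thesis by (simp add: norm2_eq_Hnorm[OF h] norm2_eq_Hnorm[OF p] power2_eq_square mult_ac)
qed

lemma ip_bound: assumes h: "vsob 0 h" and p: "vsob 0 \<phi>" shows "\<bar>ip l h \<phi>\<bar> \<le> norm2 l h * norm2 l \<phi>"
  by (rule tendsto_upperbound[OF tendsto_rabs[OF pr_ip[OF h p]]]) (auto simp: pr_bound0[OF h p])

lemma Upsilon_pair_bound: assumes h: "vsob 1 h" and p: "vsob 1 \<phi>" and \<alpha>: "0 \<le> \<alpha>"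
  shows "\<bar>Upsilon_pair l \<alpha> h \<phi>\<bar> \<le> l\<^sup>2 * (1 + \<alpha> * (2 * pi / l)\<^sup>2) * (Hnorm l 1 h * Hnorm l 1 \<phi>)"
  by (rule tendsto_upperbound[OF tendsto_rabs[OF pr_Upsilon_pair[OF h p]]]) (auto simp: pr_bound1[OF h p \<alpha>])

text \<open>The constant is the product of \<open>l\<^sup>2\<close> from Parseval and
  \<open>(2 * pi / l)\<^sup>2\<close> from the symbol. Dropping the 1 of the symbol already gives
  the inequality for truncations.\<close>

lemma Upsilon_pair_coercive: assumes h: "vsob 1 h" and \<alpha>: "0 \<le> \<alpha>"
  shows "\<alpha> * (2 * pi)\<^sup>2 * (Hnorm l 1 h)\<^sup>2 \<le> Upsilon_pair l \<alpha> h h"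
proof (rule LIMSEQ_le[OF tendsto_mult[OF tendsto_const tendsto_power[OF lset_limit[OF h]]] pr_Upsilon_pair[OF h h]], intro exI allI impI)
  fix N :: nat
  have "(lset 1 N h)\<^sup>2 = (\<Sum>k\<in>box_set N. sobolev_term l 1 h k)"
    unfolding lset_sq by (intro real_sqrt_pow2 sum_nonneg) (auto simp: sobolev_term_eq intro!: sum_nonneg)
  then have "\<alpha> * (2 * pi)\<^sup>2 * (lset 1 N h)\<^sup>2 = (\<Sum>k\<in>box_set N. \<alpha> * (2 * pi)\<^sup>2 * (kk k * (\<Sum>j\<in>UNIV. (cmod (fc (cp h j) k))\<^sup>2)))"
    by (simp only: sobolev_term_eq sum_distrib_left power_one_right)
  also have "\<dots> = l\<^sup>2 * (\<Sum>k\<in>box_set N. (\<alpha> * ((2 * pi / l)\<^sup>2 * kk k)) * (\<Sum>j\<in>UNIV. (cmod (fc (cp h j) k))\<^sup>2))"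
    unfolding sum_distrib_left[of "l\<^sup>2"] using l_pos by (intro sum.cong refl) (simp add: power_divide)
  also have "\<dots> \<le> l\<^sup>2 * (\<Sum>k\<in>box_set N. (1 + \<alpha> * ((2 * pi / l)\<^sup>2 * kk k)) * (\<Sum>j\<in>UNIV. (cmod (fc (cp h j) k))\<^sup>2))"
    by (intro mult_left_mono sum_mono mult_right_mono) (auto intro!: sum_nonneg)
  also have "\<dots> = pr \<alpha> N h h"
    unfolding pr_def mult_cnj_cmod Re_complex_of_real ..
  finally show "\<alpha> * (2 * pi)\<^sup>2 * (lset 1 N h)\<^sup>2 \<le> pr \<alpha> N h h" .
qed

lemma Upsilon_pair_commute: "Upsilon_pair l \<alpha> h \<phi> = Upsilon_pair l \<alpha> \<phi> h"
  by (simp add: Upsilon_pair_def ip_def ipm_def frob_eq inner_commute mult.commute)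

end

section \<open>Coefficients of paths and absolute continuity of the energy pairing\<close>

lemma powr2_nonneg: "0 \<le> (x::real) \<Longrightarrow> x powr 2 = x\<^sup>2"
  by (cases "x = 0") auto

lemma Lp_space2D:
  assumes f: "f \<in> Lp_space M 2 S N" and N: "\<And>u. 0 \<le> N u"
  shows "f \<in> M \<rightarrow>\<^sub>M borel_sn S N" "integrable M (\<lambda>x. (N (f x))\<^sup>2)" "(\<lambda>x. N (f x)) \<in> borel_measurable M"
    "x \<in> space M \<Longrightarrow> f x \<in> S" "sq_int M (\<lambda>x. N (f x))"
proof -
  show m: "f \<in> M \<rightarrow>\<^sub>M borel_sn S N" using f by (simp add: Lp_space_def)
  show i: "integrable M (\<lambda>x. (N (f x))\<^sup>2)" using f by (simp add: Lp_space_def powr2_nonneg[OF N])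
  have [measurable]: "(\<lambda>x. (N (f x))\<^sup>2) \<in> borel_measurable M" using i by (rule borel_measurable_integrable)
  have "(\<lambda>x. sqrt ((N (f x))\<^sup>2)) \<in> borel_measurable M" by measurable
  then show m2: "(\<lambda>x. N (f x)) \<in> borel_measurable M" using N by simp
  show "x \<in> space M \<Longrightarrow> f x \<in> S" using measurable_space[OF m] by (simp add: space_borel_sn)
  show "sq_int M (\<lambda>x. N (f x))" using i m2 by (simp add: sq_int_def)
qed

lemma sq_int_time_integrable:
  fixes f :: "real \<Rightarrow> real"
  assumes "sq_int (time_interval T) f" shows "integrable (time_interval T) f"
proof -
  interpret finite_measure "time_interval T" by (rule finite_measure_time)
  have "sq_int (time_interval T) (\<lambda>_. 1::real)" by (simp add: sq_int_def)
  from integrable_sq_int_mult[OF this assms] show ?thesis by simp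
qed

context flat_torus
begin

lemma fc_le_Hnorm: assumes u: "vsob s u" shows "cmod (fc (cp u j) k) \<le> Hnorm l s u"
proof (cases "k = 0")
  case True
  then show ?thesis using vsobD[OF u, of j] Hnorm_nonneg by (simp add: sob_def)
next
  case False
  have "(cmod (fc (cp u j) k))\<^sup>2 \<le> kk k ^ s * (cmod (fc (cp u j) k))\<^sup>2"
    using one_le_power[OF kk_ge_1[OF False], of s] mult_right_mono[of 1 "kk k ^ s" "(cmod (fc (cp u j) k))\<^sup>2"] by simp
  also have "\<dots> \<le> (hn s (cp u j))\<^sup>2" unfolding hn_sq
    using finite_sum_le_infsum[of "\<lambda>k. kk k ^ s * (cmod (fc (cp u j) k))\<^sup>2" UNIV "{k}"] vsobD[OF u, of j] by (simp add: sob_def)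
  also have "\<dots> \<le> (Hnorm l s u)\<^sup>2" by (rule power_mono[OF hn_le_Hnorm[OF u]]) simp
  finally show ?thesis by (rule power2_le_imp_le[OF _ Hnorm_nonneg])
qed

lemma coef_continuous:
  assumes u: "in_C T S (Hnorm l s) u" and S: "\<And>w. w \<in> S \<Longrightarrow> vsob s w"
  shows "continuous_on {0..T} (\<lambda>t. fc (cp (u t) j) k)"
  unfolding continuous_on_def
proof
  fix t assume t: "t \<in> {0..T}"
  have ut: "vsob s (u t)" using u t S by (auto simp: in_C_def)
  have "((\<lambda>r. fc (cp (u r) j) k - fc (cp (u t) j) k) \<longlongrightarrow> 0) (at t within {0..T})"
  proof (rule Lim_null_comparison)
    show "((\<lambda>r. Hnorm l s (u r - u t)) \<longlongrightarrow> 0) (at t within {0..T})" using u t by (simp add: in_C_def)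
    have "norm (fc (cp (u r) j) k - fc (cp (u t) j) k) \<le> Hnorm l s (u r - u t)" if "r \<in> {0..T}" for r
    proof -
      have ur: "vsob s (u r)" using u that S by (auto simp: in_C_def)
      show ?thesis using fc_le_Hnorm[OF vsob_diff[OF ur ut], of j k] fc_diff_field[OF ur ut, of j k] by simp
    qed
    then show "\<forall>\<^sub>F r in at t within {0..T}. norm (fc (cp (u r) j) k - fc (cp (u t) j) k) \<le> Hnorm l s (u r - u t)"
      by (auto simp: eventually_at_filter)
  qed
  then show "((\<lambda>t. fc (cp (u t) j) k) \<longlongrightarrow> fc (cp (u t) j) k) (at t within {0..T})" by (simp add: LIM_zero_iff)
qed

lemma Hnorm_path_continuous:
  assumes u: "in_C T S (Hnorm l s) u" and S: "\<And>w. w \<in> S \<Longrightarrow> vsob s w"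
  shows "continuous_on {0..T} (\<lambda>t. Hnorm l s (u t))"
  unfolding continuous_on_def
proof
  fix t assume t: "t \<in> {0..T}"
  have ut: "vsob s (u t)" using u t S by (auto simp: in_C_def)
  have "((\<lambda>r. Hnorm l s (u r) - Hnorm l s (u t)) \<longlongrightarrow> 0) (at t within {0..T})"
  proof (rule Lim_null_comparison)
    show "((\<lambda>r. Hnorm l s (u r - u t)) \<longlongrightarrow> 0) (at t within {0..T})" using u t by (simp add: in_C_def)
    have "norm (Hnorm l s (u r) - Hnorm l s (u t)) \<le> Hnorm l s (u r - u t)" if "r \<in> {0..T}" for r
      using Hnorm_diff_abs[OF _ ut, of "u r"] u that S by (auto simp: in_C_def)
    then show "\<forall>\<^sub>F r in at t within {0..T}. norm (Hnorm l s (u r) - Hnorm l s (u t)) \<le> Hnorm l s (u r - u t)"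
      by (auto simp: eventually_at_filter)
  qed
  then show "((\<lambda>t. Hnorm l s (u t)) \<longlongrightarrow> Hnorm l s (u t)) (at t within {0..T})" by (simp add: LIM_zero_iff)
qed

lemma coef_measurable:
  assumes u: "u \<in> M \<rightarrow>\<^sub>M borel_sn S (Hnorm l s)" and S: "\<And>w. w \<in> S \<Longrightarrow> vsob s w"
  shows "(\<lambda>t. fc (cp (u t) j) k) \<in> borel_measurable M"
proof (rule measurable_compose[OF u])
  show "(\<lambda>u. fc (cp u j) k) \<in> borel_measurable (borel_sn S (Hnorm l s))"
  proof (rule borel_sn_lipschitz[of _ _ 1])
    fix u w assume "u \<in> S" "w \<in> S"
    then have uw: "vsob s u" "vsob s w" using S by auto
    show "norm (fc (cp w j) k - fc (cp u j) k) \<le> 1 * Hnorm l s (w - u)"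
      using fc_le_Hnorm[OF vsob_diff[OF uw(2,1)], of j k] fc_diff_field[OF uw(2,1), of j k] by simp
  qed (rule Hnorm_nonneg)
qed

lemma coef_measurable_L2:
  assumes u: "u \<in> M \<rightarrow>\<^sub>M borel_sn (L2dot l) (norm2 l)"
  shows "(\<lambda>t. fc (cp (u t) j) k) \<in> borel_measurable M"
proof (rule measurable_compose[OF u])
  show "(\<lambda>u. fc (cp u j) k) \<in> borel_measurable (borel_sn (L2dot l) (norm2 l))"
  proof (rule borel_sn_lipschitz[of _ _ "1 / l"])
    fix u w assume "u \<in> L2dot l" "w \<in> L2dot l"
    then have uw: "vsob 0 u" "vsob 0 w" by (auto simp: L2dot_iff)
    show "norm (fc (cp w j) k - fc (cp u j) k) \<le> 1 / l * norm2 l (w - u)"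
      using fc_le_Hnorm[OF vsob_diff[OF uw(2,1)], of j k] fc_diff_field[OF uw(2,1), of j k] l_pos
      by (simp add: norm2_eq_Hnorm[OF vsob_diff[OF uw(2,1)]])
  qed simp
qed

lemma fc_real_parts:
  assumes f: "integrable TL f"
  shows "Re (fc f k) = (\<integral>x. f x * trig {k} (\<lambda>_. 1) x \<partial>TL) / l\<^sup>2" "Im (fc f k) = - (\<integral>x. f x * trig {k} (\<lambda>_. - \<i>) x \<partial>TL) / l\<^sup>2"
proof -
  have i: "integrable TL (\<lambda>x. complex_of_real (f x) * cnj (expo k x))"
    using f by (intro integrable_mult_expo) auto
  have "Re (\<integral>x. complex_of_real (f x) * cnj (expo k x) \<partial>TL) = (\<integral>x. f x * trig {k} (\<lambda>_. 1) x \<partial>TL)"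
    "Im (\<integral>x. complex_of_real (f x) * cnj (expo k x) \<partial>TL) = - (\<integral>x. f x * trig {k} (\<lambda>_. - \<i>) x \<partial>TL)"
    unfolding integral_Re[OF i, symmetric] integral_Im[OF i, symmetric] by (simp_all add: trig_def)
  then show "Re (fc f k) = (\<integral>x. f x * trig {k} (\<lambda>_. 1) x \<partial>TL) / l\<^sup>2" "Im (fc f k) = - (\<integral>x. f x * trig {k} (\<lambda>_. - \<i>) x \<partial>TL) / l\<^sup>2"
    by (simp_all add: fc_def fco_def Re_divide_of_real[symmetric] Im_divide_of_real[symmetric] flip: of_real_power)
qed

text \<open>The test field is a cosine or sine wave in component \<open>j\<close>. It has mean zero,
  as \<open>L2dot\<close> requires, only for \<open>k \<noteq> 0\<close>; for \<open>k = 0\<close>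
  the coefficients of the path and of its derivative vanish identically.\<close>

lemma coef_ac:
  assumes T: "0 < T" and u: "in_C T (spaceV l) (Hnorm l 1) u"
    and u': "u' \<in> Lp_space (time_interval T) 2 (spaceV l) (Hnorm l 1)" and d: "has_time_deriv l T u u'"
  shows "ac T (\<lambda>t. Re (fc (cp (u t) j) k)) (\<lambda>t. Re (fc (cp (u' t) j) k))"
    "ac T (\<lambda>t. Im (fc (cp (u t) j) k)) (\<lambda>t. Im (fc (cp (u' t) j) k))"
proof -
  note L = Lp_space2D[OF u' Hnorm_nonneg]
  have uv: "vsob 1 (u t)" and uv': "vsob 1 (u' t)" if "t \<in> {0..T}" for t
    using u L(4)[of t] that by (auto simp: in_C_def space_time intro: spaceV_vsob)
  have cc: "continuous_on {0..T} (\<lambda>t. fc (cp (u t) j) k)" by (rule coef_continuous[OF u spaceV_vsob])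
  have mm: "(\<lambda>t. fc (cp (u' t) j) k) \<in> borel_measurable (time_interval T)" by (rule coef_measurable[OF L(1) spaceV_vsob])
  have ii: "integrable (time_interval T) (\<lambda>t. fc (cp (u' t) j) k)"
    by (rule Bochner_Integration.integrable_bound[OF sq_int_time_integrable[OF L(5)] mm])
       (auto intro!: AE_I2 simp: space_time fc_le_Hnorm[OF uv'] Hnorm_nonneg)
  have main: "ac T f g" if k: "k \<noteq> 0" and f: "continuous_on {0..T} f" and g: "integrable (time_interval T) g"
    and fz: "\<And>t. t \<in> {0..T} \<Longrightarrow> f t = \<sigma> * (\<integral>x. u t x $ j * trig {k} (\<lambda>_. c) x \<partial>TL)"
    and gz: "\<And>t. t \<in> {0..T} \<Longrightarrow> g t = \<sigma> * (\<integral>x. u' t x $ j * trig {k} (\<lambda>_. c) x \<partial>TL)" for f g \<sigma> c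
  proof (rule weak_time_derivative_ac[OF T f g])
    define \<zeta> :: vfield where "\<zeta> x = axis j (trig {k} (\<lambda>_. c) x)" for x
    have \<zeta>: "\<zeta> \<in> L2dot l"
    proof (rule L2dotI)
      fix i
      have cz: "cp \<zeta> i = (if i = j then trig {k} (\<lambda>_. c) else (\<lambda>x. 0))" by (auto simp: \<zeta>_def axis_def)
      have L2: "L2p (trig {k} (\<lambda>_. c))" by (simp add: L2p_def periodic_trig sq_int_trig)
      have "(\<integral>x. trig {k} (\<lambda>_. c) x \<partial>TL) = Re (\<integral>x. c * expo k x \<partial>TL)"
        using integral_Re[of TL "\<lambda>x. c * expo k x"] integrable_sq_int[OF sq_int_cmult[OF sq_int_expo]] by (simp add: trig_def)
      also have "\<dots> = 0" using k by (simp add: integral_expo)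
      finally have "fc (trig {k} (\<lambda>_. c)) 0 = 0" using fc_zero_iff[OF L2p_integrable[OF L2]] by simp
      then show "L2p (cp \<zeta> i)" "fc (cp \<zeta> i) 0 = 0" unfolding cz using L2 sob_L2p[OF sob_zero] sob_zero[of 0] by (auto simp: sob_def)
    qed
    have ipz: "ip l w \<zeta> = (\<integral>x. w x $ j * trig {k} (\<lambda>_. c) x \<partial>TL)" for w :: vfield
      unfolding ip_def \<zeta>_def by (simp add: inner_axis)
    fix \<eta> :: "real \<Rightarrow> real" assume sm: "smooth1 \<eta>" and cs: "\<exists>a b. 0 < a \<and> b < T \<and> (\<forall>t. t \<notin> {a..b} \<longrightarrow> \<eta> t = 0)"
    have "(\<integral>t. deriv \<eta> t * ip l (u t) \<zeta> \<partial>time_interval T) = - (\<integral>t. \<eta> t * ip l (u' t) \<zeta> \<partial>time_interval T)"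
      using d sm cs \<zeta> unfolding has_time_deriv_def smooth1_def by blast
    then have "\<sigma> * (\<integral>t. deriv \<eta> t * ip l (u t) \<zeta> \<partial>time_interval T) = - (\<sigma> * (\<integral>t. \<eta> t * ip l (u' t) \<zeta> \<partial>time_interval T))" by simp
    moreover have "(\<integral>t. deriv \<eta> t * f t \<partial>time_interval T) = (\<integral>t. \<sigma> * (deriv \<eta> t * ip l (u t) \<zeta>) \<partial>time_interval T)"
      by (rule Bochner_Integration.integral_cong) (auto simp: space_time fz ipz)
    moreover have "(\<integral>t. \<eta> t * g t \<partial>time_interval T) = (\<integral>t. \<sigma> * (\<eta> t * ip l (u' t) \<zeta>) \<partial>time_interval T)"
      by (rule Bochner_Integration.integral_cong) (auto simp: space_time gz ipz)
    ultimately show "(\<integral>t. deriv \<eta> t * f t \<partial>time_interval T) = - (\<integral>t. \<eta> t * g t \<partial>time_interval T)"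
      by (simp only: integral_mult_right_zero)
  qed
  have zero: "ac T f g" if "\<And>t. t \<in> {0..T} \<Longrightarrow> f t = 0" "\<And>t. t \<in> {0..T} \<Longrightarrow> g t = 0" for f g :: "real \<Rightarrow> real"
  proof -
    have z: "(\<integral>s. g s \<partial>time_interval t) = 0" if t: "t \<in> {0..T}" for t
    proof -
      have "(\<integral>s. g s \<partial>time_interval t) = (\<integral>s. 0 \<partial>time_interval t)"
        by (rule Bochner_Integration.integral_cong) (use t \<open>\<And>t. t \<in> {0..T} \<Longrightarrow> g t = 0\<close> in \<open>auto simp: space_time\<close>)
      then show ?thesis by simp
    qed
    have "integrable (time_interval T) g \<longleftrightarrow> integrable (time_interval T) (\<lambda>s. 0 :: real)"
      by (rule Bochner_Integration.integrable_cong) (use that in \<open>auto simp: space_time\<close>)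
    then show ?thesis unfolding ac_def using z that T by simp
  qed
  have z0: "fc (cp (u t) j) 0 = 0" "fc (cp (u' t) j) 0 = 0" if "t \<in> {0..T}" for t
    using vsobD[OF uv[OF that], of j] vsobD[OF uv'[OF that], of j] by (auto simp: sob_def)
  show "ac T (\<lambda>t. Re (fc (cp (u t) j) k)) (\<lambda>t. Re (fc (cp (u' t) j) k))"
  proof (cases "k = 0")
    case True then show ?thesis using z0 by (intro zero) auto
  next
    case False
    then show ?thesis
      by (rule main[where \<sigma>="1 / l\<^sup>2" and c=1])
         (use cc ii fc_real_parts(1)[OF integrable_sq_int[OF vsob_sq_int[OF uv]]] fc_real_parts(1)[OF integrable_sq_int[OF vsob_sq_int[OF uv']]] in \<open>auto intro: continuous_intros\<close>)
  qed
  show "ac T (\<lambda>t. Im (fc (cp (u t) j) k)) (\<lambda>t. Im (fc (cp (u' t) j) k))"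
  proof (cases "k = 0")
    case True then show ?thesis using z0 by (intro zero) auto
  next
    case False
    then show ?thesis
      by (rule main[where \<sigma>="- 1 / l\<^sup>2" and c="- \<i>"])
         (use cc ii fc_real_parts(2)[OF integrable_sq_int[OF vsob_sq_int[OF uv]]] fc_real_parts(2)[OF integrable_sq_int[OF vsob_sq_int[OF uv']]] in \<open>auto intro: continuous_intros\<close>)
  qed
qed

text \<open>The time regularity shared by solutions of the linearized and of the adjoint equation,
  with \<open>u'\<close> as explicit derivative, so that every statement about paths serves
  both.\<close>

definition vpath :: "real \<Rightarrow> (real \<Rightarrow> vfield) \<Rightarrow> (real \<Rightarrow> vfield) \<Rightarrow> bool" where
  "vpath T u u' \<longleftrightarrow> in_C T (spaceV l) (Hnorm l 1) u \<and>
     u' \<in> Lp_space (time_interval T) 2 (spaceV l) (Hnorm l 1) \<and> has_time_deriv l T u u'"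

lemma vpathD:
  assumes "vpath T u u'"
  shows "t \<in> {0..T} \<Longrightarrow> u t \<in> spaceV l" "t \<in> {0..T} \<Longrightarrow> vsob 1 (u t)" "t \<in> {0..T} \<Longrightarrow> vsob 1 (u' t)"
    "sq_int (time_interval T) (\<lambda>t. Hnorm l 1 (u' t))" "continuous_on {0..T} (\<lambda>t. Hnorm l 1 (u t))"
proof -
  have u: "in_C T (spaceV l) (Hnorm l 1) u" and u': "u' \<in> Lp_space (time_interval T) 2 (spaceV l) (Hnorm l 1)"
    using assms by (auto simp: vpath_def)
  note L = Lp_space2D[OF u' Hnorm_nonneg]
  show "t \<in> {0..T} \<Longrightarrow> u t \<in> spaceV l" using u by (simp add: in_C_def)
  then show "t \<in> {0..T} \<Longrightarrow> vsob 1 (u t)" by (rule spaceV_vsob)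
  show "t \<in> {0..T} \<Longrightarrow> vsob 1 (u' t)" using L(4)[of t] by (auto simp: space_time intro: spaceV_vsob)
  show "sq_int (time_interval T) (\<lambda>t. Hnorm l 1 (u' t))" by (rule L(5))
  show "continuous_on {0..T} (\<lambda>t. Hnorm l 1 (u t))" by (rule Hnorm_path_continuous[OF u spaceV_vsob])
qed

lemma pr_ac:
  assumes T: "0 < T" and u: "vpath T u u'" and w: "vpath T w w'"
  shows "ac T (\<lambda>t. pr \<alpha> N (u t) (w t)) (\<lambda>s. pr \<alpha> N (u' s) (w s) + pr \<alpha> N (u s) (w' s))"
proof -
  note cu = coef_ac[OF T, of u u'] and cw = coef_ac[OF T, of w w']
  have "ac T (\<lambda>t. l\<^sup>2 * (\<Sum>k\<in>box_set N. (1 + \<alpha> * ((2 * pi / l)\<^sup>2 * kk k)) * (\<Sum>j\<in>UNIV.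
      Re (fc (cp (u t) j) k) * Re (fc (cp (w t) j) k) + Im (fc (cp (u t) j) k) * Im (fc (cp (w t) j) k))))
    (\<lambda>t. l\<^sup>2 * (\<Sum>k\<in>box_set N. (1 + \<alpha> * ((2 * pi / l)\<^sup>2 * kk k)) * (\<Sum>j\<in>UNIV.
      (Re (fc (cp (u' t) j) k) * Re (fc (cp (w t) j) k) + Re (fc (cp (u t) j) k) * Re (fc (cp (w' t) j) k)) +
      (Im (fc (cp (u' t) j) k) * Im (fc (cp (w t) j) k) + Im (fc (cp (u t) j) k) * Im (fc (cp (w' t) j) k)))))"
    using u w unfolding vpath_def by (intro ac_cmult ac_sum ac_add ac_mult cu cw) auto
  moreover have "(\<lambda>t. l\<^sup>2 * (\<Sum>k\<in>box_set N. (1 + \<alpha> * ((2 * pi / l)\<^sup>2 * kk k)) * (\<Sum>j\<in>UNIV.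
      Re (fc (cp (u t) j) k) * Re (fc (cp (w t) j) k) + Im (fc (cp (u t) j) k) * Im (fc (cp (w t) j) k)))) = (\<lambda>t. pr \<alpha> N (u t) (w t))"
    by (simp add: pr_def)
  moreover have "(\<lambda>t. l\<^sup>2 * (\<Sum>k\<in>box_set N. (1 + \<alpha> * ((2 * pi / l)\<^sup>2 * kk k)) * (\<Sum>j\<in>UNIV.
      (Re (fc (cp (u' t) j) k) * Re (fc (cp (w t) j) k) + Re (fc (cp (u t) j) k) * Re (fc (cp (w' t) j) k)) +
      (Im (fc (cp (u' t) j) k) * Im (fc (cp (w t) j) k) + Im (fc (cp (u t) j) k) * Im (fc (cp (w' t) j) k))))) =
      (\<lambda>s. pr \<alpha> N (u' s) (w s) + pr \<alpha> N (u s) (w' s))"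
  proof
    fix t
    have "(\<Sum>j\<in>UNIV. (Re (fc (cp (u' t) j) k) * Re (fc (cp (w t) j) k) + Re (fc (cp (u t) j) k) * Re (fc (cp (w' t) j) k)) +
      (Im (fc (cp (u' t) j) k) * Im (fc (cp (w t) j) k) + Im (fc (cp (u t) j) k) * Im (fc (cp (w' t) j) k))) =
      (\<Sum>j\<in>UNIV. Re (fc (cp (u' t) j) k * cnj (fc (cp (w t) j) k))) + (\<Sum>j\<in>UNIV. Re (fc (cp (u t) j) k * cnj (fc (cp (w' t) j) k)))" for k
      by (simp add: sum.distrib)
    then show "l\<^sup>2 * (\<Sum>k\<in>box_set N. (1 + \<alpha> * ((2 * pi / l)\<^sup>2 * kk k)) * (\<Sum>j\<in>UNIV.
      (Re (fc (cp (u' t) j) k) * Re (fc (cp (w t) j) k) + Re (fc (cp (u t) j) k) * Re (fc (cp (w' t) j) k)) +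
      (Im (fc (cp (u' t) j) k) * Im (fc (cp (w t) j) k) + Im (fc (cp (u t) j) k) * Im (fc (cp (w' t) j) k)))) =
      pr \<alpha> N (u' t) (w t) + pr \<alpha> N (u t) (w' t)"
      unfolding pr_def by (simp only: distrib_left sum.distrib)
  qed
  ultimately show ?thesis by (simp only:)
qed

text \<open>The product rule is exact for \<open>pr\<close>, a finite sum of products of absolutely
  continuous coefficients. The limit is dominated by the continuous norms of the paths times the
  square-integrable norms of their derivatives.\<close>

theorem Upsilon_pair_ac:
  assumes T: "0 < T" and \<alpha>: "0 \<le> \<alpha>" and u: "vpath T u u'" and w: "vpath T w w'"
  shows "ac T (\<lambda>t. Upsilon_pair l \<alpha> (u t) (w t)) (\<lambda>s. Upsilon_pair l \<alpha> (u' s) (w s) + Upsilon_pair l \<alpha> (u s) (w' s))"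
proof -
  define \<kappa> where "\<kappa> = l\<^sup>2 * (1 + \<alpha> * (2 * pi / l)\<^sup>2)"
  have \<kappa>: "0 \<le> \<kappa>" unfolding \<kappa>_def using \<alpha> by (intro mult_nonneg_nonneg add_nonneg_nonneg) auto
  note D = vpathD[OF u] and E = vpathD[OF w]
  define q where "q N s = pr \<alpha> N (u' s) (w s) + pr \<alpha> N (u s) (w' s)" for N s
  define Q where "Q s = Upsilon_pair l \<alpha> (u' s) (w s) + Upsilon_pair l \<alpha> (u s) (w' s)" for s
  define b where "b s = \<kappa> * (Hnorm l 1 (w s) * Hnorm l 1 (u' s) + Hnorm l 1 (u s) * Hnorm l 1 (w' s))" for s
  note pa = pr_ac[OF T u w, of \<alpha>]
  have lim: "(\<lambda>N. q N s) \<longlonglongrightarrow> Q s" if "s \<in> {0..T}" for s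
    unfolding q_def Q_def using that by (intro tendsto_add pr_Upsilon_pair D E)
  have qm: "q N \<in> borel_measurable (time_interval T)" for N
    using ac_integrable[OF pa[of N]] unfolding q_def[abs_def] by auto
  have Qm: "Q \<in> borel_measurable (time_interval T)"
    by (rule borel_measurable_LIMSEQ_real[where u=q]) (use lim qm in \<open>auto simp: space_time\<close>)
  have bi: "integrable (time_interval T) b" unfolding b_def
    by (intro integrable_mult_right Bochner_Integration.integrable_add time_bounded_mult D(5) E(5) sq_int_time_integrable D(4) E(4))
  have qb: "\<bar>q N s\<bar> \<le> b s" if s: "s \<in> {0..T}" for N s
  proof -
    have "\<bar>pr \<alpha> N (u' s) (w s)\<bar> \<le> \<kappa> * (Hnorm l 1 (u' s) * Hnorm l 1 (w s))" "\<bar>pr \<alpha> N (u s) (w' s)\<bar> \<le> \<kappa> * (Hnorm l 1 (u s) * Hnorm l 1 (w' s))"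
      unfolding \<kappa>_def using s by (auto intro!: pr_bound1 D E \<alpha>)
    then show ?thesis unfolding q_def b_def by (simp add: distrib_left mult.commute[of "Hnorm l 1 (w s)"])
  qed
  have Qb: "\<bar>Q s\<bar> \<le> b s" if "s \<in> {0..T}" for s
    by (rule tendsto_upperbound[OF tendsto_rabs[OF lim[OF that]]]) (auto simp: qb[OF that])
  have Qi: "integrable (time_interval T) Q"
    by (rule Bochner_Integration.integrable_bound[OF bi Qm]) (auto intro!: AE_I2 order_trans[OF Qb] simp: space_time)
  have "Upsilon_pair l \<alpha> (u t) (w t) = Upsilon_pair l \<alpha> (u 0) (w 0) + (\<integral>s. Q s \<partial>time_interval t)" if t: "t \<in> {0..T}" for t
  proof -
    have "(\<lambda>N. \<integral>s. q N s \<partial>time_interval t) \<longlonglongrightarrow> (\<integral>s. Q s \<partial>time_interval t)"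
    proof (rule integral_dominated_convergence[where w=b])
      show "Q \<in> borel_measurable (time_interval t)" "\<And>N. q N \<in> borel_measurable (time_interval t)" "integrable (time_interval t) b"
        using t Qm qm bi by (auto intro: measurable_time_sub integrable_time_sub)
    qed (use t lim qb in \<open>auto intro!: AE_I2 simp: space_time\<close>)
    then have "(\<lambda>N. pr \<alpha> N (u 0) (w 0) + (\<integral>s. q N s \<partial>time_interval t)) \<longlonglongrightarrow> Upsilon_pair l \<alpha> (u 0) (w 0) + (\<integral>s. Q s \<partial>time_interval t)"
      using T by (intro tendsto_add pr_Upsilon_pair D E) auto
    moreover have eq: "pr \<alpha> N (u 0) (w 0) + (\<integral>s. q N s \<partial>time_interval t) = pr \<alpha> N (u t) (w t)" for N
      unfolding q_def by (rule acD[OF pa t, symmetric])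
    ultimately have "(\<lambda>N. pr \<alpha> N (u t) (w t)) \<longlonglongrightarrow> Upsilon_pair l \<alpha> (u 0) (w 0) + (\<integral>s. Q s \<partial>time_interval t)" by (simp only: eq)
    then show ?thesis by (rule LIMSEQ_unique[rotated]) (intro pr_Upsilon_pair D E t)
  qed
  then show ?thesis using Qi unfolding ac_def Q_def[abs_def] by blast
qed

end

section \<open>Energy estimate and duality along a single path\<close>

lemma measure_time: "0 \<le> T \<Longrightarrow> measure (time_interval T) (space (time_interval T)) = T"
  unfolding space_time unfolding time_interval_def by (simp add: measure_restrict_space)

lemma integral_time_const: "0 \<le> T \<Longrightarrow> (\<integral>s. c \<partial>time_interval T) = c * (T::real)"
  by (simp add: measure_time mult.commute)

lemma AE_time_sub: "t \<le> T \<Longrightarrow> AE s in time_interval T. P s \<Longrightarrow> AE s in time_interval t. P s"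
  unfolding AE_time by (auto elim!: eventually_mono)

lemma integral_time_mono_nonneg:
  fixes F :: "real \<Rightarrow> real"
  assumes F: "integrable (time_interval T) F" "AE s in time_interval T. 0 \<le> F s" and t: "t \<le> T"
  shows "(\<integral>s. F s \<partial>time_interval t) \<le> (\<integral>s. F s \<partial>time_interval T)"
proof -
  have "(\<integral>s. F s \<partial>time_interval t) = (\<integral>s. indicator {0..t} s * F s \<partial>time_interval T)"
    unfolding integral_time by (rule Bochner_Integration.integral_cong) (use t in \<open>auto simp: indicator_def\<close>)
  also have "\<dots> \<le> (\<integral>s. F s \<partial>time_interval T)"
  proof (rule integral_mono_AE)
    have [measurable]: "F \<in> borel_measurable (time_interval T)" using F(1) by auto
    show "integrable (time_interval T) (\<lambda>s. indicator {0..t} s * F s)"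
      by (rule Bochner_Integration.integrable_bound[OF F(1)]) (auto simp: indicator_def)
    show "AE s in time_interval T. indicator {0..t} s * F s \<le> F s" using F(2) by eventually_elim (auto simp: indicator_def)
  qed (rule F)
  finally show ?thesis .
qed

context flat_torus
begin

lemma Upsilon_pair_ac_self:
  assumes T: "0 < T" and \<alpha>: "0 \<le> \<alpha>" and u: "vpath T u u'"
  shows "ac T (\<lambda>t. Upsilon_pair l \<alpha> (u t) (u t)) (\<lambda>s. 2 * Upsilon_pair l \<alpha> (u' s) (u s))"
proof -
  have "(\<lambda>s. Upsilon_pair l \<alpha> (u' s) (u s) + Upsilon_pair l \<alpha> (u s) (u' s)) = (\<lambda>s. 2 * Upsilon_pair l \<alpha> (u' s) (u s))"
    using Upsilon_pair_commute[of \<alpha> "u _" "u' _"] by simp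
  then show ?thesis using Upsilon_pair_ac[OF T \<alpha> u u] by simp
qed

text \<open>Young's inequality splits the source term, the resulting L^2 norm is absorbed by means
  of 1 \<le> 1 + a^2, and coercivity exchanges the H^1 norm for the energy itself.\<close>

lemma energy_inequality:
  assumes \<alpha>: "0 < \<alpha>" and C: "0 \<le> C" and m: "vsob 1 m"
    and le: "X \<le> P * norm2 l m + C * (1 + a\<^sup>2) * (Hnorm l 1 m)\<^sup>2"
  shows "2 * X \<le> P\<^sup>2 + (l\<^sup>2 + 2 * C) / (\<alpha> * (2 * pi)\<^sup>2) * (1 + a\<^sup>2) * Upsilon_pair l \<alpha> m m"
proof -
  have c0: "0 < \<alpha> * (2 * pi)\<^sup>2" using \<alpha> by simp
  have "2 * (P * norm2 l m) \<le> P\<^sup>2 + (norm2 l m)\<^sup>2"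
    using zero_le_power2[of "P - norm2 l m"] by (simp add: power2_eq_square algebra_simps)
  moreover have "(norm2 l m)\<^sup>2 \<le> l\<^sup>2 * (Hnorm l 1 m)\<^sup>2"
    using power_mono[OF norm2_le_Hnorm[OF m], of 2] by (simp add: power_mult_distrib)
  moreover have "l\<^sup>2 * (Hnorm l 1 m)\<^sup>2 \<le> l\<^sup>2 * ((1 + a\<^sup>2) * (Hnorm l 1 m)\<^sup>2)"
    by (intro mult_left_mono) (auto simp: distrib_right)
  moreover have "(l\<^sup>2 + 2 * C) * (1 + a\<^sup>2) * (Hnorm l 1 m)\<^sup>2 = l\<^sup>2 * ((1 + a\<^sup>2) * (Hnorm l 1 m)\<^sup>2) + 2 * (C * (1 + a\<^sup>2) * (Hnorm l 1 m)\<^sup>2)"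
    by (simp add: algebra_simps)
  ultimately have "2 * X \<le> P\<^sup>2 + (l\<^sup>2 + 2 * C) * (1 + a\<^sup>2) * (Hnorm l 1 m)\<^sup>2"
    using le by linarith
  also have "(l\<^sup>2 + 2 * C) * (1 + a\<^sup>2) * (Hnorm l 1 m)\<^sup>2 =
     (l\<^sup>2 + 2 * C) / (\<alpha> * (2 * pi)\<^sup>2) * (1 + a\<^sup>2) * (\<alpha> * (2 * pi)\<^sup>2 * (Hnorm l 1 m)\<^sup>2)"
    using \<alpha> by simp
  also have "\<dots> \<le> (l\<^sup>2 + 2 * C) / (\<alpha> * (2 * pi)\<^sup>2) * (1 + a\<^sup>2) * Upsilon_pair l \<alpha> m m"
    using C c0 by (intro mult_left_mono Upsilon_pair_coercive m mult_nonneg_nonneg) (auto simp: \<alpha> less_imp_le)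
  finally show ?thesis by simp
qed

lemma norm2_le_energy:
  assumes \<alpha>: "0 < \<alpha>" and m: "vsob 1 m"
  shows "(norm2 l m)\<^sup>2 \<le> l\<^sup>2 / (\<alpha> * (2 * pi)\<^sup>2) * Upsilon_pair l \<alpha> m m"
proof -
  have "(norm2 l m)\<^sup>2 \<le> l\<^sup>2 * (Hnorm l 1 m)\<^sup>2"
    using power_mono[OF norm2_le_Hnorm[OF m], of 2] by (simp add: power_mult_distrib)
  also have "\<dots> = l\<^sup>2 / (\<alpha> * (2 * pi)\<^sup>2) * (\<alpha> * (2 * pi)\<^sup>2 * (Hnorm l 1 m)\<^sup>2)" using \<alpha> by simp
  also have "\<dots> \<le> l\<^sup>2 / (\<alpha> * (2 * pi)\<^sup>2) * Upsilon_pair l \<alpha> m m"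
    using \<alpha> by (intro mult_left_mono Upsilon_pair_coercive m) auto
  finally show ?thesis .
qed

text \<open>The Gronwall rate: \<open>l\<^sup>2\<close> stems from Young's inequality for the
  source, \<open>2 * C\<close> from the bound of the form, and the denominator is the coercivity
  constant.\<close>

definition kap :: "real \<Rightarrow> real \<Rightarrow> real" where "kap \<alpha> C = (l\<^sup>2 + 2 * C) / (\<alpha> * (2 * pi)\<^sup>2)"

lemma kap_pos: "0 < \<alpha> \<Longrightarrow> 0 \<le> C \<Longrightarrow> 0 < kap \<alpha> C"
  unfolding kap_def using l_pos by (intro divide_pos_pos add_pos_nonneg mult_pos_pos) auto

text \<open>Gronwall acts on the energy, a squared norm, so the final square root halves the
  exponent. The summand 1 in the rate yields a factor depending only on \<open>T\<close>, separated
  from the one that depends on the coefficient.\<close>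

lemma energy_estimate:
  assumes T: "0 < T" and \<alpha>: "0 < \<alpha>" and C: "0 \<le> C" and m: "vpath T m m'"
    and P: "integrable (time_interval T) (\<lambda>t. (P t)\<^sup>2)" and a: "integrable (time_interval T) (\<lambda>t. (a t)\<^sup>2)"
    and z: "Upsilon_pair l \<alpha> (m 0) (m 0) = 0"
    and ae: "AE t in time_interval T. Upsilon_pair l \<alpha> (m' t) (m t) \<le>
           P t * norm2 l (m t) + C * (1 + (a t)\<^sup>2) * (Hnorm l 1 (m t))\<^sup>2"
    and t: "t \<in> {0..T}"
  shows "norm2 l (m t) \<le> sqrt (l\<^sup>2 / (\<alpha> * (2 * pi)\<^sup>2)) * sqrt (\<integral>s. (P s)\<^sup>2 \<partial>time_interval T) *
     exp (kap \<alpha> C / 2 * T) * exp (kap \<alpha> C / 2 * (\<integral>s. (a s)\<^sup>2 \<partial>time_interval T))"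
proof -
  define E where "E t = Upsilon_pair l \<alpha> (m t) (m t)" for t
  define k where "k t = kap \<alpha> C * (1 + (a t)\<^sup>2)" for t
  define A where "A = (\<integral>s. (P s)\<^sup>2 \<partial>time_interval T)"
  have A0: "0 \<le> A" by (simp add: A_def)
  interpret F: finite_measure "time_interval T" by (rule finite_measure_time)
  note D = vpathD[OF m]
  have Eac: "ac T E (\<lambda>s. 2 * Upsilon_pair l \<alpha> (m' s) (m s))"
    unfolding E_def[abs_def] by (rule Upsilon_pair_ac_self[OF T less_imp_le[OF \<alpha>] m])
  have Ec: "continuous_on {0..T} E" by (rule ac_continuous[OF Eac])
  have ki: "integrable (time_interval T) k" unfolding k_def using a by auto
  have k0: "0 \<le> k t" for t using kap_pos[OF \<alpha> C] by (simp add: k_def)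
  have kE: "integrable (time_interval T) (\<lambda>s. k s * E s)" using time_bounded_mult[OF Ec ki] by (simp add: mult.commute)
  have Pi: "integrable (time_interval s) (\<lambda>s. (P s)\<^sup>2)" "integrable (time_interval s) (\<lambda>s. k s * E s)"
    "integrable (time_interval s) (\<lambda>s. 2 * Upsilon_pair l \<alpha> (m' s) (m s))" if "s \<in> {0..T}" for s
    using that integrable_time_sub[OF _ P, of s] integrable_time_sub[OF _ kE, of s] integrable_time_sub[OF _ ac_integrable[OF Eac], of s] by auto
  have Ple: "(\<integral>s. (P s)\<^sup>2 \<partial>time_interval s) \<le> A" if "s \<in> {0..T}" for s
    unfolding A_def by (rule integral_time_mono_nonneg[OF P]) (use that in auto)
  have "E t \<le> A * exp (\<integral>s. k s \<partial>time_interval T)"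
  proof -
    have ae': "AE s in time_interval T. 2 * Upsilon_pair l \<alpha> (m' s) (m s) \<le> (P s)\<^sup>2 + k s * E s"
      using ae AE_space unfolding k_def E_def kap_def
      by eventually_elim (rule energy_inequality[OF \<alpha> C D(2)], auto simp: space_time)
    have "E t \<le> A * exp (\<integral>s. k s \<partial>time_interval t)"
    proof (rule gronwall[OF Ec ki k0 _ A0 t])
      fix s assume s: "s \<in> {0..T}"
      have "E s = (\<integral>r. 2 * Upsilon_pair l \<alpha> (m' r) (m r) \<partial>time_interval s)" using acD[OF Eac s] z by (simp add: E_def)
      also have "\<dots> \<le> (\<integral>r. (P r)\<^sup>2 + k r * E r \<partial>time_interval s)"
        using s by (intro integral_mono_AE Bochner_Integration.integrable_add Pi AE_time_sub[OF _ ae']) auto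
      also have "\<dots> = (\<integral>r. (P r)\<^sup>2 \<partial>time_interval s) + (\<integral>r. k r * E r \<partial>time_interval s)" using Pi[OF s] by simp
      finally show "E s \<le> A + (\<integral>r. k r * E r \<partial>time_interval s)" using Ple[OF s] by simp
    qed
    also have "\<dots> \<le> A * exp (\<integral>s. k s \<partial>time_interval T)"
      using A0 t k0 by (intro mult_left_mono) (auto intro!: integral_time_mono_nonneg[OF ki])
    finally show ?thesis .
  qed
  also have "(\<integral>s. k s \<partial>time_interval T) = kap \<alpha> C * T + kap \<alpha> C * (\<integral>s. (a s)\<^sup>2 \<partial>time_interval T)"
    unfolding k_def using a T by (simp add: integral_time_const distrib_left measure_time)
  finally have "E t \<le> A * exp (kap \<alpha> C * T + kap \<alpha> C * (\<integral>s. (a s)\<^sup>2 \<partial>time_interval T))" .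
  then have "(norm2 l (m t))\<^sup>2 \<le> l\<^sup>2 / (\<alpha> * (2 * pi)\<^sup>2) * (A * exp (kap \<alpha> C * T + kap \<alpha> C * (\<integral>s. (a s)\<^sup>2 \<partial>time_interval T)))"
    using norm2_le_energy[OF \<alpha> D(2)[OF t]] \<alpha> unfolding E_def by (meson mult_left_mono order_trans divide_nonneg_pos mult_pos_pos zero_le_power2 zero_less_power pi_gt_zero zero_less_numeral less_imp_le divide_nonneg_nonneg mult_nonneg_nonneg)
  also have "\<dots> = (sqrt (l\<^sup>2 / (\<alpha> * (2 * pi)\<^sup>2)) * sqrt A * exp (kap \<alpha> C / 2 * T) * exp (kap \<alpha> C / 2 * (\<integral>s. (a s)\<^sup>2 \<partial>time_interval T)))\<^sup>2"
  proof -
    have "(exp (x / 2))\<^sup>2 = exp x" for x :: real by (simp add: power2_eq_square exp_add[symmetric])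
    from this[of "kap \<alpha> C * T"] this[of "kap \<alpha> C * (\<integral>s. (a s)\<^sup>2 \<partial>time_interval T)"] show ?thesis
      using A0 \<alpha> by (simp add: power_mult_distrib exp_add)
  qed
  finally show ?thesis unfolding A_def[symmetric] by (rule power2_le_imp_le) (use A0 \<alpha> in auto)
qed

lemma Hnorm_same_zero:
  assumes s: "same_field l u (\<lambda>x. 0)" and u: "vsob 1 u" shows "Hnorm l 1 u = 0"
proof -
  have "fc (cp u j) k = fc (\<lambda>x. 0) k" for j k
    by (rule fc_cong_AE) (use s vsob_sq_int[OF u, of j] in \<open>auto simp: same_field_def sq_int_def elim!: eventually_mono\<close>)
  then have "fc (cp u j) k = 0" for j k by (simp add: fc_def fco_def)
  then show ?thesis by (simp add: Hnorm_def sobolev_term_eq)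
qed

lemma Upsilon_pair_zero:
  assumes s: "same_field l u (\<lambda>x. 0)" and u: "vsob 1 u" and w: "vsob 1 w" and \<alpha>: "0 \<le> \<alpha>"
  shows "Upsilon_pair l \<alpha> u w = 0"
  using Upsilon_pair_bound[OF u w \<alpha>] Hnorm_same_zero[OF s u] by simp

lemma pr0_measurable:
  assumes f: "\<And>j k. (\<lambda>t. fc (cp (f t) j) k) \<in> borel_measurable M" and g: "\<And>j k. (\<lambda>t. fc (cp (g t) j) k) \<in> borel_measurable M"
  shows "(\<lambda>t. pr 0 N (f t) (g t)) \<in> borel_measurable M"
proof -
  note [measurable] = f g
  show ?thesis unfolding pr_def by measurable
qed

lemma path_coef_measurable:
  assumes u: "in_C T S (Hnorm l s) u" and S: "\<And>w. w \<in> S \<Longrightarrow> vsob s w"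
  shows "(\<lambda>t. fc (cp (u t) j) k) \<in> borel_measurable (time_interval T)"
proof -
  have "sets (time_interval T) = sets (restrict_space borel {0..T})"
    unfolding time_interval_def by (rule sets_restrict_space_cong) simp
  then show ?thesis using borel_measurable_continuous_on_restrict[OF coef_continuous[OF assms]] measurable_cong_sets by blast
qed

lemma ip_time_integrable:
  assumes f: "f \<in> Lp_space (time_interval T) 2 (L2dot l) (norm2 l)" and m: "vpath T m m'"
  shows "integrable (time_interval T) (\<lambda>t. ip l (f t) (m t))"
    "(\<lambda>N. \<integral>t. pr 0 N (f t) (m t) \<partial>time_interval T) \<longlonglongrightarrow> (\<integral>t. ip l (f t) (m t) \<partial>time_interval T)"
    "\<And>B. (\<And>t. t \<in> {0..T} \<Longrightarrow> norm2 l (m t) \<le> B) \<Longrightarrow> 0 < T \<Longrightarrow>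
       \<bar>\<integral>t. ip l (f t) (m t) \<partial>time_interval T\<bar> \<le> B * (sqrt T * sqrt (\<integral>t. (norm2 l (f t))\<^sup>2 \<partial>time_interval T))"
proof -
  let ?M = "time_interval T"
  interpret F: finite_measure ?M by (rule finite_measure_time)
  note L = Lp_space2D[OF f norm2_nonneg]
  note D = vpathD[OF m]
  have mC: "in_C T (spaceV l) (Hnorm l 1) m" using m by (simp add: vpath_def)
  have f0: "vsob 0 (f t)" and m0: "vsob 0 (m t)" if "t \<in> {0..T}" for t
    using L(4)[of t] that vsob_mono[OF D(2)[OF that], of 0] by (auto simp: space_time L2dot_iff)
  have qm: "(\<lambda>t. pr 0 N (f t) (m t)) \<in> borel_measurable ?M" for N
    by (intro pr0_measurable coef_measurable_L2[OF L(1)] path_coef_measurable[OF mC spaceV_vsob])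
  have lim: "(\<lambda>N. pr 0 N (f t) (m t)) \<longlonglongrightarrow> ip l (f t) (m t)" if "t \<in> {0..T}" for t by (intro pr_ip f0 m0 that)
  have im: "(\<lambda>t. ip l (f t) (m t)) \<in> borel_measurable ?M"
    by (rule borel_measurable_LIMSEQ_real[where u="\<lambda>N t. pr 0 N (f t) (m t)"]) (use lim qm in \<open>auto simp: space_time\<close>)
  define b where "b t = (l * Hnorm l 1 (m t)) * norm2 l (f t)" for t
  have bi: "integrable ?M b" unfolding b_def
    by (intro time_bounded_mult continuous_intros D(5) sq_int_time_integrable L(5))
  have bb: "norm2 l (f t) * norm2 l (m t) \<le> b t" if "t \<in> {0..T}" for t
    unfolding b_def using mult_left_mono[OF norm2_le_Hnorm[OF D(2)[OF that]] norm2_nonneg[of "f t"]] by (simp add: mult.commute)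
  have ib: "\<bar>ip l (f t) (m t)\<bar> \<le> b t" if "t \<in> {0..T}" for t
    using ip_bound[OF f0[OF that] m0[OF that]] bb[OF that] by simp
  show ii: "integrable ?M (\<lambda>t. ip l (f t) (m t))"
    by (rule Bochner_Integration.integrable_bound[OF bi im]) (auto intro!: AE_I2 order_trans[OF ib] simp: space_time)
  show "(\<lambda>N. \<integral>t. pr 0 N (f t) (m t) \<partial>?M) \<longlonglongrightarrow> (\<integral>t. ip l (f t) (m t) \<partial>?M)"
  proof (rule integral_dominated_convergence[OF im qm bi])
    show "AE t in ?M. (\<lambda>N. pr 0 N (f t) (m t)) \<longlonglongrightarrow> ip l (f t) (m t)" using lim by (auto intro!: AE_I2 simp: space_time)
    show "AE t in ?M. norm (pr 0 N (f t) (m t)) \<le> b t" for N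
      using order_trans[OF pr_bound0 bb] f0 m0 by (auto intro!: AE_I2 simp: space_time)
  qed
  fix B assume B: "\<And>t. t \<in> {0..T} \<Longrightarrow> norm2 l (m t) \<le> B" and T: "0 < T"
  have B0: "0 \<le> B" using order_trans[OF norm2_nonneg B[of 0]] T by simp
  have fi: "integrable ?M (\<lambda>t. norm2 l (f t))" by (rule sq_int_time_integrable[OF L(5)])
  have "\<bar>\<integral>t. ip l (f t) (m t) \<partial>?M\<bar> \<le> (\<integral>t. \<bar>ip l (f t) (m t)\<bar> \<partial>?M)" by (rule integral_abs_bound)
  also have "\<dots> \<le> (\<integral>t. B * norm2 l (f t) \<partial>?M)"
  proof (rule integral_mono_AE)
    show "AE t in ?M. \<bar>ip l (f t) (m t)\<bar> \<le> B * norm2 l (f t)"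
    proof (rule AE_I2)
      fix t assume "t \<in> space ?M"
      then have t: "t \<in> {0..T}" by (simp add: space_time)
      have "\<bar>ip l (f t) (m t)\<bar> \<le> norm2 l (f t) * norm2 l (m t)" by (rule ip_bound[OF f0[OF t] m0[OF t]])
      also have "\<dots> \<le> norm2 l (f t) * B" by (intro mult_left_mono B t) simp
      finally show "\<bar>ip l (f t) (m t)\<bar> \<le> B * norm2 l (f t)" by (simp add: mult.commute)
    qed
  qed (use ii fi in auto)
  also have "\<dots> = B * (\<integral>t. norm2 l (f t) \<partial>?M)" by simp
  also have "(\<integral>t. norm2 l (f t) \<partial>?M) \<le> sqrt T * sqrt (\<integral>t. (norm2 l (f t))\<^sup>2 \<partial>?M)"
  proof -
    have o: "sq_int ?M (\<lambda>_. 1::real)" by (simp add: sq_int_def)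
    show ?thesis using Cauchy_Schwarz_norm(1)[OF o L(5)] T by (simp add: l2norm_def measure_time)
  qed
  finally show "\<bar>\<integral>t. ip l (f t) (m t) \<partial>?M\<bar> \<le> B * (sqrt T * sqrt (\<integral>t. (norm2 l (f t))\<^sup>2 \<partial>?M))"
    using B0 by (simp add: mult_left_mono)
qed

text \<open>The equations are combined before integration, so the common term \<open>L\<close>
  cancels at almost every time and only integrable pairings remain. The boundary terms vanish
  because each endpoint annihilates one of the two factors.\<close>

theorem pathwise_duality:
  assumes T: "0 < T" and \<alpha>: "0 \<le> \<alpha>"
    and m: "vpath T m m'" and p: "vpath T p p'" and m0: "same_field l (m 0) (\<lambda>x. 0)" and pT: "same_field l (p T) (\<lambda>x. 0)"
    and \<psi>: "\<psi> \<in> Lp_space (time_interval T) 2 (L2dot l) (norm2 l)" and g: "g \<in> Lp_space (time_interval T) 2 (L2dot l) (norm2 l)"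
    and e1: "AE t in time_interval T. Upsilon_pair l \<alpha> (m' t) (p t) = ip l (\<psi> t) (p t) + L t"
    and e2: "AE t in time_interval T. - Upsilon_pair l \<alpha> (p' t) (m t) = ip l (g t) (m t) + L t"
  shows "(\<integral>t. ip l (\<psi> t) (p t) \<partial>time_interval T) = (\<integral>t. ip l (g t) (m t) \<partial>time_interval T)"
proof -
  let ?M = "time_interval T"
  note D = vpathD[OF m] and E = vpathD[OF p]
  have T0: "0 \<in> {0..T}" "T \<in> {0..T}" using T by auto
  note uac = Upsilon_pair_ac[OF T \<alpha> m p]
  have "Upsilon_pair l \<alpha> (m T) (p T) = 0"
    using Upsilon_pair_zero[OF pT E(2)[OF T0(2)] D(2)[OF T0(2)] \<alpha>] by (simp add: Upsilon_pair_commute)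
  moreover have "Upsilon_pair l \<alpha> (m 0) (p 0) = 0" by (rule Upsilon_pair_zero[OF m0 D(2)[OF T0(1)] E(2)[OF T0(1)] \<alpha>])
  ultimately have "(\<integral>s. Upsilon_pair l \<alpha> (m' s) (p s) + Upsilon_pair l \<alpha> (m s) (p' s) \<partial>?M) = 0"
    using acD[OF uac T0(2)] by simp
  moreover have "(\<integral>s. Upsilon_pair l \<alpha> (m' s) (p s) + Upsilon_pair l \<alpha> (m s) (p' s) \<partial>?M) = (\<integral>s. ip l (\<psi> s) (p s) - ip l (g s) (m s) \<partial>?M)"
  proof (rule integral_cong_AE)
    show "(\<lambda>s. Upsilon_pair l \<alpha> (m' s) (p s) + Upsilon_pair l \<alpha> (m s) (p' s)) \<in> borel_measurable ?M"
      using ac_integrable[OF uac] by auto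
    show "(\<lambda>s. ip l (\<psi> s) (p s) - ip l (g s) (m s)) \<in> borel_measurable ?M"
      using ip_time_integrable(1)[OF \<psi> p] ip_time_integrable(1)[OF g m] by auto
    show "AE s in ?M. Upsilon_pair l \<alpha> (m' s) (p s) + Upsilon_pair l \<alpha> (m s) (p' s) = ip l (\<psi> s) (p s) - ip l (g s) (m s)"
      using e1 e2 by eventually_elim (simp add: Upsilon_pair_commute[of \<alpha> "m _"])
  qed
  ultimately show ?thesis using ip_time_integrable(1)[OF \<psi> p] ip_time_integrable(1)[OF g m] by simp
qed

end

section \<open>Dependence on the random parameter\<close>

lemma (in complete_measure) borel_measurable_AE_eq:
  assumes h: "h \<in> borel_measurable M" and ae: "AE x in M. f x = h x"
  shows "f \<in> borel_measurable M"
proof (rule measurableI)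
  fix A :: "'b set" assume A: "A \<in> sets borel"
  show "f -` A \<inter> space M \<in> sets M"
  proof (rule in_sets_AE)
    show "h -` A \<inter> space M \<in> sets M" using h A by (rule measurable_sets)
    show "AE x in M. (x \<in> h -` A \<inter> space M) = (x \<in> f -` A \<inter> space M)" using ae by eventually_elim auto
  qed auto
qed simp

lemma (in complete_measure) borel_measurable_AE_limit:
  fixes X :: "nat \<Rightarrow> 'a \<Rightarrow> real"
  assumes [measurable]: "\<And>n. X n \<in> borel_measurable M" and lim: "AE x in M. (\<lambda>n. X n x) \<longlonglongrightarrow> Y x"
  shows "Y \<in> borel_measurable M"
proof (rule borel_measurable_AE_eq)
  show "(\<lambda>x. lim (\<lambda>n. X n x)) \<in> borel_measurable M" by measurable
  show "AE x in M. Y x = lim (\<lambda>n. X n x)" using lim by eventually_elim (simp add: limI)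
qed

text \<open>Replacing \<open>B\<close> by its Bernstein polynomials leaves finitely many values of
  \<open>B\<close> multiplied by integrals of \<open>A\<close> against fixed functions. This
  separates the two factors: one is sampled at fixed times, the other enters through continuous
  functionals.\<close>

lemma bernstein_integral_limit:
  fixes A B :: "real \<Rightarrow> real"
  assumes T: "0 < T" and A: "integrable (time_interval T) A" and B: "continuous_on {0..T} B"
  shows "(\<lambda>n. \<Sum>i\<le>n. B (T * (real i / real n)) * (\<integral>t. A t * Bernstein n i (t / T) \<partial>time_interval T)) \<longlonglongrightarrow> (\<integral>t. A t * B t \<partial>time_interval T)"
proof (rule LIMSEQ_I)
  fix e :: real assume e: "0 < e"
  let ?M = "time_interval T"
  define I where "I = (\<integral>t. \<bar>A t\<bar> \<partial>?M)"
  have I0: "0 \<le> I" by (simp add: I_def)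
  define d where "d = e / (I + 1)"
  have d: "0 < d" using e I0 by (simp add: d_def)
  have c: "continuous_on {0..1} (\<lambda>x. B (T * x))"
    by (rule continuous_on_compose2[OF B]) (use T in \<open>auto intro!: continuous_intros simp: mult_left_le\<close>)
  obtain N where N: "\<And>n x. N \<le> n \<Longrightarrow> x \<in> {0..1} \<Longrightarrow> \<bar>B (T * x) - (\<Sum>k\<le>n. B (T * (real k / real n)) * Bernstein n k x)\<bar> < d"
    using Bernstein_Weierstrass[OF c d] by auto
  have bc: "continuous_on {0..T} (\<lambda>t. Bernstein n i (t / T))" for n i
    unfolding Bernstein_def by (intro continuous_intros) (use T in auto)
  have i1: "integrable ?M (\<lambda>t. A t * Bernstein n i (t / T))" for n i
    using time_bounded_mult[OF bc A] by (simp add: mult.commute)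
  have i2: "integrable ?M (\<lambda>t. A t * B t)" using time_bounded_mult[OF B A] by (simp add: mult.commute)
  have "norm ((\<Sum>i\<le>n. B (T * (real i / real n)) * (\<integral>t. A t * Bernstein n i (t / T) \<partial>?M)) - (\<integral>t. A t * B t \<partial>?M)) < e" if n: "N \<le> n" for n
  proof -
    let ?S = "\<lambda>t. \<Sum>i\<le>n. B (T * (real i / real n)) * Bernstein n i (t / T)"
    have i3: "integrable ?M (\<lambda>t. \<Sum>i\<le>n. B (T * (real i / real n)) * (A t * Bernstein n i (t / T)))"
      by (intro Bochner_Integration.integrable_sum integrable_mult_right i1)
    have "(\<Sum>i\<le>n. B (T * (real i / real n)) * (\<integral>t. A t * Bernstein n i (t / T) \<partial>?M)) =
       (\<integral>t. (\<Sum>i\<le>n. B (T * (real i / real n)) * (A t * Bernstein n i (t / T))) \<partial>?M)"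
      by (subst Bochner_Integration.integral_sum) (auto intro!: i1)
    then have "(\<Sum>i\<le>n. B (T * (real i / real n)) * (\<integral>t. A t * Bernstein n i (t / T) \<partial>?M)) - (\<integral>t. A t * B t \<partial>?M) =
       (\<integral>t. (\<Sum>i\<le>n. B (T * (real i / real n)) * (A t * Bernstein n i (t / T))) - A t * B t \<partial>?M)"
      using i3 i2 by simp
    then have "norm ((\<Sum>i\<le>n. B (T * (real i / real n)) * (\<integral>t. A t * Bernstein n i (t / T) \<partial>?M)) - (\<integral>t. A t * B t \<partial>?M)) \<le>
       (\<integral>t. \<bar>(\<Sum>i\<le>n. B (T * (real i / real n)) * (A t * Bernstein n i (t / T))) - A t * B t\<bar> \<partial>?M)"
      by (simp only: real_norm_def integral_abs_bound)
    also have "\<dots> \<le> (\<integral>t. d * \<bar>A t\<bar> \<partial>?M)"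
    proof (rule integral_mono_AE)
      show "AE t in ?M. \<bar>(\<Sum>i\<le>n. B (T * (real i / real n)) * (A t * Bernstein n i (t / T))) - A t * B t\<bar> \<le> d * \<bar>A t\<bar>"
      proof (rule AE_I2)
        fix t assume "t \<in> space ?M"
        then have t: "t / T \<in> {0..1}" using T by (auto simp: space_time)
        have "(\<Sum>i\<le>n. B (T * (real i / real n)) * (A t * Bernstein n i (t / T))) = A t * ?S t"
          by (simp only: sum_distrib_left mult_ac)
        then have "\<bar>(\<Sum>i\<le>n. B (T * (real i / real n)) * (A t * Bernstein n i (t / T))) - A t * B t\<bar> = \<bar>A t\<bar> * \<bar>B t - ?S t\<bar>"
          by (simp only: right_diff_distrib[symmetric] abs_mult abs_minus_commute[of "?S t"])
        also have "\<dots> \<le> \<bar>A t\<bar> * d" using N[OF n t] T by (intro mult_left_mono) auto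
        finally show "\<bar>(\<Sum>i\<le>n. B (T * (real i / real n)) * (A t * Bernstein n i (t / T))) - A t * B t\<bar> \<le> d * \<bar>A t\<bar>" by (simp only: mult.commute)
      qed
    qed (use i2 i3 A in auto)
    also have "\<dots> = d * I" by (simp add: I_def)
    also have "\<dots> < e" unfolding d_def using e I0 by (simp add: field_simps)
    finally show ?thesis .
  qed
  then show "\<exists>no. \<forall>n\<ge>no. norm ((\<Sum>i\<le>n. B (T * (real i / real n)) * (\<integral>t. A t * Bernstein n i (t / T) \<partial>?M)) - (\<integral>t. A t * B t \<partial>?M)) < e"
    by blast
qed

context flat_torus
begin

text \<open>Valid for every field: if the series diverges, the supremum is infinite and
  \<open>enn2real\<close> sends it to 0, the default value of \<open>infsum\<close>. Measurability
  of the norm thus holds also along paths that lie in the space only at almost every time.\<close>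

lemma Hnorm_sq_SUP: "(Hnorm l s u)\<^sup>2 = enn2real (SUP N. ennreal (\<Sum>k\<in>box_set N. sobolev_term l s u k))"
proof -
  let ?f = "sobolev_term l s u"
  have f0: "0 \<le> ?f k" for k by (auto simp: sobolev_term_eq intro!: sum_nonneg)
  have H: "(Hnorm l s u)\<^sup>2 = infsum ?f UNIV" unfolding Hnorm_def using f0 by (intro real_sqrt_pow2 infsum_nonneg)
  have inc: "incseq (\<lambda>N. ennreal (\<Sum>k\<in>box_set N. ?f k))"
    by (intro incseq_SucI ennreal_leI sum_mono2) (use f0 box_mono in auto)
  show ?thesis
  proof (cases "?f summable_on UNIV")
    case True
    then have "(\<lambda>N. ennreal (\<Sum>k\<in>box_set N. ?f k)) \<longlonglongrightarrow> ennreal (infsum ?f UNIV)"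
      by (intro tendsto_ennrealI has_sum_box) simp
    then have "(SUP N. ennreal (\<Sum>k\<in>box_set N. ?f k)) = ennreal (infsum ?f UNIV)"
      using LIMSEQ_unique[OF LIMSEQ_SUP[OF inc]] by blast
    then show ?thesis using f0 by (simp add: H infsum_nonneg)
  next
    case False
    have top: "(SUP N. ennreal (\<Sum>k\<in>box_set N. ?f k)) = \<top>"
    proof (rule ccontr)
      assume "(SUP N. ennreal (\<Sum>k\<in>box_set N. ?f k)) \<noteq> \<top>"
      then obtain B where B: "0 \<le> B" "(SUP N. ennreal (\<Sum>k\<in>box_set N. ?f k)) = ennreal B" by (cases "SUP N. ennreal (\<Sum>k\<in>box_set N. ?f k)") auto
      have le: "(\<Sum>k\<in>box_set N. ?f k) \<le> B" for N
        using SUP_upper[of N UNIV "\<lambda>N. ennreal (\<Sum>k\<in>box_set N. ?f k)"] B by (simp add: ennreal_le_iff)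
      have "sum ?f F \<le> B" if F: "finite F" for F
      proof -
        obtain N where "F \<subseteq> box_set N" using box_exhaust[OF F] by blast
        then have "sum ?f F \<le> (\<Sum>k\<in>box_set N. ?f k)" using f0 by (intro sum_mono2) auto
        then show ?thesis using le[of N] by simp
      qed
      then have "?f summable_on UNIV"
        by (intro nonneg_bdd_above_summable_on) (use f0 in \<open>auto simp: bdd_above_def\<close>)
      then show False using False by simp
    qed
    show ?thesis by (simp only: top H infsum_not_exists[OF False] enn2real_top)
  qed
qed

lemma Hnorm_sq_measurable:
  assumes u: "\<And>j k. (\<lambda>t. fc (cp (u t) j) k) \<in> borel_measurable M"
  shows "(\<lambda>t. (Hnorm l s (u t))\<^sup>2) \<in> borel_measurable M"
proof -
  note [measurable] = u
  have [measurable]: "(\<lambda>t. sobolev_term l s (u t) k) \<in> borel_measurable M" for k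
    unfolding sobolev_term_eq by measurable
  show ?thesis unfolding Hnorm_sq_SUP by measurable
qed

abbreviation L2L2 :: "real \<Rightarrow> (real \<Rightarrow> vfield) set" where
  "L2L2 T \<equiv> Lp_space (time_interval T) 2 (L2dot l) (norm2 l)"

lemma Lp_norm2_eq: "Lp_norm (time_interval T) 2 (norm2 l) f = sqrt (\<integral>t. (norm2 l (f t))\<^sup>2 \<partial>time_interval T)"
  unfolding Lp_norm_def powr2_nonneg[OF norm2_nonneg] by (simp add: powr_half_sqrt)

text \<open>The functional is Lipschitz in the L^2 norm over time. The work lies in showing that the
  norm of \<open>w - u\<close> is measurable and square-integrable in time; otherwise
  \<open>Lp_norm\<close> of the difference could be the default value 0 of a non-existing
  integral.\<close>

lemma coef_functional_measurable:
  assumes \<beta>: "continuous_on {0..T} \<beta>" and r: "r = Re \<or> r = Im"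
  shows "(\<lambda>g. \<integral>t. r (fc (cp (g t) j) k) * \<beta> t \<partial>time_interval T) \<in> borel_measurable (borel_sn (L2L2 T) (Lp_norm (time_interval T) 2 (norm2 l)))"
proof -
  let ?M = "time_interval T"
  interpret F: finite_measure ?M by (rule finite_measure_time)
  obtain B where B: "\<And>t. t \<in> {0..T} \<Longrightarrow> \<bar>\<beta> t\<bar> \<le> B" using continuous_time_bounded[OF \<beta>] by blast
  have rl: "r (z - w) = r z - r w" "\<bar>r z\<bar> \<le> cmod z" for z w using r abs_Re_le_cmod abs_Im_le_cmod by auto
  have rm: "(\<lambda>t. r (X t)) \<in> borel_measurable ?M" if "X \<in> borel_measurable ?M" for X using r that by auto
  show ?thesis
  proof (rule borel_sn_lipschitz[of _ _ "\<bar>B\<bar> / l * l2norm ?M (\<lambda>_. 1::real)"])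
    show "0 \<le> Lp_norm ?M 2 (norm2 l) u" for u by (simp add: Lp_norm2_eq)
    fix u w assume u: "u \<in> L2L2 T" and w: "w \<in> L2L2 T"
    note Lu = Lp_space2D[OF u norm2_nonneg] and Lw = Lp_space2D[OF w norm2_nonneg]
    have cm: "(\<lambda>t. fc (cp (u t) j) k) \<in> borel_measurable ?M" "(\<lambda>t. fc (cp (w t) j) k) \<in> borel_measurable ?M" for j k
      by (auto intro!: coef_measurable_L2 Lu Lw)
    have v0: "vsob 0 (u t)" "vsob 0 (w t)" if "t \<in> {0..T}" for t using Lu(4)[of t] Lw(4)[of t] that by (auto simp: space_time L2dot_iff)
    have dm: "(\<lambda>t. norm2 l ((w - u) t)) \<in> borel_measurable ?M"
    proof (rule borel_measurable_LIMSEQ_real[where u="\<lambda>N t. l * lset 0 N (w t - u t)"])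
      fix t assume "t \<in> space ?M"
      then have v: "vsob 0 (w t - u t)" by (auto simp: space_time intro!: vsob_diff v0)
      from tendsto_mult[OF tendsto_const lset_limit[OF v]]
      show "(\<lambda>N. l * lset 0 N (w t - u t)) \<longlonglongrightarrow> norm2 l ((w - u) t)" by (simp add: norm2_eq_Hnorm[OF v])
    next
      fix N
      note [measurable] = cm
      have "(\<lambda>t. l * L2_set (\<lambda>p. sqrt (kk (fst p) ^ 0) * cmod (fc (cp (w t) (snd p)) (fst p) - fc (cp (u t) (snd p)) (fst p))) (box_set N \<times> UNIV)) \<in> borel_measurable ?M"
        unfolding L2_set_def by measurable
      then show "(\<lambda>t. l * lset 0 N (w t - u t)) \<in> borel_measurable ?M"
        by (rule measurable_cong[THEN iffD1, rotated]) (simp only: space_time lset_def fc_diff_field[OF v0(2) v0(1)])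
    qed
    have dle: "(norm2 l ((w - u) t))\<^sup>2 \<le> 2 * (norm2 l (w t))\<^sup>2 + 2 * (norm2 l (u t))\<^sup>2" if t: "t \<in> {0..T}" for t
    proof -
      have n: "norm2 l (w t - u t) \<le> norm2 l (w t) + norm2 l (u t)"
      proof -
        have z: "vsob 0 (\<lambda>x. 0 :: real^2)" by (auto simp: vsob_def sob_zero)
        have "Hnorm l 0 (w t - u t) \<le> Hnorm l 0 (w t) + Hnorm l 0 (w t - u t - w t)"
          by (rule Hnorm_triangle_diff[OF vsob_diff[OF v0(2)[OF t] v0(1)[OF t]] v0(2)[OF t]])
        moreover have "w t - u t - w t = (\<lambda>x. 0) - u t" by (simp add: fun_eq_iff)
        moreover have "Hnorm l 0 ((\<lambda>x. 0) - u t) = Hnorm l 0 (u t - (\<lambda>x. 0))" by (rule Hnorm_minus_commute[OF z v0(1)[OF t]])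
        moreover have "u t - (\<lambda>x. 0) = u t" by (simp add: fun_eq_iff)
        ultimately have "Hnorm l 0 (w t - u t) \<le> Hnorm l 0 (w t) + Hnorm l 0 (u t)" by simp
        from mult_left_mono[OF this less_imp_le[OF l_pos]] show ?thesis
          by (simp add: norm2_eq_Hnorm[OF v0(1)[OF t]] norm2_eq_Hnorm[OF v0(2)[OF t]] norm2_eq_Hnorm[OF vsob_diff[OF v0(2)[OF t] v0(1)[OF t]]] distrib_left)
      qed
      have "(norm2 l ((w - u) t))\<^sup>2 \<le> (norm2 l (w t) + norm2 l (u t))\<^sup>2" using n by (simp add: power_mono)
      also have "\<dots> \<le> 2 * (norm2 l (w t))\<^sup>2 + 2 * (norm2 l (u t))\<^sup>2"
        using zero_le_power2[of "norm2 l (w t) - norm2 l (u t)"] by (simp add: power2_eq_square algebra_simps)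
      finally show ?thesis .
    qed
    have dsq: "sq_int ?M (\<lambda>t. norm2 l ((w - u) t))"
    proof -
      have "integrable ?M (\<lambda>t. (norm2 l ((w - u) t))\<^sup>2)"
      proof (rule Bochner_Integration.integrable_bound)
        show "integrable ?M (\<lambda>t. 2 * (norm2 l (w t))\<^sup>2 + 2 * (norm2 l (u t))\<^sup>2)" using Lu(2) Lw(2) by auto
        show "(\<lambda>t. (norm2 l ((w - u) t))\<^sup>2) \<in> borel_measurable ?M" using dm by measurable
        show "AE t in ?M. norm ((norm2 l ((w - u) t))\<^sup>2) \<le> norm (2 * (norm2 l (w t))\<^sup>2 + 2 * (norm2 l (u t))\<^sup>2)"
          using dle by (auto intro!: AE_I2 simp: space_time)
      qed
      then show ?thesis using dm by (simp add: sq_int_def)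
    qed
    have cb: "integrable ?M (\<lambda>t. r (fc (cp (h t) j) k) * \<beta> t)" if h: "h \<in> L2L2 T" for h
    proof -
      note Lh = Lp_space2D[OF h norm2_nonneg]
      have "integrable ?M (\<lambda>t. r (fc (cp (h t) j) k))"
      proof (rule Bochner_Integration.integrable_bound)
        show "integrable ?M (\<lambda>t. norm2 l (h t) / l)" using sq_int_time_integrable[OF Lh(5)] by simp
        show "(\<lambda>t. r (fc (cp (h t) j) k)) \<in> borel_measurable ?M" by (intro rm coef_measurable_L2 Lh)
        show "AE t in ?M. norm (r (fc (cp (h t) j) k)) \<le> norm (norm2 l (h t) / l)"
        proof (rule AE_I2)
          fix t assume "t \<in> space ?M"
          then have "vsob 0 (h t)" using Lh(4) by (simp add: L2dot_iff)
          then show "norm (r (fc (cp (h t) j) k)) \<le> norm (norm2 l (h t) / l)"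
            using order_trans[OF rl(2) fc_le_Hnorm] l_pos by (simp add: norm2_eq_Hnorm Hnorm_nonneg)
        qed
      qed
      from time_bounded_mult[OF \<beta> this] show ?thesis by (simp add: mult.commute)
    qed
    have "norm ((\<integral>t. r (fc (cp (w t) j) k) * \<beta> t \<partial>?M) - (\<integral>t. r (fc (cp (u t) j) k) * \<beta> t \<partial>?M)) =
       \<bar>\<integral>t. r (fc (cp (w t) j) k) * \<beta> t - r (fc (cp (u t) j) k) * \<beta> t \<partial>?M\<bar>"
      using cb[OF u] cb[OF w] by simp
    also have "\<dots> \<le> (\<integral>t. \<bar>r (fc (cp (w t) j) k) * \<beta> t - r (fc (cp (u t) j) k) * \<beta> t\<bar> \<partial>?M)" by (rule integral_abs_bound)
    also have "\<dots> \<le> (\<integral>t. \<bar>B\<bar> / l * norm2 l ((w - u) t) \<partial>?M)"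
    proof (rule integral_mono_AE)
      show "AE t in ?M. \<bar>r (fc (cp (w t) j) k) * \<beta> t - r (fc (cp (u t) j) k) * \<beta> t\<bar> \<le> \<bar>B\<bar> / l * norm2 l ((w - u) t)"
      proof (rule AE_I2)
        fix t assume "t \<in> space ?M"
        then have t: "t \<in> {0..T}" by (simp add: space_time)
        have v: "vsob 0 (w t - u t)" by (intro vsob_diff v0 t)
        have "\<bar>r (fc (cp (w t) j) k) * \<beta> t - r (fc (cp (u t) j) k) * \<beta> t\<bar> = \<bar>r (fc (cp (w t - u t) j) k)\<bar> * \<bar>\<beta> t\<bar>"
          unfolding fc_diff_field[OF v0(2)[OF t] v0(1)[OF t]] rl(1) by (simp only: left_diff_distrib[symmetric] abs_mult)
        also have "\<dots> \<le> Hnorm l 0 (w t - u t) * \<bar>B\<bar>"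
          using B[OF t] order_trans[OF rl(2) fc_le_Hnorm[OF v]] by (intro mult_mono Hnorm_nonneg) auto
        finally show "\<bar>r (fc (cp (w t) j) k) * \<beta> t - r (fc (cp (u t) j) k) * \<beta> t\<bar> \<le> \<bar>B\<bar> / l * norm2 l ((w - u) t)"
          using l_pos by (simp add: norm2_eq_Hnorm[OF v] mult.commute)
      qed
    qed (use cb[OF u] cb[OF w] sq_int_time_integrable[OF dsq] in auto)
    also have "\<dots> = \<bar>B\<bar> / l * (\<integral>t. norm2 l ((w - u) t) \<partial>?M)" by simp
    also have "\<dots> \<le> \<bar>B\<bar> / l * (l2norm ?M (\<lambda>_. 1::real) * l2norm ?M (\<lambda>t. norm2 l ((w - u) t)))"
    proof (rule mult_left_mono)
      have o: "sq_int ?M (\<lambda>_. 1::real)" by (simp add: sq_int_def)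
      show "(\<integral>t. norm2 l ((w - u) t) \<partial>?M) \<le> l2norm ?M (\<lambda>_. 1::real) * l2norm ?M (\<lambda>t. norm2 l ((w - u) t))"
        using Cauchy_Schwarz_norm(1)[OF o dsq] by simp
    qed (use l_pos in auto)
    finally show "norm ((\<integral>t. r (fc (cp (w t) j) k) * \<beta> t \<partial>?M) - (\<integral>t. r (fc (cp (u t) j) k) * \<beta> t \<partial>?M)) \<le>
        \<bar>B\<bar> / l * l2norm ?M (\<lambda>_. 1::real) * Lp_norm ?M 2 (norm2 l) (w - u)"
      by (simp add: Lp_norm2_eq l2norm_def mult.assoc)
  qed
qed

text \<open>\<open>g\<close> is measurable as an L^2(0,T)-valued variable and \<open>m\<close> only
  at each fixed time. For each mode the time integral is a limit of Bernstein sums, and the modes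
  are summed by Parseval. The limits exist only almost surely, which is where completeness of
  \<open>M\<close> enters.\<close>

lemma pairing_measurable:
  fixes M :: "'w measure"
  assumes "complete_measure M" and T: "0 < T"
    and g: "g \<in> M \<rightarrow>\<^sub>M borel_sn (L2L2 T) (Lp_norm (time_interval T) 2 (norm2 l))"
    and m: "\<And>t. t \<in> {0..T} \<Longrightarrow> (\<lambda>\<omega>. m \<omega> t) \<in> M \<rightarrow>\<^sub>M borel_sn (spaceV l) (Hnorm l 1)"
    and mp: "AE \<omega> in M. \<exists>m'. vpath T (m \<omega>) m'"
  shows "(\<lambda>\<omega>. \<integral>t. ip l (g \<omega> t) (m \<omega> t) \<partial>time_interval T) \<in> borel_measurable M"
proof -
  interpret complete_measure M by fact
  let ?M = "time_interval T"
  have gL: "g \<omega> \<in> L2L2 T" if "\<omega> \<in> space M" for \<omega> using measurable_space[OF g that] by (simp add: space_borel_sn)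
  have ci: "integrable ?M (\<lambda>t. r (fc (cp (g \<omega> t) j) k))" if \<omega>: "\<omega> \<in> space M" and r: "r = Re \<or> r = Im" for \<omega> j k r
  proof -
    note Lh = Lp_space2D[OF gL[OF \<omega>] norm2_nonneg]
    have rl: "\<bar>r z\<bar> \<le> cmod z" for z using r abs_Re_le_cmod abs_Im_le_cmod by auto
    show ?thesis
    proof (rule Bochner_Integration.integrable_bound)
      show "integrable ?M (\<lambda>t. norm2 l (g \<omega> t) / l)" using sq_int_time_integrable[OF Lh(5)] by simp
      show "(\<lambda>t. r (fc (cp (g \<omega> t) j) k)) \<in> borel_measurable ?M" using r coef_measurable_L2[OF Lh(1), of j k] by auto
      show "AE t in ?M. norm (r (fc (cp (g \<omega> t) j) k)) \<le> norm (norm2 l (g \<omega> t) / l)"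
      proof (rule AE_I2)
        fix t assume "t \<in> space ?M"
        then have "vsob 0 (g \<omega> t)" using Lh(4) by (simp add: L2dot_iff)
        then show "norm (r (fc (cp (g \<omega> t) j) k)) \<le> norm (norm2 l (g \<omega> t) / l)"
          using order_trans[OF rl fc_le_Hnorm] l_pos by (simp add: norm2_eq_Hnorm Hnorm_nonneg)
      qed
    qed
  qed
  have mc: "continuous_on {0..T} (\<lambda>t. r (fc (cp (m \<omega> t) j) k))" if "vpath T (m \<omega>) m'" "r = Re \<or> r = Im" for \<omega> m' r j k
    using that coef_continuous[of T "spaceV l" 1 "m \<omega>" j k] spaceV_vsob by (auto simp: vpath_def intro: continuous_intros)
  have Z: "(\<lambda>\<omega>. \<integral>t. r (fc (cp (g \<omega> t) j) k) * r (fc (cp (m \<omega> t) j) k) \<partial>?M) \<in> borel_measurable M" if r: "r = Re \<or> r = Im" for r j k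
  proof (rule borel_measurable_AE_limit)
    show "(\<lambda>\<omega>. \<Sum>i\<le>n. r (fc (cp (m \<omega> (T * (real i / real n))) j) k) * (\<integral>t. r (fc (cp (g \<omega> t) j) k) * Bernstein n i (t / T) \<partial>?M)) \<in> borel_measurable M" for n
    proof (intro borel_measurable_sum borel_measurable_times)
      fix i assume i: "i \<in> {..n}"
      have "T * (real i / real n) \<in> {0..T}" using i T by (auto simp: divide_simps)
      from coef_measurable[OF m[OF this] spaceV_vsob, of j k]
      show "(\<lambda>\<omega>. r (fc (cp (m \<omega> (T * (real i / real n))) j) k)) \<in> borel_measurable M" using r by auto
      have "continuous_on {0..T} (\<lambda>t. Bernstein n i (t / T))" unfolding Bernstein_def by (intro continuous_intros) (use T in auto)
      from measurable_compose[OF g coef_functional_measurable[OF this r]]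
      show "(\<lambda>\<omega>. \<integral>t. r (fc (cp (g \<omega> t) j) k) * Bernstein n i (t / T) \<partial>?M) \<in> borel_measurable M" .
    qed
    show "AE \<omega> in M. (\<lambda>n. \<Sum>i\<le>n. r (fc (cp (m \<omega> (T * (real i / real n))) j) k) * (\<integral>t. r (fc (cp (g \<omega> t) j) k) * Bernstein n i (t / T) \<partial>?M)) \<longlonglongrightarrow>
        (\<integral>t. r (fc (cp (g \<omega> t) j) k) * r (fc (cp (m \<omega> t) j) k) \<partial>?M)"
      using mp AE_space
    proof eventually_elim
      case (elim \<omega>)
      then obtain m' where "vpath T (m \<omega>) m'" by blast
      from bernstein_integral_limit[OF T ci[OF elim(2) r] mc[OF this r]] show ?case .
    qed
  qed
  have "(\<lambda>\<omega>. l\<^sup>2 * (\<Sum>k\<in>box_set N. \<Sum>j\<in>UNIV. (\<integral>t. Re (fc (cp (g \<omega> t) j) k) * Re (fc (cp (m \<omega> t) j) k) \<partial>?M) + (\<integral>t. Im (fc (cp (g \<omega> t) j) k) * Im (fc (cp (m \<omega> t) j) k) \<partial>?M))) \<in> borel_measurable M" for N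
    by (intro borel_measurable_times borel_measurable_const borel_measurable_sum borel_measurable_add Z) auto
  then show ?thesis
  proof (rule borel_measurable_AE_limit)
    show "AE \<omega> in M. (\<lambda>N. l\<^sup>2 * (\<Sum>k\<in>box_set N. \<Sum>j\<in>UNIV. (\<integral>t. Re (fc (cp (g \<omega> t) j) k) * Re (fc (cp (m \<omega> t) j) k) \<partial>?M) + (\<integral>t. Im (fc (cp (g \<omega> t) j) k) * Im (fc (cp (m \<omega> t) j) k) \<partial>?M)))
       \<longlonglongrightarrow> (\<integral>t. ip l (g \<omega> t) (m \<omega> t) \<partial>?M)"
      using mp AE_space
    proof eventually_elim
      case (elim \<omega>)
      then obtain m' where p: "vpath T (m \<omega>) m'" by blast
      have ii: "integrable ?M (\<lambda>t. r (fc (cp (g \<omega> t) j) k) * r (fc (cp (m \<omega> t) j) k))" if r: "r = Re \<or> r = Im" for r j k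
        using time_bounded_mult[OF mc[OF p r] ci[OF elim(2) r]] by (simp add: mult.commute)
      have "(\<integral>t. pr 0 N (g \<omega> t) (m \<omega> t) \<partial>?M) = l\<^sup>2 * (\<Sum>k\<in>box_set N. \<Sum>j\<in>UNIV. (\<integral>t. Re (fc (cp (g \<omega> t) j) k) * Re (fc (cp (m \<omega> t) j) k) \<partial>?M) + (\<integral>t. Im (fc (cp (g \<omega> t) j) k) * Im (fc (cp (m \<omega> t) j) k) \<partial>?M))" for N
      proof -
        have "(\<integral>t. pr 0 N (g \<omega> t) (m \<omega> t) \<partial>?M) = (\<integral>t. l\<^sup>2 * (\<Sum>k\<in>box_set N. \<Sum>j\<in>UNIV. Re (fc (cp (g \<omega> t) j) k) * Re (fc (cp (m \<omega> t) j) k) + Im (fc (cp (g \<omega> t) j) k) * Im (fc (cp (m \<omega> t) j) k)) \<partial>?M)"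
          by (simp add: pr_def)
        also have "\<dots> = l\<^sup>2 * (\<Sum>k\<in>box_set N. \<Sum>j\<in>UNIV. \<integral>t. Re (fc (cp (g \<omega> t) j) k) * Re (fc (cp (m \<omega> t) j) k) + Im (fc (cp (g \<omega> t) j) k) * Im (fc (cp (m \<omega> t) j) k) \<partial>?M)"
          by (subst integral_mult_right_zero, subst Bochner_Integration.integral_sum)
             (auto intro!: Bochner_Integration.integrable_sum Bochner_Integration.integrable_add ii sum.cong Bochner_Integration.integral_sum)
        also have "\<dots> = l\<^sup>2 * (\<Sum>k\<in>box_set N. \<Sum>j\<in>UNIV. (\<integral>t. Re (fc (cp (g \<omega> t) j) k) * Re (fc (cp (m \<omega> t) j) k) \<partial>?M) + (\<integral>t. Im (fc (cp (g \<omega> t) j) k) * Im (fc (cp (m \<omega> t) j) k) \<partial>?M))"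
          by (subst Bochner_Integration.integral_add[OF ii ii]) auto
        finally show ?thesis .
      qed
      then show ?case using ip_time_integrable(2)[OF gL[OF elim(2)] p] by (simp only:)
    qed
  qed
qed

end

text \<open>With m the maximum of G, P and Y^(1/(p-2)), the product is at most m * m * m^(p-2) =
  m^p, and m^p is one of the three terms. The exponents p, p and p/(p-2) are conjugate.\<close>

lemma young_three:
  fixes G P Y p :: real
  assumes "0 \<le> G" "0 \<le> P" "0 < Y" "2 < p"
  shows "G * P * Y \<le> G powr p + P powr p + Y powr (p / (p - 2))"
proof -
  define Z where "Z = Y powr (1 / (p - 2))"
  define m where "m = max G (max P Z)"
  have Z: "0 < Z" using assms by (simp add: Z_def)
  have m: "0 < m" "G \<le> m" "P \<le> m" "Z \<le> m" using Z by (auto simp: m_def less_max_iff_disj)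
  have "Y = Z powr (p - 2)" using assms by (simp add: Z_def powr_powr)
  also have "\<dots> \<le> m powr (p - 2)" using Z m assms by (intro powr_mono2) auto
  finally have Y: "Y \<le> m powr (p - 2)" .
  have "G * P * Y \<le> m * m * m powr (p - 2)" using assms m Y by (intro mult_mono) auto
  also have "\<dots> = m powr p" using m by (simp add: powr_diff power2_eq_square powr_numeral)
  also have "\<dots> \<le> G powr p + P powr p + Z powr p"
  proof -
    have "m = G \<or> m = P \<or> m = Z" by (auto simp: m_def max_def)
    then show ?thesis by auto
  qed
  also have "Z powr p = Y powr (p / (p - 2))" using assms by (simp add: Z_def powr_powr)
  finally show ?thesis .
qed

section \<open>Regularity of the state, the pathwise bound and the passage to expectations\<close>

context flat_torus
begin

lemma in_Linf_DAhalf: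
  assumes u: "in_Linf l T (DAhalf l s) (Hnorm l s) u" and L: "\<And>t. t \<in> {0..T} \<Longrightarrow> u t \<in> L2dot l"
  shows "AE t in time_interval T. u t \<in> DAhalf l s"
    "\<exists>C. AE t in time_interval T. Hnorm l s (u t) \<le> C"
proof -
  obtain w C where w: "w \<in> time_interval T \<rightarrow>\<^sub>M borel_sn (DAhalf l s) (Hnorm l s)"
    and C: "AE t in time_interval T. Hnorm l s (w t) \<le> C"
    and same: "AE t in time_interval T. same_field l (w t) (u t)"
    using u unfolding in_Linf_def by blast
  have wD: "w t \<in> DAhalf l s" if "t \<in> space (time_interval T)" for t
    using measurable_space[OF w that] by (simp add: space_borel_sn)
  show "AE t in time_interval T. u t \<in> DAhalf l s"
    using same AE_space by eventually_elim (rule same_field_DAhalf(1)[OF _ L wD], simp_all add: space_time)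
  show "\<exists>C. AE t in time_interval T. Hnorm l s (u t) \<le> C"
  proof
    show "AE t in time_interval T. Hnorm l s (u t) \<le> C"
      using same AE_space C
    proof eventually_elim
      case (elim t)
      have "u t \<in> L2dot l" using L elim(2) by (simp add: space_time)
      from same_field_DAhalf(2)[OF elim(1) this wD[OF elim(2)]] elim(3) show ?case by simp
    qed
  qed
qed

text \<open>Boundedness comes from the essentially bounded representative, measurability in time
  from the coefficients of the continuous path.\<close>

lemma Hnorm_sq_time_integrable:
  assumes c: "in_C T (DAhalf l 2) (Hnorm l 2) v" and i: "in_Linf l T (DAhalf l 3) (Hnorm l 3) v"
  shows "integrable (time_interval T) (\<lambda>t. (Hnorm l 3 (v t))\<^sup>2)" "AE t in time_interval T. v t \<in> DAhalf l 3"
proof -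
  interpret F: finite_measure "time_interval T" by (rule finite_measure_time)
  have L: "v t \<in> L2dot l" if "t \<in> {0..T}" for t
    using c that by (auto simp: in_C_def DAhalf_def Hdot_def)
  note A = in_Linf_DAhalf[OF i L]
  show "AE t in time_interval T. v t \<in> DAhalf l 3" by (rule A(1))
  obtain C where C: "AE t in time_interval T. Hnorm l 3 (v t) \<le> C" using A(2) by blast
  have m: "(\<lambda>t. (Hnorm l 3 (v t))\<^sup>2) \<in> borel_measurable (time_interval T)"
    by (rule Hnorm_sq_measurable, rule path_coef_measurable[OF c]) (simp add: DAhalf_iff)
  show "integrable (time_interval T) (\<lambda>t. (Hnorm l 3 (v t))\<^sup>2)"
  proof (rule F.integrable_const_bound[OF _ m])
    show "AE t in time_interval T. norm ((Hnorm l 3 (v t))\<^sup>2) \<le> C\<^sup>2"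
      using C by eventually_elim (simp add: power_mono Hnorm_nonneg)
  qed
qed

text \<open>Stated without premises as a rewrite rule, so that the right-hand side can be folded
  into \<open>Lform\<close> inside the unfolded notion of solution, underneath its
  quantifiers.\<close>

lemma linearized_rhs:
  "ip l h \<phi> - \<nu> * ipm l (grad l m) (grad l \<phi>)
     + trib l u \<phi> (Upsilon l \<alpha>\<^sub>1 m) + trib l m \<phi> (Upsilon l \<alpha>\<^sub>1 u)
     - trib l \<phi> u (Upsilon l \<alpha>\<^sub>1 m) - trib l \<phi> m (Upsilon l \<alpha>\<^sub>1 u)
     - (\<alpha>\<^sub>1 + \<alpha>\<^sub>2) * ipm l (\<lambda>x. symgrad l u x ** symgrad l m x + symgrad l m x ** symgrad l u x) (grad l \<phi>)
     - \<beta> * ipm l (\<lambda>x. frob (symgrad l u x) (symgrad l u x) *\<^sub>R symgrad l m x) (grad l \<phi>)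
     - 2 * \<beta> * ipm l (\<lambda>x. frob (symgrad l m x) (symgrad l u x) *\<^sub>R symgrad l u x) (grad l \<phi>)
   = ip l h \<phi> + Lform \<nu> \<alpha>\<^sub>1 \<alpha>\<^sub>2 \<beta> u m \<phi>"
  by (simp add: Lform_def)

lemma pathwise_bound:
  assumes T: "0 < T" and \<alpha>: "0 < \<alpha>\<^sub>1" and C: "0 \<le> C"
    and Lb: "\<And>u m a b. vsob 3 u \<Longrightarrow> dvf u \<Longrightarrow> vsob 2 m \<Longrightarrow> (\<And>j. hn 3 (cp u j) \<le> a) \<Longrightarrow> (\<And>j. hn 1 (cp m j) \<le> b) \<Longrightarrow>
         \<bar>Lform \<nu> \<alpha>\<^sub>1 \<alpha>\<^sub>2 \<beta> u m m\<bar> \<le> C * (1 + a\<^sup>2) * b\<^sup>2"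
    and m: "vpath T m m'" and m0: "same_field l (m 0) (\<lambda>x. 0)"
    and mA: "AE t in time_interval T. m t \<in> DAhalf l 2" and vA: "AE t in time_interval T. v t \<in> DAhalf l 3"
    and a: "integrable (time_interval T) (\<lambda>t. (Hnorm l 3 (v t))\<^sup>2)"
    and \<psi>: "\<psi> \<in> L2L2 T" and g: "g \<in> L2L2 T"
    and e: "AE t in time_interval T. Upsilon_pair l \<alpha>\<^sub>1 (m' t) (m t) = ip l (\<psi> t) (m t) + Lform \<nu> \<alpha>\<^sub>1 \<alpha>\<^sub>2 \<beta> (v t) (m t) (m t)"
  shows "\<bar>\<integral>t. ip l (g t) (m t) \<partial>time_interval T\<bar> \<le>
     sqrt T * sqrt (l\<^sup>2 / (\<alpha>\<^sub>1 * (2 * pi)\<^sup>2)) * exp (kap \<alpha>\<^sub>1 C / 2 * T) *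
     (Lp_norm (time_interval T) 2 (norm2 l) g * Lp_norm (time_interval T) 2 (norm2 l) \<psi> *
      exp (kap \<alpha>\<^sub>1 C / 2 * (\<integral>s. (Hnorm l 3 (v s))\<^sup>2 \<partial>time_interval T)))"
proof -
  note D = vpathD[OF m] and LP = Lp_space2D[OF \<psi> norm2_nonneg]
  have T0: "0 \<in> {0..T}" using T by simp
  have z: "Upsilon_pair l \<alpha>\<^sub>1 (m 0) (m 0) = 0"
    by (rule Upsilon_pair_zero[OF m0 D(2)[OF T0] D(2)[OF T0] less_imp_le[OF \<alpha>]])
  have ae: "AE t in time_interval T. Upsilon_pair l \<alpha>\<^sub>1 (m' t) (m t) \<le>
       norm2 l (\<psi> t) * norm2 l (m t) + C * (1 + (Hnorm l 3 (v t))\<^sup>2) * (Hnorm l 1 (m t))\<^sup>2"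
    using e mA vA AE_space
  proof eventually_elim
    case (elim t)
    have m2: "vsob 2 (m t)" and v3: "vsob 3 (v t)" "dvf (v t)" using elim by (auto simp: DAhalf_iff)
    have m1: "vsob 1 (m t)" "vsob 0 (m t)" using vsob_mono[OF m2] by auto
    have p0: "vsob 0 (\<psi> t)" using LP(4)[OF elim(4)] by (simp add: L2dot_iff)
    have "\<bar>Lform \<nu> \<alpha>\<^sub>1 \<alpha>\<^sub>2 \<beta> (v t) (m t) (m t)\<bar> \<le> C * (1 + (Hnorm l 3 (v t))\<^sup>2) * (Hnorm l 1 (m t))\<^sup>2"
      by (rule Lb[OF v3 m2 hn_le_Hnorm[OF v3(1)] hn_le_Hnorm[OF m1(1)]])
    moreover have "\<bar>ip l (\<psi> t) (m t)\<bar> \<le> norm2 l (\<psi> t) * norm2 l (m t)" by (rule ip_bound[OF p0 m1(2)])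
    ultimately show ?case using elim(1) by linarith
  qed
  note B = energy_estimate[OF T \<alpha> C m LP(2) a z ae]
  from ip_time_integrable(3)[OF g m B T] show ?thesis by (simp only: Lp_norm2_eq mult_ac)
qed

end

theorem proposition7p1:
  fixes l T \<nu> \<alpha>\<^sub>1 \<alpha>\<^sub>2 \<beta> p :: real
    and M :: "'w measure" and F :: "real \<Rightarrow> 'w measure"
    and G :: "'u::{real_inner, complete_space} \<Rightarrow> vfield"
    and W f v g \<psi> \<pp> \<mm> :: "'w \<Rightarrow> real \<Rightarrow> vfield"
    and v\<^sub>0 :: vfield
  assumes "l > 0" and "T > 0"
    and "\<nu> > 0" and "\<alpha>\<^sub>1 > 0" and "\<beta> > 0" and "\<bar>\<alpha>\<^sub>1 + \<alpha>\<^sub>2\<bar> \<le> sqrt (24 * \<nu> * \<beta>)"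
    and "filtered_space M F"
    and "hilbert_schmidt l G"
    and "wiener l M F G W"
    and "f \<in> Lp_L2 M 2 T (Hdot l 1) (Hnorm l 1)"
    and "v\<^sub>0 \<in> DAhalf l 3"
    and "state_solution l T \<nu> \<alpha>\<^sub>1 \<alpha>\<^sub>2 \<beta> M F W f v\<^sub>0 v"
    and "\<And>c t. c > 0 \<Longrightarrow> t \<in> {0..T} \<Longrightarrow>
           integrable M (\<lambda>\<omega>. exp (c * (\<integral>s. (Hnorm l 3 (v \<omega> s))\<^sup>2 \<partial>time_interval t)))"
    and "p > 2"
    and "g \<in> Lp_L2 M p T (L2dot l) (norm2 l)"
    and "\<psi> \<in> Lp_L2 M p T (L2dot l) (norm2 l)"
    and "adjoint_solution l T \<nu> \<alpha>\<^sub>1 \<alpha>\<^sub>2 \<beta> M v g \<pp>"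
    and "linearized_solution l T \<nu> \<alpha>\<^sub>1 \<alpha>\<^sub>2 \<beta> M v \<psi> \<mm>"
  shows "integrable M (\<lambda>\<omega>. \<integral>t. ip l (\<psi> \<omega> t) (\<pp> \<omega> t) \<partial>time_interval T) \<and>
         integrable M (\<lambda>\<omega>. \<integral>t. ip l (g \<omega> t) (\<mm> \<omega> t) \<partial>time_interval T) \<and>
         (\<integral>\<omega>. (\<integral>t. ip l (\<psi> \<omega> t) (\<pp> \<omega> t) \<partial>time_interval T) \<partial>M) =
         (\<integral>\<omega>. (\<integral>t. ip l (g \<omega> t) (\<mm> \<omega> t) \<partial>time_interval T) \<partial>M)"
proof -
  interpret flat_torus l by standard fact
  have cM: "complete_measure M" using assms(7) by (simp add: filtered_space_def)
  note T = \<open>T > 0\<close> and \<alpha> = \<open>\<alpha>\<^sub>1 > 0\<close> and p = \<open>p > 2\<close>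
  let ?N = "Lp_norm (time_interval T) 2 (norm2 l)"
  obtain C where C: "C \<ge> 0" and Lb0: "\<forall>u m a b. vsob 3 u \<longrightarrow> dvf u \<longrightarrow> vsob 2 m \<longrightarrow> (\<forall>j. hn 3 (cp u j) \<le> a) \<longrightarrow> (\<forall>j. hn 1 (cp m j) \<le> b) \<longrightarrow>
      \<bar>Lform \<nu> \<alpha>\<^sub>1 \<alpha>\<^sub>2 \<beta> u m m\<bar> \<le> C * (1 + a\<^sup>2) * b\<^sup>2"
    using Lform_bound[of \<nu> \<alpha>\<^sub>1 \<alpha>\<^sub>2 \<beta>] by blast
  have Lb: "\<bar>Lform \<nu> \<alpha>\<^sub>1 \<alpha>\<^sub>2 \<beta> u m m\<bar> \<le> C * (1 + a\<^sup>2) * b\<^sup>2"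
    if "vsob 3 u" "dvf u" "vsob 2 m" "\<And>j. hn 3 (cp u j) \<le> a" "\<And>j. hn 1 (cp m j) \<le> b" for u m a b
    using Lb0 that by simp
  have gm: "g \<in> M \<rightarrow>\<^sub>M borel_sn (L2L2 T) ?N" and gi: "integrable M (\<lambda>\<omega>. ?N (g \<omega>) powr p)"
    and \<psi>m: "\<psi> \<in> M \<rightarrow>\<^sub>M borel_sn (L2L2 T) ?N" and \<psi>i: "integrable M (\<lambda>\<omega>. ?N (\<psi> \<omega>) powr p)"
    using assms(15,16) by (auto simp: Lp_L2_def Lp_space_def[of M])
  have gL: "g \<omega> \<in> L2L2 T" and \<psi>L: "\<psi> \<omega> \<in> L2L2 T" if "\<omega> \<in> space M" for \<omega>
    using measurable_space[OF gm that] measurable_space[OF \<psi>m that] by (simp_all only: space_borel_sn)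
  define K where "K = sqrt T * sqrt (l\<^sup>2 / (\<alpha>\<^sub>1 * (2 * pi)\<^sup>2)) * exp (kap \<alpha>\<^sub>1 C / 2 * T)"
  have K0: "0 \<le> K" using T \<alpha> by (simp add: K_def)
  define Y where "Y \<omega> = exp (kap \<alpha>\<^sub>1 C / 2 * (\<integral>s. (Hnorm l 3 (v \<omega> s))\<^sup>2 \<partial>time_interval T))" for \<omega>
  have vae: "AE \<omega> in M. in_C T (DAhalf l 2) (Hnorm l 2) (v \<omega>) \<and> in_Linf l T (DAhalf l 3) (Hnorm l 3) (v \<omega>)"
    using assms(12) by (simp add: state_solution_def)
  have mt: "(\<lambda>\<omega>. \<mm> \<omega> t) \<in> M \<rightarrow>\<^sub>M borel_sn (spaceV l) (Hnorm l 1)" if "t \<in> {0..T}" for t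
    using assms(18) that by (simp add: linearized_solution_def)
  note mae = assms(18)[unfolded linearized_solution_def Let_def, unfolded linearized_rhs, THEN conjunct2]
  note pae = assms(17)[unfolded adjoint_solution_def Let_def, THEN conjunct2]
  have mp: "AE \<omega> in M. \<exists>m'. vpath T (\<mm> \<omega>) m'"
    using mae by eventually_elim (auto simp: vpath_def)
  \<comment> \<open>The identity and the bound are obtained together on one almost sure event, where
    the state is regular and both equations hold.\<close>
  have main: "AE \<omega> in M. (\<integral>t. ip l (\<psi> \<omega> t) (\<pp> \<omega> t) \<partial>time_interval T) = (\<integral>t. ip l (g \<omega> t) (\<mm> \<omega> t) \<partial>time_interval T) \<and>
      \<bar>\<integral>t. ip l (g \<omega> t) (\<mm> \<omega> t) \<partial>time_interval T\<bar> \<le> K * (?N (g \<omega>) * ?N (\<psi> \<omega>) * Y \<omega>)"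
    using vae mae pae AE_space
  proof eventually_elim
    case (elim \<omega>)
    note v = Hnorm_sq_time_integrable[OF elim(1)[THEN conjunct1] elim(1)[THEN conjunct2]]
    obtain m' where m: "vpath T (\<mm> \<omega>) m'" and mI: "in_Linf l T (DAhalf l 2) (Hnorm l 2) (\<mm> \<omega>)" and m0: "same_field l (\<mm> \<omega> 0) (\<lambda>x. 0)"
      and me: "AE t in time_interval T. \<forall>\<phi>\<in>spaceV l. Upsilon_pair l \<alpha>\<^sub>1 (m' t) \<phi> = ip l (\<psi> \<omega> t) \<phi> + Lform \<nu> \<alpha>\<^sub>1 \<alpha>\<^sub>2 \<beta> (v \<omega> t) (\<mm> \<omega> t) \<phi>"
      using elim(2) unfolding vpath_def by blast
    obtain p' where p: "vpath T (\<pp> \<omega>) p'" and pI: "in_Linf l T (DAhalf l 2) (Hnorm l 2) (\<pp> \<omega>)" and pT: "same_field l (\<pp> \<omega> T) (\<lambda>x. 0)"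
      and pe: "AE t in time_interval T. \<forall>\<phi>\<in>spaceV l. - Upsilon_pair l \<alpha>\<^sub>1 (p' t) \<phi> =
         ip l (g \<omega> t) \<phi> - \<nu> * ip l (stokes l (\<pp> \<omega> t)) \<phi>
         + Upsilon_pair l \<alpha>\<^sub>1 (convect l (v \<omega> t) (\<pp> \<omega> t)) \<phi>
         - ip l (cograd l (\<pp> \<omega> t) (Upsilon l \<alpha>\<^sub>1 (v \<omega> t))) \<phi>
         - Upsilon_pair l \<alpha>\<^sub>1 (convect l (\<pp> \<omega> t) (v \<omega> t)) \<phi>
         + ip l (convect l (\<pp> \<omega> t) (Upsilon l \<alpha>\<^sub>1 (v \<omega> t))) \<phi>
         + (\<alpha>\<^sub>1 + \<alpha>\<^sub>2) * ip l (divm l (\<lambda>x. symgrad l (v \<omega> t) x ** symgrad l (\<pp> \<omega> t) x + symgrad l (\<pp> \<omega> t) x ** symgrad l (v \<omega> t) x)) \<phi>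
         + \<beta> * ip l (divm l (\<lambda>x. frob (symgrad l (v \<omega> t) x) (symgrad l (v \<omega> t) x) *\<^sub>R symgrad l (\<pp> \<omega> t) x)) \<phi>
         + 2 * \<beta> * ip l (divm l (\<lambda>x. frob (symgrad l (\<pp> \<omega> t) x) (symgrad l (v \<omega> t) x) *\<^sub>R symgrad l (v \<omega> t) x)) \<phi>"
      using elim(3) unfolding vpath_def by blast
    note D = vpathD[OF m] and E = vpathD[OF p]
    have mA: "AE t in time_interval T. \<mm> \<omega> t \<in> DAhalf l 2" and pA: "AE t in time_interval T. \<pp> \<omega> t \<in> DAhalf l 2"
      using in_Linf_DAhalf(1)[OF mI vsob_L2dot[OF D(2)]] in_Linf_DAhalf(1)[OF pI vsob_L2dot[OF E(2)]] by auto
    have e1: "AE t in time_interval T. Upsilon_pair l \<alpha>\<^sub>1 (m' t) (\<pp> \<omega> t) = ip l (\<psi> \<omega> t) (\<pp> \<omega> t) + Lform \<nu> \<alpha>\<^sub>1 \<alpha>\<^sub>2 \<beta> (v \<omega> t) (\<mm> \<omega> t) (\<pp> \<omega> t)"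
      using me AE_space by eventually_elim (use E(1) in \<open>auto simp: space_time\<close>)
    have e0: "AE t in time_interval T. Upsilon_pair l \<alpha>\<^sub>1 (m' t) (\<mm> \<omega> t) = ip l (\<psi> \<omega> t) (\<mm> \<omega> t) + Lform \<nu> \<alpha>\<^sub>1 \<alpha>\<^sub>2 \<beta> (v \<omega> t) (\<mm> \<omega> t) (\<mm> \<omega> t)"
      using me AE_space by eventually_elim (use D(1) in \<open>auto simp: space_time\<close>)
    have e2: "AE t in time_interval T. - Upsilon_pair l \<alpha>\<^sub>1 (p' t) (\<mm> \<omega> t) = ip l (g \<omega> t) (\<mm> \<omega> t) + Lform \<nu> \<alpha>\<^sub>1 \<alpha>\<^sub>2 \<beta> (v \<omega> t) (\<mm> \<omega> t) (\<pp> \<omega> t)"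
      using pe AE_space mA pA v(2)
    proof eventually_elim
      case (elim t)
      have mV: "\<mm> \<omega> t \<in> spaceV l" using D(1) elim(2) by (simp add: space_time)
      have r: "vsob 3 (v \<omega> t)" "vsob 2 (\<pp> \<omega> t)" "dvf (\<pp> \<omega> t)" "vsob 2 (\<mm> \<omega> t)" "dvf (\<mm> \<omega> t)" using elim by (simp_all only: DAhalf_iff)
      show ?case using bspec[OF elim(1) mV] adjoint_duality[OF r stokes_ip[OF r(2,3) mV], of \<nu> \<alpha>\<^sub>1 \<alpha>\<^sub>2 \<beta>] by linarith
    qed
    show ?case
      using pathwise_duality[OF T less_imp_le[OF \<alpha>] m p m0 pT \<psi>L[OF elim(4)] gL[OF elim(4)] e1 e2]
        pathwise_bound[OF T \<alpha> C Lb m m0 mA v(2) v(1) \<psi>L[OF elim(4)] gL[OF elim(4)] e0]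
      unfolding K_def Y_def by blast
  qed
  define H where "H \<omega> = K * (?N (g \<omega>) powr p + ?N (\<psi> \<omega>) powr p + Y \<omega> powr (p / (p - 2)))" for \<omega>
  \<comment> \<open>\<open>Y\<close> to the power p/(p-2) is again an exponential of the time
    integral of the squared H^3 norm. The moment hypothesis is used at time \<open>T\<close> with
    the constant p/(p-2) times \<open>kap \<alpha>\<^sub>1 C / 2\<close>.\<close>
  have Yi: "integrable M (\<lambda>\<omega>. Y \<omega> powr (p / (p - 2)))"
  proof -
    have "0 < p / (p - 2) * (kap \<alpha>\<^sub>1 C / 2)" using p kap_pos[OF \<alpha> C] by simp
    from assms(13)[OF this, of T] T show ?thesis by (simp add: Y_def powr_def mult.assoc)
  qed
  have Hi: "integrable M H" unfolding H_def using gi \<psi>i Yi by (intro integrable_mult_right Bochner_Integration.integrable_add)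
  have J: "(\<lambda>\<omega>. \<integral>t. ip l (g \<omega> t) (\<mm> \<omega> t) \<partial>time_interval T) \<in> borel_measurable M"
    by (rule pairing_measurable[OF cM T gm mt mp])
  \<comment> \<open>The pairing with \<open>\<pp>\<close> equals almost surely one that is already
    measurable; completeness of \<open>M\<close> transfers the measurability.\<close>
  have I: "(\<lambda>\<omega>. \<integral>t. ip l (\<psi> \<omega> t) (\<pp> \<omega> t) \<partial>time_interval T) \<in> borel_measurable M"
    by (rule complete_measure.borel_measurable_AE_eq[OF cM J]) (use main in eventually_elim, simp)
  have gint: "integrable M (\<lambda>\<omega>. \<integral>t. ip l (g \<omega> t) (\<mm> \<omega> t) \<partial>time_interval T)"
  proof (rule Bochner_Integration.integrable_bound[OF Hi J])
    show "AE \<omega> in M. norm (\<integral>t. ip l (g \<omega> t) (\<mm> \<omega> t) \<partial>time_interval T) \<le> norm (H \<omega>)"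
      using main
    proof eventually_elim
      case (elim \<omega>)
      have "?N (g \<omega>) * ?N (\<psi> \<omega>) * Y \<omega> \<le> ?N (g \<omega>) powr p + ?N (\<psi> \<omega>) powr p + Y \<omega> powr (p / (p - 2))"
        by (rule young_three) (use p in \<open>auto simp: Lp_norm2_eq Y_def\<close>)
      from mult_left_mono[OF this K0] elim have "\<bar>\<integral>t. ip l (g \<omega> t) (\<mm> \<omega> t) \<partial>time_interval T\<bar> \<le> H \<omega>" unfolding H_def by linarith
      then show ?case by simp
    qed
  qed
  have eq: "AE \<omega> in M. (\<integral>t. ip l (g \<omega> t) (\<mm> \<omega> t) \<partial>time_interval T) = (\<integral>t. ip l (\<psi> \<omega> t) (\<pp> \<omega> t) \<partial>time_interval T)"
    using main by eventually_elim simp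
  show ?thesis
    using gint integrable_cong_AE[OF J I eq] integral_cong_AE[OF J I eq] by simp
qed

end
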